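(* Let $g\ge2$ and let $\mathscr R$ be a Riemann surface of genus $g-1$ with two punctures $v_1,v_2$, marked with (the twist equivalence class of) an admissible curve $\mathcal A_1$ from $v_1$ to $v_2$ and with curves $\alpha_2,\alpha_3,\dots,\alpha_{2g}$, where $\alpha_2$ is the boundary curve of the cusp $V_1$ at $v_1$ and $(\alpha_3,\dots,\alpha_{2g})$ is a canonical homology basis of the compactification $\overline{\mathscr R}=\mathscr R\cup\{v_1,v_2\}$ with $\mathcal A_1\cap\alpha_j=\emptyset$ for $j=3,\dots,2g$. Let $P_{\mathscr R}(\lambda)$, $\lambda>0$, be the associated family of $2g\times2g$ matrices defined in the context. Then $P_{\mathscr R}(\lambda)$ is symplectic for all $\lambda>0$, i.e. $P_{\mathscr R}(\lambda)\,\mathbf J\,P_{\mathscr R}(\lambda)=\mathbf J$, where $\mathbf J$ is the block diagonal $2g\times2g$ matrix with $g$ diagonal blocks $\begin{pmatrix}0&1\\-1&0\end{pmatrix}$.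
   Context: All forms are real; $\mathbb S_1=\mathbb R/\mathbb Z$; $E(\omega)=\int_{\mathscr R}\omega\wedge\star\omega$. A canonical homology basis $(\alpha_3,\dots,\alpha_{2g})$ of $\overline{\mathscr R}$ consists of oriented simple closed curves (avoiding the punctures) such that $\alpha_{2k-1}$ meets $\alpha_{2k}$ in exactly one point with intersection number $+1$ ($k=2,\dots,g$), other pairs being disjoint. Endow $\mathscr R$ with its complete hyperbolic metric and write $\mathscr R=V_1\cup\mathfrak M^{\mathscr R}\cup V_2$, where $V_1,V_2$ are the cusps at $v_1,v_2$ cut off along the horocycles of length $1$. They have conformal coordinates $(x,y)$ with $V_1=(-\infty,0]\times\mathbb S_1$, metric $(dx^2+dy^2)/(x-1)^2$, and $V_2=[0,\infty)\times\mathbb S_1$, metric $(dx^2+dy^2)/(x+1)^2$, $dx\wedge dy$ positively oriented. A curve $\mathcal A:\mathbb R\to\mathscr R$ is admissible if $\mathcal A(s)\to v_1$ as $s\to-\infty$, $\mathcal A(s)\to v_2$ as $s\to+\infty$, and in each cusp the $y$-coordinate of $\mathcal A(s)$ converges. (Two admissible curves are twist equivalent if, up to homotopies through admissible curves keeping the limits of the $y$-coordinates fixed, they differ by simultaneous twists by the same real parameter $b$ in both cusps, i.e. by twist maps rotating the ends of $V_1$ and of $V_2$ by $y\mapsto y+b$; all constants below depend only on the twist equivalence class.) $\alpha_2$ is oriented in the direction of increasing $y$. Forms: $\tau_1$ is the unique exact harmonic 1-form on $\mathscr R$ with logarithmic poles at $v_1,v_2$ that on $V_1$ and $V_2$ has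 the form $\tau_1=dx+(\text{a form exponentially decaying as } |x|\to\infty)$. $(\tau_3,\dots,\tau_{2g})$ is the dual basis of harmonic forms on $\overline{\mathscr R}$: $\int_{\alpha_i}\tau_j=\delta_{ij}$, $i,j\geq 3$. Set $\tau_2=\star\tau_1-\sum_{k=3}^{2g}\left(\int_{\alpha_k}\star\tau_1\right)\tau_k$. Constants: $q_{ij}=\int_{\mathscr R}\tau_i\wedge\star\tau_j$ for $i,j\in\{2,\dots,2g\}$, $(i,j)\ne(2,2)$; $q_{1j}=q_{j1}=0$ for $j=1,\dots,2g$; $\pi_{22}=E(\tau_2-\star\tau_1)$; $\kappa_1=1$ and $\kappa_j=-\int_{\mathcal A_1}\tau_j$ for $j=2,\dots,2g$. Definition: $P_{\mathscr R}(\lambda)=(p_{ij}(\lambda))_{i,j=1,\dots,2g}$ with $p_{ij}(\lambda)=q_{ij}+\frac{\kappa_i\kappa_j}{\lambda}$ for $(i,j)\ne(2,2)$ and $p_{22}(\lambda)=\pi_{22}+\lambda+\frac{\kappa_2^2}{\lambda}$. *)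

theory Defs
  imports "HOL-Complex_Analysis.Complex_Analysis" "HOL-Homology.Homology" "Jordan_Normal_Form.Matrix"
begin

text \<open>A chart is a domain together with a complex coordinate; the coordinate is only meaningful on
  the domain. The compact surface is the whole type, and a punctured surface is given by the same
  atlas and an open subset \<open>S\<close>.\<close>

type_synonym 'a chart = "'a set \<times> ('a \<Rightarrow> complex)"

abbreviation cdom :: "'a chart \<Rightarrow> 'a set" where "cdom c \<equiv> fst c"
abbreviation crd :: "'a chart \<Rightarrow> 'a \<Rightarrow> complex" where "crd c \<equiv> snd c"

definition cinv :: "'a chart \<Rightarrow> complex \<Rightarrow> 'a" where
  "cinv c = inv_into (cdom c) (crd c)"

definition transition :: "'a chart \<Rightarrow> 'a chart \<Rightarrow> complex \<Rightarrow> complex" where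
  "transition c d = crd d \<circ> cinv c"

definition riemann_atlas :: "('a::t2_space) chart set \<Rightarrow> bool" where
  "riemann_atlas A \<longleftrightarrow>
     (\<Union>c\<in>A. cdom c) = UNIV \<and>
     (\<forall>c\<in>A. open (cdom c) \<and> open (crd c ` cdom c) \<and>
             homeomorphism (cdom c) (crd c ` cdom c) (crd c) (cinv c)) \<and>
     (\<forall>c\<in>A. \<forall>d\<in>A. transition c d holomorphic_on crd c ` (cdom c \<inter> cdom d))"

definition compact_riemann_surface :: "('a::t2_space) chart set \<Rightarrow> bool" where
  "compact_riemann_surface A \<longleftrightarrow>
     compact (UNIV :: 'a set) \<and> connected (UNIV :: 'a set) \<and> riemann_atlas A"

text \<open>The genus of a closed oriented surface is half of the rank of its first homology group.\<close>

definition has_genus :: "'a::topological_space itself \<Rightarrow> nat \<Rightarrow> bool" where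
  "has_genus _ h \<longleftrightarrow>
     homology_group 1 (euclidean :: 'a topology) \<cong> free_Abelian_group {..<2 * h}"

text \<open>A real 1-form assigns to a chart and a point of its domain a covector, acting on tangent
  vectors that are written as complex numbers in the coordinate of the chart. So for
  \<open>\<omega> = a dx + b dy\<close> the coefficients are \<open>a = \<omega> c p 1\<close> and \<open>b = \<omega> c p \<i>\<close>. A 2-form is given by
  its coefficient with respect to \<open>dx \<and> dy\<close>.\<close>

type_synonym 'a form1 = "'a chart \<Rightarrow> 'a \<Rightarrow> complex \<Rightarrow> real"
type_synonym 'a form2 = "'a chart \<Rightarrow> 'a \<Rightarrow> real"

definition C1_on :: "complex set \<Rightarrow> (complex \<Rightarrow> real) \<Rightarrow> bool" where
  "C1_on W u \<longleftrightarrow>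
     (\<forall>z\<in>W. u differentiable (at z)) \<and>
     (\<forall>v. continuous_on W (\<lambda>z. frechet_derivative u (at z) v))"

definition form1_on :: "'a chart set \<Rightarrow> 'a set \<Rightarrow> 'a form1 \<Rightarrow> bool" where
  "form1_on A S \<omega> \<longleftrightarrow>
     (\<forall>c\<in>A. \<forall>p\<in>cdom c \<inter> S. linear (\<omega> c p)) \<and>
     (\<forall>c\<in>A. \<forall>d\<in>A. \<forall>p\<in>cdom c \<inter> cdom d \<inter> S. \<forall>v.
        \<omega> c p v = \<omega> d p (deriv (transition c d) (crd c p) * v)) \<and>
     (\<forall>c\<in>A. \<forall>v. C1_on (crd c ` (cdom c \<inter> S)) (\<lambda>z. \<omega> c (cinv c z) v))"

definition ext_deriv :: "'a form1 \<Rightarrow> 'a form2" where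
  "ext_deriv \<omega> c p =
     frechet_derivative (\<lambda>z. \<omega> c (cinv c z) \<i>) (at (crd c p)) 1
     - frechet_derivative (\<lambda>z. \<omega> c (cinv c z) 1) (at (crd c p)) \<i>"

definition closed_form :: "'a chart set \<Rightarrow> 'a set \<Rightarrow> 'a form1 \<Rightarrow> bool" where
  "closed_form A S \<omega> \<longleftrightarrow> form1_on A S \<omega> \<and> (\<forall>c\<in>A. \<forall>p\<in>cdom c \<inter> S. ext_deriv \<omega> c p = 0)"

text \<open>The sign is such that \<open>\<star>dx = dy\<close> and \<open>\<star>dy = -dx\<close>.\<close>

definition hodge :: "'a form1 \<Rightarrow> 'a form1" where
  "hodge \<omega> = (\<lambda>c p v. - \<omega> c p (\<i> * v))"

definition harmonic_form :: "'a chart set \<Rightarrow> 'a set \<Rightarrow> 'a form1 \<Rightarrow> bool" where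
  "harmonic_form A S \<omega> \<longleftrightarrow> closed_form A S \<omega> \<and> closed_form A S (hodge \<omega>)"

definition wedge :: "'a form1 \<Rightarrow> 'a form1 \<Rightarrow> 'a form2" where
  "wedge \<omega> \<eta> = (\<lambda>c p. \<omega> c p 1 * \<eta> c p \<i> - \<omega> c p \<i> * \<eta> c p 1)"

definition primitive_on :: "'a chart set \<Rightarrow> 'a set \<Rightarrow> 'a form1 \<Rightarrow> ('a \<Rightarrow> real) \<Rightarrow> bool" where
  "primitive_on A S \<omega> f \<longleftrightarrow>
     (\<forall>c\<in>A. \<forall>p\<in>cdom c \<inter> S. ((f \<circ> cinv c) has_derivative \<omega> c p) (at (crd c p)))"

definition exact_form :: "'a chart set \<Rightarrow> 'a set \<Rightarrow> 'a form1 \<Rightarrow> bool" where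
  "exact_form A S \<omega> \<longleftrightarrow> (\<exists>f. primitive_on A S \<omega> f)"

text \<open>A 2-form is integrated by cutting \<open>S\<close> into countably many Borel pieces, each contained in a
  chart domain; the integral is required to converge absolutely.\<close>

definition has_surface_integral ::
    "('a::t2_space) chart set \<Rightarrow> 'a set \<Rightarrow> 'a form2 \<Rightarrow> real \<Rightarrow> bool" where
  "has_surface_integral A S \<theta> I \<longleftrightarrow>
     (\<exists>B c. disjoint_family B \<and> (\<Union>n. B n) = S \<and>
        (\<forall>n::nat. c n \<in> A \<and> B n \<in> sets borel \<and> B n \<subseteq> cdom (c n) \<and>
           set_integrable lborel (crd (c n) ` B n) (\<lambda>z. \<theta> (c n) (cinv (c n) z))) \<and>
        summable (\<lambda>n. LINT z:crd (c n) ` B n|lborel. \<bar>\<theta> (c n) (cinv (c n) z)\<bar>) \<and>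
        (\<lambda>n. LINT z:crd (c n) ` B n|lborel. \<theta> (c n) (cinv (c n) z)) sums I)"

definition surface_integral :: "('a::t2_space) chart set \<Rightarrow> 'a set \<Rightarrow> 'a form2 \<Rightarrow> real" where
  "surface_integral A S \<theta> = (THE I. has_surface_integral A S \<theta> I)"

definition energy :: "('a::t2_space) chart set \<Rightarrow> 'a set \<Rightarrow> 'a form1 \<Rightarrow> real" where
  "energy A S \<omega> = surface_integral A S (wedge \<omega> (hodge \<omega>))"

text \<open>Curves are only assumed continuous. The integral of a closed form along a curve \<open>\<gamma>\<close> is the
  increment of a function on the parameter line that, near each parameter, is the pullback by \<open>\<gamma>\<close>
  of a local primitive of the form.\<close>

definition primitive_along ::
    "('a::t2_space) chart set \<Rightarrow> 'a form1 \<Rightarrow> (real \<Rightarrow> 'a) \<Rightarrow> (real \<Rightarrow> real) \<Rightarrow> bool" where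
  "primitive_along A \<omega> \<gamma> F \<longleftrightarrow>
     (\<forall>t. \<exists>U f. open U \<and> \<gamma> t \<in> U \<and> primitive_on A U \<omega> f \<and>
            (\<forall>\<^sub>F s in nhds t. F s = f (\<gamma> s)))"

text \<open>Closed curves are maps on \<open>\<real>\<close> of period 1, i.e. maps on \<open>\<real>/\<int>\<close>.\<close>

definition closed_curve_integral ::
    "('a::t2_space) chart set \<Rightarrow> 'a form1 \<Rightarrow> (real \<Rightarrow> 'a) \<Rightarrow> real" where
  "closed_curve_integral A \<omega> \<gamma> = (THE I. \<exists>F. primitive_along A \<omega> \<gamma> F \<and> I = F 1 - F 0)"

definition line_integral ::
    "('a::t2_space) chart set \<Rightarrow> 'a form1 \<Rightarrow> (real \<Rightarrow> 'a) \<Rightarrow> real" where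
  "line_integral A \<omega> \<gamma> =
     (THE I. \<exists>F l m. primitive_along A \<omega> \<gamma> F \<and> (F \<longlongrightarrow> l) at_bot \<and> (F \<longlongrightarrow> m) at_top \<and> I = m - l)"

definition simple_closed_curve :: "(real \<Rightarrow> 'a::t2_space) \<Rightarrow> bool" where
  "simple_closed_curve \<gamma> \<longleftrightarrow>
     continuous_on UNIV \<gamma> \<and> (\<forall>s t. \<gamma> s = \<gamma> t \<longleftrightarrow> s - t \<in> \<int>)"

text \<open>The local intersection number of \<open>a\<close> and \<open>b\<close> at an isolated common point \<open>a s = b t\<close> is the
  local degree at the origin of \<open>(\<xi>, \<eta>) \<mapsto> a (s + \<xi>) - b (t - \<eta>)\<close>, computed in a chart. It equals
  \<open>+1\<close> for a transversal crossing with positively oriented pair of tangents. The circle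
  \<open>(\<xi>, \<eta>) = (sin \<theta>, - cos \<theta>)\<close> is positively oriented.\<close>

definition has_local_intersection_number ::
    "('a::t2_space) chart set \<Rightarrow> (real \<Rightarrow> 'a) \<Rightarrow> real \<Rightarrow> (real \<Rightarrow> 'a) \<Rightarrow> real \<Rightarrow> int \<Rightarrow> bool" where
  "has_local_intersection_number A a s b t n \<longleftrightarrow>
     a s = b t \<and>
     (\<exists>c\<in>A. a s \<in> cdom c \<and>
        (\<forall>\<^sub>F \<epsilon> in at_right 0.
           winding_number
             (\<lambda>\<theta>. crd c (a (s + \<epsilon> * sin (2 * pi * \<theta>))) - crd c (b (t + \<epsilon> * cos (2 * pi * \<theta>)))) 0
           = of_int n))"

text \<open>The curves have the indices \<open>3, \<dots>, 2 g\<close>, and \<open>g - 1\<close> is the genus.\<close>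

definition canonical_basis ::
    "('a::t2_space) chart set \<Rightarrow> 'a set \<Rightarrow> nat \<Rightarrow> (nat \<Rightarrow> real \<Rightarrow> 'a) \<Rightarrow> bool" where
  "canonical_basis A S g \<alpha> \<longleftrightarrow>
     (\<forall>k\<in>{3..2*g}. simple_closed_curve (\<alpha> k) \<and> range (\<alpha> k) \<subseteq> S) \<and>
     (\<forall>k\<in>{2..g}. \<exists>s t. range (\<alpha> (2*k-1)) \<inter> range (\<alpha> (2*k)) = {\<alpha> (2*k) t} \<and>
         has_local_intersection_number A (\<alpha> (2*k-1)) s (\<alpha> (2*k)) t 1) \<and>
     (\<forall>i\<in>{3..2*g}. \<forall>j\<in>{3..2*g}.
         i < j \<and> \<not> (\<exists>k\<in>{2..g}. i = 2*k-1 \<and> j = 2*k) \<longrightarrow> range (\<alpha> i) \<inter> range (\<alpha> j) = {})"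

text \<open>A conformal metric \<open>\<rho>\<^sup>2 (dx\<^sup>2 + dy\<^sup>2)\<close> is given by its density \<open>\<rho>\<close> in each chart.\<close>

type_synonym 'a density = "'a chart \<Rightarrow> 'a \<Rightarrow> real"

definition laplacian :: "(complex \<Rightarrow> real) \<Rightarrow> complex \<Rightarrow> real" where
  "laplacian u z =
     frechet_derivative (\<lambda>w. frechet_derivative u (at w) 1) (at z) 1
     + frechet_derivative (\<lambda>w. frechet_derivative u (at w) \<i>) (at z) \<i>"

definition conformal_metric :: "'a chart set \<Rightarrow> 'a set \<Rightarrow> 'a density \<Rightarrow> bool" where
  "conformal_metric A S \<rho> \<longleftrightarrow>
     (\<forall>c\<in>A. \<forall>p\<in>cdom c \<inter> S. \<rho> c p > 0) \<and>
     (\<forall>c\<in>A. \<forall>d\<in>A. \<forall>p\<in>cdom c \<inter> cdom d \<inter> S.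
        \<rho> c p = \<rho> d p * cmod (deriv (transition c d) (crd c p))) \<and>
     (\<forall>c\<in>A. C1_on (crd c ` (cdom c \<inter> S)) (\<lambda>z. \<rho> c (cinv c z)) \<and>
        (\<forall>v. C1_on (crd c ` (cdom c \<inter> S))
           (\<lambda>z. frechet_derivative (\<lambda>w. \<rho> c (cinv c w)) (at z) v)))"

definition gauss_curvature :: "'a density \<Rightarrow> 'a chart \<Rightarrow> 'a \<Rightarrow> real" where
  "gauss_curvature \<rho> c p = - laplacian (\<lambda>z. ln (\<rho> c (cinv c z))) (crd c p) / (\<rho> c p)\<^sup>2"

text \<open>\<open>joined_by A S \<rho> p q L\<close>: there is a piecewise \<open>C\<^sup>1\<close> curve in \<open>S\<close> of length \<open>L\<close> from \<open>p\<close> to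
  \<open>q\<close>; the curve is a concatenation of arcs that lie in charts.\<close>

inductive joined_by ::
    "'a chart set \<Rightarrow> 'a set \<Rightarrow> 'a density \<Rightarrow> 'a \<Rightarrow> 'a \<Rightarrow> real \<Rightarrow> bool"
  for A :: "'a chart set" and S :: "'a set" and \<rho> :: "'a density" and p :: 'a where
  refl: "p \<in> S \<Longrightarrow> joined_by A S \<rho> p p 0"
| step: "joined_by A S \<rho> p q L \<Longrightarrow> c \<in> A \<Longrightarrow> q \<in> cdom c \<Longrightarrow> r \<in> cdom c \<Longrightarrow>
         valid_path \<gamma> \<Longrightarrow> path_image \<gamma> \<subseteq> crd c ` (cdom c \<inter> S) \<Longrightarrow>
         pathstart \<gamma> = crd c q \<Longrightarrow> pathfinish \<gamma> = crd c r \<Longrightarrow>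
         joined_by A S \<rho> p r
           (L + integral {0..1} (\<lambda>t. \<rho> c (cinv c (\<gamma> t)) * cmod (vector_derivative \<gamma> (at t))))"

definition metric_dist :: "'a chart set \<Rightarrow> 'a set \<Rightarrow> 'a density \<Rightarrow> 'a \<Rightarrow> 'a \<Rightarrow> real" where
  "metric_dist A S \<rho> p q = Inf {L. joined_by A S \<rho> p q L}"

definition complete_metric :: "'a chart set \<Rightarrow> 'a set \<Rightarrow> 'a density \<Rightarrow> bool" where
  "complete_metric A S \<rho> \<longleftrightarrow>
     (\<forall>\<sigma>. range \<sigma> \<subseteq> S \<and>
          (\<forall>e>0. \<exists>N. \<forall>m\<ge>N. \<forall>n\<ge>N. metric_dist A S \<rho> (\<sigma> m) (\<sigma> n) < e) \<longrightarrow>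
          (\<exists>p\<in>S. (\<lambda>n::nat. metric_dist A S \<rho> (\<sigma> n) p) \<longlonglongrightarrow> 0))"

definition complete_hyperbolic_metric :: "'a chart set \<Rightarrow> 'a set \<Rightarrow> 'a density \<Rightarrow> bool" where
  "complete_hyperbolic_metric A S \<rho> \<longleftrightarrow>
     conformal_metric A S \<rho> \<and> complete_metric A S \<rho> \<and>
     (\<forall>c\<in>A. \<forall>p\<in>cdom c \<inter> S. gauss_curvature \<rho> c p = -1)"

text \<open>Cusps with their coordinates \<open>z = x + \<i> y\<close> are given by the inverse of the coordinate, lifted
  from the half-infinite cylinder to the half plane; \<open>\<sigma> = -1\<close> for \<open>V\<^sub>1 = (-\<infinity>, 0] \<times> \<real>/\<int>\<close> and
  \<open>\<sigma> = 1\<close> for \<open>V\<^sub>2 = [0, \<infinity>) \<times> \<real>/\<int>\<close>. The cusp itself is \<open>\<kappa> ` cusp_halfplane \<sigma>\<close>.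
  On these half planes \<open>(x - 1)\<^sup>2\<close> and \<open>(x + 1)\<^sup>2\<close>, respectively, are both \<open>(1 + \<bar>x\<bar>)\<^sup>2\<close>.\<close>

definition cusp_halfplane :: "real \<Rightarrow> complex set" where
  "cusp_halfplane \<sigma> = {z. \<sigma> * Re z \<ge> 0}"

definition cusp_coordinates ::
    "('a::t2_space) chart set \<Rightarrow> 'a set \<Rightarrow> 'a density \<Rightarrow> real \<Rightarrow> 'a \<Rightarrow> (complex \<Rightarrow> 'a) \<Rightarrow> bool" where
  "cusp_coordinates A S \<rho> \<sigma> v \<kappa> \<longleftrightarrow>
     continuous_on (cusp_halfplane \<sigma>) \<kappa> \<and> \<kappa> ` cusp_halfplane \<sigma> \<subseteq> S \<and>
     (\<forall>z\<in>cusp_halfplane \<sigma>. \<forall>w\<in>cusp_halfplane \<sigma>.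
        \<kappa> z = \<kappa> w \<longleftrightarrow> (\<exists>n::int. w = z + \<i> * of_int n)) \<and>
     (\<forall>z\<in>cusp_halfplane \<sigma>. \<forall>c\<in>A. \<kappa> z \<in> cdom c \<longrightarrow>
        (\<exists>D. ((crd c \<circ> \<kappa>) has_field_derivative D) (at z within cusp_halfplane \<sigma>) \<and>
             \<rho> c (\<kappa> z) * cmod D = 1 / (1 + \<bar>Re z\<bar>))) \<and>
     (\<kappa> \<longlongrightarrow> v) (filtercomap (\<lambda>z. \<sigma> * Re z) at_top)"

text \<open>\<open>\<alpha>\<close> parametrizes the boundary \<open>x = 0\<close> of the cusp once in the direction of increasing \<open>y\<close>.\<close>

definition cusp_boundary_curve :: "(complex \<Rightarrow> 'a) \<Rightarrow> (real \<Rightarrow> 'a) \<Rightarrow> bool" where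
  "cusp_boundary_curve \<kappa> \<alpha> \<longleftrightarrow>
     (\<exists>h. continuous_on UNIV h \<and> strict_mono h \<and> (\<forall>t. h (t + 1) = h t + 1) \<and>
          (\<forall>t. \<alpha> t = \<kappa> (\<i> * of_real (h t))))"

text \<open>The \<open>y\<close>-coordinate of \<open>\<gamma> s\<close> converges in \<open>\<real>/\<int>\<close>; \<open>F\<close> will be \<open>at_bot\<close> or \<open>at_top\<close>.\<close>

definition y_converges ::
    "real \<Rightarrow> (complex \<Rightarrow> 'a) \<Rightarrow> (real \<Rightarrow> 'a) \<Rightarrow> real filter \<Rightarrow> bool" where
  "y_converges \<sigma> \<kappa> \<gamma> F \<longleftrightarrow>
     (\<exists>z y. (\<forall>\<^sub>F s in F. z s \<in> cusp_halfplane \<sigma> \<and> \<kappa> (z s) = \<gamma> s) \<and> ((\<lambda>s. Im (z s)) \<longlongrightarrow> y) F)"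

definition admissible_curve ::
    "'a set \<Rightarrow> 'a \<Rightarrow> (complex \<Rightarrow> 'a) \<Rightarrow> 'a \<Rightarrow> (complex \<Rightarrow> 'a) \<Rightarrow> (real \<Rightarrow> 'a::t2_space) \<Rightarrow> bool" where
  "admissible_curve S v1 \<kappa>1 v2 \<kappa>2 \<gamma> \<longleftrightarrow>
     continuous_on UNIV \<gamma> \<and> range \<gamma> \<subseteq> S \<and>
     (\<gamma> \<longlongrightarrow> v1) at_bot \<and> (\<gamma> \<longlongrightarrow> v2) at_top \<and>
     y_converges (-1) \<kappa>1 \<gamma> at_bot \<and> y_converges 1 \<kappa>2 \<gamma> at_top"

text \<open>The pullback of \<open>\<omega>\<close> to the cusp is \<open>dx\<close> up to a form whose coefficients decay exponentially.
  For a harmonic form this says that it has a logarithmic pole at the puncture: the coordinate of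
  the punctured disc is \<open>\<zeta> = exp (\<plusminus>2 \<pi> z)\<close>, so \<open>dx = \<plusminus> d log \<bar>\<zeta>\<bar> / (2 \<pi>)\<close>.\<close>

definition asymptotic_to_dx ::
    "'a chart set \<Rightarrow> real \<Rightarrow> (complex \<Rightarrow> 'a) \<Rightarrow> 'a form1 \<Rightarrow> bool" where
  "asymptotic_to_dx A \<sigma> \<kappa> \<omega> \<longleftrightarrow>
     (\<exists>C. \<exists>\<delta>>0. \<forall>z\<in>cusp_halfplane \<sigma>. \<forall>c\<in>A. \<forall>D.
        \<kappa> z \<in> cdom c \<and> ((crd c \<circ> \<kappa>) has_field_derivative D) (at z within cusp_halfplane \<sigma>) \<longrightarrow>
        (\<forall>v. \<bar>\<omega> c (\<kappa> z) (D * v) - Re v\<bar> \<le> C * exp (- \<delta> * \<bar>Re z\<bar>) * cmod v))"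

definition tau2 ::
    "('a::t2_space) chart set \<Rightarrow> nat \<Rightarrow> (nat \<Rightarrow> real \<Rightarrow> 'a) \<Rightarrow> (nat \<Rightarrow> 'a form1) \<Rightarrow> 'a form1" where
  "tau2 A g \<alpha> \<tau> =
     (\<lambda>c p v. hodge (\<tau> 1) c p v
        - (\<Sum>k=3..2*g. closed_curve_integral A (hodge (\<tau> 1)) (\<alpha> k) * \<tau> k c p v))"

definition q_const ::
    "('a::t2_space) chart set \<Rightarrow> 'a set \<Rightarrow> (nat \<Rightarrow> 'a form1) \<Rightarrow> nat \<Rightarrow> nat \<Rightarrow> real" where
  "q_const A S \<tau> i j =
     (if i = 1 \<or> j = 1 then 0 else surface_integral A S (wedge (\<tau> i) (hodge (\<tau> j))))"

definition pi22_const :: "('a::t2_space) chart set \<Rightarrow> 'a set \<Rightarrow> (nat \<Rightarrow> 'a form1) \<Rightarrow> real" where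
  "pi22_const A S \<tau> = energy A S (\<lambda>c p v. \<tau> 2 c p v - hodge (\<tau> 1) c p v)"

definition kappa_const ::
    "('a::t2_space) chart set \<Rightarrow> (real \<Rightarrow> 'a) \<Rightarrow> (nat \<Rightarrow> 'a form1) \<Rightarrow> nat \<Rightarrow> real" where
  "kappa_const A \<gamma> \<tau> j = (if j = 1 then 1 else - line_integral A (\<tau> j) \<gamma>)"

definition p_entry ::
    "('a::t2_space) chart set \<Rightarrow> 'a set \<Rightarrow> (real \<Rightarrow> 'a) \<Rightarrow> (nat \<Rightarrow> 'a form1) \<Rightarrow> real
      \<Rightarrow> nat \<Rightarrow> nat \<Rightarrow> real" where
  "p_entry A S \<gamma> \<tau> lam i j =
     (if i = 2 \<and> j = 2
      then pi22_const A S \<tau> + lam + (kappa_const A \<gamma> \<tau> 2)\<^sup>2 / lam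
      else q_const A S \<tau> i j + kappa_const A \<gamma> \<tau> i * kappa_const A \<gamma> \<tau> j / lam)"

text \<open>Matrix entries are counted from 0, the constants from 1.\<close>

definition P_matrix ::
    "('a::t2_space) chart set \<Rightarrow> 'a set \<Rightarrow> (real \<Rightarrow> 'a) \<Rightarrow> (nat \<Rightarrow> 'a form1) \<Rightarrow> nat \<Rightarrow> real
      \<Rightarrow> real Matrix.mat" where
  "P_matrix A S \<gamma> \<tau> g lam =
     Matrix.mat (2*g) (2*g) (\<lambda>(i, j). p_entry A S \<gamma> \<tau> lam (i + 1) (j + 1))"

definition J_matrix :: "nat \<Rightarrow> real Matrix.mat" where
  "J_matrix g = diag_block_mat (replicate g (mat_of_rows_list 2 [[0, 1], [-1, 0]]))"

end

theory Submission
  imports Defs "Jordan_Normal_Form.Determinant"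
begin

text \<open>The proof computes everything through the pairing \<open>\<integral> \<omega> \<and> \<eta>\<close> of closed forms on the compact
  surface. A curve has a dual closed form, built as a sum of forms with a pair of opposite residues
  supported in small discs, and the pairing with it is the integral along the curve. The period of
  the dual form of one curve along a second curve is their intersection number, so the forms \<open>\<tau>\<^sub>j\<close>,
  \<open>j \<ge> 3\<close>, have the intersection matrix \<open>J\<close>; since the Hodge star preserves the pairing, the energy
  matrix \<open>Q\<close> of these forms satisfies \<open>Q J Q = J\<close>. By the asymptotics in the cusps, \<open>\<star>\<tau>\<^sub>1\<close> has residues
  of opposite sign at the punctures, so it differs from the dual form of the curve \<open>\<gamma>\<close> by a closed
  form on the compact surface. As \<open>\<tau>\<^sub>1\<close> is exact, this gives \<open>\<kappa> = J c\<close> for the periods \<open>c\<close> of \<open>\<star>\<tau>\<^sub>1\<close>.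
  The second row of \<open>P\<close> is \<open>- Q c\<close> with corner \<open>c\<^sup>T Q c\<close>, and the claim is linear algebra; the value
  of \<open>\<kappa>\<^sub>2\<close> plays no role.\<close>

section \<open>Differential calculus in the plane\<close>

text \<open>The curves are merely continuous, so there is no tubular neighbourhood from which a dual
  form could be taken. A curve is cut into arcs inside coordinate discs instead. The form of an arc
  depends on it only through its two end points and a disc containing it, and residues cancel where
  arcs are joined. The price is regularity: cutoffs are C^1, so the forms have only continuous
  coefficients. A closed form is therefore one with local C^1 primitives (\<open>locex\<close>), and
  Stokes' theorem is derived without second derivatives, from central differences in the plane. Two
  facts that are usually quoted appear as conclusions. That the curves \<open>\<alpha> k\<close>
  carry all periods follows from the rank of the homology group and the existence of the dual basis,
  by inverting a square matrix. For the intersection matrix one crossing is evaluated per handle: a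
  dual form of \<open>\<alpha> (2*m)\<close> has period -1 on \<open>\<alpha> (2*m-1)\<close>.
  Antisymmetry of the pairing fixes the remaining periods of the dual forms, those on the own curve
  included.\<close>

definition C1f :: "complex set => (complex => real) => (complex => complex => real) => bool" where
 "C1f W u u' \<longleftrightarrow> (\<forall>z\<in>W. (u has_derivative u' z) (at z)) & (\<forall>v. continuous_on W (%z. u' z v))"

lemma C1f_D: "C1f W u u' ==> z \<in> W ==> (u has_derivative u' z) (at z)"
 by (simp add: C1f_def)

lemma C1f_cont': "C1f W u u' ==> continuous_on W (%z. u' z v)"
 by (simp add: C1f_def)

lemma C1f_lin: "C1f W u u' ==> z \<in> W ==> linear (u' z)"
 using C1f_D has_derivative_linear by blast

lemma C1f_cont: "C1f W u u' ==> continuous_on W u"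
 by (meson C1f_D continuous_at_imp_continuous_on has_derivative_continuous)

lemma C1f_subset: "C1f W u u' ==> V \<subseteq> W ==> C1f V u u'"
 unfolding C1f_def by (meson continuous_on_subset subsetD)

lemma C1f_const: "C1f W (%z. c) (%z v. 0)"
 by (auto simp: C1f_def)

lemma C1f_linear: "bounded_linear l ==> C1f W l (%z. l)"
 by (auto simp: C1f_def bounded_linear_imp_has_derivative)

lemma C1f_add: "C1f W u u' ==> C1f W w w' ==> C1f W (%z. u z + w z) (%z v. u' z v + w' z v)"
 by (auto simp: C1f_def intro!: derivative_intros continuous_intros)

lemma C1f_diff: "C1f W u u' ==> C1f W w w' ==> C1f W (%z. u z - w z) (%z v. u' z v - w' z v)"
 by (auto simp: C1f_def intro!: derivative_intros continuous_intros)

lemma C1f_mult: "C1f W u u' ==> C1f W w w' ==>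
 C1f W (%z. u z * w z) (%z v. u z * w' z v + u' z v * w z)"
 using C1f_cont[of W u u'] C1f_cont[of W w w']
 by (auto simp: C1f_def intro!: has_derivative_mult continuous_intros)

lemma C1f_cmult: "C1f W u u' ==> C1f W (%z. c * u z) (%z v. c * u' z v)"
 by (auto simp: C1f_def intro!: derivative_intros continuous_intros)

lemma C1f_comp_real:
 assumes "C1f W u u'" "!!z. z \<in> W ==> (g has_real_derivative g' (u z)) (at (u z))" "continuous_on (u ` W) g'"
 shows "C1f W (%z. g (u z)) (%z v. g' (u z) * u' z v)"
 unfolding C1f_def
proof (intro conjI ballI allI)
 show "((%z. g (u z)) has_derivative (%v. g' (u z) * u' z v)) (at z)" if "z \<in> W" for z
  using has_derivative_compose[OF C1f_D[OF assms(1) that], of g "(*) (g' (u z))"] assms(2)[OF that]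
  by (simp add: has_field_derivative_def)
 show "continuous_on W (%z. g' (u z) * u' z v)" for v
  by (intro continuous_intros C1f_cont'[OF assms(1)] continuous_on_compose2[OF assms(3) C1f_cont[OF assms(1)]]) auto
qed

lemma C1f_comp_holo:
 assumes "C1f W u u'" "T holomorphic_on V" "open V" "T ` V \<subseteq> W"
 shows "C1f V (%z. u (T z)) (%z v. u' (T z) (deriv T z * v))"
 unfolding C1f_def
proof (intro conjI ballI allI)
 show "((%z. u (T z)) has_derivative (%v. u' (T z) (deriv T z * v))) (at z)" if "z \<in> V" for z
 proof -
  have "(T has_derivative (%v. deriv T z * v)) (at z)"
   using holomorphic_derivI[OF assms(2,3) that] by (simp add: has_field_derivative_def)
  moreover have "T z \<in> W" using assms that by auto
  ultimately show ?thesis using has_derivative_compose C1f_D[OF assms(1)] by blast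
 qed
 have c: "continuous_on V T" using assms(2) holomorphic_on_imp_continuous_on by blast
 show "continuous_on V (%z. u' (T z) (deriv T z * v))" for v
 proof -
  \<comment> \<open>Continuity of \<open>u'\<close> is known only for a fixed direction, whereas the
    direction here moves with \<open>z\<close>; hence the expansion in the basis 1, \<i>.\<close>
  have "u' (T z) (deriv T z * v) = Re (deriv T z * v) * u' (T z) 1 + Im (deriv T z * v) * u' (T z) \<i>" if "z \<in> V" for z
  proof -
   have l: "linear (u' (T z))" using C1f_lin[OF assms(1)] assms(4) that by blast
   have "deriv T z * v = Re (deriv T z * v) *\<^sub>R 1 + Im (deriv T z * v) *\<^sub>R \<i>"
    by (simp add: complex_eq_iff)
   then have "u' (T z) (deriv T z * v) = u' (T z) (Re (deriv T z * v) *\<^sub>R 1 + Im (deriv T z * v) *\<^sub>R \<i>)" by simp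
   also have "\<dots> = Re (deriv T z * v) * u' (T z) 1 + Im (deriv T z * v) * u' (T z) \<i>"
    using l by (simp add: linear_add linear_cmul)
   finally show ?thesis .
  qed
  moreover have "continuous_on V (%z. Re (deriv T z * v) * u' (T z) 1 + Im (deriv T z * v) * u' (T z) \<i>)"
   using assms(2,3,4)
   by (intro continuous_intros continuous_on_compose2[OF C1f_cont'[OF assms(1)] c]
     holomorphic_on_imp_continuous_on holomorphic_deriv) auto
  ultimately show ?thesis by (simp cong: continuous_on_cong)
 qed
qed

lemma linear_complex_real:
 assumes "linear (l :: complex => real)" shows "l v = Re v * l 1 + Im v * l \<i>"
proof -
 have "l v = l (Re v *\<^sub>R 1 + Im v *\<^sub>R \<i>)" by (rule arg_cong[of _ _ l]) (simp add: complex_eq_iff)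
 also have "\<dots> = Re v * l 1 + Im v * l \<i>" using assms by (simp add: linear_add linear_cmul)
 finally show ?thesis .
qed

lemma C1f_Re: assumes "f holomorphic_on V" "open V"
 shows "C1f V (%z. Re (f z)) (%z v. Re (deriv f z * v))"
 using C1f_comp_holo[OF C1f_linear[OF bounded_linear_Re] assms, of UNIV] by simp

lemma C1f_Im: assumes "f holomorphic_on V" "open V"
 shows "C1f V (%z. Im (f z)) (%z v. Im (deriv f z * v))"
 using C1f_comp_holo[OF C1f_linear[OF bounded_linear_Im] assms, of UNIV] by simp

lemma C1f_cong:
 assumes "C1f W u u'" "open W" "!!z. z \<in> W ==> u z = w z"
 shows "C1f W w u'"
proof -
 have "(w has_derivative u' z) (at z)" if "z \<in> W" for z
  using has_derivative_transform_within_open[OF C1f_D[OF assms(1) that] assms(2) that] assms(3) by auto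
 then show ?thesis using assms(1) by (auto simp: C1f_def)
qed

lemma C1f_cong':
 assumes "C1f W u u'" "open W" "!!z. z \<in> W ==> u z = w z" "!!z v. z \<in> W ==> u' z v = w' z v"
 shows "C1f W w w'"
proof -
 have "u' z = w' z" if "z \<in> W" for z using assms(4)[OF that] by blast
 then show ?thesis using C1f_cong[OF assms(1-3)] by (auto simp: C1f_def cong: continuous_on_cong)
qed

lemma C1f_Un:
 assumes "C1f W u u'" "C1f V u u'" "open W" "open V"
 shows "C1f (W Un V) u u'"
 using assms unfolding C1f_def by (auto intro: continuous_on_open_Un)

lemma C1f_unique:
 assumes "C1f W u u'" "C1f V u u2'" "z \<in> W" "z \<in> V"
 shows "u' z = u2' z"
 using has_derivative_unique[OF C1f_D[OF assms(1,3)] C1f_D[OF assms(2,4)]] .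

text \<open>\<open>W\<close> and the complement of \<open>K\<close> are open and cover the plane.
  Only the vanishing of \<open>u\<close> off \<open>K\<close> is assumed; that of \<open>u'\<close>
  on the overlap follows from uniqueness of derivatives.\<close>

lemma C1f_extend0:
 assumes "C1f W u u'" "open W" "closed K" "K \<subseteq> W" "!!z. z ~: K ==> u z = 0"
 shows "C1f UNIV u (%z v. if z \<in> K then u' z v else 0)"
proof -
 have o: "open (- K)" using assms by auto
 have 0: "C1f (- K) u (%z v. 0)" by (rule C1f_cong[OF C1f_const]) (use assms in auto)
 then have e: "u' z = (%v. 0)" if "z \<in> W - K" for z
  using C1f_unique[OF assms(1) 0, of z] that by auto
 have "C1f W u (%z v. if z \<in> K then u' z v else 0)"
  by (rule C1f_cong'[OF assms(1)]) (use assms e in auto)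
 moreover have "C1f (- K) u (%z v. if z \<in> K then u' z v else 0)"
  by (rule C1f_cong'[OF 0 o]) (use assms e in auto)
 moreover have "W Un - K = UNIV" using assms by auto
 ultimately show ?thesis using C1f_Un[of W u _ "- K"] assms o by simp
qed

lemma C1f_zero_outside:
 assumes "C1f UNIV u u'" "closed K" "!!z. z ~: K ==> u z = 0" "z ~: K"
 shows "u' z v = 0"
proof -
 have 0: "C1f (- K) u (%z v. 0)" by (rule C1f_cong[OF C1f_const]) (use assms in auto)
 show ?thesis using C1f_unique[OF assms(1) 0, of z] assms(4) by auto
qed

section \<open>Cutoff functions of class C^1\<close>

definition sq_pos :: "real => real" where "sq_pos x = (max 0 x)\<^sup>2"

lemma sq_pos_deriv: "(sq_pos has_real_derivative 2 * max 0 x) (at x)"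
proof -
 consider "x > 0" | "x < 0" | "x = 0" by linarith
 then show ?thesis
 proof cases
  case 1
  have "((%x. x\<^sup>2) has_real_derivative 2 * max 0 x) (at x)" using 1 by (auto intro!: derivative_eq_intros)
  then show ?thesis
   by (rule has_field_derivative_transform_within_open[of _ _ _ "{0<..}"]) (use 1 in \<open>auto simp: sq_pos_def\<close>)
 next
  case 2
  have "((%x. 0) has_real_derivative 2 * max 0 x) (at x)" using 2 by (auto intro!: derivative_eq_intros)
  then show ?thesis
   by (rule has_field_derivative_transform_within_open[of _ _ _ "{..<0}"]) (use 2 in \<open>auto simp: sq_pos_def\<close>)
 next
  case 3
  have "((%h. (sq_pos (0 + h) - sq_pos 0) / h) \<longlongrightarrow> 0) (at 0)"
  proof (rule Lim_null_comparison)
   show "\<forall>\<^sub>F h in at 0. norm ((sq_pos (0 + h) - sq_pos 0) / h) <= \<bar>h\<bar>"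
    by (rule always_eventually) (auto simp: sq_pos_def max_def power2_eq_square)
   show "((%h::real. \<bar>h\<bar>) \<longlongrightarrow> 0) (at 0)" by (auto intro!: tendsto_eq_intros)
  qed
  then show ?thesis using 3 by (simp add: DERIV_def)
 qed
qed

text \<open>The variable \<open>t\<close> is 0 on the inner circle and 1 on the outer one, and the
  quotient \<open>s\<close> falls from 1 to 0 between these values with a continuous derivative,
  because \<open>sq_pos\<close> is C^1. Taking \<open>t\<close> affine in the square of the distance
  makes it a polynomial, smooth also at the centre.\<close>

lemma ex_cutoff:
 fixes w :: complex and r1 r2 :: real
 assumes "0 < r1" "r1 < r2"
 obtains h h' where "C1f UNIV h h'" "!!z. z \<in> cball w r1 ==> h z = 1" "!!z. z ~: ball w r2 ==> h z = 0"
  "!!z. 0 <= h z & h z <= 1"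
proof -
 define t where "t z = ((Re (z - w))\<^sup>2 + (Im (z - w))\<^sup>2 - r1\<^sup>2) / (r2\<^sup>2 - r1\<^sup>2)" for z
 define t' where "t' z v = (2 * Re (z - w) * Re v + 2 * Im (z - w) * Im v) / (r2\<^sup>2 - r1\<^sup>2)" for z v
 have d: "r2\<^sup>2 - r1\<^sup>2 > 0" using assms by (simp add: power_strict_mono)
 define e where "e = 1 / (r2\<^sup>2 - r1\<^sup>2)"
 have t_eq: "t = (%z. e * ((Re (z - w))\<^sup>2 + (Im (z - w))\<^sup>2 - r1\<^sup>2))"
  "t' = (%z v. e * (2 * Re (z - w) * Re v + 2 * Im (z - w) * Im v))"
  by (auto simp: t_def t'_def e_def fun_eq_iff)
 have t: "C1f UNIV t t'" unfolding C1f_def t_eq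
  by (auto intro!: derivative_eq_intros continuous_intros simp: algebra_simps)
 have tt: "t z = ((cmod (z - w))\<^sup>2 - r1\<^sup>2) / (r2\<^sup>2 - r1\<^sup>2)" for z
  by (simp add: t_def cmod_power2)
 define s where "s x = sq_pos (1 - x) / (sq_pos (1 - x) + sq_pos x)" for x
 define s' where "s' x = (- 2 * max 0 (1 - x) * (sq_pos (1 - x) + sq_pos x) - sq_pos (1 - x) * (- 2 * max 0 (1 - x) + 2 * max 0 x)) / ((sq_pos (1 - x) + sq_pos x) * (sq_pos (1 - x) + sq_pos x))" for x
 have ne: "sq_pos (1 - x) + sq_pos x > 0" for x
  by (cases "x > 0") (auto simp: sq_pos_def add_nonneg_pos add_pos_nonneg)
 have sd: "(s has_real_derivative s' x) (at x)" for x
 proof -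
  have 1: "((%x. sq_pos (1 - x)) has_real_derivative - 2 * max 0 (1 - x)) (at x)"
   by (rule DERIV_chain2[OF sq_pos_deriv, of "%x. 1 - x" "-1" x UNIV, THEN DERIV_cong]) (auto intro!: derivative_eq_intros)
  show ?thesis unfolding s_def s'_def
   using ne[of x] by (intro DERIV_divide DERIV_add sq_pos_deriv 1) auto
 qed
 have sc: "continuous_on UNIV sq_pos" using sq_pos_deriv by (meson DERIV_continuous continuous_at_imp_continuous_on)
 have s'c: "continuous_on X s'" for X unfolding s'_def using ne
  by (intro continuous_intros continuous_on_compose2[OF sc]) (auto simp: less_imp_neq[symmetric])
 have C: "C1f UNIV (%z. s (t z)) (%z v. s' (t z) * t' z v)"
  by (rule C1f_comp_real[OF t sd s'c])
 show ?thesis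
 proof (rule that[OF C])
  show "s (t z) = 1" if "z \<in> cball w r1" for z
  proof -
   have "cmod (z - w) <= r1" using that by (simp add: dist_norm norm_minus_commute)
   then have "(cmod (z - w))\<^sup>2 <= r1\<^sup>2" by (simp add: power_mono)
   then have "t z <= 0" using d by (simp add: tt divide_nonpos_pos)
   then have "sq_pos (t z) = 0" by (simp add: sq_pos_def)
   then show ?thesis using ne[of "t z"] by (simp add: s_def)
  qed
  show "s (t z) = 0" if "z ~: ball w r2" for z
  proof -
   have "cmod (z - w) \<ge> r2" using that by (simp add: dist_norm norm_minus_commute)
   then have "(cmod (z - w))\<^sup>2 \<ge> r2\<^sup>2" using assms by (simp add: power_mono)
   then have "t z \<ge> 1" using d by (simp add: tt)
   then show ?thesis by (simp add: sq_pos_def s_def)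
  qed
  have n: "0 <= sq_pos x" for x by (simp add: sq_pos_def)
  show "0 <= s (t z) & s (t z) <= 1" for z
   using ne[of "t z"] n[of "t z"] n[of "1 - t z"] by (simp add: s_def field_simps)
 qed
qed

lemma C1f_bound:
 assumes "C1f W u u'" "compact K" "K \<subseteq> W"
 obtains B where "B \<ge> 0" "!!z v. z \<in> K ==> \<bar>u' z v\<bar> <= B * cmod v"
proof -
 have c: "compact ((%z. u' z v) ` K)" for v
  using C1f_cont'[OF assms(1), of v] assms(2,3) compact_continuous_image continuous_on_subset by blast
 obtain B1 where B1: "!!z. z \<in> K ==> \<bar>u' z 1\<bar> <= B1"
  using compact_imp_bounded[OF c[of 1]] by (auto simp: bounded_iff)
 obtain B2 where B2: "!!z. z \<in> K ==> \<bar>u' z \<i>\<bar> <= B2"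
  using compact_imp_bounded[OF c[of \<i>]] by (auto simp: bounded_iff)
 show ?thesis
 proof (rule that[of "\<bar>B1\<bar> + \<bar>B2\<bar>"])
  show "\<bar>u' z v\<bar> <= (\<bar>B1\<bar> + \<bar>B2\<bar>) * cmod v" if "z \<in> K" for z v
  proof -
   have "u' z v = Re v * u' z 1 + Im v * u' z \<i>"
    by (rule linear_complex_real[OF C1f_lin[OF assms(1)]]) (use assms that in auto)
   then have "\<bar>u' z v\<bar> <= \<bar>Re v\<bar> * \<bar>u' z 1\<bar> + \<bar>Im v\<bar> * \<bar>u' z \<i>\<bar>"
    by (metis abs_mult abs_triangle_ineq)
   also have "\<dots> <= cmod v * \<bar>B1\<bar> + cmod v * \<bar>B2\<bar>"
    using B1[OF that] B2[OF that] abs_Re_le_cmod[of v] abs_Im_le_cmod[of v]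
    by (intro add_mono mult_mono) auto
   finally show ?thesis by (simp add: algebra_simps)
  qed
 qed auto
qed

section \<open>Stokes and Cauchy formulas in the plane\<close>

text \<open>The coefficient of a wedge product with respect to dx \<and> dy, for fields of covectors
  on the plane.\<close>

definition wd :: "(complex => complex => real) => (complex => complex => real) => complex => real" where
 "wd a b z = a z 1 * b z \<i> - a z \<i> * b z 1"

lemma integrable_compact_support:
 fixes f :: "complex => real"
 assumes "continuous_on UNIV f" "compact K" "!!z. z ~: K ==> f z = 0"
 shows "integrable lborel f"
proof -
 have "integrable lborel (%x. indicator K x *\<^sub>R f x)"
  by (rule borel_integrable_compact) (use assms continuous_on_subset[OF assms(1)] in auto)
 moreover have "(%x. indicator K x *\<^sub>R f x) = f" using assms(3) by (auto simp: indicator_def fun_eq_iff)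
 ultimately show ?thesis by simp
qed

text \<open>Symmetric difference quotients replace derivatives because integrals over the plane are
  invariant under translation: a summation by parts is then an exact identity and asks for no second
  derivative.\<close>

definition cdiff :: "(complex => real) => complex => nat => complex => real" where
 "cdiff f v n z = (f (z + v / of_nat (Suc n)) - f (z - v / of_nat (Suc n))) * (Suc n / 2)"

lemma cdiff_tendsto:
 assumes "(f has_derivative f') (at z)"
 shows "(%n. cdiff f v n z) \<longlonglongrightarrow> f' v"
proof -
 have l: "linear f'" using assms has_derivative_linear by blast
 define g where "g t = f (z + of_real t * v)" for t :: real
 have "((%t::real. z + of_real t * v) has_derivative (%t. of_real t * v)) (at 0)"
  by (auto intro!: derivative_eq_intros)
 then have "(g has_derivative (%t. f' (of_real t * v))) (at 0)"
  unfolding g_def using has_derivative_compose[of "%t::real. z + of_real t * v" _ 0 UNIV f f'] assms by simp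
 moreover have "f' (of_real t * v) = f' v * t" for t
  using linear_cmul[OF l, of t v] by (simp add: scaleR_conv_of_real)
 ultimately have "(g has_real_derivative f' v) (at 0)" by (simp add: has_field_derivative_def)
 then have g: "((%h. (g h - g 0) / h) \<longlongrightarrow> f' v) (at 0)" by (simp add: DERIV_def)
 have s1: "filterlim (%n. inverse (real (Suc n))) (at 0) sequentially"
  by (rule filterlim_atI[OF LIMSEQ_inverse_real_of_nat]) auto
 have s2: "filterlim (%n. - inverse (real (Suc n))) (at 0) sequentially"
  by (rule filterlim_atI) (use tendsto_minus[OF LIMSEQ_inverse_real_of_nat] in auto)
 have "(%n. ((g (inverse (real (Suc n))) - g 0) / inverse (real (Suc n))
    + (g (- inverse (real (Suc n))) - g 0) / (- inverse (real (Suc n)))) / 2) \<longlonglongrightarrow> (f' v + f' v) / 2"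
  by (intro tendsto_intros filterlim_compose[OF g] s1 s2) auto
 moreover have "((g (inverse (real (Suc n))) - g 0) / inverse (real (Suc n))
    + (g (- inverse (real (Suc n))) - g 0) / (- inverse (real (Suc n)))) / 2 = cdiff f v n z" for n
  by (simp add: cdiff_def g_def field_simps)
 ultimately show ?thesis by simp
qed

lemma cdiff_bound:
 assumes "C1f UNIV f f'" "!!w v. w \<in> cball 0 R ==> \<bar>f' w v\<bar> <= B * cmod v" "cmod v <= 1" "cmod z + 1 <= R" "B \<ge> 0"
 shows "\<bar>cdiff f v n z\<bar> <= B"
proof -
 define h where "h = v / of_nat (Suc n)"
 have h: "cmod h <= 1 / Suc n" using assms(3) by (simp add: h_def norm_divide divide_right_mono del: of_nat_Suc)
 have "1 / real (Suc n) <= 1" by simp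
 then have h1: "cmod h <= 1" using h by linarith
 have "norm (f (z + h) - f (z - h)) <= B * norm ((z + h) - (z - h))"
 proof (rule differentiable_bound[of "cball 0 R" f f'])
  show "(f has_derivative f' x) (at x within cball 0 R)" for x
   using C1f_D[OF assms(1)] has_derivative_at_withinI by blast
  show "onorm (f' x) <= B" if "x \<in> cball 0 R" for x
   using assms(2)[OF that] assms(5) by (intro onorm_bound) auto
  show "z + h \<in> cball 0 R" "z - h \<in> cball 0 R"
   using h1 assms(4) norm_triangle_ineq[of z h] norm_triangle_ineq4[of z h] by auto
 qed auto
 also have "\<dots> = B * (2 * cmod h)"
  by (metis (no_types, lifting) add_diff_cancel_left' diff_add_cancel diff_diff_eq2 mult_2 norm_mult norm_numeral)
 also have "\<dots> <= B * (2 * (1 / Suc n))" using h assms(5) by (intro mult_left_mono) auto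
 finally have "\<bar>f (z + h) - f (z - h)\<bar> * (Suc n / 2) <= B * (2 * (1 / Suc n)) * (Suc n / 2)"
  by (intro mult_right_mono) auto
 then show ?thesis by (simp add: cdiff_def h_def abs_mult)
qed

lemma integral_translate:
 fixes f :: "complex => real"
 assumes "f \<in> borel_measurable borel"
 shows "integral\<^sup>L lborel (%z. f (z + a)) = integral\<^sup>L lborel f"
proof -
 have "integral\<^sup>L lborel f = integral\<^sup>L (distr lborel borel ((+) a)) f" by (simp add: lborel_distr_plus)
 also have "\<dots> = integral\<^sup>L lborel (%z. f (a + z))"
  using assms by (subst integral_distr) auto
 finally show ?thesis by (simp add: add.commute)
qed

text \<open>The integral of E(z+a) p(z+b) depends only on b-a. When both products are expanded, each
  of the four differences \<plusminus>h \<plusminus> \<i>h occurs twice, with opposite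
  signs.\<close>

lemma plane_stokes_aux:
 assumes E: "continuous_on UNIV E" and p: "continuous_on UNIV p" and s: "!!z. z ~: cball 0 R ==> p z = 0"
 shows "integrable lborel (%z. cdiff E 1 n z * cdiff p \<i> n z - cdiff E \<i> n z * cdiff p 1 n z)"
  and "integral\<^sup>L lborel (%z. cdiff E 1 n z * cdiff p \<i> n z - cdiff E \<i> n z * cdiff p 1 n z) = 0"
proof -
 define h where "h = 1 / complex_of_real (Suc n)"
 define s where "s a = integral\<^sup>L lborel (%z. E z * p (z + a))" for a
 have i: "integrable lborel (%z. E (z + a) * p (z + b))" for a b
 proof (rule integrable_compact_support)
  show "continuous_on UNIV (%z. E (z + a) * p (z + b))"
   by (intro continuous_intros continuous_on_compose2[OF E] continuous_on_compose2[OF p]) auto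
  show "compact (cball (- b) R)" by simp
  show "E (z + a) * p (z + b) = 0" if "z ~: cball (- b) R" for z
   using s[of "z + b"] that by (simp add: dist_norm norm_minus_commute add.commute)
 qed
 have I: "integral\<^sup>L lborel (%z. E (z + a) * p (z + b)) = s (b - a)" for a b
 proof -
  have "continuous_on UNIV (%z. E z * p (z + (b - a)))"
   by (intro continuous_intros E continuous_on_compose2[OF p]) auto
  then have "integral\<^sup>L lborel (%z. E (z + a) * p (z + a + (b - a))) = s (b - a)"
   unfolding s_def by (intro integral_translate borel_measurable_continuous_onI)
  then show ?thesis by (simp add: algebra_simps)
 qed
 have s1: "s (h - - \<i> * h) = s (\<i> * h - - h)" and s2: "s (- h - - \<i> * h) = s (\<i> * h - h)"
  and s3: "s (h - \<i> * h) = s (- \<i> * h - - h)" and s4: "s (- h - \<i> * h) = s (- \<i> * h - h)"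
  by (auto intro!: arg_cong[of _ _ s])
 have eq: "(%z. cdiff E 1 n z * cdiff p \<i> n z - cdiff E \<i> n z * cdiff p 1 n z) =
  (%z. (E (z + h) * p (z + \<i> * h) - E (z + h) * p (z + - \<i> * h) - E (z + - h) * p (z + \<i> * h) + E (z + - h) * p (z + - \<i> * h)
   - (E (z + \<i> * h) * p (z + h) - E (z + \<i> * h) * p (z + - h) - E (z + - \<i> * h) * p (z + h) + E (z + - \<i> * h) * p (z + - h)))
   * ((Suc n / 2) * (Suc n / 2)))"
 proof
  fix z
  have alg: "(a - b) * r * ((c - d) * r) - (a' - b') * r * ((c' - d') * r) =
   (a * c - a * d - b * c + b * d - (a' * c' - a' * d' - b' * c' + b' * d')) * (r * r)"
   for a b c d a' b' c' d' r :: real by (simp only: algebra_simps)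
  have h: "z + 1 / of_nat (Suc n) = z + h" "z - 1 / of_nat (Suc n) = z + - h"
   "z + \<i> / of_nat (Suc n) = z + \<i> * h" "z - \<i> / of_nat (Suc n) = z + - \<i> * h"
   by (simp_all add: h_def del: of_nat_Suc)
  show "cdiff E 1 n z * cdiff p \<i> n z - cdiff E \<i> n z * cdiff p 1 n z =
   (E (z + h) * p (z + \<i> * h) - E (z + h) * p (z + - \<i> * h) - E (z + - h) * p (z + \<i> * h) + E (z + - h) * p (z + - \<i> * h)
   - (E (z + \<i> * h) * p (z + h) - E (z + \<i> * h) * p (z + - h) - E (z + - \<i> * h) * p (z + h) + E (z + - \<i> * h) * p (z + - h)))
   * ((Suc n / 2) * (Suc n / 2))"
   unfolding cdiff_def h by (rule alg)
 qed
 have hb: "has_bochner_integral lborel (%z. E (z + a) * p (z + b)) (s (b - a))" for a b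
  using i I by (simp add: has_bochner_integral_iff)
 have "has_bochner_integral lborel (%z. cdiff E 1 n z * cdiff p \<i> n z - cdiff E \<i> n z * cdiff p 1 n z)
  ((s (\<i> * h - h) - s (- \<i> * h - h) - s (\<i> * h - - h) + s (- \<i> * h - - h)
   - (s (h - \<i> * h) - s (- h - \<i> * h) - s (h - - \<i> * h) + s (- h - - \<i> * h)))
   * ((Suc n / 2) * (Suc n / 2)))"
  unfolding eq by (intro has_bochner_integral_mult_left has_bochner_integral_add has_bochner_integral_diff hb)
 then show "integrable lborel (%z. cdiff E 1 n z * cdiff p \<i> n z - cdiff E \<i> n z * cdiff p 1 n z)"
  "integral\<^sup>L lborel (%z. cdiff E 1 n z * cdiff p \<i> n z - cdiff E \<i> n z * cdiff p 1 n z) = 0"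
  unfolding s1 s2 s3 s4 by (simp_all add: has_bochner_integral_iff)
qed

lemma plane_stokes:
 assumes E: "C1f UNIV E E'" and p: "C1f UNIV p p'" and s: "!!z. z ~: cball 0 R ==> p z = 0"
 shows "integrable lborel (wd E' p')" and "integral\<^sup>L lborel (wd E' p') = 0"
proof -
 have cE: "continuous_on UNIV E" and cp: "continuous_on UNIV p" using E p C1f_cont by auto
 obtain B where B: "B \<ge> 0" "!!z v. z \<in> cball 0 (R + 2) ==> \<bar>E' z v\<bar> <= B * cmod v"
  using C1f_bound[OF E, of "cball 0 (R + 2)"] by auto
 obtain C where C: "C \<ge> 0" "!!z v. z \<in> cball 0 (R + 2) ==> \<bar>p' z v\<bar> <= C * cmod v"
  using C1f_bound[OF p, of "cball 0 (R + 2)"] by auto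
 define f where "f n z = cdiff E 1 n z * cdiff p \<i> n z - cdiff E \<i> n z * cdiff p 1 n z" for n z
 \<comment> \<open>Shifts have length at most 1. Outside the disc of radius \<open>R\<close> + 1 the
   differences of \<open>p\<close> therefore vanish, and inside it all arguments stay in the disc of
   radius \<open>R\<close> + 2, where both derivatives are bounded.\<close>
 define w where "w z = (B * C + B * C) * indicator (cball 0 (R + 1)) z" for z :: complex
 have lim: "(%n. f n z) \<longlonglongrightarrow> wd E' p' z" for z
  unfolding f_def wd_def by (intro tendsto_intros cdiff_tendsto C1f_D[OF E] C1f_D[OF p]) auto
 have bd: "norm (f n z) <= w z" for n z
 proof (cases "z \<in> cball 0 (R + 1)")
  case True
  then have z: "cmod z + 1 <= R + 2" by simp
  have "norm (f n z) <= \<bar>cdiff E 1 n z\<bar> * \<bar>cdiff p \<i> n z\<bar> + \<bar>cdiff E \<i> n z\<bar> * \<bar>cdiff p 1 n z\<bar>"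
   unfolding f_def by (metis abs_mult abs_triangle_ineq4 real_norm_def)
  also have "\<dots> <= B * C + B * C"
   using B C z by (intro add_mono mult_mono cdiff_bound[OF E] cdiff_bound[OF p]) auto
  finally show ?thesis using True by (simp add: w_def)
 next
  case False
  have "p (z + v / of_nat (Suc n)) = 0 & p (z - v / of_nat (Suc n)) = 0" if "cmod v = 1" for v
  proof -
   have "cmod (v / of_nat (Suc n)) <= 1" using that by (simp add: norm_divide del: of_nat_Suc)
   then show ?thesis using False norm_diff_ineq[of z "v / of_nat (Suc n)"] norm_triangle_ineq2[of z "v / of_nat (Suc n)"]
    by (intro conjI s) (auto simp del: of_nat_Suc)
  qed
  then have "f n z = 0" by (simp add: f_def cdiff_def del: of_nat_Suc)
  then show ?thesis using False by (simp add: w_def)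
 qed
 have wi: "integrable lborel w" unfolding w_def
  using emeasure_bounded_finite[of "cball (0::complex) (R+1)"] by (intro integrable_mult_right integrable_real_indicator) (auto simp: top.not_eq_extremum)
 have m: "f n \<in> borel_measurable lborel" for n
  using plane_stokes_aux(1)[OF cE cp s, where n = n] unfolding f_def by blast
 have m2: "wd E' p' \<in> borel_measurable lborel"
  by (rule borel_measurable_LIMSEQ_real[OF lim m])
 show "integrable lborel (wd E' p')"
  by (rule integrable_dominated_convergence[where s = f and w = w]) (use lim bd m m2 wi in auto)
 have "(%n. integral\<^sup>L lborel (f n)) \<longlonglongrightarrow> integral\<^sup>L lborel (wd E' p')"
  by (rule integral_dominated_convergence[where s = f and w = w]) (use lim bd m m2 wi in auto)
 moreover have "integral\<^sup>L lborel (f n) = 0" for n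
  using plane_stokes_aux(2)[OF cE cp s, where n = n] unfolding f_def by blast
 ultimately show "integral\<^sup>L lborel (wd E' p') = 0" by (simp add: LIMSEQ_const_iff)
qed

text \<open>\<open>plane_stokes\<close> with a coordinate function, Im or Re, in the place of
  \<open>E\<close>.\<close>

lemma integral_deriv_0:
 assumes p: "C1f UNIV p p'" and s: "!!z. z ~: cball 0 R ==> p z = 0"
 shows "integrable lborel (%z. p' z 1)" "integral\<^sup>L lborel (%z. p' z 1) = 0"
  "integrable lborel (%z. p' z \<i>)" "integral\<^sup>L lborel (%z. p' z \<i>) = 0"
proof -
 have 1: "wd (%z. Im) p' = (%z. - p' z 1)" and 2: "wd (%z. Re) p' = (%z. p' z \<i>)"
  by (simp_all add: wd_def fun_eq_iff)
 have "integrable lborel (%z. - p' z 1)" "integral\<^sup>L lborel (%z. - p' z 1) = 0"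
  using plane_stokes[OF C1f_linear[OF bounded_linear_Im] p s] unfolding 1 by blast+
 then show "integrable lborel (%z. p' z 1)" "integral\<^sup>L lborel (%z. p' z 1) = 0"
  using integrable_minus[of lborel "%z. - p' z 1"] by simp_all
 show "integrable lborel (%z. p' z \<i>)" "integral\<^sup>L lborel (%z. p' z \<i>) = 0"
  using plane_stokes[OF C1f_linear[OF bounded_linear_Re] p s] unfolding 2 by blast+
qed

section \<open>Radial integrals and the kernel of a simple pole\<close>

lemma layer_cake:
 fixes f :: "complex => real"
 assumes [measurable]: "f \<in> borel_measurable borel" and "!!z. f z \<ge> 0"
 shows "(\<integral>\<^sup>+z. ennreal (f z) \<partial>lborel) = (\<integral>\<^sup>+t. emeasure lborel {z. t < f z} * indicator {0<..} t \<partial>lborel)"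
proof -
 have 1: "ennreal (f z) = (\<integral>\<^sup>+t. indicator {0<..<f z} t \<partial>lborel)" for z
  using assms(2)[of z] by simp
 have [measurable]: "(%(z, t). indicator {0<..<f z} t :: ennreal) \<in> borel_measurable (lborel \<Otimes>\<^sub>M lborel)"
 proof -
  have "(%(z, t). indicator {0<..<f z} t :: ennreal) = (%x. indicator {x. 0 < snd x & snd x < f (fst x)} x)"
   by (auto simp: fun_eq_iff indicator_def)
  also have "\<dots> \<in> borel_measurable (lborel \<Otimes>\<^sub>M lborel)" by measurable
  finally show ?thesis .
 qed
 have "(\<integral>\<^sup>+z. ennreal (f z) \<partial>lborel) = (\<integral>\<^sup>+z. (\<integral>\<^sup>+t. indicator {0<..<f z} t \<partial>lborel) \<partial>lborel)"
  by (simp only: 1)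
 also have "\<dots> = (\<integral>\<^sup>+t. (\<integral>\<^sup>+z. indicator {0<..<f z} t \<partial>lborel) \<partial>lborel)"
  by (rule lborel_pair.Fubini'[symmetric]) measurable
 also have "\<dots> = (\<integral>\<^sup>+t. emeasure lborel {z. t < f z} * indicator {0<..} t \<partial>lborel)"
 proof (rule nn_integral_cong)
  fix t :: real
  have "(%z. indicator {0<..<f z} t :: ennreal) = (%z. indicator {0<..} t * indicator {z. t < f z} z)"
   by (auto simp: fun_eq_iff indicator_def)
  then show "(\<integral>\<^sup>+z. indicator {0<..<f z} t \<partial>lborel) = emeasure lborel {z. t < f z} * indicator {0<..} t"
   by (simp add: nn_integral_cmult mult.commute)
 qed
 finally show ?thesis .
qed

lemma emeasure_disc: "r \<ge> 0 ==> emeasure lborel (ball (c :: complex) r) = ennreal (pi * r\<^sup>2)"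
 by (simp add: emeasure_ball unit_ball_vol_2)

text \<open>The superlevel set at height t lies in the discs of radius R and 1/t, so its area is at
  most pi R^2 and at most pi / t^2. The first bound is used up to t = 1, the second, which is
  integrable there, beyond.\<close>

lemma integrable_inverse_dist:
 fixes p :: complex
 shows "integrable lborel (%z. C * (indicator (ball p R) z / cmod (z - p)))"
proof (cases "R > 0")
 case False
 then have "ball p R = {}" by simp
 then have "indicator (ball p R) = (%z. 0 :: real)" unfolding \<open>ball p R = {}\<close> by (simp add: fun_eq_iff)
 then show ?thesis by simp
next
 case True
 define f where "f z = indicator (ball p R) z / cmod (z - p)" for z
 have 1: "(%z. cmod (z - p)) \<in> borel_measurable borel"
  by (intro borel_measurable_continuous_onI continuous_intros)
 have [measurable]: "f \<in> borel_measurable borel" unfolding f_def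
  by (intro borel_measurable_divide borel_measurable_indicator 1) auto
 have bd: "emeasure lborel {z. t < f z} * indicator {0<..} t <= ennreal (pi * R\<^sup>2) * indicator {0..1} t + ennreal (pi / t\<^sup>2) * indicator {1..} t"
  if "t > 0" for t :: real
 proof (cases "t <= 1")
  case True
  have "{z. t < f z} \<subseteq> ball p R" using that by (auto simp: f_def indicator_def split: if_splits)
  then have "emeasure lborel {z. t < f z} <= ennreal (pi * R\<^sup>2)"
   using emeasure_mono[of "{z. t < f z}" "ball p R" lborel] emeasure_disc[of R p] \<open>R > 0\<close> by simp
  then show ?thesis using True that by (simp add: indicator_def add_increasing2)
 next
  case False
  have "{z. t < f z} \<subseteq> ball p (1 / t)"
  proof
   fix z assume "z \<in> {z. t < f z}"
   then have z: "t < indicator (ball p R) z / cmod (z - p)" by (simp add: f_def)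
   then have "z \<in> ball p R" using that by (cases "z \<in> ball p R") auto
   moreover have "cmod (z - p) > 0" using z that by (cases "z = p") auto
   ultimately have "z \<in> ball p R" "cmod (z - p) > 0" by auto
   then have "t < 1 / cmod (z - p)" using z by simp
   then show "z \<in> ball p (1 / t)" using that \<open>cmod (z - p) > 0\<close> by (simp add: field_simps dist_norm norm_minus_commute)
  qed
  then have "emeasure lborel {z. t < f z} <= ennreal (pi * (1 / t)\<^sup>2)"
   using emeasure_mono[of "{z. t < f z}" "ball p (1/t)" lborel] emeasure_disc[of "1/t" p] that by simp
  then show ?thesis using False that by (simp add: indicator_def power_divide)
 qed
 have "(\<integral>\<^sup>+z. ennreal (f z) \<partial>lborel) = (\<integral>\<^sup>+t. emeasure lborel {z. t < f z} * indicator {0<..} t \<partial>lborel)"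
  by (rule layer_cake) (fact, simp add: f_def)
 also have "\<dots> <= (\<integral>\<^sup>+t. ennreal (pi * R\<^sup>2) * indicator {0..1} t + ennreal (pi / t\<^sup>2) * indicator {1..} t \<partial>lborel)"
 proof (rule nn_integral_mono)
  show "emeasure lborel {z. t < f z} * indicator {0<..} t <= ennreal (pi * R\<^sup>2) * indicator {0..1} t + ennreal (pi / t\<^sup>2) * indicator {1..} t" for t :: real
   using bd[of t] by (cases "t > 0") auto
 qed
 also have "\<dots> = (\<integral>\<^sup>+t. ennreal (pi * R\<^sup>2) * indicator {0..1::real} t \<partial>lborel) + (\<integral>\<^sup>+t. ennreal (pi / t\<^sup>2) * indicator {1..} t \<partial>lborel)"
  by (rule nn_integral_add) auto
 also have "(\<integral>\<^sup>+t. ennreal (pi * R\<^sup>2) * indicator {0..1::real} t \<partial>lborel) = ennreal (pi * R\<^sup>2)"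
  by (simp add: nn_integral_cmult_indicator)
 also have "(\<integral>\<^sup>+t. ennreal (pi / t\<^sup>2) * indicator {1..} t \<partial>lborel) = ennreal (0 - (- pi / 1))"
 proof (rule nn_integral_FTC_atLeast)
  show "((%t. - pi / t) has_real_derivative pi / x\<^sup>2) (at x)" if "1 <= x" for x
   using that by (auto intro!: derivative_eq_intros simp: power2_eq_square)
  show "((%t. - pi / t) \<longlongrightarrow> 0) at_top" by (rule tendsto_divide_0) (auto simp: filterlim_at_top_imp_at_infinity filterlim_ident)
 qed auto
 also have "ennreal (pi * R\<^sup>2) + ennreal (0 - (- pi / 1)) < \<infinity>" by simp
 finally have "integrable lborel f"
  by (intro integrableI_nonneg) (use \<open>f \<in> borel_measurable borel\<close> in simp, simp add: f_def, simp)
 then show ?thesis unfolding f_def by (rule integrable_mult_right)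
qed

lemma C1f_kernel_bounds:
 assumes p: "C1f UNIV p p'" and s: "!!z. z ~: cball a R ==> p z = 0"
 obtains B where "B \<ge> 0" "!!z v. \<bar>p' z v\<bar> <= B * cmod v * indicator (ball a (R+1)) z"
  "!!z. \<bar>p z - p a\<bar> <= B * cmod (z - a)"
proof -
 obtain B where B: "B \<ge> 0" "!!z v. z \<in> cball a (\<bar>R\<bar> + 1) ==> \<bar>p' z v\<bar> <= B * cmod v"
  using C1f_bound[OF p, of "cball a (\<bar>R\<bar> + 1)"] by auto
 have 0: "p' z v = 0" if "z ~: cball a R" for z v
  by (rule C1f_zero_outside[OF p _ s that]) auto
 have B': "\<bar>p' z v\<bar> <= B * cmod v" for z v
  using B 0[of z v] by (cases "z \<in> cball a R") auto
 show ?thesis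
 proof (rule that[OF B(1)])
  show "\<bar>p' z v\<bar> <= B * cmod v * indicator (ball a (R+1)) z" for z v
   using B'[of z v] 0[of z v] by (auto simp: indicator_def)
  show "\<bar>p z - p a\<bar> <= B * cmod (z - a)" for z
  proof -
   have "norm (p z - p a) <= B * norm (z - a)"
   proof (rule differentiable_bound[of UNIV p p'])
    show "(p has_derivative p' x) (at x within UNIV)" for x using C1f_D[OF p] by auto
    show "onorm (p' x) <= B" for x using B' B(1) by (intro onorm_bound) auto
   qed auto
   then show ?thesis by simp
  qed
 qed
qed

text \<open>For \<open>e\<close> = 0 this is the radial derivative divided by the radius, which is
  minus the coefficient of d arg (z-a) \<and> dp; a positive \<open>e\<close> removes the
  singularity at \<open>a\<close>.\<close>

definition kern :: "complex => real => (complex => complex => real) => complex => real" where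
 "kern a e p' z = p' z (z - a) / ((cmod (z - a))\<^sup>2 + e)"

lemma kern_measurable:
 assumes p: "C1f UNIV p p'" shows "kern a e p' \<in> borel_measurable borel"
proof -
 have "p' z (z - a) = Re (z - a) * p' z 1 + Im (z - a) * p' z \<i>" for z
  by (rule linear_complex_real[OF C1f_lin[OF p]]) simp
 moreover have [measurable]: "(%z. p' z v) \<in> borel_measurable borel" for v
  using C1f_cont'[OF p] borel_measurable_continuous_onI by blast
 ultimately show ?thesis unfolding kern_def[abs_def] by simp
qed

text \<open>The divergence theorem for \<open>p\<close> times the vector field (z-a) / (|z-a|^2 +
  e). The divergence of the field is 2e / (|z-a|^2 + e)^2, a weight that concentrates at
  \<open>a\<close> as \<open>e\<close> tends to 0.\<close>

lemma kern_eps: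
 assumes p: "C1f UNIV p p'" and s: "!!z. z ~: cball a R ==> p z = 0" and e: "e > 0"
 shows "integrable lborel (kern a e p')"
  "integrable lborel (%z. p z * (2 * e / ((cmod (z - a))\<^sup>2 + e)\<^sup>2))"
  "integral\<^sup>L lborel (kern a e p') = - integral\<^sup>L lborel (%z. p z * (2 * e / ((cmod (z - a))\<^sup>2 + e)\<^sup>2))"
proof -
 define N where "N z = (Re (z - a))\<^sup>2 + (Im (z - a))\<^sup>2 + e" for z
 define N' where "N' z v = 2 * Re (z - a) * Re v + 2 * Im (z - a) * Im v" for z v
 have N: "N z > 0" for z using e by (simp add: N_def add_nonneg_pos)
 have N0: "N z ~= 0" for z using N[of z] by simp
 have NN: "(cmod (z - a))\<^sup>2 + e = N z" for z by (simp add: N_def cmod_power2)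
 have CN: "C1f UNIV N N'" unfolding C1f_def N_def N'_def
  by (auto intro!: derivative_eq_intros continuous_intros simp: algebra_simps)
 have CI: "C1f UNIV (%z. inverse (N z)) (%z v. - (inverse (N z) ^ 2) * N' z v)"
  by (rule C1f_comp_real[OF CN]) (use N0 in \<open>auto intro!: derivative_eq_intros continuous_intros simp: power2_eq_square\<close>)
 have CR: "C1f UNIV (%z. Re (z - a)) (%z v. Re v)" and CIm: "C1f UNIV (%z. Im (z - a)) (%z v. Im v)"
  unfolding C1f_def by (auto intro!: derivative_eq_intros continuous_intros)
 note C1 = C1f_mult[OF p C1f_mult[OF CR CI]] and C2 = C1f_mult[OF p C1f_mult[OF CIm CI]]
 have s0: "p z = 0" if "z ~: cball 0 (cmod a + R)" for z
 proof (rule s)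
  show "z ~: cball a R" using that norm_triangle_ineq[of "z - a" a] by (auto simp: dist_norm norm_minus_commute)
 qed
 note I1 = integral_deriv_0[OF C1, of "cmod a + R"] and I2 = integral_deriv_0[OF C2, of "cmod a + R"]
 let ?D = "%z. p z * (2 * e / ((cmod (z - a))\<^sup>2 + e)\<^sup>2)"
 have "?D z + kern a e p' z =
  (p z * (Re (z - a) * (- (inverse (N z) ^ 2) * N' z 1) + Re 1 * inverse (N z)) + p' z 1 * (Re (z - a) * inverse (N z)))
 + (p z * (Im (z - a) * (- (inverse (N z) ^ 2) * N' z \<i>) + Im \<i> * inverse (N z)) + p' z \<i> * (Im (z - a) * inverse (N z)))" for z
 proof -
  have "p' z (z - a) = Re (z - a) * p' z 1 + Im (z - a) * p' z \<i>"
   by (rule linear_complex_real[OF C1f_lin[OF p]]) simp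
  then have 1: "kern a e p' z = p' z 1 * (Re (z - a) * inverse (N z)) + p' z \<i> * (Im (z - a) * inverse (N z))"
   unfolding kern_def NN by (simp only: divide_inverse) (simp only: algebra_simps)
  have "2 * e / (N z)\<^sup>2 = Re (z - a) * (- (inverse (N z) ^ 2) * N' z 1) + Re 1 * inverse (N z) + (Im (z - a) * (- (inverse (N z) ^ 2) * N' z \<i>) + Im \<i> * inverse (N z))"
  proof -
   have "2 * e' / n\<^sup>2 = x * (- (inverse n ^ 2) * (2 * x)) + inverse n + (y * (- (inverse n ^ 2) * (2 * y)) + inverse n)"
    if "n = x\<^sup>2 + y\<^sup>2 + e'" "n ~= 0" for n x y e' :: real
   proof -
    have "e' = n - x * x - y * y" using that by (simp add: power2_eq_square)
    then have "2 * e' / n\<^sup>2 = (2 * n - 2 * x * x - 2 * y * y) / n\<^sup>2" by simp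
    also have "\<dots> = x * (- (inverse n ^ 2) * (2 * x)) + inverse n + (y * (- (inverse n ^ 2) * (2 * y)) + inverse n)"
     using that(2) by (simp add: field_simps power2_eq_square)
    finally show ?thesis .
   qed
   from this[OF N_def N0] show ?thesis by (simp add: N'_def)
  qed
  then show ?thesis unfolding 1 NN by (simp only:) (simp only: algebra_simps)
 qed
 then have eq: "(%z. ?D z + kern a e p' z) = (%z.
  (p z * (Re (z - a) * (- (inverse (N z) ^ 2) * N' z 1) + Re 1 * inverse (N z)) + p' z 1 * (Re (z - a) * inverse (N z)))
 + (p z * (Im (z - a) * (- (inverse (N z) ^ 2) * N' z \<i>) + Im \<i> * inverse (N z)) + p' z \<i> * (Im (z - a) * inverse (N z))))"
  by blast
 have i: "integrable lborel (%z. ?D z + kern a e p' z)" and z: "integral\<^sup>L lborel (%z. ?D z + kern a e p' z) = 0"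
  unfolding eq using I1(1,2) I2(3,4) s0 by simp_all
 show D: "integrable lborel ?D"
 proof (rule integrable_compact_support)
  show "continuous_on UNIV ?D" unfolding NN
   by (intro continuous_intros C1f_cont[OF p] C1f_cont[OF CN]) (use N0 in auto)
  show "compact (cball a R)" by simp
 qed (use s in auto)
 have "integrable lborel (%z. (?D z + kern a e p' z) - ?D z)" by (rule Bochner_Integration.integrable_diff[OF i D])
 then show k: "integrable lborel (kern a e p')" by simp
 show "integral\<^sup>L lborel (kern a e p') = - integral\<^sup>L lborel ?D"
  using z Bochner_Integration.integral_add[OF D k] by simp
qed

lemma kern_bound:
 assumes "e \<ge> 0" "B \<ge> 0" "!!z v. \<bar>p' z v\<bar> <= B * cmod v * indicator (ball a (R+1)) z"
 shows "\<bar>kern a e p' z\<bar> <= B * (indicator (ball a (R+1)) z / cmod (z - a))"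
proof (cases "z = a")
 case True
 then show ?thesis using assms(3)[of a 0] by (simp add: kern_def)
next
 case False
 then have "cmod (z - a) > 0" by simp
 have "\<bar>kern a e p' z\<bar> = \<bar>p' z (z - a)\<bar> / ((cmod (z - a))\<^sup>2 + e)"
  using assms(1) by (simp add: kern_def abs_divide)
 also have "\<dots> <= (B * cmod (z - a) * indicator (ball a (R+1)) z) / ((cmod (z - a))\<^sup>2)"
  using assms \<open>cmod (z - a) > 0\<close> by (intro frac_le) auto
 also have "\<dots> = B * (indicator (ball a (R+1)) z / cmod (z - a))"
  using False by (simp add: power2_eq_square)
 finally show ?thesis .
qed

lemma tendsto_inverse_Suc: "(%n. 1 / real (Suc n)) \<longlonglongrightarrow> 0"
 by (rule LIMSEQ_inverse_real_of_nat[unfolded inverse_eq_divide])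

lemma kern_limit:
 assumes p: "C1f UNIV p p'" and s: "!!z. z ~: cball a R ==> p z = 0"
 shows "integrable lborel (kern a 0 p')"
  "(%n. integral\<^sup>L lborel (kern a (1 / real (Suc n)) p')) \<longlonglongrightarrow> integral\<^sup>L lborel (kern a 0 p')"
proof -
 obtain B where B: "B \<ge> 0" "!!z v. \<bar>p' z v\<bar> <= B * cmod v * indicator (ball a (R+1)) z"
  "!!z. \<bar>p z - p a\<bar> <= B * cmod (z - a)"
  using C1f_kernel_bounds[OF p s] by metis
 have m: "kern a e p' \<in> borel_measurable lborel" for e using kern_measurable[OF p] by simp
 have m': "kern a (1 / real (Suc n)) p' \<in> borel_measurable lborel" for n by (rule m)
 note w = integrable_inverse_dist[of B a "R + 1"]
 have bd: "norm (kern a (1 / real (Suc n)) p' z) <= B * (indicator (ball a (R+1)) z / cmod (z - a))" for n z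
  using kern_bound[OF _ B(1) B(2), of "1 / real (Suc n)" z] by simp
 have lim: "(%n. kern a (1 / real (Suc n)) p' z) \<longlonglongrightarrow> kern a 0 p' z" for z
 proof (cases "z = a")
  case True
  have "p' a 0 = 0" using linear_0[OF C1f_lin[OF p]] by auto
  then show ?thesis using True by (simp add: kern_def)
 next
  case False
  then show ?thesis unfolding kern_def
   by (intro tendsto_intros tendsto_inverse_Suc) auto
 qed
 show "integrable lborel (kern a 0 p')"
  by (rule integrable_dominated_convergence[where s = "%n. kern a (1 / real (Suc n)) p'" and w = "%z. B * (indicator (ball a (R+1)) z / cmod (z - a))"]) (use lim bd w m m' in auto)
 show "(%n. integral\<^sup>L lborel (kern a (1 / real (Suc n)) p')) \<longlonglongrightarrow> integral\<^sup>L lborel (kern a 0 p')"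
  by (rule integral_dominated_convergence[where s = "%n. kern a (1 / real (Suc n)) p'" and w = "%z. B * (indicator (ball a (R+1)) z / cmod (z - a))"]) (use lim bd w m m' in auto)
qed

text \<open>If \<open>p\<close> vanishes at \<open>a\<close>, the weight in \<open>kern_eps\<close>
  can be dominated: |p| \<le> B r together with e r^2 \<le> (r^2 + e)^2 gives the integrable bound 2
  B / r, while the pointwise limit is 0.\<close>

lemma kern_0:
 assumes p: "C1f UNIV p p'" and s: "!!z. z ~: cball a R ==> p z = 0" and 0: "p a = 0"
 shows "integral\<^sup>L lborel (kern a 0 p') = 0"
proof -
 obtain B where B: "B \<ge> 0" "!!z v. \<bar>p' z v\<bar> <= B * cmod v * indicator (ball a (R+1)) z"
  "!!z. \<bar>p z - p a\<bar> <= B * cmod (z - a)"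
  using C1f_kernel_bounds[OF p s] by metis
 define f where "f n z = p z * (2 * (1 / real (Suc n)) / ((cmod (z - a))\<^sup>2 + (1 / real (Suc n)))\<^sup>2)" for n z
 have m: "f n \<in> borel_measurable lborel" for n
  using kern_eps(2)[OF p s, where e = "1 / real (Suc n)"] unfolding f_def by auto
 have lim: "(%n. f n z) \<longlonglongrightarrow> 0" for z
 proof (cases "z = a")
  case True
  then show ?thesis using 0 by (simp add: f_def)
 next
  case False
  then have "(%n. f n z) \<longlonglongrightarrow> p z * (2 * 0 / ((cmod (z - a))\<^sup>2 + 0)\<^sup>2)" unfolding f_def
   by (intro tendsto_intros tendsto_inverse_Suc) auto
  then show ?thesis by simp
 qed
 have bd: "norm (f n z) <= (2 * B) * (indicator (ball a (R+1)) z / cmod (z - a))" for n z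
 proof (cases "z \<in> cball a R & z ~= a")
  case False
  then have "f n z = 0" using s 0 by (auto simp: f_def)
  then show ?thesis using B by simp
 next
  case True
  define r e where "r = cmod (z - a)" and "e = 1 / real (Suc n)"
  have r: "r > 0" and e: "e > 0" using True by (auto simp: r_def e_def)
  have "norm (f n z) = \<bar>p z\<bar> * (2 * e / (r\<^sup>2 + e)\<^sup>2)" using e
   by (simp add: f_def r_def[symmetric] e_def[symmetric] abs_mult abs_divide del: of_nat_Suc divide_divide_eq_left times_divide_eq_right)
  also have "\<dots> <= (B * r) * (2 / r\<^sup>2)"
  proof (rule mult_mono)
   show "\<bar>p z\<bar> <= B * r" using B(3)[of z] 0 by (simp add: r_def)
   have "e * r\<^sup>2 <= (r\<^sup>2 + e)\<^sup>2" using e r by (simp add: power2_eq_square algebra_simps)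
   moreover have "2 * e / x <= 2 / y" if "x > 0" "y > 0" "e * y <= x" for x y :: real
    using that by (simp add: field_simps)
   moreover have "(r\<^sup>2 + e)\<^sup>2 > 0" "r\<^sup>2 > 0" using e r by (simp_all add: add_pos_pos add_nonneg_eq_0_iff)
   ultimately show "2 * e / (r\<^sup>2 + e)\<^sup>2 <= 2 / r\<^sup>2" by blast
  qed (use B r e in auto)
  also have "\<dots> = (2 * B) * (indicator (ball a (R+1)) z / cmod (z - a))"
   using r True by (simp add: r_def[symmetric] power2_eq_square)
  finally show ?thesis .
 qed
 have "(%n. integral\<^sup>L lborel (f n)) \<longlonglongrightarrow> integral\<^sup>L lborel (%z::complex. 0 :: real)"
 proof (rule integral_dominated_convergence)
  show "f n \<in> borel_measurable lborel" for n by (rule m)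
  show "integrable lborel (%z. 2 * B * (indicator (ball a (R+1)) z / cmod (z - a)))"
   by (rule integrable_inverse_dist)
  show "AE z in lborel. norm (f n z) <= 2 * B * (indicator (ball a (R+1)) z / cmod (z - a))" for n
   using bd by blast
 qed (use lim in auto)
 then have "(%n. - integral\<^sup>L lborel (f n)) \<longlonglongrightarrow> 0" using tendsto_minus by fastforce
 moreover have "- integral\<^sup>L lborel (f n) = integral\<^sup>L lborel (kern a (1 / real (Suc n)) p')" for n
  using kern_eps(3)[OF p s, where e = "1 / real (Suc n)"] unfolding f_def by simp
 ultimately show ?thesis using LIMSEQ_unique[OF kern_limit(2)[OF p s]] by simp
qed

text \<open>The superlevel sets are discs of area pi (1 - t), for t between 0 and 1.\<close>

lemma integral_paraboloid: "integral\<^sup>L lborel (%z::complex. max 0 (1 - (cmod (z - a))\<^sup>2)) = pi / 2"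
proof (rule integral_eq_nn_integral[THEN trans])
 have "(\<integral>\<^sup>+z. ennreal (max 0 (1 - (cmod (z - a))\<^sup>2)) \<partial>lborel)
  = (\<integral>\<^sup>+t. emeasure lborel {z. t < max 0 (1 - (cmod (z - a))\<^sup>2)} * indicator {0<..} t \<partial>lborel)"
  by (rule layer_cake) auto
 also have "\<dots> = (\<integral>\<^sup>+t. ennreal (pi * (1 - t)) * indicator {0..1} t \<partial>lborel)"
 proof (rule nn_integral_cong_AE)
  have "AE t in lborel. t ~= (0::real)" by (rule AE_lborel_singleton)
  then show "AE t in lborel. emeasure lborel {z. t < max 0 (1 - (cmod (z - a))\<^sup>2)} * indicator {0<..} t = ennreal (pi * (1 - t)) * indicator {0..1} t"
  proof (rule AE_mp, intro AE_I2 impI)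
   fix t :: real assume "t ~= 0"
   show "emeasure lborel {z. t < max 0 (1 - (cmod (z - a))\<^sup>2)} * indicator {0<..} t = ennreal (pi * (1 - t)) * indicator {0..1} t"
   proof (cases "0 < t & t <= 1")
    case True
    have "{z. t < max 0 (1 - (cmod (z - a))\<^sup>2)} = ball a (sqrt (1 - t))"
     unfolding set_eq_iff
    proof (intro allI)
     fix z
     have "cmod (z - a) < sqrt (1 - t) \<longleftrightarrow> (cmod (z - a))\<^sup>2 < 1 - t"
      using True by (metis abs_norm_cancel real_sqrt_abs real_sqrt_less_iff)
     then show "z \<in> {z. t < max 0 (1 - (cmod (z - a))\<^sup>2)} \<longleftrightarrow> z \<in> ball a (sqrt (1 - t))"
      using True by (auto simp: dist_norm norm_minus_commute less_max_iff_disj)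
    qed
    then show ?thesis using True by (simp add: emeasure_disc)
   next
    case False
    then consider "t < 0" | "t > 1" using \<open>t ~= 0\<close> by linarith
    then show ?thesis
    proof cases
     case 1
     then show ?thesis by simp
    next
     case 2
     then have "{z. t < max 0 (1 - (cmod (z - a))\<^sup>2)} = {}"
      by (auto simp: less_max_iff_disj not_less intro: order_trans[of _ 1])
     then show ?thesis using 2 by simp
    qed
   qed
  qed
 qed
 also have "\<dots> = ennreal ((pi * 1 - pi / 2 * (1 * 1)) - (pi * 0 - pi / 2 * (0 * 0)))"
 proof (rule nn_integral_FTC_Icc[where F = "%t. pi * t - pi / 2 * (t * t)" and f = "%t. pi * (1 - t)"])
  show "((%t. pi * t - pi / 2 * (t * t)) has_real_derivative pi * (1 - x)) (at x)" for x
   by (auto intro!: derivative_eq_intros simp: algebra_simps)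
 qed (auto intro: mult_nonneg_nonneg)
 finally show "enn2real (\<integral>\<^sup>+z. ennreal (max 0 (1 - (cmod (z - a))\<^sup>2)) \<partial>lborel) = pi / 2"
  by simp
qed auto

text \<open>Both sides are linear in \<open>p\<close> and \<open>kern_0\<close> settles the case
  p(a) = 0, so a single function with p(a) = 1 decides the constant. The bump max(0, 1-r^2)^2 is
  convenient: its kernel is -4 max(0, 1-r^2), with integral -4 pi/2.\<close>

lemma kern_integral:
 assumes p: "C1f UNIV p p'" and s: "!!z. z ~: cball a R ==> p z = 0"
 shows "integral\<^sup>L lborel (kern a 0 p') = - 2 * pi * p a"
proof -
 define b where "b z = sq_pos (1 - (Re (z - a))\<^sup>2 - (Im (z - a))\<^sup>2)" for z
 define b' where "b' z v = 2 * max 0 (1 - (Re (z - a))\<^sup>2 - (Im (z - a))\<^sup>2) * (- 2 * Re (z - a) * Re v - 2 * Im (z - a) * Im v)" for z v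
 have b: "C1f UNIV b b'" unfolding b_def[abs_def] b'_def[abs_def]
 proof (rule C1f_comp_real)
  show "C1f UNIV (%z. 1 - (Re (z - a))\<^sup>2 - (Im (z - a))\<^sup>2) (%z v. - 2 * Re (z - a) * Re v - 2 * Im (z - a) * Im v)"
   unfolding C1f_def by (auto intro!: derivative_eq_intros continuous_intros simp: algebra_simps)
  show "(sq_pos has_real_derivative 2 * max 0 x) (at x)" for x by (rule sq_pos_deriv)
 qed (intro continuous_intros)
 have rr: "1 - (Re (z - a))\<^sup>2 - (Im (z - a))\<^sup>2 = 1 - (cmod (z - a))\<^sup>2" for z by (simp add: cmod_power2)
 have kb: "kern a 0 b' z = - 4 * max 0 (1 - (cmod (z - a))\<^sup>2)" if "z ~= a" for z
 proof -
  have "- 2 * Re (z - a) * Re (z - a) - 2 * Im (z - a) * Im (z - a) = - 2 * (cmod (z - a))\<^sup>2"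
   unfolding cmod_power2 by (simp only: power2_eq_square) (simp only: algebra_simps)
  then have "b' z (z - a) = - 4 * max 0 (1 - (cmod (z - a))\<^sup>2) * (cmod (z - a))\<^sup>2"
   unfolding b'_def rr by simp
  then have "kern a 0 b' z = - 4 * max 0 (1 - (cmod (z - a))\<^sup>2) * (cmod (z - a))\<^sup>2 / (cmod (z - a))\<^sup>2" by (simp add: kern_def)
  then show ?thesis using that by simp
 qed
 have "integral\<^sup>L lborel (kern a 0 b') = integral\<^sup>L lborel (%z. - 4 * max 0 (1 - (cmod (z - a))\<^sup>2))"
 proof (rule integral_cong_AE)
  show "kern a 0 b' \<in> borel_measurable lborel" using kern_measurable[OF b] by simp
  have "AE z in lborel. z ~= a" by (rule AE_lborel_singleton)
  then show "AE z in lborel. kern a 0 b' z = - 4 * max 0 (1 - (cmod (z - a))\<^sup>2)" by eventually_elim (rule kb)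
 qed simp
 also have "\<dots> = - 4 * (pi / 2)" by (subst integral_mult_right_zero) (simp only: integral_paraboloid)
 finally have Ib: "integral\<^sup>L lborel (kern a 0 b') = - 2 * pi" by simp
 have sb: "b z = 0" if "z ~: cball a 1" for z
 proof -
  have "1 <= (cmod (z - a))\<^sup>2" using that by (simp add: dist_norm norm_minus_commute one_le_power)
  then show ?thesis unfolding b_def rr by (simp add: sq_pos_def)
 qed
 have ba: "b a = 1" by (simp add: b_def sq_pos_def)
 define q where "q z = p z - p a * b z" for z
 have q: "C1f UNIV q (%z v. p' z v - p a * b' z v)" unfolding q_def[abs_def]
  by (intro C1f_diff p C1f_cmult b)
 have "integral\<^sup>L lborel (kern a 0 (%z v. p' z v - p a * b' z v)) = 0"
  by (rule kern_0[OF q, of a "max R 1"]) (use s sb ba in \<open>auto simp: q_def\<close>)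
 moreover have "kern a 0 (%z v. p' z v - p a * b' z v) = (%z. kern a 0 p' z - p a * kern a 0 b' z)"
  by (simp add: fun_eq_iff kern_def diff_divide_distrib)
 ultimately have "integral\<^sup>L lborel (kern a 0 p') - p a * integral\<^sup>L lborel (kern a 0 b') = 0"
  using kern_limit(1)[OF p s] kern_limit(1)[OF b sb] by simp
 then show ?thesis using Ib by (simp add: algebra_simps)
qed

text \<open>Im (v / (z-a)) is the differential of arg (z-a). This is the weak form of the statement
  that the exterior derivative of that differential is 2 pi times the point mass at
  \<open>a\<close>.\<close>

lemma wd_Im_pole:
 assumes p: "C1f UNIV p p'" and s: "!!z. z ~: cball a R ==> p z = 0"
 shows "integrable lborel (wd (%z v. Im (v / (z - a))) p')"
  "integral\<^sup>L lborel (wd (%z v. Im (v / (z - a))) p') = 2 * pi * p a"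
proof -
 have "wd (%z v. Im (v / (z - a))) p' z = - kern a 0 p' z" for z
 proof -
  have "p' z (z - a) = Re (z - a) * p' z 1 + Im (z - a) * p' z \<i>"
   by (rule linear_complex_real[OF C1f_lin[OF p]]) simp
  moreover have "Im (1 / w) * A - Im (\<i> / w) * B = - ((Re w * B + Im w * A) / ((Re w)\<^sup>2 + (Im w)\<^sup>2 + 0))" for w A B
   by (simp add: Im_divide diff_divide_distrib add_divide_distrib)
  ultimately show ?thesis unfolding wd_def kern_def cmod_power2 by simp
 qed
 then have eq: "wd (%z v. Im (v / (z - a))) p' = (%z. - kern a 0 p' z)" by blast
 show "integrable lborel (wd (%z v. Im (v / (z - a))) p')"
  "integral\<^sup>L lborel (wd (%z v. Im (v / (z - a))) p') = 2 * pi * p a"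
  unfolding eq using kern_limit(1)[OF p s] kern_integral[OF p s] by auto
qed

section \<open>Change of variables and surface integrals\<close>

text \<open>The change of variables theorem speaks about \<open>real^n\<close>; these two maps carry
  integrals over the complex plane there and back.\<close>

definition vec_complex :: "complex => real^2" where "vec_complex z = vector [Re z, Im z]"
definition complex_vec :: "real^2 => complex" where "complex_vec v = Complex (vec_nth v 1) (vec_nth v 2)"

lemma complex_vec_inverse [simp]: "complex_vec (vec_complex z) = z"
 by (simp add: complex_vec_def vec_complex_def)

lemma vec_complex_inverse [simp]: "vec_complex (complex_vec v) = v"
 by (simp add: complex_vec_def vec_complex_def Finite_Cartesian_Product.vec_eq_iff forall_2)

lemma bounded_linear_vec_complex: "bounded_linear vec_complex"
 by (rule linear_linear[THEN iffD2])
  (auto intro!: linearI simp: vec_complex_def Finite_Cartesian_Product.vec_eq_iff forall_2)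

lemma bounded_linear_complex_vec: "bounded_linear complex_vec"
 by (rule linear_linear[THEN iffD2]) (auto intro!: linearI simp: complex_vec_def complex_eq_iff)

lemma borel_vec_complex [measurable]: "vec_complex \<in> borel_measurable borel"
 and borel_complex_vec [measurable]: "complex_vec \<in> borel_measurable borel"
 using bounded_linear_vec_complex bounded_linear_complex_vec
 by (auto intro!: borel_measurable_continuous_onI linear_continuous_on)

lemma lborel_complex_vec: "distr lborel borel complex_vec = lborel"
proof (rule lborel_eqI[symmetric])
 fix l u :: complex assume le: "!!b. b \<in> Basis ==> l \<bullet> b <= u \<bullet> b"
 then have "Re l <= Re u" "Im l <= Im u" using le[of 1] le[of \<i>] by (auto simp: Basis_complex_def inner_complex_def)
 have BR: "(Basis :: (real^2) set) = {axis 1 1, axis 2 1}" by (auto simp: Basis_vec_def UNIV_2)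
 have "emeasure (distr lborel borel complex_vec) (box l u) = emeasure lborel (complex_vec -` box l u)"
  by (simp add: emeasure_distr)
 also have "complex_vec -` box l u = box (vec_complex l) (vec_complex u)"
  unfolding box_def by (auto simp: BR complex_vec_def vec_complex_def Basis_complex_def inner_complex_def inner_axis)
 also have "emeasure lborel \<dots> = ennreal (\<Prod>b\<in>Basis. (vec_complex u - vec_complex l) \<bullet> b)"
  by (rule emeasure_lborel_box) (use \<open>Re l <= Re u\<close> \<open>Im l <= Im u\<close> in
    \<open>auto simp: BR inner_axis vec_complex_def\<close>)
 also have "(\<Prod>b\<in>Basis. (vec_complex u - vec_complex l) \<bullet> b) = (\<Prod>b\<in>Basis. (u - l) \<bullet> b)"
 proof -
  have "axis 1 1 ~= (axis 2 1 :: real^2)" by (simp add: axis_eq_axis)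
  then show ?thesis unfolding BR
   by (simp add: inner_axis vec_complex_def Basis_complex_def inner_complex_def)
 qed
 finally show "emeasure (distr lborel borel complex_vec) (box l u) = ennreal (\<Prod>b\<in>Basis. (u - l) \<bullet> b)" by simp
qed simp

lemma set_integrable_vec:
 fixes f :: "complex => real"
 assumes "f' = (%z. indicator X z *\<^sub>R f z)" "f' \<in> borel_measurable borel"
 shows "set_integrable lborel X f \<longleftrightarrow> set_integrable lborel (vec_complex ` X) (%v. f (complex_vec v))"
  "(LINT z:X|lborel. f z) = (LINT v:vec_complex ` X|lborel. f (complex_vec v))"
proof -
 have "indicator (vec_complex ` X) v = (indicator X (complex_vec v) :: real)" for v
  by (auto simp: indicator_def image_iff) (metis vec_complex_inverse complex_vec_inverse)+
 then have eq: "(%v. indicator (vec_complex ` X) v *\<^sub>R f (complex_vec v)) = (%v. f' (complex_vec v))"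
  by (simp add: assms(1))
 show "set_integrable lborel X f \<longleftrightarrow> set_integrable lborel (vec_complex ` X) (%v. f (complex_vec v))"
  unfolding set_integrable_def eq assms(1)[symmetric]
  by (subst lborel_complex_vec[symmetric]) (use assms(2) in \<open>simp add: integrable_distr_eq\<close>)
 show "(LINT z:X|lborel. f z) = (LINT v:vec_complex ` X|lborel. f (complex_vec v))"
  unfolding set_lebesgue_integral_def eq assms(1)[symmetric]
  by (subst lborel_complex_vec[symmetric]) (use assms(2) in \<open>simp add: integral_distr\<close>)
qed

lemma det_complex_mult: "Determinants.det (matrix (%v. vec_complex (D * complex_vec v))) = (cmod D)\<^sup>2"
 unfolding det_2 matrix_def cmod_power2
 by (simp add: vec_complex_def complex_vec_def axis_def power2_eq_square)

text \<open>The real determinant of multiplication by the complex derivative is its squared modulus,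
  by \<open>det_complex_mult\<close>. Values are sent to \<open>real^1\<close> to match the type of
  the theorem applied.\<close>

lemma holomorphic_change_of_variables:
 fixes f :: "complex => real"
 assumes W: "open W" and T: "T holomorphic_on W" and inj: "inj_on T W"
  and X: "X \<subseteq> W" "X \<in> sets borel" and f: "set_integrable lborel (T ` X) f"
 shows "set_integrable lborel X (%z. (cmod (deriv T z))\<^sup>2 * f (T z))"
  "(LINT z:X|lborel. (cmod (deriv T z))\<^sup>2 * f (T z)) = (LINT z:T ` X|lborel. f z)"
proof -
 let ?f = "%z. (cmod (deriv T z))\<^sup>2 * f (T z)"
 define f1 where "f1 z = indicator (T ` X) z *\<^sub>R f z" for z
 define f2 where "f2 z = indicator X z *\<^sub>R ?f z" for z
 have f1_eq: "f1 = (%z. indicator (T ` X) z *\<^sub>R f z)" and f2_eq: "f2 = (%z. indicator X z *\<^sub>R ?f z)"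
  by (simp_all add: f1_def f2_def fun_eq_iff)
 have m1: "f1 \<in> borel_measurable borel"
  using f unfolding set_integrable_def f1_def[symmetric] by auto
 have cT: "continuous_on W T" using T holomorphic_on_imp_continuous_on by blast
 \<comment> \<open>Borel measurability is shown separately, with \<open>T\<close> and its derivative
   extended by 0 outside \<open>W\<close>. It is needed to return from the completed measure, on
   which absolute integrability is defined, to \<open>lborel\<close>.\<close>
 have m2: "f2 \<in> borel_measurable borel"
 proof -
  have [measurable]: "(%z. indicator W z *\<^sub>R T z) \<in> borel_measurable borel"
   "(%z. indicator W z *\<^sub>R deriv T z) \<in> borel_measurable borel"
   using W T cT by (auto intro!: borel_measurable_continuous_on_indicator holomorphic_on_imp_continuous_on holomorphic_deriv)
  have [measurable]: "X \<in> sets borel" "f1 \<in> borel_measurable borel" by fact+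
  have "f2 = (%z. indicator X z *\<^sub>R ((cmod (indicator W z *\<^sub>R deriv T z))\<^sup>2 * f1 (indicator W z *\<^sub>R T z)))"
   using X(1) by (auto simp: f2_def f1_def indicator_def fun_eq_iff)
  also have "\<dots> \<in> borel_measurable borel" by measurable
  finally show ?thesis .
 qed
 define g where "g v = vec_complex (T (complex_vec v))" for v
 define S where "S = vec_complex ` X"
 have gS: "g ` S = vec_complex ` T ` X" by (force simp: g_def S_def)
 have S_eq: "S = complex_vec -` X"
  by (auto simp: S_def image_iff) (metis vec_complex_inverse)
 have Sb: "S \<in> sets borel" unfolding S_eq using measurable_sets[OF borel_complex_vec X(2)] by simp
 have Sl: "S \<in> sets lebesgue" using Sb by (simp add: sets_completionI_sets)
 have dg: "(g has_derivative (%v. vec_complex (deriv T (complex_vec x) * complex_vec v))) (at x within S)" if "x \<in> S" for x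
 proof -
  have "complex_vec x \<in> W" using that X by (auto simp: S_def)
  then have "(T has_derivative (%v. deriv T (complex_vec x) * v)) (at (complex_vec x))"
   using holomorphic_derivI[OF T W] by (simp add: has_field_derivative_def)
  then have "((%v. T (complex_vec v)) has_derivative (%v. deriv T (complex_vec x) * complex_vec v)) (at x within S)"
   using has_derivative_compose[OF bounded_linear_imp_has_derivative[OF bounded_linear_complex_vec]] by blast
  then show ?thesis unfolding g_def
   using bounded_linear.has_derivative[OF bounded_linear_vec_complex] by blast
 qed
 have ig: "inj_on g S"
 proof (rule inj_onI)
  fix x y assume "x \<in> S" "y \<in> S" "g x = g y"
  then have "T (complex_vec x) = T (complex_vec y)" unfolding g_def by (metis complex_vec_inverse)
  moreover have "complex_vec x \<in> W" "complex_vec y \<in> W" using \<open>x \<in> S\<close> \<open>y \<in> S\<close> X by (auto simp: S_def)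
  ultimately have "complex_vec x = complex_vec y" using inj inj_onD by metis
  then show "x = y" by (metis vec_complex_inverse)
 qed
 let ?F = "%v. f (complex_vec v)" and ?G = "%v. ?f (complex_vec v)"
 have F: "set_integrable lborel (g ` S) ?F"
  using f set_integrable_vec(1)[OF f1_eq m1] gS by simp
 then have F': "?F absolutely_integrable_on (g ` S)"
  unfolding set_integrable_def using integrable_completion[OF borel_measurable_integrable] by blast
 have intF: "(LINT v:g ` S|lborel. ?F v) = integral (g ` S) ?F"
  using F F' by (metis set_borel_integral_eq_integral(2))
 have a: "(%v. Finite_Cartesian_Product.vec (?F v) :: real^1) absolutely_integrable_on (g ` S)"
  using F' by (simp add: absolutely_integrable_on_1_iff)
 have i: "integral (g ` S) (%v. Finite_Cartesian_Product.vec (?F v) :: real^1) = Finite_Cartesian_Product.vec (integral (g ` S) ?F)"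
  by (simp add: integral_on_1_eq Finite_Cartesian_Product.vec_eq_iff)
 have "(%x. \<bar>Determinants.det (matrix (%v. vec_complex (deriv T (complex_vec x) * complex_vec v)))\<bar> *\<^sub>R (Finite_Cartesian_Product.vec (?F (g x)) :: real^1)) absolutely_integrable_on S &
   integral S (%x. \<bar>Determinants.det (matrix (%v. vec_complex (deriv T (complex_vec x) * complex_vec v)))\<bar> *\<^sub>R (Finite_Cartesian_Product.vec (?F (g x)) :: real^1)) = Finite_Cartesian_Product.vec (integral (g ` S) ?F)"
  using has_absolute_integral_change_of_variables[OF Sl dg ig, of "%v. Finite_Cartesian_Product.vec (?F v)" "Finite_Cartesian_Product.vec (integral (g ` S) ?F)"] a i by blast
 moreover have "\<bar>Determinants.det (matrix (%v. vec_complex (deriv T (complex_vec x) * complex_vec v)))\<bar> *\<^sub>R (Finite_Cartesian_Product.vec (?F (g x)) :: real^1) = Finite_Cartesian_Product.vec (?G x)" for x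
  unfolding det_complex_mult by (simp add: g_def Finite_Cartesian_Product.vec_eq_iff)
 ultimately have G: "?G absolutely_integrable_on S" "integral S ?G = integral (g ` S) ?F"
  by (simp_all add: absolutely_integrable_on_1_iff integral_on_1_eq Finite_Cartesian_Product.vec_eq_iff)
 have mG: "(%v. indicator S v *\<^sub>R ?G v) \<in> borel_measurable borel"
 proof -
  have "(%v. indicator S v *\<^sub>R ?G v) = (%v. f2 (complex_vec v))"
   by (auto simp: S_eq f2_def indicator_def fun_eq_iff)
  then show ?thesis using m2 by simp
 qed
 have G': "set_integrable lborel S ?G"
  using G(1) mG unfolding set_integrable_def by (simp add: integrable_completion)
 show "set_integrable lborel X ?f"
  using G' set_integrable_vec(1)[OF f2_eq m2] S_def by simp
 have "(LINT z:X|lborel. ?f z) = (LINT v:S|lborel. ?G v)"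
  using set_integrable_vec(2)[OF f2_eq m2] S_def by simp
 also have "\<dots> = integral S ?G" using G' by (rule set_borel_integral_eq_integral(2))
 also have "\<dots> = (LINT v:g ` S|lborel. ?F v)" using G(2) intF by simp
 also have "\<dots> = (LINT z:T ` X|lborel. f z)"
  using set_integrable_vec(2)[OF f1_eq m1] gS by simp
 finally show "(LINT z:X|lborel. ?f z) = (LINT z:T ` X|lborel. f z)" .
qed

section \<open>Charts and transition maps\<close>

locale compact_surface =
 fixes A :: "('a::t2_space) chart set"
 assumes surface: "compact_riemann_surface A"
begin

lemma atlas: "riemann_atlas A" and compact_UNIV: "compact (UNIV :: 'a set)" and connected_UNIV: "connected (UNIV :: 'a set)"
 using surface by (auto simp: compact_riemann_surface_def)

lemma chart_cover: "\<exists>c\<in>A. p \<in> cdom c"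
 using atlas unfolding riemann_atlas_def by blast

lemma open_cdom: "c \<in> A ==> open (cdom c)" and open_crd_cdom: "c \<in> A ==> open (crd c ` cdom c)"
 and homeo: "c \<in> A ==> homeomorphism (cdom c) (crd c ` cdom c) (crd c) (cinv c)"
 using atlas by (auto simp: riemann_atlas_def)

lemma cinv_crd [simp]: "c \<in> A ==> p \<in> cdom c ==> cinv c (crd c p) = p"
 using homeo by (simp add: homeomorphism_def)

lemma crd_cinv [simp]: "c \<in> A ==> z \<in> crd c ` cdom c ==> crd c (cinv c z) = z"
 using homeo by (auto simp: homeomorphism_def)

lemma cinv_in_cdom: "c \<in> A ==> z \<in> crd c ` cdom c ==> cinv c z \<in> cdom c"
 by auto

lemma inj_on_crd: "c \<in> A ==> inj_on (crd c) (cdom c)"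
 by (metis inj_onI cinv_crd)

lemma crd_image_iff: "c \<in> A ==> X \<subseteq> cdom c ==> z \<in> crd c ` X \<longleftrightarrow> z \<in> crd c ` cdom c & cinv c z \<in> X"
 by force

lemma crd_cinv_image: "c \<in> A ==> W \<subseteq> crd c ` cdom c ==> crd c ` cinv c ` W = W"
 by force

lemma continuous_crd: "c \<in> A ==> continuous_on (cdom c) (crd c)"
 and continuous_cinv: "c \<in> A ==> continuous_on (crd c ` cdom c) (cinv c)"
 using homeo by (auto simp: homeomorphism_def)

lemma open_crd_image:
 assumes "c \<in> A" "open U" "U \<subseteq> cdom c" shows "open (crd c ` U)"
proof -
 have "crd c ` U = crd c ` cdom c Int cinv c -` U" using assms crd_image_iff[of c U] by blast
 then show ?thesis using continuous_on_open_vimage[OF open_crd_cdom[OF assms(1)]] continuous_cinv[OF assms(1)] assms(2)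
  by (metis Int_commute)
qed

lemma open_cinv_image:
 assumes "c \<in> A" "open W" "W \<subseteq> crd c ` cdom c" shows "open (cinv c ` W)"
proof -
 have "cinv c ` W = cdom c Int crd c -` W"
 proof (rule subset_antisym; rule subsetI)
  fix p assume "p \<in> cinv c ` W"
  then obtain z where z: "z \<in> W" "p = cinv c z" by blast
  then have "z \<in> crd c ` cdom c" using assms by blast
  then show "p \<in> cdom c Int crd c -` W" using assms z by auto
 next
  fix p assume "p \<in> cdom c Int crd c -` W"
  then show "p \<in> cinv c ` W" using cinv_crd[OF assms(1)] by (metis IntE imageI vimageE)
 qed
 then show ?thesis using continuous_on_open_vimage[OF open_cdom[OF assms(1)]] continuous_crd[OF assms(1)] assms(2)
  by (metis Int_commute)
qed

lemma open_crd_Int: "c \<in> A ==> open U ==> open (crd c ` (cdom c Int U))"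
 by (rule open_crd_image) (auto intro: open_cdom)

lemma transition_holomorphic: "c \<in> A ==> d \<in> A ==> transition c d holomorphic_on crd c ` (cdom c Int cdom d)"
 using atlas by (auto simp: riemann_atlas_def)

lemma open_overlap: "c \<in> A ==> d \<in> A ==> open (crd c ` (cdom c Int cdom d))"
 by (intro open_crd_Int open_cdom)

lemma transition_crd [simp]: "c \<in> A ==> p \<in> cdom c ==> transition c d (crd c p) = crd d p"
 by (simp add: transition_def)

lemma transition_deriv:
 "c \<in> A ==> d \<in> A ==> p \<in> cdom c Int cdom d ==> (transition c d has_field_derivative deriv (transition c d) (crd c p)) (at (crd c p))"
 by (intro holomorphic_derivI[OF transition_holomorphic open_overlap]) auto

lemma transition_deriv_inverse:
 assumes "c \<in> A" "d \<in> A" "p \<in> cdom c Int cdom d"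
 shows "deriv (transition d c) (crd d p) * deriv (transition c d) (crd c p) = 1"
proof -
 have 1: "((transition d c \<circ> transition c d) has_field_derivative deriv (transition d c) (crd d p) * deriv (transition c d) (crd c p)) (at (crd c p))"
  using assms transition_deriv[of d c p] transition_deriv[of c d p] by (intro DERIV_chain) auto
 have "((transition d c \<circ> transition c d) has_field_derivative 1) (at (crd c p))"
  by (rule has_field_derivative_transform_within_open[of "%z. z" _ _ "crd c ` (cdom c Int cdom d)"])
   (use assms open_overlap in auto)
 then show ?thesis using 1 DERIV_unique by blast
qed

lemma transition_deriv_compose:
 assumes "c \<in> A" "d \<in> A" "e \<in> A" "p \<in> cdom c Int cdom d Int cdom e"
 shows "deriv (transition c e) (crd c p) = deriv (transition d e) (crd d p) * deriv (transition c d) (crd c p)"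
proof -
 have 1: "((transition d e \<circ> transition c d) has_field_derivative deriv (transition d e) (crd d p) * deriv (transition c d) (crd c p)) (at (crd c p))"
  using assms transition_deriv[of d e p] transition_deriv[of c d p] by (intro DERIV_chain) auto
 have "(transition c e has_field_derivative deriv (transition d e) (crd d p) * deriv (transition c d) (crd c p)) (at (crd c p))"
  by (rule has_field_derivative_transform_within_open[OF 1, of "crd c ` (cdom c Int (cdom d Int cdom e))"])
   (use assms in \<open>auto intro!: open_crd_Int open_Int open_cdom\<close>)
 then show ?thesis by (rule DERIV_imp_deriv)
qed

lemma transition_deriv_self: "c \<in> A ==> p \<in> cdom c ==> deriv (transition c c) (crd c p) = 1"
proof -
 assume a: "c \<in> A" "p \<in> cdom c"
 have "(transition c c has_field_derivative 1) (at (crd c p))"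
  by (rule has_field_derivative_transform_within_open[of "%z. z" _ _ "crd c ` cdom c"])
   (use a open_crd_cdom in auto)
 then show ?thesis by (rule DERIV_imp_deriv)
qed

lemma borel_crd_image:
 assumes "c \<in> A" "B \<in> sets borel" "B \<subseteq> cdom c" shows "crd c ` B \<in> sets borel"
proof -
 have "cinv c \<in> borel_measurable (restrict_space borel (crd c ` cdom c))"
  by (rule borel_measurable_continuous_on_restrict[OF continuous_cinv[OF assms(1)]])
 then have "cinv c -` B Int space (restrict_space borel (crd c ` cdom c)) \<in> sets (restrict_space borel (crd c ` cdom c))"
  using assms(2) measurable_sets by blast
 then have "cinv c -` B Int crd c ` cdom c \<in> sets borel"
  using open_crd_cdom[OF assms(1)] by (simp add: sets_restrict_space_iff space_restrict_space)
 moreover have "cinv c -` B Int crd c ` cdom c = crd c ` B" using assms crd_image_iff[of c B] by blast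
 ultimately show ?thesis by simp
qed

section \<open>Integration of 2-forms over the surface\<close>

definition charts :: "'a chart list" where
 "charts = (SOME cs. set cs \<subseteq> A & (\<Union>c\<in>set cs. cdom c) = UNIV)"

lemma charts: "set charts \<subseteq> A" "(\<Union>c\<in>set charts. cdom c) = UNIV"
proof -
 have cov: "UNIV \<subseteq> \<Union>(cdom ` A)" using chart_cover by auto
 obtain T where T: "T \<subseteq> cdom ` A" "finite T" "UNIV \<subseteq> \<Union>T"
  by (rule compactE[OF compact_UNIV cov]) (use open_cdom in auto)
 then obtain C where C': "C \<subseteq> A" "finite C" "T = cdom ` C" using finite_subset_image[OF T(2,1)] by blast
 then have C: "C \<subseteq> A" "finite C" "UNIV \<subseteq> (\<Union>c\<in>C. cdom c)" using T by auto
 obtain cs where "set cs = C" using C(2) finite_list by blast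
 then have "\<exists>cs. set cs \<subseteq> A & (\<Union>c\<in>set cs. cdom c) = UNIV" using C by auto
 then have "set charts \<subseteq> A & (\<Union>c\<in>set charts. cdom c) = UNIV" unfolding charts_def by (rule someI_ex)
 then show "set charts \<subseteq> A" "(\<Union>c\<in>set charts. cdom c) = UNIV" by auto
qed

abbreviation ch :: "nat => 'a chart" where "ch i \<equiv> charts ! i"

text \<open>A finite cover by charts made disjoint. With these fixed Borel pieces an integral over
  the surface is a finite sum of integrals in the plane.\<close>

definition piece :: "nat => 'a set" where
 "piece i = cdom (ch i) - (\<Union>j<i. cdom (ch j))"

lemma ch_in: "i < length charts ==> ch i \<in> A" using charts(1) by auto

lemma piece_cdom: "piece i \<subseteq> cdom (ch i)" by (auto simp: piece_def)

lemma piece_disjoint: "i ~= j ==> piece i Int piece j = {}"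
 by (cases "i < j") (auto simp: piece_def)

lemma piece_cover: "(\<Union>i<length charts. piece i) = UNIV"
proof -
 have "\<exists>i<length charts. p \<in> piece i" for p
 proof -
  define P where "P i \<longleftrightarrow> i < length charts & p \<in> cdom (ch i)" for i
  have "\<exists>i. P i" using charts(2) unfolding P_def by (metis UNIV_I UN_E in_set_conv_nth)
  then have "P (LEAST i. P i)" "!!j. j < (LEAST i. P i) ==> \<not> P j" using LeastI_ex not_less_Least by blast+
  then show ?thesis unfolding P_def piece_def by (metis (no_types, lifting) DiffI UN_E lessThan_iff order_less_trans)
 qed
 then show ?thesis by blast
qed

lemma piece_borel: "i < length charts ==> piece i \<in> sets borel"
 unfolding piece_def using ch_in open_cdom by (intro sets.Diff sets.finite_UN borel_open) auto

definition pull :: "'a chart => 'a form2 => complex => real" where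
 "pull c \<theta> z = \<theta> c (cinv c z)"

definition intble :: "'a set => 'a form2 => bool" where
 "intble X \<theta> \<longleftrightarrow> (\<forall>i<length charts. set_integrable lborel (crd (ch i) ` (piece i Int X)) (pull (ch i) \<theta>))"

definition integ :: "'a set => 'a form2 => real" where
 "integ X \<theta> = (\<Sum>i<length charts. LINT z:crd (ch i) ` (piece i Int X)|lborel. pull (ch i) \<theta> z)"

text \<open>The transformation law of a 2-form: the real Jacobian of a transition map is the squared
  modulus of its complex derivative.\<close>

definition cov2 :: "'a set => 'a form2 => bool" where
 "cov2 X \<theta> \<longleftrightarrow> (\<forall>c\<in>A. \<forall>d\<in>A. \<forall>p\<in>cdom c Int cdom d Int X. \<theta> c p = (cmod (deriv (transition c d) (crd c p)))\<^sup>2 * \<theta> d p)"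

lemma cov2_subset: "cov2 X \<theta> ==> Y \<subseteq> X ==> cov2 Y \<theta>"
 by (auto simp: cov2_def)

lemma chart_change:
 assumes "c \<in> A" "d \<in> A" and X: "X \<subseteq> cdom c Int cdom d" "X \<in> sets borel" and "cov2 X \<theta>"
  and i: "set_integrable lborel (crd d ` X) (pull d \<theta>)"
 shows "set_integrable lborel (crd c ` X) (pull c \<theta>)"
  "(LINT z:crd c ` X|lborel. pull c \<theta> z) = (LINT z:crd d ` X|lborel. pull d \<theta> z)"
proof -
 let ?T = "transition c d" and ?W = "crd c ` (cdom c Int cdom d)"
 have im: "?T ` (crd c ` X) = crd d ` X" unfolding image_image
  by (rule image_cong) (use assms in auto)
 have inj: "inj_on ?T ?W"
 proof (rule inj_onI)
  fix x y assume "x \<in> ?W" "y \<in> ?W" "?T x = ?T y"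
  then obtain p q where pq: "p \<in> cdom c Int cdom d" "q \<in> cdom c Int cdom d" "x = crd c p" "y = crd c q" by blast
  then have "crd d p = crd d q" using \<open>?T x = ?T y\<close> assms by simp
  then show "x = y" using pq inj_on_crd[OF assms(2)] by (metis Int_iff inj_onD)
 qed
 have Xb: "crd c ` X \<in> sets borel" using borel_crd_image assms by auto
 have eq: "(cmod (deriv ?T z))\<^sup>2 * pull d \<theta> (?T z) = pull c \<theta> z" if zX: "z \<in> crd c ` X" for z
 proof -
  obtain p where p: "p \<in> X" "z = crd c p" using zX by blast
  then have "p \<in> cdom c" "p \<in> cdom d" using X by auto
  then have "\<theta> c p = (cmod (deriv (transition c d) (crd c p)))\<^sup>2 * \<theta> d p"
   using \<open>cov2 X \<theta>\<close> p assms(1,2) unfolding cov2_def by blast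
  then show ?thesis using p \<open>p \<in> cdom c\<close> \<open>p \<in> cdom d\<close> assms(1,2) by (simp add: pull_def)
 qed
 note T = holomorphic_change_of_variables[OF open_overlap[OF assms(1,2)] transition_holomorphic[OF assms(1,2)] inj
   _ Xb, where f = "pull d \<theta>", unfolded im, OF _ i]
 have sub: "crd c ` X \<subseteq> ?W" using X by auto
 show "set_integrable lborel (crd c ` X) (pull c \<theta>)"
 proof -
  have "set_integrable lborel (crd c ` X) (%z. (cmod (deriv ?T z))\<^sup>2 * pull d \<theta> (?T z)) = set_integrable lborel (crd c ` X) (pull c \<theta>)"
   by (rule set_integrable_cong[OF HOL.refl HOL.refl]) (rule eq)
  then show ?thesis using T(1)[OF sub] by (rule iffD1)
 qed
 show "(LINT z:crd c ` X|lborel. pull c \<theta> z) = (LINT z:crd d ` X|lborel. pull d \<theta> z)"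
  unfolding T(2)[OF sub, symmetric] by (rule set_lebesgue_integral_cong) (use eq Xb in auto)
qed

text \<open>Independence of the fixed pieces: the part of \<open>X\<close> in each piece is moved
  from the chart of the piece to \<open>d\<close>, and the parts are reassembled there.\<close>

lemma integ_chart:
 assumes d: "d \<in> A" and X: "X \<subseteq> cdom d" "X \<in> sets borel" and c2: "cov2 X \<theta>"
 shows "intble X \<theta> \<longleftrightarrow> set_integrable lborel (crd d ` X) (pull d \<theta>)"
  "intble X \<theta> ==> integ X \<theta> = (LINT z:crd d ` X|lborel. pull d \<theta> z)"
proof -
 let ?P = "%i. piece i Int X"
 have Pb: "?P i \<in> sets borel" if "i < length charts" for i using piece_borel[OF that] X by auto
 have PX: "crd d ` X = (\<Union>i<length charts. crd d ` ?P i)" using piece_cover by blast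
 have bor: "crd d ` ?P i \<in> sets lborel" if "i < length charts" for i using borel_crd_image[OF d Pb[OF that]] X by auto
 have c2': "cov2 (?P i) \<theta>" for i by (rule cov2_subset[OF c2]) auto
 have sub: "?P i \<subseteq> cdom (ch i) Int cdom d" "?P i \<subseteq> cdom d Int cdom (ch i)" for i using piece_cdom X by auto
 have *: "set_integrable lborel (crd d ` ?P i) (pull d \<theta>)" if "intble X \<theta>" "i < length charts" for i
  using chart_change(1)[OF d ch_in[OF that(2)] sub(2) Pb[OF that(2)] c2'] that unfolding intble_def by blast
 show iff: "intble X \<theta> \<longleftrightarrow> set_integrable lborel (crd d ` X) (pull d \<theta>)"
 proof
  assume "intble X \<theta>"
  then show "set_integrable lborel (crd d ` X) (pull d \<theta>)" unfolding PX
   using * bor by (intro set_integrable_UN) auto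
 next
  assume a: "set_integrable lborel (crd d ` X) (pull d \<theta>)"
  show "intble X \<theta>" unfolding intble_def
  proof (intro allI impI)
   fix i assume i: "i < length charts"
   have "set_integrable lborel (crd d ` ?P i) (pull d \<theta>)"
    by (rule set_integrable_subset[OF a bor[OF i]]) auto
   then show "set_integrable lborel (crd (ch i) ` ?P i) (pull (ch i) \<theta>)"
    by (rule chart_change(1)[OF ch_in[OF i] d sub(1) Pb[OF i] c2'])
  qed
 qed
 assume I: "intble X \<theta>"
 have "(LINT z:crd d ` X|lborel. pull d \<theta> z) = (\<Sum>i<length charts. LINT z:crd d ` ?P i|lborel. pull d \<theta> z)"
  unfolding PX
 proof (rule set_integral_finite_Union)
  show "disjoint_family_on (%i. crd d ` (piece i Int X)) {..<length charts}"
   unfolding disjoint_family_on_def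
  proof (intro ballI impI)
   fix m n :: nat assume "m ~= n"
   then show "crd d ` (piece m Int X) Int crd d ` (piece n Int X) = {}"
    using piece_disjoint[of m n] inj_on_crd[OF d] X by (auto simp: inj_on_def)
  qed
 qed (use * I bor in auto)
 also have "\<dots> = integ X \<theta>" unfolding integ_def
 proof (rule sum.cong[OF HOL.refl])
  fix i assume "i \<in> {..<length charts}"
  then have i: "i < length charts" by simp
  show "(LINT z:crd d ` ?P i|lborel. pull d \<theta> z) = (LINT z:crd (ch i) ` ?P i|lborel. pull (ch i) \<theta> z)"
   by (rule chart_change(2)[OF d ch_in[OF i] sub(2) Pb[OF i] c2']) (use I i in \<open>auto simp: intble_def\<close>)
 qed
 finally show "integ X \<theta> = (LINT z:crd d ` X|lborel. pull d \<theta> z)" by simp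
qed

end

lemma set_integral_sums:
 fixes f :: "'b => real"
 assumes meas: "!!i::nat. B i \<in> sets M" and disj: "disjoint_family B"
  and i: "set_integrable M (\<Union>i. B i) f"
 shows "(%n. LINT x:B n|M. f x) sums (LINT x:(\<Union>i. B i)|M. f x)"
proof -
 have dis: "B i Int B j = {}" if "i ~= j" for i j using disj that by (auto simp: disjoint_family_on_def)
 have iB: "set_integrable M (B n) f" for n by (rule set_integrable_subset[OF i meas]) auto
 have ia: "set_integrable M (\<Union>i. B i) (%x. \<bar>f x\<bar>)" by (rule set_integrable_abs[OF i])
 have "summable (%n. LINT x:B n|M. \<bar>f x\<bar>)"
 proof (rule summableI_nonneg_bounded)
  show "0 <= (LINT x:B n|M. \<bar>f x\<bar>)" for n
   unfolding set_lebesgue_integral_def by (rule integral_nonneg_AE) simp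
  show "(\<Sum>k<n. LINT x:B k|M. \<bar>f x\<bar>) <= (LINT x:(\<Union>i. B i)|M. \<bar>f x\<bar>)" for n
  proof -
   have iBa: "set_integrable M (B k) (%x. \<bar>f x\<bar>)" for k by (rule set_integrable_abs[OF iB])
   have "(\<Sum>k<n. LINT x:B k|M. \<bar>f x\<bar>) = (LINT x:(\<Union>k<n. B k)|M. \<bar>f x\<bar>)"
    by (rule set_integral_finite_Union[symmetric]) (use disj iBa meas in \<open>auto simp: disjoint_family_on_def\<close>)
   also have "\<dots> <= (LINT x:(\<Union>i. B i)|M. \<bar>f x\<bar>)"
    unfolding set_lebesgue_integral_def
   proof (rule integral_mono_AE)
    have "set_integrable M (\<Union>k<n. B k) (%x. \<bar>f x\<bar>)"
     by (rule set_integrable_subset[OF ia]) (use meas in auto)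
    then show "integrable M (%x. indicat_real (\<Union>k<n. B k) x *\<^sub>R \<bar>f x\<bar>)" by (simp add: set_integrable_def)
    show "integrable M (%x. indicat_real (\<Union>i. B i) x *\<^sub>R \<bar>f x\<bar>)" using ia by (simp add: set_integrable_def)
   qed (auto simp: indicator_def)
   finally show ?thesis .
  qed
 qed
 then have "summable (%n. LINT x:B n|M. f x)"
 proof (rule summable_comparison_test'[of _ 0])
  show "norm (LINT x:B n|M. f x) <= (LINT x:B n|M. \<bar>f x\<bar>)" for n
   unfolding set_lebesgue_integral_def
   using integral_abs_bound[of M "%x. indicat_real (B n) x *\<^sub>R f x"] by (simp add: abs_mult)
 qed
 then have "(%n. LINT x:B n|M. f x) sums suminf (%n. LINT x:B n|M. f x)" by (rule summable_sums)
 also have "suminf (%n. LINT x:B n|M. f x) = (LINT x:(\<Union>i. B i)|M. f x)"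
  by (rule lebesgue_integral_countable_add[symmetric]) (use meas dis i in auto)
 finally show ?thesis .
qed

context compact_surface
begin

text \<open>The integrand on one piece, extended by 0 to the plane, so that the theorems on
  integrals of functions apply to it directly.\<close>

definition itg :: "'a set => 'a form2 => nat => complex => real" where
 "itg X \<theta> i z = indicator (crd (ch i) ` (piece i Int X)) z *\<^sub>R pull (ch i) \<theta> z"

lemma intble_itg: "intble X \<theta> \<longleftrightarrow> (\<forall>i<length charts. integrable lborel (itg X \<theta> i))"
 unfolding intble_def set_integrable_def itg_def[abs_def] ..

lemma integ_itg: "integ X \<theta> = (\<Sum>i<length charts. integral\<^sup>L lborel (itg X \<theta> i))"
 unfolding integ_def set_lebesgue_integral_def itg_def[abs_def] ..

lemma integ_support:
 assumes "X \<subseteq> Y" "!!i p. i < length charts ==> p \<in> cdom (ch i) Int (Y - X) ==> \<theta> (ch i) p = 0"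
 shows "intble Y \<theta> \<longleftrightarrow> intble X \<theta>" "integ Y \<theta> = integ X \<theta>"
proof -
 have eq: "itg Y \<theta> i z = itg X \<theta> i z" if i: "i < length charts" for i z
 proof (cases "z \<in> crd (ch i) ` (piece i Int Y) & z ~: crd (ch i) ` (piece i Int X)")
  case True
  then obtain p where p: "p \<in> piece i" "p \<in> Y" "z = crd (ch i) p" by blast
  then have "p ~: X" using True by blast
  moreover have "p \<in> cdom (ch i)" using p piece_cdom by blast
  ultimately have "pull (ch i) \<theta> z = 0" using p assms(2)[OF i, of p] ch_in[OF i] by (simp add: pull_def)
  then show ?thesis by (simp add: itg_def)
 next
  case False
  then have "z \<in> crd (ch i) ` (piece i Int Y) \<longleftrightarrow> z \<in> crd (ch i) ` (piece i Int X)" using assms(1) by blast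
  then show ?thesis by (simp add: indicator_def itg_def)
 qed
 have "itg Y \<theta> i = itg X \<theta> i" if "i < length charts" for i using eq[OF that] by blast
 then show "intble Y \<theta> \<longleftrightarrow> intble X \<theta>" "integ Y \<theta> = integ X \<theta>"
  by (simp_all add: intble_itg integ_itg)
qed

lemma integ_cong:
 assumes "!!c p. c \<in> A ==> p \<in> cdom c Int X ==> \<theta> c p = \<theta>' c p"
 shows "intble X \<theta> \<longleftrightarrow> intble X \<theta>'" "integ X \<theta> = integ X \<theta>'"
proof -
 have eq: "itg X \<theta> i z = itg X \<theta>' i z" if i: "i < length charts" for i z
 proof (cases "z \<in> crd (ch i) ` (piece i Int X)")
  case True
  then obtain p where p: "p \<in> piece i" "p \<in> X" "z = crd (ch i) p" by blast
  then have "p \<in> cdom (ch i)" using piece_cdom by blast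
  then show ?thesis using p assms[OF ch_in[OF i], of p] ch_in[OF i] by (simp add: pull_def itg_def)
 qed (simp add: itg_def)
 have "itg X \<theta> i = itg X \<theta>' i" if "i < length charts" for i using eq[OF that] by blast
 then show "intble X \<theta> \<longleftrightarrow> intble X \<theta>'" "integ X \<theta> = integ X \<theta>'"
  by (simp_all add: intble_itg integ_itg)
qed

lemma integ_linear:
 assumes "intble X \<theta>" "intble X \<theta>'"
 shows "intble X (%c p. a * \<theta> c p + b * \<theta>' c p)"
  "integ X (%c p. a * \<theta> c p + b * \<theta>' c p) = a * integ X \<theta> + b * integ X \<theta>'"
proof -
 have p: "pull c (%c p. a * \<theta> c p + b * \<theta>' c p) = (%z. a * pull c \<theta> z + b * pull c \<theta>' z)" for c
  by (simp add: pull_def fun_eq_iff)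
 have i: "set_integrable lborel (crd (ch i) ` (piece i Int X)) (%z. a * pull (ch i) \<theta> z)"
  "set_integrable lborel (crd (ch i) ` (piece i Int X)) (%z. b * pull (ch i) \<theta>' z)" if "i < length charts" for i
  using assms that by (simp_all add: intble_def)
 show "intble X (%c p. a * \<theta> c p + b * \<theta>' c p)"
  unfolding intble_def p using set_integral_add(1)[OF i] by blast
 have "integ X (%c p. a * \<theta> c p + b * \<theta>' c p) = (\<Sum>i<length charts.
   (LINT z:crd (ch i) ` (piece i Int X)|lborel. a * pull (ch i) \<theta> z) + (LINT z:crd (ch i) ` (piece i Int X)|lborel. b * pull (ch i) \<theta>' z))"
  unfolding integ_def p using set_integral_add(2)[OF i] by (intro sum.cong) auto
 also have "\<dots> = a * integ X \<theta> + b * integ X \<theta>'"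
  by (simp add: sum.distrib integ_def sum_distrib_left)
 finally show "integ X (%c p. a * \<theta> c p + b * \<theta>' c p) = a * integ X \<theta> + b * integ X \<theta>'" .
qed

lemma integ_sum:
 assumes "finite I" "!!k. k \<in> I ==> intble X (\<theta> k)"
 shows "intble X (%c p. \<Sum>k\<in>I. a k * \<theta> k c p)"
  "integ X (%c p. \<Sum>k\<in>I. a k * \<theta> k c p) = (\<Sum>k\<in>I. a k * integ X (\<theta> k))"
proof -
 have "intble X (%c p. \<Sum>k\<in>I. a k * \<theta> k c p) & integ X (%c p. \<Sum>k\<in>I. a k * \<theta> k c p) = (\<Sum>k\<in>I. a k * integ X (\<theta> k))"
  using assms
 proof (induction I rule: finite_induct)
  case empty
  then show ?case by (simp add: intble_def integ_def pull_def set_integrable_def)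
 next
  case (insert k I)
  then have IH: "intble X (%c p. \<Sum>k\<in>I. a k * \<theta> k c p)" "integ X (%c p. \<Sum>k\<in>I. a k * \<theta> k c p) = (\<Sum>k\<in>I. a k * integ X (\<theta> k))"
   and k: "intble X (\<theta> k)" by auto
  from integ_linear[OF k IH(1), of "a k" 1] show ?case using insert.hyps IH(2) by simp
 qed
 then show "intble X (%c p. \<Sum>k\<in>I. a k * \<theta> k c p)"
  "integ X (%c p. \<Sum>k\<in>I. a k * \<theta> k c p) = (\<Sum>k\<in>I. a k * integ X (\<theta> k))" by auto
qed

lemma intble_subset:
 assumes "intble Y \<theta>" "X \<subseteq> Y" "X \<in> sets borel"
 shows "intble X \<theta>"
 unfolding intble_def
proof (intro allI impI)
 fix i assume i: "i < length charts"
 show "set_integrable lborel (crd (ch i) ` (piece i Int X)) (pull (ch i) \<theta>)"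
 proof (rule set_integrable_subset)
  show "set_integrable lborel (crd (ch i) ` (piece i Int Y)) (pull (ch i) \<theta>)" using assms i by (simp add: intble_def)
  show "crd (ch i) ` (piece i Int X) \<in> sets lborel"
   using borel_crd_image[OF ch_in[OF i], of "piece i Int X"] piece_borel[OF i] piece_cdom[of i] assms(3) by auto
 qed (use assms(2) in auto)
qed

lemma intble_Union:
 assumes "finite F" "!!X. X \<in> F ==> intble X \<theta>" "!!X. X \<in> F ==> X \<in> sets borel"
 shows "intble (\<Union>F) \<theta>"
 unfolding intble_def
proof (intro allI impI)
 fix i assume i: "i < length charts"
 have "crd (ch i) ` (piece i Int \<Union>F) = (\<Union>X\<in>F. crd (ch i) ` (piece i Int X))" by blast
 moreover have "set_integrable lborel (\<Union>X\<in>F. crd (ch i) ` (piece i Int X)) (pull (ch i) \<theta>)"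
 proof (rule set_integrable_UN[OF assms(1)])
  fix X assume X: "X \<in> F"
  show "set_integrable lborel (crd (ch i) ` (piece i Int X)) (pull (ch i) \<theta>)"
   using assms(2)[OF X] i by (simp add: intble_def)
  show "crd (ch i) ` (piece i Int X) \<in> sets lborel"
   using borel_crd_image[OF ch_in[OF i], of "piece i Int X"] piece_borel[OF i] piece_cdom[of i] assms(3)[OF X] by auto
 qed
 ultimately show "set_integrable lborel (crd (ch i) ` (piece i Int \<Union>F)) (pull (ch i) \<theta>)" by simp
qed

text \<open>By compactness finitely many of the given neighbourhoods cover the surface. The finite
  set \<open>P\<close> is closed, so what remains of each neighbourhood is a Borel set.\<close>

lemma intble_local:
 assumes P: "finite P" and loc: "!!p. \<exists>U. open U & p \<in> U & intble (U - P) \<theta>"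
 shows "intble (- P) \<theta>"
proof -
 obtain U where U: "!!p. open (U p)" "!!p. p \<in> U p" "!!p. intble (U p - P) \<theta>" using loc by metis
 obtain C where C: "finite C" "UNIV \<subseteq> (\<Union>p\<in>C. U p)"
  using compactE_image[OF compact_UNIV, of UNIV U] U(1,2) by (metis UNIV_I UN_I subsetI)
 have "intble (\<Union>((%p. U p - P) ` C)) \<theta>"
  by (rule intble_Union) (use C U P in \<open>auto intro!: borel_open open_Diff finite_imp_closed\<close>)
 moreover have "\<Union>((%p. U p - P) ` C) = - P" using C(2) by auto
 ultimately show ?thesis by simp
qed

lemma borel_finite: "finite (P :: 'a set) ==> P \<in> sets borel" "finite (P :: 'a set) ==> - P \<in> sets borel"
 by (auto intro: borel_closed borel_open finite_imp_closed)

lemma integ_null: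
 assumes "finite P" "X \<in> sets borel"
 shows "intble (X - P) \<theta> \<longleftrightarrow> intble X \<theta>" "integ (X - P) \<theta> = integ X \<theta>"
proof -
 have cnt: "countable (crd (ch i) ` P)" for i using assms(1) by (simp add: countable_finite)
 have ne: "itg (X - P) \<theta> i z = itg X \<theta> i z" if "z ~: crd (ch i) ` P" for i z
  using that by (auto simp: indicator_def itg_def)
 have "integrable lborel (itg (X - P) \<theta> i) = integrable lborel (itg X \<theta> i)" for i
  by (rule integrable_discrete_difference[OF cnt]) (auto intro: ne)
 moreover have "integral\<^sup>L lborel (itg (X - P) \<theta> i) = integral\<^sup>L lborel (itg X \<theta> i)" for i
  by (rule integral_discrete_difference[OF cnt]) (auto intro: ne)
 ultimately show "intble (X - P) \<theta> \<longleftrightarrow> intble X \<theta>" "integ (X - P) \<theta> = integ X \<theta>"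
  by (simp_all add: intble_itg integ_itg)
qed

text \<open>The fixed pieces form one decomposition as in \<open>has_surface_integral\<close>. Any
  other one is intersected with them and resummed by countable additivity, so all decompositions
  give the same value and the definite description is meaningful.\<close>

lemma surface_integral_eq:
 assumes S: "S \<in> sets borel" and i: "intble S \<theta>" and c2: "cov2 S \<theta>"
 shows "surface_integral A S \<theta> = integ S \<theta>"
 unfolding surface_integral_def
proof (rule the_equality)
 let ?m = "length charts"
 have m0: "0 < ?m" using charts(2) by (cases charts) auto
 define B where "B n = (if n < ?m then piece n Int S else {})" for n
 \<comment> \<open>A default chart beyond the finite list, where \<open>B n\<close> is
   empty.\<close>
 define c where "c n = (if n < ?m then ch n else ch 0)" for n
 have "(%n. LINT z:crd (c n) ` B n|lborel. \<theta> (c n) (cinv (c n) z)) sums (\<Sum>n<?m. LINT z:crd (c n) ` B n|lborel. \<theta> (c n) (cinv (c n) z))"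
  by (rule sums_finite) (auto simp: B_def set_lebesgue_integral_def)
 also have "(\<Sum>n<?m. LINT z:crd (c n) ` B n|lborel. \<theta> (c n) (cinv (c n) z)) = integ S \<theta>"
  unfolding integ_def by (rule sum.cong) (auto simp: B_def c_def pull_def[abs_def])
 finally have s: "(%n. LINT z:crd (c n) ` B n|lborel. \<theta> (c n) (cinv (c n) z)) sums integ S \<theta>" .
 have s2: "summable (%n. LINT z:crd (c n) ` B n|lborel. \<bar>\<theta> (c n) (cinv (c n) z)\<bar>)"
  by (rule summable_finite[of "{..<?m}"]) (auto simp: B_def set_lebesgue_integral_def)
 have 1: "disjoint_family B" unfolding disjoint_family_on_def B_def using piece_disjoint by auto
 have 2: "(\<Union>n. B n) = S"
 proof (rule subset_antisym; rule subsetI)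
  fix p assume "p \<in> S"
  obtain n where "n < ?m" "p \<in> piece n" using piece_cover by blast
  then show "p \<in> (\<Union>n. B n)" using \<open>p \<in> S\<close> by (auto simp: B_def intro!: exI[of _ n])
 qed (auto simp: B_def split: if_splits)
 have 3: "c n \<in> A & B n \<in> sets borel & B n \<subseteq> cdom (c n) &
     set_integrable lborel (crd (c n) ` B n) (%z. \<theta> (c n) (cinv (c n) z))" for n
 proof (cases "n < ?m")
  case True
  have "set_integrable lborel (crd (ch n) ` (piece n Int S)) (%z. \<theta> (ch n) (cinv (ch n) z))"
   using i True unfolding intble_def pull_def[abs_def] by blast
  then show ?thesis using True ch_in[OF True] piece_borel[OF True] piece_cdom[of n] S by (auto simp: B_def c_def)
 next
  case False
  then show ?thesis using ch_in[OF m0] by (simp add: B_def c_def)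
 qed
 show "has_surface_integral A S \<theta> (integ S \<theta>)"
  unfolding has_surface_integral_def using 1 2 3 s s2 by blast
next
 fix I assume "has_surface_integral A S \<theta> I"
 then obtain B c where B: "disjoint_family B" "(\<Union>n. B n) = S"
  and c: "!!n. c n \<in> A & B n \<in> sets borel & B n \<subseteq> cdom (c n)"
  and s: "(%n. LINT z:crd (c n) ` B n|lborel. \<theta> (c n) (cinv (c n) z)) sums I"
  unfolding has_surface_integral_def by blast
 have Bi: "intble (B n) \<theta>" for n by (rule intble_subset[OF i]) (use B c in auto)
 have e: "(LINT z:crd (c n) ` B n|lborel. \<theta> (c n) (cinv (c n) z)) = integ (B n) \<theta>" for n
 proof -
  have "B n \<subseteq> S" using B(2) by blast
  then have "cov2 (B n) \<theta>" by (rule cov2_subset[OF c2])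
  then show ?thesis using integ_chart(2)[of "c n" "B n" \<theta>] Bi[of n] c[of n] unfolding pull_def[abs_def] by simp
 qed
 have "(%n. integ (B n) \<theta>) sums integ S \<theta>" unfolding integ_def
 proof (rule sums_sum)
  fix k assume "k \<in> {..<length charts}"
  then have k: "k < length charts" by simp
  have U: "crd (ch k) ` (piece k Int S) = (\<Union>n. crd (ch k) ` (piece k Int B n))" using B(2) by blast
  have "disjoint_family (%n. crd (ch k) ` (piece k Int B n))"
   unfolding disjoint_family_on_def
  proof (intro ballI impI)
   fix m n :: nat assume "m ~= n"
   then have "B m Int B n = {}" using B(1) by (auto simp: disjoint_family_on_def)
   then show "crd (ch k) ` (piece k Int B m) Int crd (ch k) ` (piece k Int B n) = {}"
    using inj_on_crd[OF ch_in[OF k]] piece_cdom[of k] by (auto simp: inj_on_def)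
  qed
  moreover have "crd (ch k) ` (piece k Int B n) \<in> sets lborel" for n
   using borel_crd_image[OF ch_in[OF k], of "piece k Int B n"] piece_borel[OF k] piece_cdom[of k] c[of n] by auto
  moreover have "set_integrable lborel (\<Union>n. crd (ch k) ` (piece k Int B n)) (pull (ch k) \<theta>)"
   using i k unfolding intble_def U[symmetric] by blast
  ultimately show "(%n. LINT z:crd (ch k) ` (piece k Int B n)|lborel. pull (ch k) \<theta> z) sums
   (LINT z:crd (ch k) ` (piece k Int S)|lborel. pull (ch k) \<theta> z)"
   unfolding U by (intro set_integral_sums)
 qed
 then show "I = integ S \<theta>" using s unfolding e by (rule sums_unique2[rotated])
qed

text \<open>The passage from surface to plane for a form supported in a coordinate disc:
  \<open>g\<close> is the integrand extended by 0. No relation is required on the finite set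
  \<open>P\<close>, where the form may have poles.\<close>

lemma integ_chart_disc:
 assumes c: "c \<in> A" and R: "cball z0 R \<subseteq> crd c ` cdom c" and P: "finite P" and c2: "cov2 (- P) \<theta>"
  and z: "!!d p. d \<in> A ==> p \<in> cdom d - P ==> p ~: cinv c ` cball z0 R ==> \<theta> d p = 0"
  and g: "integrable lborel g" "!!z. z ~: cball z0 R ==> g z = 0"
   "!!z. z \<in> cball z0 R ==> cinv c z ~: P ==> g z = pull c \<theta> z"
 shows "intble (- P) \<theta>" "integ (- P) \<theta> = integral\<^sup>L lborel g"
proof -
 let ?K = "cinv c ` cball z0 R"
 have K: "?K \<subseteq> cdom c" "crd c ` ?K = cball z0 R" using R c crd_cinv_image[OF c R] cinv_in_cdom[OF c] by auto
 have "compact ?K" by (rule compact_continuous_image[OF continuous_on_subset[OF continuous_cinv[OF c] R]]) simp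
 then have Kb: "?K - P \<in> sets borel" using P by (intro sets.Diff borel_finite borel_closed compact_imp_closed)
 have sup: "intble (- P) \<theta> = intble (?K - P) \<theta>" "integ (- P) \<theta> = integ (?K - P) \<theta>"
 proof -
  have "\<theta> (ch i) p = 0" if "i < length charts" "p \<in> cdom (ch i) Int (- P - (?K - P))" for i p
   using z[OF ch_in[OF that(1)], of p] that(2) by blast
  then show "intble (- P) \<theta> = intble (?K - P) \<theta>" "integ (- P) \<theta> = integ (?K - P) \<theta>"
   by (intro integ_support; blast)+
 qed
 have cK: "cov2 (?K - P) \<theta>" by (rule cov2_subset[OF c2]) auto
 have KP: "?K - P \<subseteq> cdom c" using K by auto
 note ic = integ_chart[OF c KP Kb cK]
 have cnt: "countable (crd c ` (P Int cdom c))" using P by (simp add: countable_finite)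
 have eq: "indicator (crd c ` (?K - P)) w *\<^sub>R pull c \<theta> w = g w" if w: "w ~: crd c ` (P Int cdom c)" for w
 proof (cases "w \<in> cball z0 R")
  case True
  then have k: "cinv c w \<in> ?K" "cinv c w \<in> cdom c" "crd c (cinv c w) = w" using R c cinv_in_cdom[OF c] by auto
  then have "cinv c w ~: P" using w by (metis IntI imageI)
  then have "w \<in> crd c ` (?K - P)" using k by (metis DiffI imageI)
  then show ?thesis using g(3)[OF True \<open>cinv c w ~: P\<close>] by simp
 next
  case False
  then have "w ~: crd c ` (?K - P)" using K by blast
  then show ?thesis using g(2)[OF False] by simp
 qed
 have "integrable lborel (%w. indicator (crd c ` (?K - P)) w *\<^sub>R pull c \<theta> w) = integrable lborel g"
  "integral\<^sup>L lborel (%w. indicator (crd c ` (?K - P)) w *\<^sub>R pull c \<theta> w) = integral\<^sup>L lborel g"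
  by (rule integrable_discrete_difference[OF cnt]; use eq in auto)
   (rule integral_discrete_difference[OF cnt]; use eq in auto)
 then have *: "set_integrable lborel (crd c ` (?K - P)) (pull c \<theta>)"
  "(LINT w:crd c ` (?K - P)|lborel. pull c \<theta> w) = integral\<^sup>L lborel g"
  using g(1) by (simp_all add: set_integrable_def set_lebesgue_integral_def)
 show "intble (- P) \<theta>" using sup(1) ic(1) *(1) by simp
 show "integ (- P) \<theta> = integral\<^sup>L lborel g" using sup(2) ic * by simp
qed

end

section \<open>Closed forms on the surface\<close>

text \<open>Primitives exist on discs, while the formulas in the plane ask for functions on the
  whole plane. The cutoff leaves function and derivative unchanged on the smaller closed
  disc.\<close>

lemma cutoff_primitive:
 assumes F: "C1f (ball z0 r') F F'" and r: "0 < r" "r < r'"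
 obtains E E' where "C1f UNIV E E'" "!!z. z \<in> cball z0 r ==> E z = F z & E' z = F' z"
  "!!z. z ~: ball z0 r' ==> E z = 0"
proof -
 \<comment> \<open>One third and two thirds of the way from \<open>r\<close> to \<open>r'\<close>.
   The cutoff is 1 on a disc that exceeds \<open>cball z0 r\<close>, so derivatives agree at its
   boundary too, and the support stays at a distance from the boundary of
   \<open>ball z0 r'\<close>.\<close>
 define s t where "s = r + (r' - r) / 3" and "t = r + 2 * (r' - r) / 3"
 have st: "r < s" "s < t" "t < r'" "0 < s" using r by (auto simp: s_def t_def field_simps)
 obtain h h' where h: "C1f UNIV h h'" "!!z. z \<in> cball z0 s ==> h z = 1" "!!z. z ~: ball z0 t ==> h z = 0"
  "!!z. 0 <= h z & h z <= 1"
  using ex_cutoff[of s t z0] st by metis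
 define E where "E z = (if z \<in> cball z0 t then h z * F z else 0)" for z
 have hF: "C1f (ball z0 r') (%z. h z * F z) (%z v. h z * F' z v + h' z v * F z)"
  by (rule C1f_mult[OF C1f_subset[OF h(1)] F]) auto
 have EW: "C1f (ball z0 r') E (%z v. h z * F' z v + h' z v * F z)"
  by (rule C1f_cong[OF hF]) (use h(3) in \<open>auto simp: E_def\<close>)
 have "cball z0 t \<subseteq> ball z0 r'" using st by auto
 from C1f_extend0[OF EW open_ball closed_cball this]
 have E: "C1f UNIV E (%z v. if z \<in> cball z0 t then h z * F' z v + h' z v * F z else 0)" (is "C1f UNIV E ?E'")
  by (simp add: E_def)
 show ?thesis
 proof (rule that[OF E])
  show "E z = F z & ?E' z = F' z" if "z \<in> cball z0 r" for z
  proof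
   have zs: "z \<in> ball z0 s" using that st by auto
   show "E z = F z" using zs st h(2)[of z] by (auto simp: E_def)
   have 1: "C1f (ball z0 s) E F'"
    by (rule C1f_cong[OF C1f_subset[OF F]]) (use st h(2) in \<open>auto simp: E_def\<close>)
   show "?E' z = F' z" by (rule C1f_unique[OF E 1 UNIV_I zs])
  qed
  show "E z = 0" if "z ~: ball z0 r'" for z using that st by (auto simp: E_def)
 qed
qed

lemma wd_swap: "wd a b z = - wd b a z" by (simp add: wd_def)

context compact_surface
begin

definition dpull :: "'a chart => 'a form1 => complex => complex => real" where
 "dpull c om z v = om c (cinv c z) v"

text \<open>In contrast to \<open>primitive_on\<close> this includes continuity of the derivative,
  which is what the formulas in the plane require.\<close>

definition prim :: "'a set => 'a form1 => ('a => real) => bool" where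
 "prim U om f \<longleftrightarrow> (\<forall>c\<in>A. C1f (crd c ` (cdom c Int U)) (%z. f (cinv c z)) (dpull c om))"

text \<open>The pointwise conditions of \<open>form1_on\<close>, linearity and the transformation
  law, separated from the regularity of the coefficients.\<close>

definition cov1 :: "'a set => 'a form1 => bool" where
 "cov1 U om \<longleftrightarrow> (\<forall>c\<in>A. \<forall>p\<in>cdom c Int U. linear (om c p)) &
  (\<forall>c\<in>A. \<forall>d\<in>A. \<forall>p\<in>cdom c Int cdom d Int U. \<forall>v. om c p v = om d p (deriv (transition c d) (crd c p) * v))"

lemma cov1_D: "cov1 U om ==> c \<in> A ==> d \<in> A ==> p \<in> cdom c ==> p \<in> cdom d ==> p \<in> U ==>
  om c p v = om d p (deriv (transition c d) (crd c p) * v)"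
 unfolding cov1_def by blast

lemma cov1_linear: "cov1 U om ==> c \<in> A ==> p \<in> cdom c ==> p \<in> U ==> linear (om c p)"
 unfolding cov1_def by blast

lemma cov1_subset: "cov1 U om ==> V \<subseteq> U ==> cov1 V om"
 unfolding cov1_def by blast

lemma prim_C1f: "prim U om f ==> c \<in> A ==> C1f (crd c ` (cdom c Int U)) (%z. f (cinv c z)) (dpull c om)"
 unfolding prim_def by blast

lemma dpull_crd [simp]: "c \<in> A ==> p \<in> cdom c ==> dpull c om (crd c p) v = om c p v"
 by (simp add: dpull_def)

lemma prim_primitive_on: assumes "prim U om f" shows "primitive_on A U om f"
 unfolding primitive_on_def
proof (intro ballI)
 fix c p assume c: "c \<in> A" and p: "p \<in> cdom c Int U"
 have "((%z. f (cinv c z)) has_derivative dpull c om (crd c p)) (at (crd c p))"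
  using C1f_D[OF prim_C1f[OF assms c]] p by blast
 moreover have "dpull c om (crd c p) = om c p" using c p by (simp add: fun_eq_iff)
 ultimately show "(f \<circ> cinv c has_derivative om c p) (at (crd c p))" by (simp add: o_def)
qed

lemma prim_subset: "prim U om f ==> V \<subseteq> U ==> prim V om f"
 unfolding prim_def by (meson C1f_subset Int_mono image_mono subset_refl)

lemma prim_Un: assumes "prim U om f" "prim V om f" "open U" "open V" shows "prim (U Un V) om f"
 unfolding prim_def
proof
 fix c assume c: "c \<in> A"
 have "crd c ` (cdom c Int (U Un V)) = crd c ` (cdom c Int U) Un crd c ` (cdom c Int V)" by blast
 then show "C1f (crd c ` (cdom c Int (U Un V))) (%z. f (cinv c z)) (dpull c om)"
  using C1f_Un[OF prim_C1f[OF assms(1) c] prim_C1f[OF assms(2) c]] open_crd_Int[OF c] assms(3,4) by simp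
qed

lemma prim_cong:
 assumes "prim U om f" "open U" "!!p. p \<in> U ==> f p = g p" "!!c p v. c \<in> A ==> p \<in> cdom c ==> p \<in> U ==> om c p v = \<eta> c p v"
 shows "prim U \<eta> g"
 unfolding prim_def
proof
 fix c assume c: "c \<in> A"
 show "C1f (crd c ` (cdom c Int U)) (%z. g (cinv c z)) (dpull c \<eta>)"
 proof (rule C1f_cong'[OF prim_C1f[OF assms(1) c] open_crd_Int[OF c assms(2)]])
  fix z assume "z \<in> crd c ` (cdom c Int U)"
  then obtain p where p: "p \<in> cdom c" "p \<in> U" "z = crd c p" by blast
  then show "f (cinv c z) = g (cinv c z)" "dpull c om z v = dpull c \<eta> z v" for v using assms(3,4) c by simp_all
 qed
qed

lemma prim_const: "prim U (%c p v. 0) (%p. k)"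
 using C1f_const unfolding prim_def dpull_def[abs_def] by blast

lemma prim_add: "prim U om f ==> prim U \<eta> g ==> prim U (%c p v. om c p v + \<eta> c p v) (%p. f p + g p)"
 unfolding prim_def dpull_def[abs_def] by (intro ballI C1f_add) blast+

lemma prim_diff: "prim U om f ==> prim U \<eta> g ==> prim U (%c p v. om c p v - \<eta> c p v) (%p. f p - g p)"
 unfolding prim_def dpull_def[abs_def] by (intro ballI C1f_diff) blast+

lemma prim_cmult: "prim U om f ==> prim U (%c p v. k * om c p v) (%p. k * f p)"
 unfolding prim_def dpull_def[abs_def] by (intro ballI C1f_cmult) blast+

lemma prim_mult: "prim U om f ==> prim U \<eta> g ==> prim U (%c p v. f p * \<eta> c p v + om c p v * g p) (%p. f p * g p)"
 unfolding prim_def dpull_def[abs_def]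
proof (rule ballI)
 fix c assume a: "\<forall>c\<in>A. C1f (crd c ` (cdom c Int U)) (%z. f (cinv c z)) (%z v. om c (cinv c z) v)"
  "\<forall>c\<in>A. C1f (crd c ` (cdom c Int U)) (%z. g (cinv c z)) (%z v. \<eta> c (cinv c z) v)" "c \<in> A"
 then show "C1f (crd c ` (cdom c Int U)) (%z. f (cinv c z) * g (cinv c z))
  (%z v. f (cinv c z) * \<eta> c (cinv c z) v + om c (cinv c z) v * g (cinv c z))" by (intro C1f_mult) blast+
qed

text \<open>In each chart the form is the derivative of the same function, so the transformation law
  is the chain rule.\<close>

lemma prim_cov1: assumes f: "prim U om f" and U: "open U" shows "cov1 U om"
 unfolding cov1_def
proof (intro conjI ballI allI)
 fix c p assume c: "c \<in> A" and p: "p \<in> cdom c Int U"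
 have "linear (dpull c om (crd c p))" using C1f_lin[OF prim_C1f[OF f c]] p by blast
 moreover have "dpull c om (crd c p) = om c p" using c p by (simp add: fun_eq_iff)
 ultimately show "linear (om c p)" by simp
next
 fix c d p v assume c: "c \<in> A" and d: "d \<in> A" and p: "p \<in> cdom c Int cdom d Int U"
 let ?V = "crd c ` (cdom c Int (cdom d Int U))" and ?T = "transition c d"
 have V: "open ?V" using open_crd_Int[OF c] open_cdom[OF d] U by blast
 have T: "?T holomorphic_on ?V" by (rule holomorphic_on_subset[OF transition_holomorphic[OF c d]]) auto
 have TV: "?T ` ?V \<subseteq> crd d ` (cdom d Int U)" using c by auto
 have 1: "C1f ?V (%z. f (cinv d (?T z))) (%z v. dpull d om (?T z) (deriv ?T z * v))"
  by (rule C1f_comp_holo[OF prim_C1f[OF f d] T V TV])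
 have 2: "C1f ?V (%z. f (cinv c z)) (%z v. dpull d om (?T z) (deriv ?T z * v))"
  by (rule C1f_cong[OF 1 V]) (use c d in auto)
 have "dpull c om (crd c p) = (%v. dpull d om (?T (crd c p)) (deriv ?T (crd c p) * v))"
  by (rule C1f_unique[OF prim_C1f[OF f c] 2]) (use p in auto)
 then have "dpull c om (crd c p) v = dpull d om (?T (crd c p)) (deriv ?T (crd c p) * v)" by simp
 then show "om c p v = om d p (deriv ?T (crd c p) * v)" using c d p by simp
qed

lemma prim_of_chart:
 assumes c: "c \<in> A" and U: "open U" "U \<subseteq> cdom c" and cov: "cov1 U om" and u: "C1f (crd c ` U) u (dpull c om)"
 shows "prim U om (%p. u (crd c p))"
 unfolding prim_def
proof
 fix d assume d: "d \<in> A"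
 let ?V = "crd d ` (cdom d Int U)" and ?T = "transition d c"
 have V: "open ?V" by (rule open_crd_Int[OF d U(1)])
 have T: "?T holomorphic_on ?V" by (rule holomorphic_on_subset[OF transition_holomorphic[OF d c]]) (use U in auto)
 have TV: "?T ` ?V \<subseteq> crd c ` U" using d by auto
 have 1: "C1f ?V (%z. u (?T z)) (%z v. dpull c om (?T z) (deriv ?T z * v))"
  by (rule C1f_comp_holo[OF u T V TV])
 show "C1f ?V (%z. u (crd c (cinv d z))) (dpull d om)"
 proof (rule C1f_cong'[OF 1 V])
  fix z assume "z \<in> ?V"
  then obtain p where p: "p \<in> cdom d" "p \<in> U" "z = crd d p" by blast
  then have pc: "p \<in> cdom c" using U by blast
  show "u (?T z) = u (crd c (cinv d z))" using p d by simp
  show "dpull c om (?T z) (deriv ?T z * v) = dpull d om z v" for v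
   using p pc c d cov1_D[OF cov d c p(1) pc p(2), of v] by simp
 qed
qed

text \<open>A form given in the chart \<open>c\<close>, moved to the other charts by the
  transformation law and set to 0 off the chart domain. In its uses \<open>N\<close> vanishes
  outside a compact part of the chart image, so the edge of the domain causes no
  discontinuity.\<close>

definition push :: "'a chart => (complex => complex => real) => 'a form1" where
 "push c N d p v = (if p \<in> cdom c then N (crd c p) (deriv (transition d c) (crd d p) * v) else 0)"

lemma push_cov1:
 assumes c: "c \<in> A" and l: "!!z. z \<in> crd c ` cdom c ==> linear (N z)"
 shows "cov1 UNIV (push c N)"
 unfolding cov1_def
proof (intro conjI ballI allI)
 fix d p assume "d \<in> A" "p \<in> cdom d Int UNIV"
 show "linear (push c N d p)"
 proof (cases "p \<in> cdom c")
  case True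
  then have N: "linear (N (crd c p))" using l by blast
  show ?thesis
   by (rule linearI) (use True N in \<open>simp_all add: push_def algebra_simps linear_add linear_cmul\<close>)
 qed (auto simp: push_def[abs_def] linear_iff)
next
 fix d e p v assume "d \<in> A" "e \<in> A" "p \<in> cdom d Int cdom e Int UNIV"
 then show "push c N d p v = push c N e p (deriv (transition d e) (crd d p) * v)"
  using transition_deriv_compose[of d e c p] c by (simp add: push_def mult.assoc)
qed

lemma dpull_push: "c \<in> A ==> z \<in> crd c ` cdom c ==> dpull c (push c N) z v = N z v"
 by (auto simp: dpull_def push_def transition_deriv_self)

definition ext0 :: "'a chart => (complex => real) => 'a => real" where
 "ext0 c u p = (if p \<in> cdom c then u (crd c p) else 0)"

text \<open>The image of \<open>K\<close> is compact, hence closed in the surface. Its complement,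
  where everything is 0, and the chart domain form an open cover.\<close>

lemma prim_ext0:
 assumes c: "c \<in> A" and K: "compact K" "K \<subseteq> crd c ` cdom c" and u: "C1f (crd c ` cdom c) u u'"
  and 0: "!!z. z \<in> crd c ` cdom c ==> z ~: K ==> u z = 0"
 shows "prim UNIV (push c u') (ext0 c u)"
proof -
 have "compact (cinv c ` K)"
  by (rule compact_continuous_image[OF continuous_on_subset[OF continuous_cinv[OF c] K(2)] K(1)])
 then have oK: "open (- cinv c ` K)" by (simp add: compact_imp_closed open_Compl)
 have cov: "cov1 UNIV (push c u')" using push_cov1[OF c] C1f_lin[OF u] by blast
 have "C1f (crd c ` cdom c) u (dpull c (push c u'))"
  by (rule C1f_cong'[OF u open_crd_cdom[OF c]]) (use dpull_push[OF c] in auto)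
 from prim_of_chart[OF c open_cdom[OF c] subset_refl cov1_subset[OF cov] this]
 have 1: "prim (cdom c) (push c u') (%p. u (crd c p))" by simp
 have 1: "prim (cdom c) (push c u') (ext0 c u)"
  by (rule prim_cong[OF 1 open_cdom[OF c]]) (auto simp: ext0_def)
 have C0: "C1f (crd c ` cdom c - K) u (%z v. 0)"
 proof (rule C1f_cong[OF C1f_const])
  show "open (crd c ` cdom c - K)" using open_crd_cdom[OF c] compact_imp_closed[OF K(1)] by (rule open_Diff)
 qed (simp add: 0)
 have u0: "u' z v = 0" if "z \<in> crd c ` cdom c" "z ~: K" for z v
 proof -
  have "u' z = (%v. 0)" by (rule C1f_unique[OF u C0 that(1)]) (use that in blast)
  then show ?thesis by simp
 qed
 have nK: "crd c p ~: K" if "p \<in> cdom c" "p ~: cinv c ` K" for p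
  using that c by (metis cinv_crd imageI)
 have 2: "prim (- cinv c ` K) (push c u') (ext0 c u)"
 proof (rule prim_cong[OF prim_const oK])
  show "0 = ext0 c u p" if "p \<in> - cinv c ` K" for p
   using 0[of "crd c p"] nK[of p] that by (simp add: ext0_def)
  show "0 = push c u' d p v" if "d \<in> A" "p \<in> cdom d" "p \<in> - cinv c ` K" for d p v
   using u0[of "crd c p"] nK[of p] that by (simp add: push_def)
 qed
 have "cdom c Un - cinv c ` K = UNIV" using K c cinv_in_cdom by blast
 then show ?thesis using prim_Un[OF 1 2 open_cdom[OF c] oK] by simp
qed

lemma pull_wedge: "pull c (wedge om \<eta>) z = wd (dpull c om) (dpull c \<eta>) z"
 by (simp add: pull_def wedge_def wd_def dpull_def)

lemma cov2_wedge:
 assumes w: "cov1 X om" and e: "cov1 X \<eta>" shows "cov2 X (wedge om \<eta>)"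
 unfolding cov2_def
proof (intro ballI)
 fix c d p assume c: "c \<in> A" and d: "d \<in> A" and p: "p \<in> cdom c Int cdom d Int X"
 define D where "D = deriv (transition c d) (crd c p)"
 have w1: "om c p v = Re (D * v) * om d p 1 + Im (D * v) * om d p \<i>" for v
 proof -
  have "om c p v = om d p (D * v)" using cov1_D[OF w c d, of p v] p by (simp add: D_def)
  also have "\<dots> = Re (D * v) * om d p 1 + Im (D * v) * om d p \<i>"
   by (rule linear_complex_real[OF cov1_linear[OF w d]]) (use p in auto)
  finally show ?thesis .
 qed
 have e1: "\<eta> c p v = Re (D * v) * \<eta> d p 1 + Im (D * v) * \<eta> d p \<i>" for v
 proof -
  have "\<eta> c p v = \<eta> d p (D * v)" using cov1_D[OF e c d, of p v] p by (simp add: D_def)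
  also have "\<dots> = Re (D * v) * \<eta> d p 1 + Im (D * v) * \<eta> d p \<i>"
   by (rule linear_complex_real[OF cov1_linear[OF e d]]) (use p in auto)
  finally show ?thesis .
 qed
 show "wedge om \<eta> c p = (cmod (deriv (transition c d) (crd c p)))\<^sup>2 * wedge om \<eta> d p"
  unfolding wedge_def w1 e1 D_def[symmetric] cmod_power2 by (simp add: algebra_simps power2_eq_square)
qed

text \<open>Closedness for forms whose coefficients are merely continuous: an exterior derivative
  need not exist, but local C^1 primitives do.\<close>

definition locex :: "'a set => 'a form1 => bool" where
 "locex U om \<longleftrightarrow> (\<forall>p\<in>U. \<exists>V f. open V & p \<in> V & prim V om f)"

lemma locexD: "locex U om ==> p \<in> U ==> \<exists>V f. open V & p \<in> V & prim V om f"
 unfolding locex_def by blast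

lemma prim_locex: "prim U om f ==> open U ==> locex U om"
 unfolding locex_def by blast

lemma locex_subset: "locex U om ==> V \<subseteq> U ==> locex V om"
 unfolding locex_def by blast

lemma locex_cov1: assumes "locex U om" shows "cov1 U om"
 unfolding cov1_def
proof (intro conjI ballI allI)
 fix c p assume "c \<in> A" "p \<in> cdom c Int U"
 then obtain V f where "open V" "p \<in> V" "prim V om f" using locexD[OF assms] by blast
 then show "linear (om c p)" using cov1_linear[OF prim_cov1] \<open>c \<in> A\<close> \<open>p \<in> cdom c Int U\<close> by blast
next
 fix c d p v assume "c \<in> A" "d \<in> A" "p \<in> cdom c Int cdom d Int U"
 then obtain V f where "open V" "p \<in> V" "prim V om f" using locexD[OF assms] by blast
 then show "om c p v = om d p (deriv (transition c d) (crd c p) * v)"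
  using cov1_D[OF prim_cov1] \<open>c \<in> A\<close> \<open>d \<in> A\<close> \<open>p \<in> cdom c Int cdom d Int U\<close> by blast
qed

lemma locex_add: assumes "locex U om" "locex U \<eta>" shows "locex U (%c p v. om c p v + \<eta> c p v)"
 unfolding locex_def
proof
 fix p assume p: "p \<in> U"
 obtain V f W g where "open V" "p \<in> V" "prim V om f" "open W" "p \<in> W" "prim W \<eta> g"
  using locexD[OF assms(1) p] locexD[OF assms(2) p] by blast
 then have "prim (V Int W) (%c p v. om c p v + \<eta> c p v) (%p. f p + g p)" "open (V Int W)" "p \<in> V Int W"
  by (auto intro!: prim_add intro: prim_subset)
 then show "\<exists>V f. open V & p \<in> V & prim V (%c p v. om c p v + \<eta> c p v) f" by blast
qed

lemma locex_cmult: assumes "locex U om" shows "locex U (%c p v. k * om c p v)"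
 unfolding locex_def
proof
 fix p assume "p \<in> U"
 then obtain V f where V: "open V" "p \<in> V" "prim V om f" using locexD[OF assms] by blast
 from prim_cmult[OF V(3), of k] V(1,2)
 show "\<exists>V f. open V & p \<in> V & prim V (%c p v. k * om c p v) f" by blast
qed

lemma locex_zero: "locex U (%c p v. 0)"
 by (rule locex_subset[OF prim_locex[OF prim_const[of UNIV 0] open_UNIV]]) simp

lemma locex_sum:
 assumes "finite I" "!!k. k \<in> I ==> locex U (om k)"
 shows "locex U (%c p v. \<Sum>k\<in>I. a k * om k c p v)"
 using assms
proof (induction I rule: finite_induct)
 case empty
 then show ?case using locex_zero by simp
next
 case (insert k I)
 then have "locex U (%c p v. a k * om k c p v + (\<Sum>k\<in>I. a k * om k c p v))"
  by (intro locex_add locex_cmult) auto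
 then show ?case using insert.hyps by simp
qed

lemma locex_continuous:
 assumes "locex U om" "c \<in> A" shows "continuous_on (crd c ` (cdom c Int U)) (%z. dpull c om z v)"
 unfolding continuous_on_def
proof
 fix z assume "z \<in> crd c ` (cdom c Int U)"
 then obtain p where p: "p \<in> cdom c" "p \<in> U" "z = crd c p" by blast
 obtain V f where V: "open V" "p \<in> V" "prim V om f" using locexD[OF assms(1) p(2)] by blast
 have "continuous_on (crd c ` (cdom c Int V)) (%z. dpull c om z v)"
  by (rule C1f_cont'[OF prim_C1f[OF V(3) assms(2)]])
 then have "isCont (%z. dpull c om z v) z"
  using continuous_on_eq_continuous_at[OF open_crd_Int[OF assms(2) V(1)]] p V by blast
 then show "((%z. dpull c om z v) \<longlongrightarrow> dpull c om z v) (at z within crd c ` (cdom c Int U))"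
  using continuous_at_imp_continuous_within continuous_within by blast
qed

lemma ex_cball:
 assumes "c \<in> A" "p \<in> cdom c" "open V" "p \<in> V"
 obtains r where "r > 0" "cball (crd c p) r \<subseteq> crd c ` (cdom c Int V)"
 using open_contains_cball[of "crd c ` (cdom c Int V)"] open_crd_Int[OF assms(1,3)] assms by blast

section \<open>Integrability of wedge products and Stokes' theorem\<close>

lemma integ_push:
 assumes c: "c \<in> A" and R: "cball z0 r \<subseteq> crd c ` cdom c"
  and l: "!!z. z \<in> crd c ` cdom c ==> linear (N z)" and 0: "!!z v. z ~: cball z0 r ==> N z v = 0"
  and w: "cov1 UNIV om" and E: "!!z. z \<in> cball z0 r ==> E' z = dpull c om z"
  and i: "integrable lborel (wd N E')"
 shows "intble UNIV (wedge (push c N) om)" "integ UNIV (wedge (push c N) om) = integral\<^sup>L lborel (wd N E')"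
proof -
 have c2: "cov2 (- {}) (wedge (push c N) om)" using cov2_wedge[OF push_cov1[OF c l] w] by simp
 have z: "wedge (push c N) om d p = 0" if "d \<in> A" "p \<in> cdom d - {}" "p ~: cinv c ` cball z0 r" for d p
 proof -
  have "push c N d p v = 0" for v
  proof (cases "p \<in> cdom c")
   case True
   have "crd c p ~: cball z0 r" using that(3) True c by (metis cinv_crd imageI)
   then show ?thesis by (simp add: push_def 0)
  qed (simp add: push_def)
  then show ?thesis by (simp add: wedge_def)
 qed
 have g0: "wd N E' z = 0" if "z ~: cball z0 r" for z using 0[OF that] by (simp add: wd_def)
 have g: "wd N E' z = pull c (wedge (push c N) om) z" if z: "z \<in> cball z0 r" for z
 proof -
  have "z \<in> crd c ` cdom c" using R z by blast
  then show ?thesis unfolding pull_wedge wd_def by (simp add: dpull_push[OF c] E[OF z])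
 qed
 show "intble UNIV (wedge (push c N) om)" "integ UNIV (wedge (push c N) om) = integral\<^sup>L lborel (wd N E')"
  using integ_chart_disc[OF c R finite.emptyI c2 z i g0 g] by simp_all
qed

text \<open>On the disc \<open>om\<close> is dF. With \<open>F\<close> cut off outside the support
  of \<open>u\<close> the claim becomes \<open>plane_stokes\<close> for two functions on the
  plane.\<close>

lemma stokes_chart:
 assumes c: "c \<in> A" and r: "0 < r" "r < r'" and R: "ball z0 r' \<subseteq> crd c ` cdom c"
  and w: "cov1 UNIV om" and F: "C1f (ball z0 r') F (dpull c om)"
  and u: "C1f (crd c ` cdom c) u u'" and 0: "!!z. z \<in> crd c ` cdom c ==> z ~: cball z0 r ==> u z = 0"
 shows "integ UNIV (wedge (push c u') om) = 0"
proof -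
 let ?W = "crd c ` cdom c"
 have cb: "cball z0 r \<subseteq> ?W" using r R by force
 define p where "p z = (if z \<in> cball z0 r then u z else 0)" for z
 define N where "N z v = (if z \<in> cball z0 r then u' z v else 0)" for z v
 have pW: "C1f ?W p u'" by (rule C1f_cong[OF u open_crd_cdom[OF c]]) (use 0 in \<open>auto simp: p_def\<close>)
 have p: "C1f UNIV p N"
  using C1f_extend0[OF pW open_crd_cdom[OF c] closed_cball cb] by (simp add: p_def N_def[abs_def])
 have uN: "u' z = N z" if "z \<in> ?W" for z using C1f_unique[OF pW p that UNIV_I] .
 obtain E E' where E: "C1f UNIV E E'" "!!z. z \<in> cball z0 r ==> E z = F z & E' z = dpull c om z"
  using cutoff_primitive[OF F r] by metis
 have p0: "p z = 0" if "z ~: cball 0 (cmod z0 + r)" for z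
 proof -
  have "z ~: cball z0 r" using that norm_triangle_ineq[of "z - z0" z0] by (auto simp: dist_norm norm_minus_commute)
  then show ?thesis by (simp add: p_def)
 qed
 note st = plane_stokes[OF E(1) p p0]
 have sw: "wd N E' = (%z. - wd E' N z)" by (rule ext, rule wd_swap)
 have i: "integrable lborel (wd N E')" "integral\<^sup>L lborel (wd N E') = 0"
  unfolding sw using st by simp_all
 have "integ UNIV (wedge (push c N) om) = 0"
  using integ_push(2)[OF c cb _ _ w _ i(1)] i(2) E(2) C1f_lin[OF p] by (simp add: N_def)
 moreover have "push c u' = push c N" using uN by (simp add: push_def fun_eq_iff)
 ultimately show ?thesis by simp
qed

text \<open>Growth of at most first order near every point, which is integrable in two dimensions.
  The condition covers simple poles, and with \<open>P\<close> empty it covers the regular closed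
  forms.\<close>

definition tame :: "'a set => 'a form1 => bool" where
 "tame P \<eta> \<longleftrightarrow> cov1 (- P) \<eta> & (\<forall>p. \<exists>c\<in>A. \<exists>r>0. \<exists>C. p \<in> cdom c & cball (crd c p) r \<subseteq> crd c ` cdom c &
  (\<forall>v. continuous_on (ball (crd c p) r - {crd c p}) (%z. dpull c \<eta> z v)) &
  (\<forall>z\<in>ball (crd c p) r - {crd c p}. \<bar>dpull c \<eta> z 1\<bar> <= C / cmod (z - crd c p) & \<bar>dpull c \<eta> z \<i>\<bar> <= C / cmod (z - crd c p)))"

lemma locex_bounded:
 assumes "locex UNIV om" "c \<in> A" "K \<subseteq> crd c ` cdom c" "compact K"
 obtains B where "B > 0" "!!z. z \<in> K ==> \<bar>dpull c om z v\<bar> <= B"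
proof -
 have "continuous_on K (%z. dpull c om z v)"
  by (rule continuous_on_subset[OF locex_continuous[OF assms(1,2)]]) (use assms(3) in simp)
 then have "bounded ((%z. dpull c om z v) ` K)" using assms(4) compact_continuous_image compact_imp_bounded by blast
 then obtain B where B: "B > 0" "!!y. y \<in> (%z. dpull c om z v) ` K ==> norm y <= B" unfolding bounded_pos by blast
 show ?thesis by (rule that[OF B(1)]) (use B(2) in force)
qed

lemma locex_tame:
 assumes w: "locex UNIV om" shows "tame {} om"
 unfolding tame_def
proof (intro conjI allI)
 show "cov1 (- {}) om" using locex_cov1[OF w] by simp
 fix p
 obtain c where c: "c \<in> A" "p \<in> cdom c" using chart_cover by blast
 obtain r where r: "r > 0" "cball (crd c p) r \<subseteq> crd c ` (cdom c Int UNIV)" using ex_cball[OF c open_UNIV UNIV_I] by blast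
 then have r': "cball (crd c p) r \<subseteq> crd c ` cdom c" by simp
 obtain B1 where B1: "B1 > 0" "!!z. z \<in> cball (crd c p) r ==> \<bar>dpull c om z 1\<bar> <= B1"
  using locex_bounded[OF w c(1) r' compact_cball, where v = 1] by blast
 obtain B2 where B2: "B2 > 0" "!!z. z \<in> cball (crd c p) r ==> \<bar>dpull c om z \<i>\<bar> <= B2"
  using locex_bounded[OF w c(1) r' compact_cball, where v = \<i>] by blast
 have bd: "x <= ((B1 + B2) * r) / cmod (z - crd c p)"
  if "z \<in> ball (crd c p) r - {crd c p}" "x <= B1 \<or> x <= B2" for x z
 proof -
  have "0 < cmod (z - crd c p)" "cmod (z - crd c p) < r" using that(1) by (auto simp: dist_norm norm_minus_commute)
  then have "(B1 + B2) * cmod (z - crd c p) <= (B1 + B2) * r" using B1 B2 by (intro mult_left_mono) auto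
  then have "B1 + B2 <= ((B1 + B2) * r) / cmod (z - crd c p)" using \<open>0 < cmod (z - crd c p)\<close> by (simp add: pos_le_divide_eq)
  then show ?thesis using that(2) B1 B2 by linarith
 qed
 show "\<exists>c\<in>A. \<exists>r>0. \<exists>C. p \<in> cdom c & cball (crd c p) r \<subseteq> crd c ` cdom c &
  (\<forall>v. continuous_on (ball (crd c p) r - {crd c p}) (%z. dpull c om z v)) &
  (\<forall>z\<in>ball (crd c p) r - {crd c p}. \<bar>dpull c om z 1\<bar> <= C / cmod (z - crd c p) & \<bar>dpull c om z \<i>\<bar> <= C / cmod (z - crd c p))"
 proof (rule bexI[OF _ c(1)], rule exI[of _ r], rule conjI[OF r(1)], rule exI[of _ "(B1 + B2) * r"], intro conjI allI ballI)
  have "ball (crd c p) r - {crd c p} \<subseteq> crd c ` (cdom c Int UNIV)" using r(2) ball_subset_cball by blast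
  then show "continuous_on (ball (crd c p) r - {crd c p}) (%z. dpull c om z v)" for v
   by (rule continuous_on_subset[OF locex_continuous[OF w c(1)]])
  fix z assume z: "z \<in> ball (crd c p) r - {crd c p}"
  then have zc: "z \<in> cball (crd c p) r" by auto
  show "\<bar>dpull c om z 1\<bar> <= (B1 + B2) * r / cmod (z - crd c p)" by (rule bd[OF z]) (use B1(2)[OF zc] in simp)
  show "\<bar>dpull c om z \<i>\<bar> <= (B1 + B2) * r / cmod (z - crd c p)" by (rule bd[OF z]) (use B2(2)[OF zc] in simp)
 qed (use r c in auto)
qed

text \<open>Near each point the coefficient of the product is at most a constant over the distance
  to that point, because the coefficients of \<open>om\<close> are continuous and hence bounded on a
  closed disc.\<close>

lemma intble_wedge:
 assumes P: "finite P" and t: "tame P \<eta>" and w: "locex UNIV om"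
 shows "intble (- P) (wedge \<eta> om)"
proof (rule intble_local[OF P])
 fix p
 have cov: "cov1 (- P) \<eta>" using t by (simp add: tame_def)
 obtain c r C where c: "c \<in> A" "p \<in> cdom c" and r: "r > 0" "cball (crd c p) r \<subseteq> crd c ` cdom c"
  and cont: "!!v. continuous_on (ball (crd c p) r - {crd c p}) (%z. dpull c \<eta> z v)"
  and C: "!!z. z \<in> ball (crd c p) r - {crd c p} ==> \<bar>dpull c \<eta> z 1\<bar> <= C / cmod (z - crd c p)"
   "!!z. z \<in> ball (crd c p) r - {crd c p} ==> \<bar>dpull c \<eta> z \<i>\<bar> <= C / cmod (z - crd c p)"
  using t unfolding tame_def by meson
 define z0 where "z0 = crd c p"
 obtain B1 where B1: "B1 > 0" "!!z. z \<in> cball z0 r ==> \<bar>dpull c om z 1\<bar> <= B1"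
  using locex_bounded[OF w c(1) r(2) compact_cball, where v = 1] unfolding z0_def by blast
 obtain B2 where B2: "B2 > 0" "!!z. z \<in> cball z0 r ==> \<bar>dpull c om z \<i>\<bar> <= B2"
  using locex_bounded[OF w c(1) r(2) compact_cball, where v = \<i>] unfolding z0_def by blast
 define U where "U = cinv c ` ball z0 r"
 have bsub: "ball z0 r \<subseteq> crd c ` cdom c" using r ball_subset_cball z0_def by blast
 have U: "open U" "U \<subseteq> cdom c" "crd c ` U = ball z0 r"
  unfolding U_def using open_cinv_image[OF c(1) open_ball bsub] bsub cinv_in_cdom[OF c(1)] crd_cinv_image[OF c(1) bsub] by auto
 have pU: "p \<in> U" using c r unfolding U_def z0_def by (metis cinv_crd centre_in_ball imageI)
 define X where "X = U - P - {p}"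
 have Xb: "X \<in> sets borel" unfolding X_def using U P by (auto intro!: borel_open open_Diff finite_imp_closed)
 have Xs: "X \<subseteq> cdom c" using U X_def by blast
 define Y where "Y = crd c ` X"
 have Yb: "Y \<in> sets borel" unfolding Y_def by (rule borel_crd_image[OF c(1) Xb Xs])
 have Ys: "Y \<subseteq> ball z0 r - {z0}"
 proof
  fix y assume "y \<in> Y"
  then obtain q where q: "q \<in> X" "y = crd c q" unfolding Y_def by blast
  then have "q \<in> cdom c" "q ~= p" "y \<in> crd c ` U" using Xs by (auto simp: X_def)
  then show "y \<in> ball z0 r - {z0}" using q U c unfolding z0_def by (metis Diff_iff cinv_crd singletonD)
 qed
 have c2: "cov2 X (wedge \<eta> om)"
  by (rule cov2_wedge[OF cov1_subset[OF cov] cov1_subset[OF locex_cov1[OF w]]]) (auto simp: X_def)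
 have cw: "continuous_on Y (%z. dpull c om z v)" for v
  by (rule continuous_on_subset[OF locex_continuous[OF w c(1)]]) (use Xs in \<open>auto simp: Y_def\<close>)
 have ce: "continuous_on Y (%z. dpull c \<eta> z v)" for v
  by (rule continuous_on_subset[OF cont]) (use Ys z0_def in simp)
 have eq: "pull c (wedge \<eta> om) = wd (dpull c \<eta>) (dpull c om)" by (rule ext, rule pull_wedge)
 have bd: "\<bar>wd (dpull c \<eta>) (dpull c om) z\<bar> <= C * (B1 + B2) / cmod (z - z0)" if z: "z \<in> Y" for z
 proof -
  have z': "z \<in> ball (crd c p) r - {crd c p}" "z \<in> cball z0 r" using Ys z z0_def by auto
  have "\<bar>wd (dpull c \<eta>) (dpull c om) z\<bar> <= \<bar>dpull c \<eta> z 1\<bar> * \<bar>dpull c om z \<i>\<bar> + \<bar>dpull c \<eta> z \<i>\<bar> * \<bar>dpull c om z 1\<bar>"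
   unfolding wd_def by (metis abs_mult abs_triangle_ineq4)
  also have "\<dots> <= (C / cmod (z - z0)) * B2 + (C / cmod (z - z0)) * B1"
   using C(1)[OF z'(1)] C(2)[OF z'(1)] B1(2)[OF z'(2)] B2(2)[OF z'(2)] unfolding z0_def[symmetric]
   by (intro add_mono mult_mono) (auto intro: order_trans[OF abs_ge_zero])
  finally show ?thesis by (simp add: algebra_simps add_divide_distrib)
 qed
 have "set_integrable lborel Y (wd (dpull c \<eta>) (dpull c om))"
  unfolding set_integrable_def
 proof (rule Bochner_Integration.integrable_bound[OF integrable_inverse_dist[of "C * (B1 + B2)" z0 r]])
  have cY: "continuous_on Y (wd (dpull c \<eta>) (dpull c om))"
   unfolding wd_def[abs_def] by (intro continuous_intros cw ce)
  show "(%z. indicat_real Y z *\<^sub>R wd (dpull c \<eta>) (dpull c om) z) \<in> borel_measurable lborel"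
   using borel_measurable_continuous_on_indicator[OF Yb cY] by simp
  show "AE z in lborel. norm (indicat_real Y z *\<^sub>R wd (dpull c \<eta>) (dpull c om) z)
    <= norm (C * (B1 + B2) * (indicat_real (ball z0 r) z / cmod (z - z0)))"
  proof (rule AE_I2)
   fix z
   show "norm (indicat_real Y z *\<^sub>R wd (dpull c \<eta>) (dpull c om) z) <= norm (C * (B1 + B2) * (indicat_real (ball z0 r) z / cmod (z - z0)))"
   proof (cases "z \<in> Y")
    case True
    then have "z \<in> ball z0 r" using Ys by blast
    moreover have "C * (B1 + B2) / cmod (z - z0) <= \<bar>C * (B1 + B2)\<bar> / cmod (z - z0)"
     by (intro divide_right_mono) auto
    ultimately show ?thesis using bd[OF True] True by simp
   qed simp
  qed
 qed
 then have "intble X (wedge \<eta> om)" using integ_chart(1)[OF c(1) Xs Xb c2] eq Y_def by simp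
 moreover have "U - P \<in> sets borel" using U P by (auto intro!: borel_open open_Diff finite_imp_closed)
 ultimately have "intble (U - P) (wedge \<eta> om)" using integ_null(1)[of "{p}" "U - P"] unfolding X_def by simp
 then show "\<exists>U. open U & p \<in> U & intble (U - P) (wedge \<eta> om)" using U pU by blast
qed

lemma intble_locex: "locex UNIV \<eta> ==> locex UNIV om ==> intble UNIV (wedge \<eta> om)"
 using intble_wedge[of "{}" \<eta> om] locex_tame by simp

lemma locex_disc:
 assumes w: "locex UNIV om"
 shows "\<exists>c\<in>A. \<exists>r>0. \<exists>F. p \<in> cdom c & cball (crd c p) r \<subseteq> crd c ` cdom c & C1f (ball (crd c p) r) F (dpull c om)"
proof -
 obtain c where c: "c \<in> A" "p \<in> cdom c" using chart_cover by blast
 obtain V f where V: "open V" "p \<in> V" "prim V om f" using locexD[OF w] by blast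
 obtain r where r: "r > 0" "cball (crd c p) r \<subseteq> crd c ` (cdom c Int V)" using ex_cball[OF c V(1,2)] by blast
 have "C1f (ball (crd c p) r) (%z. f (cinv c z)) (dpull c om)"
  by (rule C1f_subset[OF prim_C1f[OF V(3) c(1)]]) (use r(2) ball_subset_cball in blast)
 moreover have "cball (crd c p) r \<subseteq> crd c ` cdom c" using r(2) by blast
 ultimately show ?thesis using c r(1) by blast
qed

lemma prim_zero_form:
 assumes "prim U \<eta> f" "open U" "!!p. p \<in> U ==> f p = 0" "c \<in> A" "p \<in> cdom c" "p \<in> U"
 shows "\<eta> c p v = 0"
proof -
 have "prim U (%c p v. 0) f" by (rule prim_cong[OF prim_const[of U 0] assms(2)]) (use assms(3) in auto)
 then have "dpull c \<eta> (crd c p) = dpull c (%c p v. 0) (crd c p)"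
  using C1f_unique[OF prim_C1f[OF assms(1,4)] prim_C1f[OF _ assms(4)]] assms(5,6) by blast
 then have "dpull c \<eta> (crd c p) v = 0" by (simp add: dpull_def)
 then show ?thesis using assms(4,5) by simp
qed

text \<open>Induction over a finite cover by discs in which \<open>om\<close> has a primitive. The
  function splits into f b, supported in one disc, and f (1-b), which vanishes outside the remaining
  discs; in this way the partition of unity is never written down.\<close>

theorem stokes:
 assumes f: "prim UNIV \<eta> f" and w: "locex UNIV om"
 shows "integ UNIV (wedge \<eta> om) = 0"
proof -
 obtain c r F where cr: "!!p. c p \<in> A" "!!p. r p > 0" "!!p. p \<in> cdom (c p)"
  "!!p. cball (crd (c p) p) (r p) \<subseteq> crd (c p) ` cdom (c p)" "!!p. C1f (ball (crd (c p) p) (r p)) (F p) (dpull (c p) om)"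
  using locex_disc[OF w] by metis
 \<comment> \<open>A third of the radius for the cover: the cutoff \<open>h\<close> below is 1 on
   these discs and 0 beyond half of the radius, still inside the disc of the primitive.\<close>
 define D where "D p = cinv (c p) ` ball (crd (c p) p) (r p / 3)" for p
 have sub: "ball (crd (c p) p) (r p / 3) \<subseteq> crd (c p) ` cdom (c p)" for p
  using cr(4)[of p] cr(2)[of p] by (rule_tac subset_trans[OF _ cr(4)]) auto
 have D: "open (D p)" "p \<in> D p" for p
 proof -
  show "open (D p)" unfolding D_def by (rule open_cinv_image[OF cr(1) open_ball sub])
  have "crd (c p) p \<in> ball (crd (c p) p) (r p / 3)" using cr(2)[of p] by simp
  then show "p \<in> D p" unfolding D_def using cinv_crd[OF cr(1) cr(3)] by (metis imageI)
 qed
 obtain C where C: "finite C" "UNIV \<subseteq> (\<Union>p\<in>C. D p)"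
  using compactE_image[OF compact_UNIV, of UNIV D] D by (metis UNIV_I UN_I subsetI)
 \<comment> \<open>Generalised to functions that vanish outside the discs still to be treated; with
   no disc left the function and hence the form are 0.\<close>
 have "prim UNIV \<eta> f ==> (!!p. p ~: (\<Union>q\<in>C. D q) ==> f p = 0) ==> integ UNIV (wedge \<eta> om) = 0" for \<eta> f
  using C(1)
 proof (induction C arbitrary: \<eta> f rule: finite_induct)
  case empty
  have "\<eta> d p v = 0" if "d \<in> A" "p \<in> cdom d" for d p v
   by (rule prim_zero_form[OF empty(1) open_UNIV]) (use empty(2) that in auto)
  then have "integ UNIV (wedge \<eta> om) = integ UNIV (%c p. 0)"
   by (intro integ_cong) (simp add: wedge_def)
  then show ?case by (simp add: integ_itg itg_def[abs_def] pull_def)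
 next
  case (insert q C)
  define z0 R where "z0 = crd (c q) q" and "R = r q"
  have R: "R > 0" using cr(2) R_def by simp
  note cq = cr(1)[of q]
  have RW: "cball z0 R \<subseteq> crd (c q) ` cdom (c q)" using cr(4) z0_def R_def by simp
  have R3: "0 < R / 3" "R / 3 < R / 2" using R by auto
  obtain h h' where h: "C1f UNIV h h'" "!!z. z \<in> cball z0 (R / 3) ==> h z = 1" "!!z. z ~: ball z0 (R / 2) ==> h z = 0"
   "!!z. 0 <= h z & h z <= 1"
   using ex_cutoff[OF R3, of z0] by metis
  have KW: "cball z0 (R / 2) \<subseteq> crd (c q) ` cdom (c q)" using RW R by (rule_tac subset_trans[OF _ RW]) auto
  define b where "b = ext0 (c q) h"
  have hW: "C1f (crd (c q) ` cdom (c q)) h h'" by (rule C1f_subset[OF h(1)]) simp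
  have b: "prim UNIV (push (c q) h') b" unfolding b_def
   by (rule prim_ext0[OF cq compact_cball KW hW]) (use h(3) in force)
  define \<beta> where "\<beta> = (%d p v. f p * push (c q) h' d p v + \<eta> d p v * b p)"
  have \<beta>: "prim UNIV \<beta> (%p. f p * b p)" unfolding \<beta>_def by (rule prim_mult[OF insert.prems(1) b])
  define u where "u z = f (cinv (c q) z) * h z" for z
  define u' where "u' z v = f (cinv (c q) z) * h' z v + dpull (c q) \<eta> z v * h z" for z v
  have "C1f (crd (c q) ` cdom (c q)) (%z. f (cinv (c q) z)) (dpull (c q) \<eta>)"
   using prim_C1f[OF insert.prems(1) cq] by simp
  then have u: "C1f (crd (c q) ` cdom (c q)) u u'" unfolding u_def u'_def by (rule C1f_mult[OF _ hW])
  have \<beta>u: "\<beta> d p v = push (c q) u' d p v" if d: "d \<in> A" "p \<in> cdom d" for d p v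
  proof (cases "p \<in> cdom (c q)")
   case True
   have "\<eta> d p v = \<eta> (c q) p (deriv (transition d (c q)) (crd d p) * v)"
    by (rule cov1_D[OF prim_cov1[OF insert.prems(1) open_UNIV] d(1) cq d(2) True UNIV_I])
   then show ?thesis using True cq by (simp add: \<beta>_def push_def u'_def b_def ext0_def dpull_def)
  qed (simp add: \<beta>_def push_def b_def ext0_def)
  have "integ UNIV (wedge (push (c q) u') om) = 0"
  proof (rule stokes_chart[OF cq _ _ _ locex_cov1[OF w] _ u])
   show "C1f (ball z0 R) (F q) (dpull (c q) om)" using cr(5)[of q] z0_def R_def by simp
   show "0 < R / 2" "R / 2 < R" using R by auto
   show "ball z0 R \<subseteq> crd (c q) ` cdom (c q)" using RW ball_subset_cball by blast
   show "u z = 0" if "z ~: cball z0 (R / 2)" for z using h(3)[of z] that by (simp add: u_def)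
  qed
  moreover have "integ UNIV (wedge \<beta> om) = integ UNIV (wedge (push (c q) u') om)"
   by (rule integ_cong) (use \<beta>u in \<open>simp add: wedge_def\<close>)
  ultimately have 1: "integ UNIV (wedge \<beta> om) = 0" by simp
  define \<delta> where "\<delta> = (%d p v. \<eta> d p v - \<beta> d p v)"
  have \<delta>: "prim UNIV \<delta> (%p. f p - f p * b p)" unfolding \<delta>_def by (rule prim_diff[OF insert.prems(1) \<beta>])
  have 2: "integ UNIV (wedge \<delta> om) = 0"
  proof (rule insert.IH[OF \<delta>])
   fix p assume p: "p ~: (\<Union>q\<in>C. D q)"
   show "f p - f p * b p = 0"
   proof (cases "p \<in> D q")
    case True
    then obtain z where z: "z \<in> ball z0 (R / 3)" "p = cinv (c q) z" unfolding D_def z0_def R_def by blast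
    then have "z \<in> crd (c q) ` cdom (c q)" using sub[of q] z0_def R_def by blast
    then have "p \<in> cdom (c q)" "crd (c q) p = z" using z cq by auto
    then have "b p = 1" using h(2)[of z] z by (simp add: b_def ext0_def)
    then show ?thesis by simp
   next
    case False
    then show ?thesis using insert.prems(2)[of p] p by simp
   qed
  qed
  have l: "locex UNIV \<beta>" "locex UNIV \<delta>" using prim_locex \<beta> \<delta> by blast+
  have "integ UNIV (%c p. 1 * wedge \<beta> om c p + 1 * wedge \<delta> om c p) = 0"
   using integ_linear(2)[OF intble_locex[OF l(1) w] intble_locex[OF l(2) w], of 1 1] 1 2 by simp
  moreover have "(%c p. 1 * wedge \<beta> om c p + 1 * wedge \<delta> om c p) = wedge \<eta> om"
   by (simp add: wedge_def \<delta>_def fun_eq_iff algebra_simps)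
  ultimately show ?case by simp
 qed
 then show ?thesis using f C(2) by blast
qed

section \<open>Harmonic forms as real parts of holomorphic forms\<close>

definition hol :: "'a set => 'a form1 => bool" where
 "hol U om \<longleftrightarrow> cov1 U om & (\<forall>c\<in>A. \<exists>H. H holomorphic_on crd c ` (cdom c Int U) &
  (\<forall>z\<in>crd c ` (cdom c Int U). \<forall>v. dpull c om z v = Re (H z * v)))"

text \<open>For a form a dx + b dy put H = a - \<i> b. That the form and its Hodge dual are closed
  gives the Cauchy-Riemann equations for \<open>H\<close>.\<close>

lemma harmonic_hol:
 assumes U: "open U" and w: "harmonic_form A U om" shows "hol U om"
proof -
 have f1: "form1_on A U om" and ed: "!!c p. c \<in> A ==> p \<in> cdom c Int U ==> ext_deriv om c p = 0"
  and edh: "!!c p. c \<in> A ==> p \<in> cdom c Int U ==> ext_deriv (hodge om) c p = 0"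
  using w by (auto simp: harmonic_form_def closed_form_def)
 have cov: "cov1 U om" using f1 unfolding form1_on_def cov1_def by blast
 have "\<exists>H. H holomorphic_on crd c ` (cdom c Int U) & (\<forall>z\<in>crd c ` (cdom c Int U). \<forall>v. dpull c om z v = Re (H z * v))"
  if c: "c \<in> A" for c
 proof -
  let ?W = "crd c ` (cdom c Int U)"
  have W: "open ?W" by (rule open_crd_Int[OF c U])
  define a b where "a z = om c (cinv c z) 1" and "b z = om c (cinv c z) \<i>" for z
  have "C1_on ?W (%z. om c (cinv c z) v)" for v using f1 c unfolding form1_on_def by blast
  then have da: "a differentiable (at z)" and db: "b differentiable (at z)" if "z \<in> ?W" for z
   using that unfolding C1_on_def a_def[abs_def] b_def[abs_def] by blast+
  have lin: "linear (om c (cinv c z))" if "z \<in> ?W" for z using that c cov1_linear[OF cov c] by auto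
  define H where "H z = of_real (a z) - \<i> * of_real (b z)" for z
  have "H field_differentiable (at z)" if z: "z \<in> ?W" for z
  proof -
   obtain p where p: "p \<in> cdom c" "p \<in> U" "z = crd c p" using z by blast
   let ?a = "frechet_derivative a (at z)" and ?b = "frechet_derivative b (at z)"
   have Da: "(a has_derivative ?a) (at z)" and Db: "(b has_derivative ?b) (at z)"
    using da db z frechet_derivative_works by blast+
   have e1: "?b 1 = ?a \<i>" using ed[OF c, of p] p by (simp add: ext_deriv_def a_def[abs_def] b_def[abs_def])
   have ha: "hodge om c (cinv c w) \<i> = a w" and hb: "hodge om c (cinv c w) 1 = - b w" if "w \<in> ?W" for w
    using linear_neg[OF lin[OF that], of 1] by (simp_all add: hodge_def a_def b_def)
   have "((%w. hodge om c (cinv c w) \<i>) has_derivative ?a) (at z)"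
    by (rule has_derivative_transform_within_open[OF Da W z]) (simp add: ha)
   then have 1: "frechet_derivative (%w. hodge om c (cinv c w) \<i>) (at z) = ?a" using frechet_derivative_at by metis
   have "((%w. hodge om c (cinv c w) 1) has_derivative (%v. - ?b v)) (at z)"
    by (rule has_derivative_transform_within_open[OF has_derivative_minus[OF Db] W z]) (simp add: hb)
   then have 2: "frechet_derivative (%w. hodge om c (cinv c w) 1) (at z) = (%v. - ?b v)" using frechet_derivative_at by metis
   have e2: "?a 1 + ?b \<i> = 0" using edh[OF c, of p] p unfolding ext_deriv_def p(3)[symmetric] 1 2 by simp
   then have e2': "?b \<i> = - ?a 1" by linarith
   have la: "linear ?a" and lb: "linear ?b" using Da Db has_derivative_linear by blast+
   have dH: "(H has_derivative (%v. of_real (?a v) - \<i> * of_real (?b v))) (at z)"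
    unfolding H_def[abs_def] by (intro derivative_intros Da Db)
   have eqv: "of_real (?a v) - \<i> * of_real (?b v) = (of_real (?a 1) - \<i> * of_real (?b 1)) * v" for v
    using linear_complex_real[OF la, of v] linear_complex_real[OF lb, of v] e1 e2'
    by (simp add: complex_eq_iff algebra_simps)
   have "(%v. of_real (?a v) - \<i> * of_real (?b v)) = (*) (of_real (?a 1) - \<i> * of_real (?b 1))"
    by (rule ext) (rule eqv)
   with dH have "(H has_field_derivative (of_real (?a 1) - \<i> * of_real (?b 1))) (at z)"
    unfolding has_field_derivative_def by (rule back_subst[of "%f. (H has_derivative f) (at z)"])
   then show ?thesis by (auto simp: field_differentiable_def)
  qed
  then have "H holomorphic_on ?W" unfolding holomorphic_on_def using field_differentiable_at_within by blast
  moreover have "dpull c om z v = Re (H z * v)" if "z \<in> ?W" for z v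
  proof -
   have "dpull c om z v = Re v * om c (cinv c z) 1 + Im v * om c (cinv c z) \<i>"
    unfolding dpull_def by (rule linear_complex_real[OF lin[OF that]])
   then show ?thesis by (simp add: H_def a_def b_def mult.commute)
  qed
  ultimately show ?thesis by blast
 qed
 then show ?thesis using cov unfolding hol_def by blast
qed

text \<open>\<star> Re (H dz) = Re (-\<i> H dz).\<close>

lemma hol_hodge: assumes "hol U om" shows "hol U (hodge om)"
 unfolding hol_def
proof (intro conjI ballI)
 have cov: "cov1 U om" using assms by (simp add: hol_def)
 have "linear (hodge om c p)" if "c \<in> A" "p \<in> cdom c Int U" for c p
 proof -
  have l: "linear (om c p)" using cov1_linear[OF cov] that by blast
  show ?thesis by (rule linearI) (simp_all add: hodge_def distrib_left linear_add[OF l] linear_cmul[OF l])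
 qed
 moreover have "hodge om c p v = hodge om d p (deriv (transition c d) (crd c p) * v)"
  if "c \<in> A" "d \<in> A" "p \<in> cdom c Int cdom d Int U" for c d p v
  using cov1_D[OF cov that(1,2), of p "\<i> * v"] that(3) by (simp add: hodge_def mult.left_commute)
 ultimately show "cov1 U (hodge om)" unfolding cov1_def by blast
 fix c assume c: "c \<in> A"
 then obtain H where H: "H holomorphic_on crd c ` (cdom c Int U)"
  "!!z v. z \<in> crd c ` (cdom c Int U) ==> dpull c om z v = Re (H z * v)"
  using assms unfolding hol_def by blast
 show "\<exists>H. H holomorphic_on crd c ` (cdom c Int U) & (\<forall>z\<in>crd c ` (cdom c Int U). \<forall>v. dpull c (hodge om) z v = Re (H z * v))"
 proof (intro exI[of _ "%z. - \<i> * H z"] conjI ballI allI)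
  show "(%z. - \<i> * H z) holomorphic_on crd c ` (cdom c Int U)" by (intro holomorphic_intros H(1))
  fix z v assume "z \<in> crd c ` (cdom c Int U)"
  from H(2)[OF this, of "\<i> * v"] show "dpull c (hodge om) z v = Re (- \<i> * H z * v)"
   by (simp add: dpull_def hodge_def algebra_simps)
 qed
qed

lemma hol_disc_primitive:
 assumes "hol U om" "c \<in> A" "ball z0 r \<subseteq> crd c ` (cdom c Int U)"
 obtains F where "C1f (ball z0 r) F (dpull c om)"
proof -
 obtain H where H: "H holomorphic_on crd c ` (cdom c Int U)"
  "!!z v. z \<in> crd c ` (cdom c Int U) ==> dpull c om z v = Re (H z * v)"
  using assms(1,2) unfolding hol_def by blast
 obtain G where G: "!!x. x \<in> ball z0 r ==> (G has_field_derivative H x) (at x)"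
  using holomorphic_convex_primitive'[OF convex_ball open_ball holomorphic_on_subset[OF H(1) assms(3)]]
   at_within_open[OF _ open_ball] by metis
 have Gh: "G holomorphic_on ball z0 r" using G holomorphic_on_open[OF open_ball] by blast
 have "C1f (ball z0 r) (%z. Re (G z)) (dpull c om)"
 proof (rule C1f_cong'[OF C1f_Re[OF Gh open_ball] open_ball])
  fix z v assume "z \<in> ball z0 r"
  then show "Re (deriv G z * v) = dpull c om z v" using G[of z] H(2)[of z v] assms(3) by (auto dest!: DERIV_imp_deriv)
 qed simp
 then show ?thesis by (rule that)
qed

lemma hol_locex: assumes "hol U om" "open U" shows "locex U om"
 unfolding locex_def
proof
 fix p assume p: "p \<in> U"
 obtain c where c: "c \<in> A" "p \<in> cdom c" using chart_cover by blast
 obtain r where r: "r > 0" "cball (crd c p) r \<subseteq> crd c ` (cdom c Int U)" using ex_cball[OF c assms(2) p] by blast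
 have b: "ball (crd c p) r \<subseteq> crd c ` (cdom c Int U)" using r(2) ball_subset_cball by blast
 then have b': "ball (crd c p) r \<subseteq> crd c ` cdom c" by blast
 obtain F where F: "C1f (ball (crd c p) r) F (dpull c om)" using hol_disc_primitive[OF assms(1) c(1) b] .
 let ?V = "cinv c ` ball (crd c p) r"
 have V: "open ?V" by (rule open_cinv_image[OF c(1) open_ball b'])
 have VU: "?V \<subseteq> cdom c" "?V \<subseteq> U" using b c(1) by auto
 have "cov1 U om" using assms(1) by (simp add: hol_def)
 then have "prim ?V om (%p. F (crd c p))"
  by (rule prim_of_chart[OF c(1) V VU(1) cov1_subset[OF _ VU(2)]]) (use F crd_cinv_image[OF c(1) b'] in simp)
 moreover have "p \<in> ?V" using c r(1) by (metis cinv_crd centre_in_ball imageI)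
 ultimately show "\<exists>V f. open V & p \<in> V & prim V om f" using V by blast
qed

end

section \<open>Integrals along curves\<close>

context compact_surface
begin

text \<open>\<open>primitive_along\<close> for a general parameter space: the line for curves, the
  unit interval for paths, a rectangle for singular 2-simplices.\<close>

definition lft :: "'a form1 => 'b::topological_space set => ('b => 'a) => ('b => real) => bool" where
 "lft om K h F \<longleftrightarrow> (\<forall>x\<in>K. \<exists>V f. open V & h x \<in> V & primitive_on A V om f &
   (\<forall>\<^sub>F y in nhds x. y \<in> K --> F y = f (h y)))"

lemma lft_UNIV: "lft om UNIV \<gamma> F \<longleftrightarrow> primitive_along A om \<gamma> F"
 by (simp add: lft_def primitive_along_def)

lemma lftD:
 assumes "lft om K h F" "x \<in> K"
 obtains V f where "open V" "h x \<in> V" "primitive_on A V om f" "\<forall>\<^sub>F y in nhds x. y \<in> K --> F y = f (h y)"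
 using assms unfolding lft_def by blast

lemma primitive_on_subset: "primitive_on A V om f ==> W \<subseteq> V ==> primitive_on A W om f"
 unfolding primitive_on_def by blast

lemma primitive_locally_unique:
 assumes f: "primitive_on A V om f" and g: "primitive_on A V om g" and V: "open V" "p \<in> V"
 obtains N where "open N" "p \<in> N" "N \<subseteq> V" "!!q. q \<in> N ==> f q - g q = f p - g p"
proof -
 obtain c where c: "c \<in> A" "p \<in> cdom c" using chart_cover by blast
 obtain r where r: "r > 0" "cball (crd c p) r \<subseteq> crd c ` (cdom c Int V)" using ex_cball[OF c V] by blast
 let ?B = "ball (crd c p) r"
 have B: "?B \<subseteq> crd c ` (cdom c Int V)" using r(2) ball_subset_cball by blast
 then have B': "?B \<subseteq> crd c ` cdom c" by blast
 define u where "u z = f (cinv c z) - g (cinv c z)" for z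
 have du: "(u has_derivative (%v. 0)) (at z within ?B)" if z: "z \<in> ?B" for z
 proof -
  obtain q where q: "q \<in> cdom c Int V" "z = crd c q" using B z by blast
  have "(f \<circ> cinv c has_derivative om c q) (at z)" "(g \<circ> cinv c has_derivative om c q) (at z)"
   using f g c(1) q unfolding primitive_on_def by blast+
  then have "((%z. (f \<circ> cinv c) z - (g \<circ> cinv c) z) has_derivative (%v. om c q v - om c q v)) (at z)"
   by (rule has_derivative_diff)
  then have "(u has_derivative (%v. 0)) (at z)" unfolding u_def[abs_def] by simp
  then show ?thesis by (rule has_derivative_at_withinI)
 qed
 have const: "u z = u (crd c p)" if "z \<in> ?B" for z
  by (rule has_derivative_zero_unique[OF convex_ball du that]) (use r in auto)
 show ?thesis
 proof (rule that)
  show "open (cinv c ` ?B)" by (rule open_cinv_image[OF c(1) open_ball B'])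
  show "p \<in> cinv c ` ?B" using c r(1) by (metis cinv_crd centre_in_ball imageI)
  show "cinv c ` ?B \<subseteq> V" using B c(1) by auto
  show "f q - g q = f p - g p" if q: "q \<in> cinv c ` ?B" for q
  proof -
   obtain z where z: "z \<in> ?B" "q = cinv c z" using q by blast
   then show ?thesis using const[OF z(1)] c by (simp add: u_def)
  qed
 qed
qed

lemma eventually_in_nhd:
 assumes "continuous_on K h" "x \<in> K" "open N" "h x \<in> N"
 shows "\<forall>\<^sub>F y in nhds x. y \<in> K --> h y \<in> N"
proof -
 obtain T where T: "open T" "T Int K = h -` N Int K" using assms(1,3) unfolding continuous_on_open_invariant by metis
 then have "x \<in> T" "!!y. y \<in> T ==> y \<in> K ==> h y \<in> N" using assms(2,4) by blast+
 then show ?thesis using T(1) unfolding eventually_nhds by blast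
qed

lemma lft_local_diff:
 assumes h: "continuous_on K h" and F: "lft om K h F" and G: "lft om K h G" and x: "x \<in> K"
 shows "\<forall>\<^sub>F y in nhds x. y \<in> K --> F y - G y = F x - G x"
proof -
 obtain V f where V: "open V" "h x \<in> V" "primitive_on A V om f" "\<forall>\<^sub>F y in nhds x. y \<in> K --> F y = f (h y)"
  using lftD[OF F x] .
 obtain W g where W: "open W" "h x \<in> W" "primitive_on A W om g" "\<forall>\<^sub>F y in nhds x. y \<in> K --> G y = g (h y)"
  using lftD[OF G x] .
 have f: "primitive_on A (V Int W) om f" and g: "primitive_on A (V Int W) om g"
  using primitive_on_subset V(3) W(3) by blast+
 obtain N where N: "open N" "h x \<in> N" "!!q. q \<in> N ==> f q - g q = f (h x) - g (h x)"
  using primitive_locally_unique[OF f g, of "h x"] V W by (metis IntI open_Int)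
 have Fx: "F x = f (h x)" "G x = g (h x)" using eventually_nhds_x_imp_x[OF V(4)] eventually_nhds_x_imp_x[OF W(4)] x by auto
 from V(4) W(4) eventually_in_nhd[OF h x N(1,2)] show ?thesis
  by eventually_elim (use N(3) Fx in auto)
qed

text \<open>The difference of two lifts is locally constant, because two primitives of one form
  differ by a constant near each point.\<close>

lemma lft_unique:
 assumes h: "continuous_on K h" and K: "connected K" and F: "lft om K h F" and G: "lft om K h G"
  and xy: "x \<in> K" "y \<in> K"
 shows "F y - F x = G y - G x"
proof -
 have "F x - G x = F y - G y"
 proof (rule connected_local_const[OF K xy, of "%x. F x - G x"], intro ballI)
  fix a assume "a \<in> K"
  have "\<forall>\<^sub>F b in nhds a. b ~= a --> b \<in> K --> F a - G a = F b - G b"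
   using lft_local_diff[OF h F G \<open>a \<in> K\<close>] by (rule eventually_mono) simp
  then show "\<forall>\<^sub>F b in at a within K. F a - G a = F b - G b"
   unfolding eventually_at_filter .
 qed
 then show ?thesis by linarith
qed

lemma lft_subset: "lft om K h F ==> L \<subseteq> K ==> lft om L h F"
 unfolding lft_def
proof (intro ballI)
 fix x assume a: "\<forall>x\<in>K. \<exists>V f. open V & h x \<in> V & primitive_on A V om f & (\<forall>\<^sub>F y in nhds x. y \<in> K --> F y = f (h y))"
  "L \<subseteq> K" "x \<in> L"
 then obtain V f where V: "open V" "h x \<in> V" "primitive_on A V om f" "\<forall>\<^sub>F y in nhds x. y \<in> K --> F y = f (h y)" by blast
 from V(4) have "\<forall>\<^sub>F y in nhds x. y \<in> L --> F y = f (h y)" by eventually_elim (use a(2) in blast)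
 then show "\<exists>V f. open V & h x \<in> V & primitive_on A V om f & (\<forall>\<^sub>F y in nhds x. y \<in> L --> F y = f (h y))" using V by blast
qed

lemma lft_compose:
 assumes g: "continuous_on K' g" "g ` K' \<subseteq> K" and F: "lft om K h F"
 shows "lft om K' (%x. h (g x)) (%x. F (g x))"
 unfolding lft_def
proof
 fix x assume x: "x \<in> K'"
 then have gx: "g x \<in> K" using g(2) by blast
 obtain V f where V: "open V" "h (g x) \<in> V" "primitive_on A V om f" "\<forall>\<^sub>F y in nhds (g x). y \<in> K --> F y = f (h y)"
  using lftD[OF F gx] .
 obtain T where T: "open T" "g x \<in> T" "!!y. y \<in> T ==> y \<in> K ==> F y = f (h y)"
  using V(4) unfolding eventually_nhds by blast
 have "\<forall>\<^sub>F y in nhds x. y \<in> K' --> F (g y) = f (h (g y))"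
  using eventually_in_nhd[OF g(1) x T(1,2)] by eventually_elim (use T(3) g(2) in blast)
 then show "\<exists>V f. open V & h (g x) \<in> V & primitive_on A V om f & (\<forall>\<^sub>F y in nhds x. y \<in> K' --> F (g y) = f (h (g y)))"
  using V by blast
qed

lemma lft_cong:
 assumes "lft om K h F" "!!x. x \<in> K ==> h x = h' x" "!!x. x \<in> K ==> F x = F' x"
 shows "lft om K h' F'"
 unfolding lft_def
proof
 fix x assume x: "x \<in> K"
 obtain V f where V: "open V" "h x \<in> V" "primitive_on A V om f" "\<forall>\<^sub>F y in nhds x. y \<in> K --> F y = f (h y)"
  using lftD[OF assms(1) x] .
 from V(4) have "\<forall>\<^sub>F y in nhds x. y \<in> K --> F' y = f (h' y)" by eventually_elim (use assms in auto)
 then show "\<exists>V f. open V & h' x \<in> V & primitive_on A V om f & (\<forall>\<^sub>F y in nhds x. y \<in> K --> F' y = f (h' y))"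
  using V assms(2)[OF x] by auto
qed

lemma lft_add:
 assumes "lft om K h F" "lft \<eta> K h G"
 shows "lft (%c p v. om c p v + \<eta> c p v) K h (%x. F x + G x)"
 unfolding lft_def
proof
 fix x assume x: "x \<in> K"
 obtain V f where V: "open V" "h x \<in> V" "primitive_on A V om f" "\<forall>\<^sub>F y in nhds x. y \<in> K --> F y = f (h y)"
  using lftD[OF assms(1) x] .
 obtain W g where W: "open W" "h x \<in> W" "primitive_on A W \<eta> g" "\<forall>\<^sub>F y in nhds x. y \<in> K --> G y = g (h y)"
  using lftD[OF assms(2) x] .
 have "primitive_on A (V Int W) (%c p v. om c p v + \<eta> c p v) (%p. f p + g p)"
  unfolding primitive_on_def
 proof (intro ballI)
  fix c p assume "c \<in> A" "p \<in> cdom c Int (V Int W)"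
  then have "(f \<circ> cinv c has_derivative om c p) (at (crd c p))" "(g \<circ> cinv c has_derivative \<eta> c p) (at (crd c p))"
   using V(3) W(3) unfolding primitive_on_def by blast+
  from has_derivative_add[OF this] show "((%p. f p + g p) \<circ> cinv c has_derivative (%v. om c p v + \<eta> c p v)) (at (crd c p))"
   by (simp add: o_def)
 qed
 moreover from V(4) W(4) have "\<forall>\<^sub>F y in nhds x. y \<in> K --> F y + G y = f (h y) + g (h y)" by eventually_elim simp
 moreover have "open (V Int W)" "h x \<in> V Int W" using V W by auto
 ultimately show "\<exists>V f. open V & h x \<in> V & primitive_on A V (%c p v. om c p v + \<eta> c p v) f &
  (\<forall>\<^sub>F y in nhds x. y \<in> K --> F y + G y = f (h y))"
  by (intro exI[of _ "V Int W"] exI[of _ "%p. f p + g p"]) blast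
qed

lemma lft_cmult:
 assumes "lft om K h F" shows "lft (%c p v. k * om c p v) K h (%x. k * F x)"
 unfolding lft_def
proof
 fix x assume x: "x \<in> K"
 obtain V f where V: "open V" "h x \<in> V" "primitive_on A V om f" "\<forall>\<^sub>F y in nhds x. y \<in> K --> F y = f (h y)"
  using lftD[OF assms(1) x] .
 have "primitive_on A V (%c p v. k * om c p v) (%p. k * f p)"
  unfolding primitive_on_def
 proof (intro ballI)
  fix c p assume "c \<in> A" "p \<in> cdom c Int V"
  then have "(f \<circ> cinv c has_derivative om c p) (at (crd c p))" using V(3) unfolding primitive_on_def by blast
  from has_derivative_mult_right[OF this, of k] show "((%p. k * f p) \<circ> cinv c has_derivative (%v. k * om c p v)) (at (crd c p))"
   by (simp add: o_def)
 qed
 moreover from V(4) have "\<forall>\<^sub>F y in nhds x. y \<in> K --> k * F y = k * f (h y)" by eventually_elim simp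
 ultimately show "\<exists>V f. open V & h x \<in> V & primitive_on A V (%c p v. k * om c p v) f &
  (\<forall>\<^sub>F y in nhds x. y \<in> K --> k * F y = f (h y))"
  using V(1,2) by (intro exI[of _ V] exI[of _ "%p. k * f p"]) blast
qed

lemma lft_primitive: "primitive_on A V om f ==> open V ==> h ` K \<subseteq> V ==> lft om K h (%x. f (h x))"
 unfolding lft_def by (intro ballI exI[of _ V] exI[of _ f]) auto

lemma lft_zero:
 assumes "open V" "h ` K \<subseteq> V" "!!c p v. c \<in> A ==> p \<in> cdom c ==> p \<in> V ==> om c p v = 0"
 shows "lft om K h (%x. 0)"
proof -
 have "prim V om (%p. 0)" by (rule prim_cong[OF prim_const[of V 0] assms(1)]) (use assms(3) in auto)
 then have "lft om K h (%x. (%p. 0) (h x))" by (intro lft_primitive[OF prim_primitive_on assms(1,2)])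
 then show ?thesis by simp
qed

lemma lft_sum:
 assumes "finite I" "!!k. k \<in> I ==> lft (om k) K h (F k)"
 shows "lft (%c p v. \<Sum>k\<in>I. a k * om k c p v) K h (%x. \<Sum>k\<in>I. a k * F k x)"
 using assms
proof (induction I rule: finite_induct)
 case empty
 show ?case using lft_zero[OF open_UNIV, of h K "%c p v. 0"] by simp
next
 case (insert k I)
 then have "lft (%c p v. a k * om k c p v + (\<Sum>k\<in>I. a k * om k c p v)) K h (%x. a k * F k x + (\<Sum>k\<in>I. a k * F k x))"
  by (intro lft_add lft_cmult) auto
 then show ?case using insert.hyps by simp
qed

text \<open>On the connected overlap the lifts differ by one constant, which is added to
  \<open>G\<close>. Since both sets are closed, a point that lies in only one of them has a
  neighbourhood missing the other.\<close>

lemma lft_glue: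
 assumes h: "continuous_on (K Un L) h" and K: "closed K" and L: "closed L" and KL: "connected (K Int L)"
  and F: "lft om K h F" and G: "lft om L h G"
 shows "\<exists>H. lft om (K Un L) h H"
proof -
 have hK: "continuous_on (K Int L) h" by (rule continuous_on_subset[OF h]) auto
 obtain k where k: "!!x. x \<in> K Int L ==> F x = G x + k"
 proof (cases "K Int L = {}")
  case False
  then obtain a where a: "a \<in> K Int L" by blast
  have "F x - F a = G x - G a" if "x \<in> K Int L" for x
   by (rule lft_unique[OF hK KL lft_subset[OF F] lft_subset[OF G] a that]) auto
  then show ?thesis by (intro that[of "F a - G a"]) (simp add: algebra_simps)
 qed (use that in blast)
 define H where "H x = (if x \<in> K then F x else G x + k)" for x
 have HL: "H x = G x + k" if "x \<in> L" for x using that k by (auto simp: H_def)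
 have "lft om (K Un L) h H"
  unfolding lft_def
 proof
  fix x assume x: "x \<in> K Un L"
  show "\<exists>V f. open V & h x \<in> V & primitive_on A V om f & (\<forall>\<^sub>F y in nhds x. y \<in> K Un L --> H y = f (h y))"
  proof (cases "x \<in> K")
   case xK: True
   obtain V f where V: "open V" "h x \<in> V" "primitive_on A V om f" "\<forall>\<^sub>F y in nhds x. y \<in> K --> F y = f (h y)"
    using lftD[OF F xK] .
   show ?thesis
   proof (cases "x \<in> L")
    case xL: True
    obtain W g where W: "open W" "h x \<in> W" "primitive_on A W om g" "\<forall>\<^sub>F y in nhds x. y \<in> L --> G y = g (h y)"
     using lftD[OF G xL] .
    have f: "primitive_on A (V Int W) om f" and g: "primitive_on A (V Int W) om g"
     using primitive_on_subset V(3) W(3) by blast+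
    obtain N where N: "open N" "h x \<in> N" "!!q. q \<in> N ==> f q - g q = f (h x) - g (h x)"
     using primitive_locally_unique[OF f g, of "h x"] V W by (metis IntI open_Int)
    have Fx: "F x = f (h x)" "G x = g (h x)"
     using eventually_nhds_x_imp_x[OF V(4)] eventually_nhds_x_imp_x[OF W(4)] xK xL by auto
    then have kk: "f q - g q = k" if "q \<in> N" for q using N(3)[OF that] k[of x] xK xL by auto
    from V(4) W(4) eventually_in_nhd[OF h x N(1,2)]
    have "\<forall>\<^sub>F y in nhds x. y \<in> K Un L --> H y = f (h y)"
    proof eventually_elim
     case (elim y)
     show ?case
     proof
      assume y: "y \<in> K Un L"
      then have "f (h y) - g (h y) = k" using elim kk by blast
      then show "H y = f (h y)" using elim y by (auto simp: H_def)
     qed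
    qed
    then show ?thesis using V by blast
   next
    case False
    have "\<forall>\<^sub>F y in nhds x. y \<in> - L" using L False by (intro eventually_nhds_in_open) auto
    with V(4) have "\<forall>\<^sub>F y in nhds x. y \<in> K Un L --> H y = f (h y)" by eventually_elim (auto simp: H_def)
    then show ?thesis using V by blast
   qed
  next
   case False
   then have xL: "x \<in> L" using x by blast
   have "lft om L h (%x. G x + k)"
    unfolding lft_def
   proof
    fix x assume "x \<in> L"
    obtain W g where W: "open W" "h x \<in> W" "primitive_on A W om g" "\<forall>\<^sub>F y in nhds x. y \<in> L --> G y = g (h y)"
     using lftD[OF G \<open>x \<in> L\<close>] .
    have "primitive_on A W om (%p. g p + k)" unfolding primitive_on_def
    proof (intro ballI)
     fix c p assume "c \<in> A" "p \<in> cdom c Int W"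
     then have "(g \<circ> cinv c has_derivative om c p) (at (crd c p))" using W(3) unfolding primitive_on_def by blast
     from has_derivative_add[OF this has_derivative_const[of k]]
     show "((%p. g p + k) \<circ> cinv c has_derivative om c p) (at (crd c p))" by (simp add: o_def)
    qed
    moreover from W(4) have "\<forall>\<^sub>F y in nhds x. y \<in> L --> G y + k = g (h y) + k" by eventually_elim simp
    ultimately show "\<exists>V f. open V & h x \<in> V & primitive_on A V om f & (\<forall>\<^sub>F y in nhds x. y \<in> L --> G y + k = f (h y))"
     using W(1,2) by (intro exI[of _ W] exI[of _ "%p. g p + k"]) blast
   qed
   then obtain W g where W: "open W" "h x \<in> W" "primitive_on A W om g" "\<forall>\<^sub>F y in nhds x. y \<in> L --> G y + k = g (h y)"
    using lftD[OF _ xL] by blast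
   have "\<forall>\<^sub>F y in nhds x. y \<in> - K" using K False by (intro eventually_nhds_in_open) auto
   with W(4) have "\<forall>\<^sub>F y in nhds x. y \<in> K Un L --> H y = g (h y)" by eventually_elim (auto simp: H_def)
   then show ?thesis using W by blast
  qed
 qed
 then show ?thesis by blast
qed

text \<open>Every point has a small box with a lift by local exactness. Bisection of
  \<open>{c..d}\<close> glues such boxes to a strip of positive width around a vertical segment, and
  bisection of \<open>{a..b}\<close> glues the strips.\<close>

lemma lft_exists_box:
 fixes h :: "real \<times> real => 'a"
 assumes w: "locex U om" and h: "continuous_on ({a..b} \<times> {c..d}) h" "h ` ({a..b} \<times> {c..d}) \<subseteq> U" and ab: "a <= b" and cd: "c <= d"
 shows "\<exists>F. lft om ({a..b} \<times> {c..d}) h F"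
proof -
 let ?Q = "{a..b} \<times> {c..d}"
 define P where "P X \<longleftrightarrow> (\<exists>F. lft om X h F)" for X
 have sub: "P X" if "P Y" "X \<subseteq> Y" for X Y using that lft_subset unfolding P_def by blast
 have glue: "P (X Un Y)" if "P X" "P Y" "closed X" "closed Y" "convex (X Int Y)" "X Un Y \<subseteq> ?Q" for X Y
  using that lft_glue[OF continuous_on_subset[OF h(1) that(6)] that(3,4) convex_connected[OF that(5)]] unfolding P_def by blast
 have loc: "\<exists>e>0. P (({x - e..x + e} Int {a..b}) \<times> ({y - e..y + e} Int {c..d}))"
  if xy: "x \<in> {a..b}" "y \<in> {c..d}" for x y
 proof -
  have q: "(x, y) \<in> ?Q" using xy by simp
  then have "h (x, y) \<in> U" using h(2) by blast
  then obtain V f where V: "open V" "h (x, y) \<in> V" "prim V om f" using locexD[OF w] by blast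
  obtain T where T: "open T" "(x, y) \<in> T" "!!z. z \<in> T ==> z \<in> ?Q ==> h z \<in> V"
   using eventually_in_nhd[OF h(1) q V(1,2)] unfolding eventually_nhds by blast
  obtain R S where RS: "open R" "open S" "(x, y) \<in> R \<times> S" "R \<times> S \<subseteq> T" using open_prod_elim[OF T(1,2)] .
  obtain e1 where e1: "e1 > 0" "cball x e1 \<subseteq> R" using open_contains_cball RS by (metis mem_Sigma_iff)
  obtain e2 where e2: "e2 > 0" "cball y e2 \<subseteq> S" using open_contains_cball RS by (metis mem_Sigma_iff)
  define e where "e = min e1 e2"
  have e: "e > 0" using e1 e2 by (simp add: e_def)
  have "{x - e..x + e} \<subseteq> cball x e1" "{y - e..y + e} \<subseteq> cball y e2" by (auto simp: e_def cball_eq_atLeastAtMost)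
  then have "{x - e..x + e} \<subseteq> R" "{y - e..y + e} \<subseteq> S" using e1(2) e2(2) by blast+
  then have "(({x - e..x + e} Int {a..b}) \<times> ({y - e..y + e} Int {c..d})) \<subseteq> T Int ?Q" using RS(4) by blast
  then have "h ` (({x - e..x + e} Int {a..b}) \<times> ({y - e..y + e} Int {c..d})) \<subseteq> V" using T(3) by blast
  then have "P (({x - e..x + e} Int {a..b}) \<times> ({y - e..y + e} Int {c..d}))"
   unfolding P_def using lft_primitive[OF prim_primitive_on[OF V(3)] V(1)] by blast
  then show ?thesis using e by blast
 qed
 have col: "\<exists>e>0. P (({x - e..x + e} Int {a..b}) \<times> {c..d})" if x: "x \<in> {a..b}" for x
 proof -
  have "c <= c --> d <= d --> (\<exists>e>0. P (({x - e..x + e} Int {a..b}) \<times> {c..d}))"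
  proof (rule Bolzano[where P = "%p q. c <= p --> q <= d --> (\<exists>e>0. P (({x - e..x + e} Int {a..b}) \<times> {p..q}))", OF cd])
   fix p q r assume trans: "c <= p --> q <= d --> (\<exists>e>0. P (({x - e..x + e} Int {a..b}) \<times> {p..q}))"
    "c <= q --> r <= d --> (\<exists>e>0. P (({x - e..x + e} Int {a..b}) \<times> {q..r}))" "p <= q" "q <= r"
   show "c <= p --> r <= d --> (\<exists>e>0. P (({x - e..x + e} Int {a..b}) \<times> {p..r}))"
   proof (intro impI)
    assume le: "c <= p" "r <= d"
    then obtain e1 e2 where e: "e1 > 0" "P (({x - e1..x + e1} Int {a..b}) \<times> {p..q})" "e2 > 0" "P (({x - e2..x + e2} Int {a..b}) \<times> {q..r})"
     using trans by (meson order_trans)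
    let ?e = "min e1 e2"
    let ?X = "{x - ?e..x + ?e} Int {a..b}"
    have X: "?X \<subseteq> {x - e1..x + e1} Int {a..b}" "?X \<subseteq> {x - e2..x + e2} Int {a..b}" by auto
    have 1: "P (?X \<times> {p..q})" "P (?X \<times> {q..r})"
     by (rule sub[OF e(2) Sigma_mono[OF X(1) subset_refl]], rule sub[OF e(4) Sigma_mono[OF X(2) subset_refl]])
    have pq: "{p..q} Un {q..r} = {p..r}" "{p..q} Int {q..r} = {q}" using trans(3,4) by auto
    have 2: "?X \<times> {p..q} Un ?X \<times> {q..r} = ?X \<times> {p..r}" unfolding pq(1)[symmetric] by blast
    have "?X \<times> {p..q} Int ?X \<times> {q..r} = ?X \<times> {q}" unfolding pq(2)[symmetric] by blast
    then have 3: "convex (?X \<times> {p..q} Int ?X \<times> {q..r})" by (simp add: convex_Times convex_Int)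
    have 4: "?X \<times> {p..q} Un ?X \<times> {q..r} \<subseteq> {a..b} \<times> {c..d}" unfolding 2 using le by auto
    have "P (?X \<times> {p..q} Un ?X \<times> {q..r})"
     by (rule glue[OF 1 _ _ 3 4]) (intro closed_Times closed_Int closed_atLeastAtMost)+
    then show "\<exists>e>0. P (({x - e..x + e} Int {a..b}) \<times> {p..r})" unfolding 2 using e by (intro exI[of _ ?e]) auto
   qed
  next
   fix y assume local: "c <= y" "y <= d"
   then obtain e where e: "e > 0" "P (({x - e..x + e} Int {a..b}) \<times> ({y - e..y + e} Int {c..d}))" using loc[OF x, of y] by auto
   show "\<exists>e>0. \<forall>p q. p <= y & y <= q & q - p < e --> c <= p --> q <= d --> (\<exists>e>0. P (({x - e..x + e} Int {a..b}) \<times> {p..q}))"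
   proof (rule exI[of _ e], intro conjI e(1) allI impI)
    fix p q assume "p <= y & y <= q & q - p < e" "c <= p" "q <= d"
    then have "P (({x - e..x + e} Int {a..b}) \<times> {p..q})" by (intro sub[OF e(2)]) auto
    then show "\<exists>e>0. P (({x - e..x + e} Int {a..b}) \<times> {p..q})" using e(1) by blast
   qed
  qed
  then show ?thesis by simp
 qed
 have "a <= a --> b <= b --> P ({a..b} \<times> {c..d})"
 proof (rule Bolzano[where P = "%p q. a <= p --> q <= b --> P ({p..q} \<times> {c..d})", OF ab])
  fix p q r assume trans: "a <= p --> q <= b --> P ({p..q} \<times> {c..d})"
   "a <= q --> r <= b --> P ({q..r} \<times> {c..d})" "p <= q" "q <= r"
  show "a <= p --> r <= b --> P ({p..r} \<times> {c..d})"
  proof (intro impI)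
   assume le: "a <= p" "r <= b"
   then have 1: "P ({p..q} \<times> {c..d})" "P ({q..r} \<times> {c..d})" using trans by auto
   have pq: "{p..q} Un {q..r} = {p..r}" "{p..q} Int {q..r} = {q}" using trans(3,4) by auto
   have 2: "{p..q} \<times> {c..d} Un {q..r} \<times> {c..d} = {p..r} \<times> {c..d}" unfolding pq(1)[symmetric] by blast
   have "{p..q} \<times> {c..d} Int {q..r} \<times> {c..d} = {q} \<times> {c..d}" unfolding pq(2)[symmetric] by blast
   then have 3: "convex ({p..q} \<times> {c..d} Int {q..r} \<times> {c..d})" by (simp add: convex_Times)
   have 4: "{p..q} \<times> {c..d} Un {q..r} \<times> {c..d} \<subseteq> {a..b} \<times> {c..d}" unfolding 2 using le by auto
   have "P ({p..q} \<times> {c..d} Un {q..r} \<times> {c..d})"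
    by (rule glue[OF 1 _ _ 3 4]) (intro closed_Times closed_atLeastAtMost)+
   then show "P ({p..r} \<times> {c..d})" unfolding 2 .
  qed
 next
  fix x assume "a <= x" "x <= b"
  then obtain e where e: "e > 0" "P (({x - e..x + e} Int {a..b}) \<times> {c..d})" using col[of x] by auto
  show "\<exists>e>0. \<forall>p q. p <= x & x <= q & q - p < e --> a <= p --> q <= b --> P ({p..q} \<times> {c..d})"
  proof (rule exI[of _ e], intro conjI e(1) allI impI)
   fix p q assume "p <= x & x <= q & q - p < e" "a <= p" "q <= b"
   then show "P ({p..q} \<times> {c..d})" by (intro sub[OF e(2)]) auto
  qed
 qed
 then show ?thesis unfolding P_def by simp
qed

text \<open>An interval is treated as a rectangle of height 0.\<close>

lemma lft_exists_path:
 fixes g :: "real => 'a"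
 assumes w: "locex U om" and g: "continuous_on {a..b} g" "g ` {a..b} \<subseteq> U" and ab: "a <= b"
 shows "\<exists>F. lft om {a..b} g F"
proof -
 have "continuous_on ({a..b} \<times> {0..0::real}) (%x. g (fst x))"
  by (rule continuous_on_compose2[OF g(1) continuous_on_fst[OF continuous_on_id]]) auto
 moreover have "(%x. g (fst x)) ` ({a..b} \<times> {0..0::real}) \<subseteq> U" using g(2) by auto
 ultimately obtain F where F: "lft om ({a..b} \<times> {0..0::real}) (%x. g (fst x)) F"
  using lft_exists_box[OF w _ _ ab, where h = "%x. g (fst x)" and c = 0 and d = 0] by auto
 have "lft om {a..b} (%x. g (fst (x, 0::real))) (%x. F (x, 0))"
  by (rule lft_compose[OF _ _ F, where g = "%x. (x, 0)"]) (auto intro!: continuous_intros)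
 then show ?thesis by auto
qed

text \<open>Lifts on the intervals [-n, n] are compatible once they are normalised to vanish at
  0.\<close>

lemma lft_exists_line:
 fixes \<gamma> :: "real => 'a"
 assumes w: "locex U om" and g: "continuous_on UNIV \<gamma>" "range \<gamma> \<subseteq> U"
 shows "\<exists>F. lft om UNIV \<gamma> F"
proof -
 have gc: "continuous_on X \<gamma>" for X using g(1) continuous_on_subset by blast
 have ex: "\<exists>F. lft om {- real n..real n} \<gamma> F" for n
 proof (rule lft_exists_path[OF w gc])
  show "\<gamma> ` {- real n..real n} \<subseteq> U" using g(2) by blast
 qed simp
 define G where "G n = (SOME F. lft om {- real n..real n} \<gamma> F)" for n
 have G: "lft om {- real n..real n} \<gamma> (G n)" for n unfolding G_def using ex by (rule someI_ex)
 \<comment> \<open>Strictly above the absolute value, so that the interval contains a neighbourhood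
   of the point.\<close>
 define N where "N x = nat \<lceil>\<bar>x\<bar>\<rceil> + 1" for x :: real
 have N: "\<bar>x\<bar> < real (N x)" for x unfolding N_def by linarith
 define F where "F x = G (N x) x - G (N x) 0" for x
 have eq: "F y = G n y - G n 0" if "\<bar>y\<bar> <= real n" for y n
 proof -
  define m where "m = min n (N y)"
  have y: "y \<in> {- real m..real m}" "0 \<in> {- real m..real m}" using that N[of y] by (auto simp: m_def min_def)
  have "G (N y) y - G (N y) 0 = G n y - G n 0"
   by (rule lft_unique[OF gc _ lft_subset[OF G] lft_subset[OF G] y(2,1)]) (auto simp: m_def)
  then show ?thesis by (simp add: F_def)
 qed
 have "lft om UNIV \<gamma> F"
  unfolding lft_def
 proof
  fix x :: real
  define n where "n = N x"
  have "x \<in> {- real n..real n}" using N[of x] by (auto simp: n_def)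
  then obtain V f where V: "open V" "\<gamma> x \<in> V" "primitive_on A V om f"
   "\<forall>\<^sub>F y in nhds x. y \<in> {- real n..real n} --> G n y = f (\<gamma> y)"
   by (rule lftD[OF G])
  have "x \<in> {- real n<..<real n}" using N[of x] by (auto simp: n_def abs_less_iff)
  then have "\<forall>\<^sub>F y in nhds x. y \<in> {- real n<..<real n}" by (intro eventually_nhds_in_open) auto
  with V(4) have ev: "\<forall>\<^sub>F y in nhds x. F y = f (\<gamma> y) - G n 0"
  proof eventually_elim
   case (elim y)
   then have "\<bar>y\<bar> <= real n" by auto
   then show ?case using eq[of y n] elim by auto
  qed
  have "primitive_on A V om (%p. f p - G n 0)" unfolding primitive_on_def
  proof (intro ballI)
   fix c p assume "c \<in> A" "p \<in> cdom c Int V"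
   then have "(f \<circ> cinv c has_derivative om c p) (at (crd c p))" using V(3) unfolding primitive_on_def by blast
   from has_derivative_diff[OF this has_derivative_const[of "G n 0"]]
   show "((%p. f p - G n 0) \<circ> cinv c has_derivative om c p) (at (crd c p))" by (simp add: o_def)
  qed
  then show "\<exists>V f. open V & \<gamma> x \<in> V & primitive_on A V om f & (\<forall>\<^sub>F y in nhds x. y \<in> UNIV --> F y = f (\<gamma> y))"
   using V(1,2) ev by (intro exI[of _ V] exI[of _ "%p. f p - G n 0"]) auto
 qed
 then show ?thesis by blast
qed

lemma closed_curve_integral_eq:
 assumes g: "continuous_on UNIV \<gamma>" and F: "lft om UNIV \<gamma> F"
 shows "closed_curve_integral A om \<gamma> = F 1 - F 0"
 unfolding closed_curve_integral_def
proof (rule the_equality)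
 show "\<exists>F'. primitive_along A om \<gamma> F' & F 1 - F 0 = F' 1 - F' 0" using F unfolding lft_UNIV by blast
 fix I assume "\<exists>F'. primitive_along A om \<gamma> F' & I = F' 1 - F' 0"
 then obtain F' where "lft om UNIV \<gamma> F'" "I = F' 1 - F' 0" unfolding lft_UNIV by blast
 then show "I = F 1 - F 0" using lft_unique[OF g convex_connected[OF convex_UNIV] F, of F' 0 1] by simp
qed

lemma line_integral_eq:
 assumes g: "continuous_on UNIV \<gamma>" and F: "lft om UNIV \<gamma> F" "(F \<longlongrightarrow> l) at_bot" "(F \<longlongrightarrow> m) at_top"
 shows "line_integral A om \<gamma> = m - l"
 unfolding line_integral_def
proof (rule the_equality)
 show "\<exists>F l' m'. primitive_along A om \<gamma> F & (F \<longlongrightarrow> l') at_bot & (F \<longlongrightarrow> m') at_top & m - l = m' - l'"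
  using F unfolding lft_UNIV by blast
 fix I assume "\<exists>F l' m'. primitive_along A om \<gamma> F & (F \<longlongrightarrow> l') at_bot & (F \<longlongrightarrow> m') at_top & I = m' - l'"
 then obtain G l' m' where G: "lft om UNIV \<gamma> G" "(G \<longlongrightarrow> l') at_bot" "(G \<longlongrightarrow> m') at_top" "I = m' - l'" unfolding lft_UNIV by blast
 have "G x = F x + (G 0 - F 0)" for x using lft_unique[OF g convex_connected[OF convex_UNIV] F(1) G(1), of 0 x] by simp
 then have "G = (%x. F x + (G 0 - F 0))" by blast
 then have "(G \<longlongrightarrow> l + (G 0 - F 0)) at_bot" "(G \<longlongrightarrow> m + (G 0 - F 0)) at_top"
  using tendsto_add[OF F(2) tendsto_const] tendsto_add[OF F(3) tendsto_const] by metis+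
 then have "l' = l + (G 0 - F 0)" "m' = m + (G 0 - F 0)"
  using G(2,3) tendsto_unique[OF trivial_limit_at_bot_linorder] tendsto_unique[OF trivial_limit_at_top_linorder] by blast+
 then show "I = m - l" using G(4) by simp
qed

end

section \<open>Exactness and homology\<close>

definition edge :: "real => nat => real" where
 "edge t = (%i. if i = 0 then 1 - t else if i = 1 then t else 0)"

text \<open>The square is mapped onto the standard triangle, and the side with first coordinate 0 is
  collapsed to vertex 0. Lifts are available on rectangles, hence this parametrisation.\<close>

definition triangle :: "real \<times> real => nat => real" where
 "triangle x = (%i. if i = 0 then 1 - fst x else if i = 1 then fst x * (1 - snd x) else if i = 2 then fst x * snd x else 0)"

lemma edge_in: "t \<in> {0..1} ==> edge t \<in> standard_simplex 1"
 by (auto simp: standard_simplex_def edge_def)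

lemma triangle_in: "x \<in> {0..1} \<times> {0..1} ==> triangle x \<in> standard_simplex 2"
proof -
 assume "x \<in> {0..1} \<times> {0..1}"
 then have x: "0 <= fst x" "fst x <= 1" "0 <= snd x" "snd x <= 1" by auto
 have "fst x * (1 - snd x) <= 1 * 1" "fst x * snd x <= 1 * 1" using x by (intro mult_mono; simp)+
 moreover have "fst x * snd x <= fst x * 1" using x by (intro mult_left_mono) auto
 ultimately have "fst x * (1 - snd x) <= 1" "fst x * snd x <= 1" "fst x * snd x <= fst x" by simp_all
 then show ?thesis using x by (auto simp: standard_simplex_def triangle_def numeral_2_eq_2 algebra_simps)
qed

lemma singular_simplex_continuous:
 fixes m :: "'b::topological_space => nat => real" and \<sigma> :: "(nat => real) => 'a::topological_space"
 assumes s: "singular_simplex p euclidean \<sigma>" and m: "!!x. x \<in> K ==> m x \<in> standard_simplex p"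
  and c: "!!i. continuous_on K (%x. m x i)"
 shows "continuous_on K (%x. \<sigma> (m x))"
proof -
 have "continuous_map (top_of_set K) (powertop_real UNIV) m"
  unfolding continuous_map_componentwise_UNIV using c by (simp add: continuous_map_iff_continuous)
 then have "continuous_map (top_of_set K) (subtopology (powertop_real UNIV) (standard_simplex p)) m"
  unfolding continuous_map_in_subtopology using m by (auto simp: Pi_iff)
 moreover have "continuous_map (subtopology (powertop_real UNIV) (standard_simplex p)) euclidean \<sigma>"
  using s by (simp add: singular_simplex_def)
 ultimately have "continuous_map (top_of_set K) euclidean (\<sigma> \<circ> m)" by (rule continuous_map_compose)
 then show ?thesis by (simp add: continuous_map_iff_continuous o_def)
qed

text \<open>Coordinate 1 runs from 0 to 1 along the standard edge. Singular simplices are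
  extensional functions, which is the reason for \<open>restrict\<close>.\<close>

definition path_simplex :: "(real => 'a) => (nat => real) => 'a" where
 "path_simplex g = restrict (%x. g (x 1)) (standard_simplex 1)"

definition point_simplex :: "'a => (nat => real) => 'a" where
 "point_simplex p = restrict (%x. p) (standard_simplex 0)"

lemma path_simplex:
 fixes g :: "real => 'a::topological_space"
 assumes "continuous_on {0..1} g" shows "singular_simplex 1 euclidean (path_simplex g)"
proof -
 let ?S = "subtopology (powertop_real UNIV) (standard_simplex 1)"
 have "continuous_map (powertop_real UNIV) euclideanreal (%x. x (1::nat))"
  by (rule continuous_map_product_projection) simp
 then have "continuous_map ?S euclideanreal (%x. x 1)" by (rule continuous_map_from_subtopology)
 moreover have "(%x. x 1) \<in> topspace ?S \<rightarrow> {0..1::real}" by (auto simp: standard_simplex_def)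
 ultimately have "continuous_map ?S (top_of_set {0..1}) (%x. x 1)" unfolding continuous_map_in_subtopology by blast
 moreover have "continuous_map (top_of_set {0..1}) euclidean g" using assms by (simp add: continuous_map_iff_continuous)
 ultimately have "continuous_map ?S euclidean (g \<circ> (%x. x 1))" by (rule continuous_map_compose)
 then have "continuous_map ?S euclidean (path_simplex g)"
  by (rule continuous_map_eq) (auto simp: path_simplex_def)
 then show ?thesis by (simp add: singular_simplex_def path_simplex_def)
qed

lemma path_simplex_edge: "t \<in> {0..1} ==> path_simplex g (edge t) = g t"
 using edge_in[of t] by (simp add: path_simplex_def edge_def)

lemma boundary_path_simplex:
 "chain_boundary 1 (frag_of (path_simplex g)) = frag_of (point_simplex (g 1)) - frag_of (point_simplex (g 0))"
proof -
 have x: "x 0 = 1" if "x \<in> standard_simplex 0" for x :: "nat => real" using that by (simp add: standard_simplex_def)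
 have i: "simplical_face k x \<in> standard_simplex 1" if "k <= 1" "x \<in> standard_simplex 0" for k x
  using simplical_face_in_standard_simplex[of 1 k x] that by simp
 have f: "singular_face 1 k (path_simplex g) = point_simplex (g a)"
  if "k <= 1" "!!x. x \<in> standard_simplex 0 ==> simplical_face k x 1 = a" for k a
 proof (rule ext)
  fix y
  show "singular_face 1 k (path_simplex g) y = point_simplex (g a) y"
   using i[OF that(1), of y] that(2)[of y]
   by (cases "y \<in> standard_simplex 0") (simp_all add: singular_face_def point_simplex_def path_simplex_def)
 qed
 have "singular_face 1 0 (path_simplex g) = point_simplex (g 1)"
  by (rule f) (simp_all add: simplical_face_def x)
 moreover have "singular_face 1 1 (path_simplex g) = point_simplex (g 0)"
  by (rule f) (simp_all add: simplical_face_def)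
 ultimately show ?thesis by (simp add: chain_boundary_of)
qed

context compact_surface
begin

section \<open>Integrals of closed forms over singular chains\<close>

definition pint :: "'a form1 => (real => 'a) => real" where
 "pint om g = (THE I. \<exists>F. lft om {0..1} g F & I = F 1 - F 0)"

lemma pint_eq:
 assumes g: "continuous_on {0..1} g" and F: "lft om {0..1} g F"
 shows "pint om g = F 1 - F 0"
 unfolding pint_def
proof (rule the_equality)
 show "\<exists>F'. lft om {0..1} g F' & F 1 - F 0 = F' 1 - F' 0" using F by blast
 fix I assume "\<exists>F'. lft om {0..1} g F' & I = F' 1 - F' 0"
 then obtain F' where F': "lft om {0..1} g F'" "I = F' 1 - F' 0" by blast
 then show "I = F 1 - F 0" using lft_unique[OF g _ F F'(1), of 0 1] by simp
qed

definition sint :: "'a form1 => ((nat => real) => 'a) => real" where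
 "sint om \<sigma> = pint om (%t. \<sigma> (edge t))"

lemma triangle_continuous: "continuous_on K (%x. triangle x i)"
 by (cases "i = 0"; cases "i = 1"; cases "i = 2") (auto simp: triangle_def intro!: continuous_intros)

lemma sint_path:
 assumes g: "continuous_on {0..1} g" and F: "lft om {0..1} g F"
 shows "sint om (path_simplex g) = F 1 - F 0"
 unfolding sint_def
proof (rule pint_eq)
 show "continuous_on {0..1} (%t. path_simplex g (edge t))"
  using g by (rule continuous_on_eq) (simp add: path_simplex_edge)
 show "lft om {0..1} (%t. path_simplex g (edge t)) F"
  by (rule lft_cong[OF F]) (simp_all add: path_simplex_edge)
qed

definition cint :: "'a form1 => 'a chain => real" where
 "cint om c = (\<Sum>\<sigma>\<in>Poly_Mapping.keys c. of_int (Poly_Mapping.lookup c \<sigma>) * sint om \<sigma>)"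

lemma cint_superset:
 assumes "finite S" "Poly_Mapping.keys c \<subseteq> S"
 shows "cint om c = (\<Sum>\<sigma>\<in>S. of_int (Poly_Mapping.lookup c \<sigma>) * sint om \<sigma>)"
 unfolding cint_def by (rule sum.mono_neutral_left) (use assms in \<open>auto simp: in_keys_iff\<close>)

lemma cint_diff: "cint om (a - b) = cint om a - cint om b"
proof -
 let ?S = "Poly_Mapping.keys a Un Poly_Mapping.keys b"
 have "cint om (a - b) = (\<Sum>\<sigma>\<in>?S. of_int (Poly_Mapping.lookup (a - b) \<sigma>) * sint om \<sigma>)"
  by (rule cint_superset) (use keys_diff[of a b] in auto)
 also have "\<dots> = (\<Sum>\<sigma>\<in>?S. of_int (Poly_Mapping.lookup a \<sigma>) * sint om \<sigma>) - (\<Sum>\<sigma>\<in>?S. of_int (Poly_Mapping.lookup b \<sigma>) * sint om \<sigma>)"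
  unfolding sum_subtractf[symmetric] by (rule sum.cong) (auto simp: lookup_minus algebra_simps)
 also have "\<dots> = cint om a - cint om b"
  using cint_superset[of ?S a om] cint_superset[of ?S b om] by simp
 finally show ?thesis .
qed

lemma cint_zero [simp]: "cint om 0 = 0" by (simp add: cint_def)

lemma cint_minus: "cint om (- a) = - cint om a" using cint_diff[of om 0 a] by simp

lemma cint_add: "cint om (a + b) = cint om a + cint om b"
 using cint_diff[of om a "- b"] cint_minus[of om b] by simp

lemma cint_of [simp]: "cint om (frag_of \<sigma>) = sint om \<sigma>" by (simp add: cint_def)

text \<open>A lift on the square expresses the three face integrals by its values at the corners. On
  the collapsed fourth side the lift is constant, so the alternating sum is 0.\<close>

lemma cint_boundary_simplex:
 assumes w: "locex UNIV om" and s: "singular_simplex 2 euclidean s"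
 shows "cint om (chain_boundary 2 (frag_of s)) = 0"
proof -
 let ?h = "%x. s (triangle x)"
 have hc: "continuous_on ({0..1} \<times> {0..1}) ?h"
  by (rule singular_simplex_continuous[OF s triangle_in triangle_continuous])
 obtain F where F: "lft om ({0..1} \<times> {0..1}) ?h F"
  using lft_exists_box[OF w hc] by auto
 have edge_face: "sint om (singular_face 2 k s) = F (g 1) - F (g 0)"
  if k: "k <= 2" and g: "continuous_on {0..1} g" "g ` {0..1} \<subseteq> {0..1} \<times> {0..1}"
   and gk: "!!t. t \<in> {0..1} ==> simplical_face k (edge t) = triangle (g t)" for k g
  unfolding sint_def
 proof (rule pint_eq[of _ _ "%t. F (g t)", simplified])
  have e: "singular_face 2 k s (edge t) = s (triangle (g t))" if "t \<in> {0..1}" for t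
   using edge_in[OF that] gk[OF that] by (simp add: singular_face_def)
  show "continuous_on {0..1} (%t. singular_face 2 k s (edge t))"
   by (rule continuous_on_eq[OF continuous_on_compose2[OF hc g]]) (simp add: e)
  show "lft om {0..1} (%t. singular_face 2 k s (edge t)) (%t. F (g t))"
   by (rule lft_cong[OF lft_compose[OF g F]]) (simp_all add: e)
 qed
 have f0: "sint om (singular_face 2 0 s) = F (1, 1) - F (1, 0)"
 proof -
  have "sint om (singular_face 2 0 s) = F ((%t. (1, t)) 1) - F ((%t. (1, t)) 0)"
   by (rule edge_face) (auto intro!: continuous_intros simp: simplical_face_def edge_def triangle_def fun_eq_iff)
  then show ?thesis by simp
 qed
 have f1: "sint om (singular_face 2 1 s) = F (1, 1) - F (0, 1)"
 proof -
  have "sint om (singular_face 2 1 s) = F ((%t. (t, 1)) 1) - F ((%t. (t, 1)) 0)"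
   by (rule edge_face) (auto intro!: continuous_intros simp: simplical_face_def edge_def triangle_def fun_eq_iff)
  then show ?thesis by simp
 qed
 have f2: "sint om (singular_face 2 2 s) = F (1, 0) - F (0, 0)"
 proof -
  have "sint om (singular_face 2 2 s) = F ((%t. (t, 0)) 1) - F ((%t. (t, 0)) 0)"
   by (rule edge_face) (auto intro!: continuous_intros simp: simplical_face_def edge_def triangle_def fun_eq_iff)
  then show ?thesis by simp
 qed
 have F0: "F (0, 1) = F (0, 0)"
 proof -
  define p where "p = s (triangle (0, 0))"
  have "lft om {0..1::real} (%t. s (triangle (0, t))) (%t. F (0, t))"
  proof (rule lft_compose[OF _ _ F, where g = "%t. (0, t)"])
   show "continuous_on {0..1} (%t::real. (0::real, t))" by (intro continuous_intros)
  qed auto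
  then have 1: "lft om {0..1::real} (%t. p) (%t. F (0, t))"
  proof (rule lft_cong)
   have "triangle (0, x) = triangle (0, 0)" for x by (rule ext) (auto simp: triangle_def)
   then show "s (triangle (0, x)) = p" for x unfolding p_def by (rule arg_cong)
  qed simp
  obtain V f where V: "open V" "p \<in> V" "prim V om f" using locexD[OF w UNIV_I] by blast
  have 2: "lft om {0..1::real} (%t. p) (%t. f p)"
   by (rule lft_primitive[OF prim_primitive_on[OF V(3)] V(1)]) (use V(2) in auto)
  show ?thesis using lft_unique[OF _ _ 1 2, of 0 1] by simp
 qed
 have "chain_boundary 2 (frag_of s) = frag_of (singular_face 2 0 s) - frag_of (singular_face 2 1 s) + frag_of (singular_face 2 2 s)"
  by (simp add: chain_boundary_of numeral_2_eq_2)
 then show ?thesis using f0 f1 f2 F0 by (simp add: cint_add cint_diff)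
qed

lemma cint_boundary:
 assumes w: "locex UNIV om" and b: "singular_relboundary 1 euclidean {} c"
 shows "cint om c = 0"
proof -
 obtain d where d': "singular_chain (Suc 1) euclidean d" "(chain_boundary (Suc 1) d, c) \<in> mod_subset 1 (subtopology euclidean {})"
  using b unfolding singular_relboundary_def by blast
 have d: "singular_chain 2 euclidean d" "chain_boundary 2 d = c"
  using d'(1) d'(2)[unfolded mod_subset_empty] unfolding Suc_1 by auto
 have "cint om (chain_boundary 2 d) = 0"
 proof (rule frag_induction[of d "singular_simplex_set 2 euclidean"])
  show "Poly_Mapping.keys d \<subseteq> singular_simplex_set 2 euclidean" using d(1) by (simp add: singular_chain_def)
  show "cint om (chain_boundary 2 (frag_of x)) = 0" if "x \<in> singular_simplex_set 2 euclidean" for x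
   using cint_boundary_simplex[OF w] that by simp
 qed (simp_all add: chain_boundary_diff cint_diff)
 then show ?thesis using d(2) by simp
qed

abbreviation cycle :: "'a chain => bool" where "cycle c \<equiv> singular_relcycle 1 euclidean {} c"

text \<open>The cycles \<open>z i\<close> are preimages of the free generators. Any cycle is an
  integer combination of them up to a boundary, and closed forms integrate to 0 over boundaries. The
  coefficients are the same for all forms, which is what makes them usable as a matrix.\<close>

lemma homology_basis:
 assumes "homology_group 1 (euclidean :: 'a topology) \<cong> free_Abelian_group {..<n}"
 shows "\<exists>z. (\<forall>i<n. cycle (z i)) &
  (\<forall>c. cycle c --> (\<exists>m :: nat => int. \<forall>om. locex UNIV om --> cint om c = (\<Sum>i<n. of_int (m i) * cint om (z i))))"
proof -
 let ?G = "relcycle_group 1 (euclidean :: 'a topology) {}" and ?B = "singular_relboundary_set 1 (euclidean :: 'a topology) {}"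
 let ?Fr = "free_Abelian_group {..<n}"
 have H: "homology_group 1 (euclidean :: 'a topology) = ?G Mod ?B" by (simp add: relative_homology_group_def)
 obtain \<phi> where \<phi>: "\<phi> \<in> iso (?G Mod ?B) ?Fr" using assms unfolding H is_iso_def by blast
 have bij: "bij_betw \<phi> (carrier (?G Mod ?B)) (carrier ?Fr)" using \<phi> by (simp add: iso_def)
 have nB: "?B \<lhd> ?G" by (rule normal_subgroup_singular_relboundary_relcycle)
 define \<psi> where "\<psi> c = \<phi> (r_coset ?G ?B c)" for c
 have hom1: "(%c. r_coset ?G ?B c) \<in> hom ?G (?G Mod ?B)" using normal.r_coset_hom_Mod[OF nB] by simp
 have hom: "\<psi> \<in> hom ?G ?Fr"
  using hom_compose[OF hom1, of \<phi> ?Fr] \<phi> unfolding iso_def \<psi>_def[abs_def] by (simp add: o_def)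
 interpret hm: group_hom ?G ?Fr \<psi>
  using hom by (intro group_hom.intro group_hom_axioms.intro) auto
 have add: "\<psi> (a - b) = \<psi> a - \<psi> b" if "cycle a" "cycle b" for a b
 proof -
  have ab: "cycle (a - b)" using that by (simp add: singular_relcycle_diff)
  have "\<psi> ((a - b) + b) = \<psi> (a - b) + \<psi> b"
   using hm.hom_mult[of "a - b" b] ab that(2) by simp
  then show ?thesis by simp
 qed
 have surj: "\<exists>c. cycle c & \<psi> c = y" if "Poly_Mapping.keys y \<subseteq> {..<n}" for y
 proof -
  have "y \<in> carrier ?Fr" using that by (simp add: carrier_free_Abelian_group_iff)
  then have "y \<in> \<phi> ` carrier (?G Mod ?B)" using bij_betw_imp_surj_on[OF bij] by simp
  then obtain X where X: "X \<in> carrier (?G Mod ?B)" "\<phi> X = y" by (metis imageE)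
  then have "X \<in> (\<Union>c\<in>carrier ?G. {r_coset ?G ?B c})" unfolding FactGroup_def RCOSETS_def by simp
  then obtain c where c: "c \<in> carrier ?G" "X = r_coset ?G ?B c" by (elim UN_E singletonE)
  then have "cycle c & \<psi> c = y" using X(2) by (simp add: \<psi>_def)
  then show ?thesis by (rule exI)
 qed
 \<comment> \<open>The isomorphism lives on cosets of boundaries; its injectivity says that a cycle
   sent to 0 lies in the trivial coset.\<close>
 have ker: "singular_relboundary 1 euclidean {} c" if c: "cycle c" "\<psi> c = 0" for c
 proof -
  have 0: "r_coset ?G ?B 0 = ?B"
   by (simp add: right_coset_singular_relboundary homologous_rel_def) (metis singular_relboundary_minus minus_minus)
  have "\<psi> 0 = 0" using hm.hom_one by simp
  then have "\<phi> (r_coset ?G ?B c) = \<phi> (r_coset ?G ?B 0)" using c(2) by (simp add: \<psi>_def)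
  moreover have "r_coset ?G ?B c \<in> carrier (?G Mod ?B)" "r_coset ?G ?B 0 \<in> carrier (?G Mod ?B)"
   using hom_in_carrier[OF hom1, of c] hom_in_carrier[OF hom1, of 0] c(1) by simp_all
  ultimately have "r_coset ?G ?B c = r_coset ?G ?B 0" by (rule inj_onD[OF bij_betw_imp_inj_on[OF bij]])
  then have "homologous_rel_set 1 euclidean {} c = ?B" unfolding 0 by (simp add: right_coset_singular_relboundary)
  then show ?thesis by (simp add: homologous_rel_set_eq_relboundary)
 qed
 have "\<forall>i\<in>{..<n}. \<exists>c. cycle c & \<psi> c = frag_of i" using surj by simp
 then obtain z where z: "!!i. i < n ==> cycle (z i)" "!!i. i < n ==> \<psi> (z i) = frag_of i" by (metis lessThan_iff)
 \<comment> \<open>The induction runs over the image in the free group. The property concerns all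
   cycles with that image, because a preimage is determined only up to a boundary.\<close>
 define R where "R y \<longleftrightarrow> (\<forall>c. cycle c & \<psi> c = y -->
  (\<exists>m :: nat => int. \<forall>om. locex UNIV om --> cint om c = (\<Sum>i<n. of_int (m i) * cint om (z i))))" for y
 have R: "Poly_Mapping.keys y \<subseteq> {..<n} & R y" if "Poly_Mapping.keys y \<subseteq> {..<n}" for y
 proof (rule frag_induction[OF that])
  show "Poly_Mapping.keys 0 \<subseteq> {..<n} & R 0"
   unfolding R_def using ker cint_boundary by (auto intro!: exI[of _ "%i. 0"])
 next
  fix i assume i: "i \<in> {..<n}"
  have "R (frag_of i)" unfolding R_def
  proof (intro allI impI)
   fix c assume c: "cycle c & \<psi> c = frag_of i"
   have "singular_relboundary 1 euclidean {} (c - z i)"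
   proof (rule ker)
    have zi: "cycle (z i)" "\<psi> (z i) = frag_of i" using z i by (metis lessThan_iff)+
    show "cycle (c - z i)" using c zi by (intro singular_relcycle_diff) blast+
    show "\<psi> (c - z i) = 0" using add[of c "z i"] c zi by simp
   qed
   then have "cint om c = cint om (z i)" if "locex UNIV om" for om using cint_boundary[OF that] cint_diff[of om c "z i"] by simp
   moreover have "(\<Sum>j<n. of_int (if j = i then 1 else 0) * cint om (z j)) = cint om (z i)" for om
    using i by (simp add: if_distrib[of of_int] if_distrib[of "%x. x * _"] sum.delta cong: if_cong)
   ultimately show "\<exists>m :: nat => int. \<forall>om. locex UNIV om --> cint om c = (\<Sum>i<n. of_int (m i) * cint om (z i))"
    by (intro exI[of _ "%j. if j = i then 1 else 0"]) simp
  qed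
  then show "Poly_Mapping.keys (frag_of i) \<subseteq> {..<n} & R (frag_of i)" using i by simp
 next
  fix a b assume ab: "Poly_Mapping.keys a \<subseteq> {..<n} & R a" "Poly_Mapping.keys b \<subseteq> {..<n} & R b"
  obtain ca where ca: "cycle ca" "\<psi> ca = a" using surj ab(1) by blast
  obtain cb where cb: "cycle cb" "\<psi> cb = b" using surj ab(2) by blast
  obtain ma :: "nat => int" where ma: "!!om. locex UNIV om ==> cint om ca = (\<Sum>i<n. of_int (ma i) * cint om (z i))"
   using ab(1) ca unfolding R_def by blast
  obtain mb :: "nat => int" where mb: "!!om. locex UNIV om ==> cint om cb = (\<Sum>i<n. of_int (mb i) * cint om (z i))"
   using ab(2) cb unfolding R_def by blast
  have "R (a - b)" unfolding R_def
  proof (intro allI impI)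
   fix c assume c: "cycle c & \<psi> c = a - b"
   have cab: "cycle (ca - cb)" using ca cb by (simp add: singular_relcycle_diff)
   have "singular_relboundary 1 euclidean {} (c - (ca - cb))"
   proof (rule ker)
    have "cycle c" using c by simp
    then show "cycle (c - (ca - cb))" using cab by (rule singular_relcycle_diff)
    have "\<psi> (c - (ca - cb)) = \<psi> c - (\<psi> ca - \<psi> cb)" using add[OF _ cab, of c] add[OF ca(1) cb(1)] c by simp
    then show "\<psi> (c - (ca - cb)) = 0" using c ca cb by simp
   qed
   then have "cint om c = (\<Sum>i<n. of_int (ma i - mb i) * cint om (z i))" if "locex UNIV om" for om
    using cint_boundary[OF that] cint_diff[of om c "ca - cb"] cint_diff[of om ca cb] ma[OF that] mb[OF that]
    by (simp add: left_diff_distrib sum_subtractf)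
   then show "\<exists>m :: nat => int. \<forall>om. locex UNIV om --> cint om c = (\<Sum>i<n. of_int (m i) * cint om (z i))"
    by (intro exI[of _ "%i. ma i - mb i"]) blast
  qed
  then show "Poly_Mapping.keys (a - b) \<subseteq> {..<n} & R (a - b)" using ab keys_diff[of a b] by blast
 qed
 have "\<exists>m :: nat => int. \<forall>om. locex UNIV om --> cint om c = (\<Sum>i<n. of_int (m i) * cint om (z i))" if c: "cycle c" for c
 proof -
  have "\<psi> c \<in> carrier ?Fr" using hm.hom_closed[of c] c by simp
  then have "Poly_Mapping.keys (\<psi> c) \<subseteq> {..<n}" by (simp add: carrier_free_Abelian_group_iff)
  then show ?thesis using R c unfolding R_def by blast
 qed
 then show ?thesis using z(1) by blast
qed

text \<open>Coordinate discs are path connected, so the set of points reached from \<open>p\<close>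
  and its complement are both open.\<close>

lemma ex_path: "\<exists>g. continuous_on {0..1} g & g (0::real) = (p :: 'a) & g 1 = q"
proof -
 define R where "R = {q. \<exists>g. path g & pathstart g = p & pathfinish g = q}"
 have nb: "\<exists>D. open D & x \<in> D & (\<forall>y\<in>D. \<exists>g. path g & pathstart g = x & pathfinish g = y)" for x :: 'a
 proof -
  obtain c where c: "c \<in> A" "x \<in> cdom c" using chart_cover by blast
  obtain r where r: "r > 0" "cball (crd c x) r \<subseteq> crd c ` (cdom c Int UNIV)" using ex_cball[OF c open_UNIV UNIV_I] by blast
  have b: "ball (crd c x) r \<subseteq> crd c ` cdom c" using r(2) ball_subset_cball by blast
  let ?D = "cinv c ` ball (crd c x) r"
  have "\<exists>g. path g & pathstart g = x & pathfinish g = y" if y: "y \<in> ?D" for y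
  proof -
   obtain w where w: "w \<in> ball (crd c x) r" "y = cinv c w" using y by blast
   let ?g = "cinv c \<circ> linepath (crd c x) w"
   have "closed_segment (crd c x) w \<subseteq> ball (crd c x) r"
    by (rule closed_segment_subset) (use w(1) r(1) in auto)
   then have "path_image (linepath (crd c x) w) \<subseteq> crd c ` cdom c" using b by auto
   then have "path ?g"
    by (intro path_continuous_image path_linepath) (rule continuous_on_subset[OF continuous_cinv[OF c(1)]])
   moreover have "pathstart ?g = x" "pathfinish ?g = y" using c w by (auto simp: pathstart_compose pathfinish_compose)
   ultimately show ?thesis by blast
  qed
  moreover have "open ?D" by (rule open_cinv_image[OF c(1) open_ball b])
  moreover have "x \<in> ?D" using c r(1) by (metis cinv_crd centre_in_ball imageI)
  ultimately show ?thesis by blast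
 qed
 have join: "\<exists>g. path g & pathstart g = a & pathfinish g = c"
  if gh: "path g & pathstart g = a & pathfinish g = b" "path h & pathstart h = b & pathfinish h = c" for a b c :: 'a and g h
  by (rule exI[of _ "g +++ h"]) (use gh in auto)
 have "open R"
 proof (subst open_subopen, intro ballI)
  fix x assume "x \<in> R"
  then obtain g where g: "path g & pathstart g = p & pathfinish g = x" unfolding R_def by blast
  obtain D where D: "open D" "x \<in> D" "!!y. y \<in> D ==> \<exists>g. path g & pathstart g = x & pathfinish g = y" using nb by metis
  have "D \<subseteq> R"
  proof
   fix y assume "y \<in> D"
   then obtain h where "path h & pathstart h = x & pathfinish h = y" using D(3) by blast
   from join[OF g this] show "y \<in> R" by (simp add: R_def)
  qed
  then show "\<exists>T. open T & x \<in> T & T \<subseteq> R" using D by blast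
 qed
 moreover have "open (- R)"
 proof (subst open_subopen, intro ballI)
  fix x assume x: "x \<in> - R"
  obtain D where D: "open D" "x \<in> D" "!!y. y \<in> D ==> \<exists>g. path g & pathstart g = x & pathfinish g = y" using nb by metis
  have "D \<subseteq> - R"
  proof
   fix y assume "y \<in> D"
   then obtain h where h: "path h & pathstart h = x & pathfinish h = y" using D(3) by blast
   then have h': "path (reversepath h) & pathstart (reversepath h) = y & pathfinish (reversepath h) = x" by simp
   show "y \<in> - R"
   proof
    assume "y \<in> R"
    then obtain g where "path g & pathstart g = p & pathfinish g = y" unfolding R_def by blast
    from join[OF this h'] have "x \<in> R" by (simp add: R_def)
    then show False using x by blast
   qed
  qed
  then show "\<exists>T. open T & x \<in> T & T \<subseteq> - R" using D by blast
 qed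
 moreover have "p \<in> R"
 proof -
  obtain D where "p \<in> D" "!!y. y \<in> D ==> \<exists>g. path g & pathstart g = p & pathfinish g = y" using nb by metis
  then show ?thesis by (simp add: R_def)
 qed
 ultimately have "R = UNIV" using connectedD[OF connected_UNIV, of R "- R"] by auto
 then have "q \<in> R" by blast
 then show ?thesis unfolding R_def path_def pathstart_def pathfinish_def by blast
qed

lemma prim_local:
 assumes w: "locex UNIV om" and f: "!!p. \<exists>D. open D & p \<in> D & prim D om f"
 shows "prim UNIV om f"
 unfolding prim_def C1f_def
proof (intro ballI conjI allI)
 fix c z assume c: "c \<in> A" and "z \<in> crd c ` (cdom c Int UNIV)"
 then obtain p where p: "p \<in> cdom c" "z = crd c p" by blast
 obtain D where D: "open D" "p \<in> D" "prim D om f" using f by blast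
 show "((%z. f (cinv c z)) has_derivative dpull c om z) (at z)"
  by (rule C1f_D[OF prim_C1f[OF D(3) c]]) (use p D in auto)
next
 fix c v assume "c \<in> A"
 then show "continuous_on (crd c ` (cdom c Int UNIV)) (%z. dpull c om z v)" by (rule locex_continuous[OF w])
qed

lemma cycleI:
 assumes "singular_chain 1 euclidean c" "chain_boundary 1 c = 0" shows "cycle c"
 unfolding singular_relcycle_def by (simp only: assms mod_subset_empty simp_thms)

text \<open>The primitive is the integral along a chosen path from a base point. For neighbouring
  points the path to \<open>p\<close>, a segment in a disc and the reversed path to \<open>q\<close>
  form a cycle, so the function changes exactly as a local primitive does.\<close>

lemma exact_of_cycles:
 assumes w: "locex UNIV om" and z: "!!c. cycle c ==> cint om c = 0"
 shows "\<exists>f. prim UNIV om f"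
proof -
 define p0 :: 'a where "p0 = undefined"
 obtain g where g: "!!q :: 'a. continuous_on {0..1} (g q)" "!!q. g q (0::real) = p0" "!!q. g q 1 = q"
  using ex_path[of p0] by metis
 define f where "f q = sint om (path_simplex (g q))" for q
 have "\<exists>D. open D & p \<in> D & prim D om f" for p
 proof -
  obtain c where c: "c \<in> A" "p \<in> cdom c" using chart_cover by blast
  obtain V F where V: "open V" "p \<in> V" "prim V om F" using locexD[OF w UNIV_I] by blast
  obtain r where r: "r > 0" "cball (crd c p) r \<subseteq> crd c ` (cdom c Int V)" using ex_cball[OF c V(1,2)] by blast
  have b: "ball (crd c p) r \<subseteq> crd c ` (cdom c Int V)" using r(2) ball_subset_cball by blast
  then have b': "ball (crd c p) r \<subseteq> crd c ` cdom c" by blast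
  let ?D = "cinv c ` ball (crd c p) r"
  have D: "open ?D" "p \<in> ?D" "?D \<subseteq> V"
   using open_cinv_image[OF c(1) open_ball b'] c r(1) b by (auto intro!: image_eqI[of _ _ "crd c p"])
  have fq: "F q + (f p - F p) = f q" if q: "q \<in> ?D" for q
  proof -
   obtain u where u: "u \<in> ball (crd c p) r" "q = cinv c u" using q by blast
   define l where "l t = cinv c (linepath (crd c p) u t)" for t
   have "closed_segment (crd c p) u \<subseteq> ball (crd c p) r"
    by (rule closed_segment_subset) (use u(1) r(1) in auto)
   then have im: "linepath (crd c p) u ` {0..1} \<subseteq> ball (crd c p) r" by (simp add: linepath_image_01)
   have cl: "continuous_on {0..1} l" unfolding l_def
    by (rule continuous_on_compose2[OF continuous_on_subset[OF continuous_cinv[OF c(1)] b'] continuous_on_linepath im])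
   have lV: "l ` {0..1} \<subseteq> V" unfolding l_def using im D(3) by blast
   have l01: "l 0 = p" "l 1 = q" using c u by (simp_all add: l_def linepath_def)
   have sl: "sint om (path_simplex l) = F q - F p"
    using sint_path[OF cl lft_primitive[OF prim_primitive_on[OF V(3)] V(1) lV]] l01 by simp
   have cy: "cycle (frag_of (path_simplex (g p)) - (frag_of (path_simplex (g q)) - frag_of (path_simplex l)))"
   proof (rule cycleI)
    show "singular_chain 1 euclidean (frag_of (path_simplex (g p)) - (frag_of (path_simplex (g q)) - frag_of (path_simplex l)))"
     by (intro singular_chain_diff) (simp_all only: singular_chain_of path_simplex g(1) cl)
    show "chain_boundary 1 (frag_of (path_simplex (g p)) - (frag_of (path_simplex (g q)) - frag_of (path_simplex l))) = 0"
     by (simp only: chain_boundary_diff boundary_path_simplex g l01) simp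
   qed
   have "cint om (frag_of (path_simplex (g p)) - (frag_of (path_simplex (g q)) - frag_of (path_simplex l))) = 0" by (rule z[OF cy])
   then show ?thesis by (simp add: cint_diff f_def sl)
  qed
  have pf: "prim ?D (%c p v. om c p v + 0) (%q. F q + (f p - F p))"
   by (rule prim_add[OF prim_subset[OF V(3) D(3)] prim_const])
  have "prim ?D om f" by (rule prim_cong[OF pf D(1)]) (simp_all only: fq add_0_right)
  with D(1,2) have "open ?D & p \<in> ?D & prim ?D om f" by simp
  then show ?thesis by (rule exI)
 qed
 then have "prim UNIV om f" by (rule prim_local[OF w])
 then show ?thesis by (intro exI[of _ f])
qed

text \<open>This is where the genus enters. Let \<open>X\<close> be the integer matrix of the curves
  in terms of a homology basis and \<open>Y\<close> the matrix of periods of the dual forms over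
  that basis. Duality says X Y = 1. As the number of curves is the rank of the homology, both
  matrices are square and Y X = 1, so periods over the basis are recovered from those over the
  curves.\<close>

lemma periods_matrix:
 fixes \<tau> :: "nat => 'a form1" and \<alpha> :: "nat => real => 'a"
 assumes h: "has_genus TYPE('a) h"
  and a: "!!k. k < 2 * h ==> continuous_on UNIV (\<alpha> k)" "!!k. k < 2 * h ==> \<alpha> k 0 = \<alpha> k 1"
  and t: "!!j. j < 2 * h ==> locex UNIV (\<tau> j)"
  and d: "!!k j. k < 2 * h ==> j < 2 * h ==> closed_curve_integral A (\<tau> j) (\<alpha> k) = (if k = j then 1 else 0)"
  and w: "locex UNIV om" "!!k. k < 2 * h ==> closed_curve_integral A om (\<alpha> k) = 0"
 shows "\<exists>f. prim UNIV om f"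
proof -
 let ?n = "2 * h"
 obtain z where z: "!!c. cycle c ==> \<exists>m :: nat => int. \<forall>om. locex UNIV om --> cint om c = (\<Sum>i<?n. of_int (m i) * cint om (z i))"
  using homology_basis[of ?n] h unfolding has_genus_def by blast
 have ac: "continuous_on {0..1} (\<alpha> k)" if "k < ?n" for k using a(1)[OF that] continuous_on_subset by blast
 define C where "C k = frag_of (path_simplex (\<alpha> k))" for k
 have cyc: "cycle (C k)" if "k < ?n" for k unfolding C_def
 proof (rule cycleI)
  show "singular_chain 1 euclidean (frag_of (path_simplex (\<alpha> k)))"
   by (simp only: singular_chain_of path_simplex ac[OF that])
  show "chain_boundary 1 (frag_of (path_simplex (\<alpha> k))) = 0"
   by (simp only: boundary_path_simplex a(2)[OF that]) simp
 qed
 have per: "cint \<eta> (C k) = closed_curve_integral A \<eta> (\<alpha> k)" if k: "k < ?n" and e: "locex UNIV \<eta>" for \<eta> k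
 proof -
  obtain F where F: "lft \<eta> UNIV (\<alpha> k) F" using lft_exists_line[OF e a(1)[OF k]] by auto
  then have "lft \<eta> {0..1} (\<alpha> k) F" by (rule lft_subset) simp
  then show ?thesis using sint_path[OF ac[OF k]] closed_curve_integral_eq[OF a(1)[OF k] F] by (simp add: C_def)
 qed
 have "\<forall>k. \<exists>m :: nat => int. k < ?n --> (\<forall>om. locex UNIV om --> cint om (C k) = (\<Sum>i<?n. of_int (m i) * cint om (z i)))"
  using z cyc by blast
 then obtain m :: "nat => nat => int" where m: "!!k om. k < ?n ==> locex UNIV om ==> cint om (C k) = (\<Sum>i<?n. of_int (m k i) * cint om (z i))"
  by metis
 define X where "X = Matrix.mat ?n ?n (%(k, i). real_of_int (m k i))"
 define Y where "Y = Matrix.mat ?n ?n (%(i, j). cint (\<tau> j) (z i))"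
 have XY: "X * Y = 1\<^sub>m ?n"
 proof (rule eq_matI)
  fix k j assume "k < dim_row (1\<^sub>m ?n :: real Matrix.mat)" "j < dim_col (1\<^sub>m ?n :: real Matrix.mat)"
  then have kj: "k < ?n" "j < ?n" by auto
  have "(X * Y) $$ (k, j) = (\<Sum>i<?n. real_of_int (m k i) * cint (\<tau> j) (z i))"
   using kj by (simp add: X_def Y_def scalar_prod_def atLeast0LessThan)
  also have "\<dots> = (if k = j then 1 else 0)" using m[OF kj(1) t[OF kj(2)]] per[OF kj(1) t[OF kj(2)]] d[OF kj] by simp
  finally show "(X * Y) $$ (k, j) = 1\<^sub>m ?n $$ (k, j)" using kj by simp
 qed (simp_all add: X_def Y_def)
 have YX: "Y * X = 1\<^sub>m ?n"
  by (rule mat_mult_left_right_inverse[OF _ _ XY]) (simp_all add: X_def Y_def)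
 have YX': "(\<Sum>k<?n. cint (\<tau> k) (z i) * real_of_int (m k l)) = (if i = l then 1 else 0)" if "i < ?n" "l < ?n" for i l
 proof -
  have "(Y * X) $$ (i, l) = (\<Sum>k<?n. cint (\<tau> k) (z i) * real_of_int (m k l))"
   using that by (simp add: X_def Y_def scalar_prod_def atLeast0LessThan)
  then show ?thesis using that by (simp add: YX)
 qed
 have p0: "cint om (z i) = 0" if i: "i < ?n" for i
 proof -
  have "cint om (z i) = (\<Sum>l<?n. (if i = l then 1 else 0) * cint om (z l))"
   using i by (simp add: if_distrib[of "%x. x * _"] sum.delta cong: if_cong)
  also have "\<dots> = (\<Sum>l<?n. (\<Sum>k<?n. cint (\<tau> k) (z i) * real_of_int (m k l)) * cint om (z l))"
   by (intro sum.cong HOL.refl) (use YX'[OF i] in auto)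
  also have "\<dots> = (\<Sum>l<?n. \<Sum>k<?n. cint (\<tau> k) (z i) * (real_of_int (m k l) * cint om (z l)))"
   by (simp add: sum_distrib_right mult.assoc)
  also have "\<dots> = (\<Sum>k<?n. \<Sum>l<?n. cint (\<tau> k) (z i) * (real_of_int (m k l) * cint om (z l)))" by (rule sum.swap)
  also have "\<dots> = (\<Sum>k<?n. cint (\<tau> k) (z i) * (\<Sum>l<?n. real_of_int (m k l) * cint om (z l)))"
   by (simp add: sum_distrib_left)
  also have "\<dots> = 0"
   by (rule sum.neutral) (use m[OF _ w(1)] per[OF _ w(1)] w(2) in simp)
  finally show ?thesis .
 qed
 have "cint om c = 0" if c: "cycle c" for c
 proof -
  obtain m' :: "nat => int" where "cint om c = (\<Sum>i<?n. of_int (m' i) * cint om (z i))" using z[OF c] w(1) by blast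
  then show ?thesis using p0 by simp
 qed
 then show ?thesis by (rule exact_of_cycles[OF w(1)])
qed

end

section \<open>Forms with poles\<close>

text \<open>A holomorphic function on a disc has a primitive there. The cases of a pole at
  \<open>z1\<close> and of a pole elsewhere are merged in one formula, so that several poles can be
  handled at the same point.\<close>

lemma inverse_primitive:
 fixes a z1 :: complex
 obtains r G where "r > 0" "G holomorphic_on ball z1 r"
  "!!z. z \<in> ball z1 r ==> z ~= z1 ==> 1 / (z - a) = (if a = z1 then 1 / (z - z1) else 0) + deriv G z"
  "a ~= z1 ==> 1 / (z1 - a) = deriv G z1"
proof (cases "a = z1")
 case True
 show ?thesis by (rule that[of 1 "%z. 0"]) (use True in auto)
next
 case False
 define r where "r = cmod (z1 - a)"
 have r: "r > 0" using False by (simp add: r_def)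
 have ne: "z - a ~= 0" if "z \<in> ball z1 r" for z using that by (auto simp: r_def dist_norm)
 have "(%z. 1 / (z - a)) holomorphic_on ball z1 r" by (intro holomorphic_intros ne)
 then obtain G where G: "!!z. z \<in> ball z1 r ==> (G has_field_derivative 1 / (z - a)) (at z within ball z1 r)"
  using holomorphic_convex_primitive'[OF convex_ball open_ball] by blast
 then have G: "(G has_field_derivative 1 / (z - a)) (at z)" if "z \<in> ball z1 r" for z
  using that at_within_open[OF that open_ball] by metis
 have "G holomorphic_on ball z1 r" using G holomorphic_on_open[OF open_ball] by blast
 moreover have "deriv G z = 1 / (z - a)" if "z \<in> ball z1 r" for z by (rule DERIV_imp_deriv[OF G[OF that]])
 ultimately show ?thesis by (intro that[OF r]) (use False r in auto)
qed

context compact_surface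
begin

text \<open>A simple pole with a real residue: n / (2 pi) times the differential of the argument,
  which makes n the period on a small positive circle, plus the differential of a C^1
  function.\<close>

definition pole_at :: "'a chart => 'a form1 => 'a => real => bool" where
 "pole_at c \<eta> p n \<longleftrightarrow> (\<exists>r>0. cball (crd c p) r \<subseteq> crd c ` cdom c & (\<exists>u u'. C1f (ball (crd c p) r) u u' &
  (\<forall>z\<in>ball (crd c p) r - {crd c p}. \<forall>v. dpull c \<eta> z v = n / (2 * pi) * Im (v / (z - crd c p)) + u' z v)))"

lemma pole_atI:
 assumes c: "c \<in> A" "p \<in> cdom c" and r: "r > 0" and u: "C1f (ball (crd c p) r) u u'"
  and e: "!!z v. z \<in> ball (crd c p) r ==> z \<in> crd c ` cdom c ==> z ~= crd c p ==> dpull c \<eta> z v = n / (2 * pi) * Im (v / (z - crd c p)) + u' z v"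
 shows "pole_at c \<eta> p n"
proof -
 obtain s where s: "s > 0" "cball (crd c p) s \<subseteq> crd c ` (cdom c Int UNIV)" using ex_cball[OF c open_UNIV UNIV_I] by blast
 have sub: "ball (crd c p) (min r s) \<subseteq> ball (crd c p) r" "cball (crd c p) (min r s) \<subseteq> crd c ` cdom c"
  using s(2) by (auto simp: subset_iff)
 have "C1f (ball (crd c p) (min r s)) u u'" by (rule C1f_subset[OF u sub(1)])
 moreover have "dpull c \<eta> z v = n / (2 * pi) * Im (v / (z - crd c p)) + u' z v" if "z \<in> ball (crd c p) (min r s) - {crd c p}" for z v
  by (rule e) (use that sub ball_subset_cball in blast)+
 ultimately show ?thesis unfolding pole_at_def using sub(2) r s(1) by (intro exI[of _ "min r s"]) auto
qed

lemma pole_at_locex: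
 assumes w: "locex U \<eta>" and U: "open U" "p \<in> U" and c: "c \<in> A" "p \<in> cdom c"
 shows "pole_at c \<eta> p 0"
proof -
 obtain V f where V: "open V" "p \<in> V" "prim V \<eta> f" using locexD[OF w U(2)] by blast
 obtain r where r: "r > 0" "cball (crd c p) r \<subseteq> crd c ` (cdom c Int V)" using ex_cball[OF c V(1,2)] by blast
 have "C1f (ball (crd c p) r) (%z. f (cinv c z)) (dpull c \<eta>)"
  by (rule C1f_subset[OF prim_C1f[OF V(3) c(1)]]) (use r(2) ball_subset_cball in blast)
 then show ?thesis by (rule pole_atI[OF c r(1)]) simp
qed

lemma pole_at_add:
 assumes "pole_at c \<eta> p n" "pole_at c \<eta>' p n'" and c: "c \<in> A" "p \<in> cdom c"
 shows "pole_at c (%d p v. \<eta> d p v + \<eta>' d p v) p (n + n')"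
proof -
 obtain r u u' where r: "r > 0" "C1f (ball (crd c p) r) u u'"
  "!!z v. z \<in> ball (crd c p) r - {crd c p} ==> dpull c \<eta> z v = n / (2 * pi) * Im (v / (z - crd c p)) + u' z v"
  using assms(1) unfolding pole_at_def by blast
 obtain s w w' where s: "s > 0" "C1f (ball (crd c p) s) w w'"
  "!!z v. z \<in> ball (crd c p) s - {crd c p} ==> dpull c \<eta>' z v = n' / (2 * pi) * Im (v / (z - crd c p)) + w' z v"
  using assms(2) unfolding pole_at_def by blast
 have CC: "C1f (ball (crd c p) (min r s)) (%z. u z + w z) (%z v. u' z v + w' z v)"
  by (intro C1f_add C1f_subset[OF r(2)] C1f_subset[OF s(2)]) auto
 show ?thesis
 proof (rule pole_atI[OF c _ CC])
  show "min r s > 0" using r s by simp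
  fix z v assume "z \<in> ball (crd c p) (min r s)" "z ~= crd c p"
  then have "z \<in> ball (crd c p) r - {crd c p}" "z \<in> ball (crd c p) s - {crd c p}" by auto
  from r(3)[OF this(1)] s(3)[OF this(2)]
  show "dpull c (%d p v. \<eta> d p v + \<eta>' d p v) z v = (n + n') / (2 * pi) * Im (v / (z - crd c p)) + (u' z v + w' z v)"
   by (simp add: dpull_def algebra_simps add_divide_distrib)
 qed
qed

lemma pole_at_cmult:
 assumes "pole_at c \<eta> p n" and c: "c \<in> A" "p \<in> cdom c"
 shows "pole_at c (%d p v. k * \<eta> d p v) p (k * n)"
proof -
 obtain r u u' where r: "r > 0" "C1f (ball (crd c p) r) u u'"
  "!!z v. z \<in> ball (crd c p) r - {crd c p} ==> dpull c \<eta> z v = n / (2 * pi) * Im (v / (z - crd c p)) + u' z v"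
  using assms(1) unfolding pole_at_def by blast
 show ?thesis
 proof (rule pole_atI[OF c r(1) C1f_cmult[OF r(2)]])
  fix z v assume "z \<in> ball (crd c p) r" "z ~= crd c p"
  then have "z \<in> ball (crd c p) r - {crd c p}" by auto
  from r(3)[OF this]
  show "dpull c (%d p v. k * \<eta> d p v) z v = k * n / (2 * pi) * Im (v / (z - crd c p)) + k * u' z v"
   by (simp add: dpull_def algebra_simps)
 qed
qed

text \<open>Write T z - T z0 = (z - z0) g z with g without zeros near z0. The argument of the left
  side is that of z - z0 plus the imaginary part of a logarithm of g, which is a regular function;
  the residue is unchanged.\<close>

lemma pole_change:
 assumes c: "c \<in> A" "p \<in> cdom c" and d: "d \<in> A" "p \<in> cdom d" and cov: "cov1 UNIV \<eta>" and pole: "pole_at c \<eta> p n"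
 shows "pole_at d \<eta> p n"
proof -
 define z0 where "z0 = crd d p"
 obtain r u u' where r: "r > 0" "C1f (ball (crd c p) r) u u'"
  "!!z v. z \<in> ball (crd c p) r - {crd c p} ==> dpull c \<eta> z v = n / (2 * pi) * Im (v / (z - crd c p)) + u' z v"
  using pole unfolding pole_at_def by blast
 let ?T = "transition d c" and ?W = "crd d ` (cdom d Int cdom c)"
 have T: "?T holomorphic_on ?W" by (rule transition_holomorphic[OF d(1) c(1)])
 have W: "open ?W" "z0 \<in> ?W" using open_overlap[OF d(1) c(1)] c d by (auto simp: z0_def)
 have T0: "?T z0 = crd c p" using d by (simp add: z0_def)
 define g where "g z = (if z = z0 then deriv ?T z0 else (?T z - ?T z0) / (z - z0))" for z
 have g: "g holomorphic_on ?W" unfolding g_def[abs_def] by (rule pole_lemma_open[OF T W(1)])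
 have "g z0 ~= 0" using transition_deriv_inverse[OF c(1) d(1), of p] transition_deriv_inverse[OF d(1) c(1), of p] c d
  by (auto simp: g_def z0_def)
 have "isCont g z0" using g W holomorphic_on_imp_continuous_on continuous_on_eq_continuous_at by blast
 then obtain e1 where e1: "e1 > 0" "!!z. dist z z0 < e1 ==> g z ~= 0"
  using continuous_at_avoid[of z0 g 0] \<open>g z0 ~= 0\<close> by (auto simp: dist_commute)
 have "continuous_on ?W ?T" using T holomorphic_on_imp_continuous_on by blast
 then have "open (?W Int ?T -` ball (crd c p) r)" using W(1) by (intro continuous_open_preimage) auto
 moreover have "z0 \<in> ?W Int ?T -` ball (crd c p) r" using W(2) T0 r(1) by simp
 ultimately obtain e2 where e2: "e2 > 0" "ball z0 e2 \<subseteq> ?W Int ?T -` ball (crd c p) r"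
  using open_contains_ball by blast
 define e where "e = min e1 e2"
 have e: "e > 0" using e1 e2 by (simp add: e_def)
 have be: "ball z0 e \<subseteq> ?W" "?T ` ball z0 e \<subseteq> ball (crd c p) r" using e2(2) by (auto simp: e_def)
 have gne: "g z ~= 0" if "z \<in> ball z0 e" for z using e1(2)[of z] that by (auto simp: e_def dist_commute)
 have gh: "g holomorphic_on ball z0 e" by (rule holomorphic_on_subset[OF g be(1)])
 have "(%z. deriv g z / g z) holomorphic_on ball z0 e" by (intro holomorphic_intros gh gne) auto
 then obtain L where L: "!!z. z \<in> ball z0 e ==> (L has_field_derivative deriv g z / g z) (at z within ball z0 e)"
  using holomorphic_convex_primitive'[OF convex_ball open_ball] by blast
 have L: "(L has_field_derivative deriv g z / g z) (at z)" if "z \<in> ball z0 e" for z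
  using L[OF that] at_within_open[OF that open_ball] by metis
 have Lh: "L holomorphic_on ball z0 e" using L holomorphic_on_open[OF open_ball] by blast
 have C: "C1f (ball z0 e) (%z. n / (2 * pi) * Im (L z) + u (?T z))
  (%z v. n / (2 * pi) * Im (deriv L z * v) + u' (?T z) (deriv ?T z * v))"
  by (intro C1f_add C1f_cmult C1f_Im[OF Lh open_ball] C1f_comp_holo[OF r(2) holomorphic_on_subset[OF T be(1)] open_ball be(2)])
 show ?thesis
 proof (rule pole_atI[OF d e, folded z0_def, OF C])
  fix z v assume z: "z \<in> ball z0 e" "z ~= z0"
  obtain q where q: "q \<in> cdom d" "q \<in> cdom c" "z = crd d q" using z(1) be(1) by blast
  have Tz: "?T z = crd c q" using q d by simp
  have gz: "g z ~= 0" using gne z by blast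
  have Tg: "?T z - ?T z0 = (z - z0) * g z" using z by (simp add: g_def)
  then have Tne: "?T z ~= crd c p" using z gz T0 by auto
  have "((%z. (z - z0) * g z) has_field_derivative (g z + (z - z0) * deriv g z)) (at z)"
   by (auto intro!: derivative_eq_intros holomorphic_derivI[OF gh open_ball z(1)] simp: algebra_simps)
  moreover have "((%z. ?T z - ?T z0) has_field_derivative deriv ?T z) (at z)"
   using holomorphic_derivI[OF T W(1), of z] be(1) z by (auto intro!: derivative_eq_intros)
  then have "((%z. (z - z0) * g z) has_field_derivative deriv ?T z) (at z)"
   by (rule has_field_derivative_transform_within_open[of _ _ _ "ball z0 e"]) (use z in \<open>auto simp: g_def\<close>)
  ultimately have dT: "deriv ?T z = g z + (z - z0) * deriv g z" using DERIV_unique by blast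
  then have "deriv ?T z * v / (?T z - crd c p) = v / (z - z0) + deriv g z / g z * v"
   using z gz unfolding T0[symmetric] Tg dT by (simp add: divide_simps) (simp add: algebra_simps)
  then have 1: "deriv ?T z * v / (?T z - crd c p) = v / (z - z0) + deriv L z * v" using DERIV_imp_deriv[OF L[OF z(1)]] by simp
  have Tb: "?T z \<in> ball (crd c p) r" using be(2) z(1) by blast
  have "dpull d \<eta> z v = dpull c \<eta> (?T z) (deriv ?T z * v)"
   using cov1_D[OF cov d(1) c(1) q(1,2) UNIV_I, of v] q c d by (simp add: Tz)
  also have "\<dots> = n / (2 * pi) * Im (deriv ?T z * v / (?T z - crd c p)) + u' (?T z) (deriv ?T z * v)"
   by (rule r(3)) (use Tb Tne in blast)
  also have "\<dots> = n / (2 * pi) * Im (v / (z - z0)) + (n / (2 * pi) * Im (deriv L z * v) + u' (?T z) (deriv ?T z * v))"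
   unfolding 1 by (simp add: algebra_simps)
  finally show "dpull d \<eta> z v = n / (2 * pi) * Im (v / (z - z0)) + (n / (2 * pi) * Im (deriv L z * v) + u' (?T z) (deriv ?T z * v))" .
 qed
qed

text \<open>A closed form with finitely many simple poles. The residue condition is imposed at every
  point and not only on \<open>P\<close>, so that forms with different pole sets can be
  added.\<close>

definition sform :: "'a set => 'a form1 => ('a => real) => bool" where
 "sform P \<eta> N \<longleftrightarrow> finite P & locex (- P) \<eta> & (\<forall>p. \<forall>c\<in>A. p \<in> cdom c --> pole_at c \<eta> p (N p))"

lemma sform_locex: "locex UNIV om ==> sform {} om (%p. 0)"
 unfolding sform_def using pole_at_locex[OF _ open_UNIV UNIV_I] by simp

lemma sform_add:
 assumes "sform P \<eta> N" "sform Q \<eta>' N'"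
 shows "sform (P Un Q) (%c p v. \<eta> c p v + \<eta>' c p v) (%p. N p + N' p)"
 unfolding sform_def
proof (intro conjI allI ballI impI)
 show "locex (- (P Un Q)) (%c p v. \<eta> c p v + \<eta>' c p v)"
  by (rule locex_add; rule locex_subset) (use assms in \<open>auto simp: sform_def\<close>)
qed (use assms pole_at_add in \<open>auto simp: sform_def\<close>)

lemma sform_cmult:
 assumes "sform P \<eta> N" shows "sform P (%c p v. k * \<eta> c p v) (%p. k * N p)"
 using assms pole_at_cmult locex_cmult unfolding sform_def by simp

lemma sform_tame: assumes s: "sform P \<eta> N" shows "tame P \<eta>"
 unfolding tame_def
proof (intro conjI allI)
 show "cov1 (- P) \<eta>" using s locex_cov1 unfolding sform_def by blast
 fix p
 obtain c where c: "c \<in> A" "p \<in> cdom c" using chart_cover by blast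
 define z0 where "z0 = crd c p"
 define n where "n = N p"
 obtain r u u' where r: "r > 0" "cball z0 r \<subseteq> crd c ` cdom c" "C1f (ball z0 r) u u'"
  "!!z v. z \<in> ball z0 r - {z0} ==> dpull c \<eta> z v = n / (2 * pi) * Im (v / (z - z0)) + u' z v"
  using s c unfolding sform_def pole_at_def z0_def n_def by metis
 have sub: "cball z0 (r / 2) \<subseteq> ball z0 r" using r(1) by auto
 obtain B where B: "B \<ge> 0" "!!z v. z \<in> cball z0 (r / 2) ==> \<bar>u' z v\<bar> <= B * cmod v"
  using C1f_bound[OF r(3) compact_cball sub] by blast
 define C where "C = \<bar>n / (2 * pi)\<bar> + B * r"
 have bd: "\<bar>dpull c \<eta> z v\<bar> <= C / cmod (z - z0)" if z: "z \<in> ball z0 (r / 2) - {z0}" and v: "cmod v = 1" for z v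
 proof -
  have p: "0 < cmod (z - z0)" "cmod (z - z0) < r" using z r(1) by (auto simp: dist_norm norm_minus_commute)
  have "\<bar>Im (v / (z - z0))\<bar> <= 1 / cmod (z - z0)" using abs_Im_le_cmod[of "v / (z - z0)"] v by (simp add: norm_divide)
  then have 1: "\<bar>n / (2 * pi)\<bar> * \<bar>Im (v / (z - z0))\<bar> <= \<bar>n / (2 * pi)\<bar> * (1 / cmod (z - z0))" by (rule mult_left_mono) simp
  have "\<bar>u' z v\<bar> <= B" using B(2)[of z v] z v by auto
  also have "\<dots> <= B * r / cmod (z - z0)" using p B(1) by (simp add: pos_le_divide_eq mult_left_mono)
  finally have 2: "\<bar>u' z v\<bar> <= B * r / cmod (z - z0)" .
  have "\<bar>dpull c \<eta> z v\<bar> <= \<bar>n / (2 * pi) * Im (v / (z - z0))\<bar> + \<bar>u' z v\<bar>"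
   using r(4)[of z v] z r(1) abs_triangle_ineq[of "n / (2 * pi) * Im (v / (z - z0))" "u' z v"] by auto
  also have "\<dots> <= \<bar>n / (2 * pi)\<bar> * (1 / cmod (z - z0)) + B * r / cmod (z - z0)"
   using 1 2 unfolding abs_mult by (rule add_mono)
  also have "\<dots> = C / cmod (z - z0)" by (simp add: C_def add_divide_distrib)
  finally show ?thesis .
 qed
 have cont: "continuous_on (ball z0 (r / 2) - {z0}) (%z. dpull c \<eta> z v)" for v
 proof -
  have "continuous_on (ball z0 (r / 2) - {z0}) (%z. n / (2 * pi) * Im (v / (z - z0)) + u' z v)"
   by (intro continuous_intros continuous_on_subset[OF C1f_cont'[OF r(3)]]) (use r(1) in auto)
  then show ?thesis by (rule continuous_on_eq) (use r(4) r(1) in auto)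
 qed
 have cb: "cball z0 (r / 2) \<subseteq> crd c ` cdom c" using r(1,2) by (rule_tac subset_trans[OF _ r(2)]) auto
 show "\<exists>c\<in>A. \<exists>r>0. \<exists>C. p \<in> cdom c & cball (crd c p) r \<subseteq> crd c ` cdom c &
  (\<forall>v. continuous_on (ball (crd c p) r - {crd c p}) (%z. dpull c \<eta> z v)) &
  (\<forall>z\<in>ball (crd c p) r - {crd c p}. \<bar>dpull c \<eta> z 1\<bar> <= C / cmod (z - crd c p) & \<bar>dpull c \<eta> z \<i>\<bar> <= C / cmod (z - crd c p))"
  by (rule bexI[OF _ c(1)], rule exI[of _ "r / 2"], rule conjI, use r(1) in simp, rule exI[of _ C],
    unfold z0_def[symmetric], intro conjI allI ballI c(2) cb cont bd) auto
qed

text \<open>With residue 0 the form agrees on a punctured disc with the differential of a C^1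
  function. Assigning the value of that differential at the puncture removes the
  singularity.\<close>

lemma sform_regular:
 assumes s: "sform P \<eta> (%p. 0)"
 shows "\<exists>\<eta>'. locex UNIV \<eta>' & (\<forall>c p v. p ~: P --> \<eta>' c p v = \<eta> c p v)"
proof -
 have P: "finite P" and lx: "locex (- P) \<eta>" using s by (auto simp: sform_def)
 obtain ct where ct: "!!p. ct p \<in> A" "!!p. p \<in> cdom (ct p)" using chart_cover by metis
 have "\<forall>p. \<exists>r u u'. r > 0 & cball (crd (ct p) p) r \<subseteq> crd (ct p) ` cdom (ct p) & C1f (ball (crd (ct p) p) r) u u' &
  (\<forall>z\<in>ball (crd (ct p) p) r - {crd (ct p) p}. \<forall>v. dpull (ct p) \<eta> z v = u' z v)"
  using s ct unfolding sform_def pole_at_def by (metis (no_types, lifting) add_0 div_0 mult_zero_left)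
 then obtain r u u' where r: "!!p. r p > 0" "!!p. cball (crd (ct p) p) (r p) \<subseteq> crd (ct p) ` cdom (ct p)"
  "!!p. C1f (ball (crd (ct p) p) (r p)) (u p) (u' p)"
  "!!p z v. z \<in> ball (crd (ct p) p) (r p) - {crd (ct p) p} ==> dpull (ct p) \<eta> z v = u' p z v" by metis
 define \<eta>' where "\<eta>' d p v = (if p \<in> P then u' p (crd (ct p) p) (deriv (transition d (ct p)) (crd d p) * v) else \<eta> d p v)" for d p v
 have cov: "cov1 (- P) \<eta>" using locex_cov1[OF lx] .
 have lin: "linear (u' p (crd (ct p) p))" for p by (rule C1f_lin[OF r(3)]) (use r(1) in simp)
 have cov': "cov1 UNIV \<eta>'"
  unfolding cov1_def
 proof (intro conjI ballI allI)
  fix d p assume d: "d \<in> A" "p \<in> cdom d Int UNIV"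
  show "linear (\<eta>' d p)"
  proof (cases "p \<in> P")
   case True
   show ?thesis by (rule linearI) (use True lin[of p] in \<open>simp_all add: \<eta>'_def algebra_simps linear_add linear_cmul\<close>)
  next
   case False
   then show ?thesis using cov1_linear[OF cov d(1), of p] d(2) by (simp add: \<eta>'_def[abs_def])
  qed
 next
  fix d e p v assume de: "d \<in> A" "e \<in> A" "p \<in> cdom d Int cdom e Int UNIV"
  show "\<eta>' d p v = \<eta>' e p (deriv (transition d e) (crd d p) * v)"
  proof (cases "p \<in> P")
   case True
   then show ?thesis using transition_deriv_compose[OF de(1,2) ct(1)[of p], of p] de(3) ct(2)[of p] by (simp add: \<eta>'_def mult.assoc)
  next
   case False
   then show ?thesis using cov1_D[OF cov de(1,2), of p v] de(3) by (simp add: \<eta>'_def)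
  qed
 qed
 have "locex UNIV \<eta>'"
  unfolding locex_def
 proof
  fix p
  show "\<exists>V f. open V & p \<in> V & prim V \<eta>' f"
  proof (cases "p \<in> P")
   case False
   then obtain V f where V: "open V" "p \<in> V" "prim V \<eta> f" using locexD[OF lx] by blast
   have o: "open (V - P)" using V(1) P by (simp add: open_Diff finite_imp_closed)
   have "prim (V - P) \<eta>' f"
    by (rule prim_cong[OF prim_subset[OF V(3) Diff_subset] o]) (auto simp: \<eta>'_def)
   then show ?thesis using o V False by blast
  next
   case True
   let ?c = "ct p" and ?z = "crd (ct p) p"
   have b: "ball ?z (r p) \<subseteq> crd ?c ` cdom ?c" using r(2)[of p] ball_subset_cball by blast
   \<comment> \<open>Other points of \<open>P\<close> are removed from the disc: there the new form
     takes values chosen for another disc.\<close>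
   define V where "V = cinv ?c ` ball ?z (r p) - (P - {p})"
   have ob: "open (cinv ?c ` ball ?z (r p))" by (rule open_cinv_image[OF ct(1) open_ball b])
   have V: "open V" unfolding V_def using ob P by (simp add: open_Diff finite_imp_closed)
   have Vc: "V \<subseteq> cdom ?c" unfolding V_def using b cinv_in_cdom[OF ct(1)] by blast
   have pV: "p \<in> V" unfolding V_def using ct r(1)[of p] by (auto intro!: image_eqI[of _ _ ?z])
   have Vb: "crd ?c ` V \<subseteq> ball ?z (r p)" unfolding V_def using crd_cinv_image[OF ct(1) b] by blast
   have "C1f (crd ?c ` V) (u p) (dpull ?c \<eta>')"
   proof (rule C1f_cong'[OF C1f_subset[OF r(3) Vb] open_crd_image[OF ct(1) V Vc]])
    fix z v assume "z \<in> crd ?c ` V"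
    then obtain q where q: "q \<in> V" "z = crd ?c q" by blast
    then have qc: "q \<in> cdom ?c" using Vc by blast
    show "u' p z v = dpull ?c \<eta>' z v"
    proof (cases "q = p")
     case True
     then show ?thesis using q qc \<open>p \<in> P\<close> ct transition_deriv_self[OF ct(1) ct(2)] by (simp add: \<eta>'_def)
    next
     case False
     then have "q ~: P" using q(1) by (auto simp: V_def)
     moreover have "z ~= ?z" using False q qc ct by (metis cinv_crd)
     ultimately show ?thesis using r(4)[of z p v] q qc Vb ct by (auto simp: \<eta>'_def)
    qed
   qed simp
   then have "prim V \<eta>' (%q. u p (crd ?c q))" by (intro prim_of_chart[OF ct(1) V Vc cov1_subset[OF cov']]) auto
   then show ?thesis using V pV by blast
  qed
 qed
 then show ?thesis by (intro exI[of _ \<eta>']) (auto simp: \<eta>'_def)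
qed

end

section \<open>Forms dual to curves\<close>

text \<open>A branch of log ((z-b) / (z-a)) outside a disc around \<open>w0\<close> that contains
  both points; it tends to 0 at infinity. Both arguments of \<open>Ln\<close> differ from 1 by less
  than 1, so the branch cut is never met.\<close>

definition farlog :: "complex => complex => complex => complex => complex" where
 "farlog w0 a b z = Ln (1 - (b - w0) / (z - w0)) - Ln (1 - (a - w0) / (z - w0))"

lemma Re_pos_not_nonpos: "Re z > 0 ==> z ~: \<real>\<^sub>\<le>\<^sub>0"
 by (auto elim!: nonpos_Reals_cases)

lemma one_minus_Re: "cmod x < 1 ==> Re (1 - x) > 0"
 using complex_Re_le_cmod[of x] by simp

lemma far_quotient:
 assumes "a \<in> ball w0 r" "z ~: cball w0 r" shows "cmod ((a - w0) / (z - w0)) < 1"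
proof -
 have "cmod (a - w0) < r" "r < cmod (z - w0)" using assms by (auto simp: dist_norm norm_minus_commute)
 moreover from this have "0 < cmod (z - w0)" using norm_ge_zero[of "a - w0"] by linarith
 ultimately show ?thesis by (simp add: norm_divide pos_divide_less_eq)
qed

lemma farlog_deriv:
 assumes "a \<in> ball w0 r" "b \<in> ball w0 r" "z ~: cball w0 r" "r > 0"
 shows "(farlog w0 a b has_field_derivative 1 / (z - b) - 1 / (z - a)) (at z)"
proof -
 have ne: "z ~= w0" "z ~= a" "z ~= b" using assms by auto
 have 1: "((%z. Ln (1 - (x - w0) / (z - w0))) has_field_derivative 1 / (z - x) - 1 / (z - w0)) (at z)"
  if x: "x \<in> ball w0 r" "z ~= x" for x
 proof -
  have np: "1 - (x - w0) / (z - w0) ~: \<real>\<^sub>\<le>\<^sub>0"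
   by (intro Re_pos_not_nonpos one_minus_Re far_quotient[OF x(1) assms(3)])
  have nz: "1 - (x - w0) / (z - w0) ~= 0" using np by force
  have "((%z. 1 - (x - w0) / (z - w0)) has_field_derivative (x - w0) / (z - w0)\<^sup>2) (at z)"
   by (rule DERIV_cong[OF DERIV_diff[OF DERIV_const DERIV_divide[OF DERIV_const DERIV_diff[OF DERIV_ident DERIV_const]]]])
    (use ne in \<open>simp_all add: power2_eq_square minus_divide_left del: divide_minus_left\<close>)
  then have "((%z. Ln (1 - (x - w0) / (z - w0))) has_field_derivative inverse (1 - (x - w0) / (z - w0)) * ((x - w0) / (z - w0)\<^sup>2)) (at z)"
   by (rule DERIV_chain2[where f = Ln and g = "%z. 1 - (x - w0) / (z - w0)", OF has_field_derivative_Ln[OF np]])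
  moreover have "inverse (1 - (x - w0) / (z - w0)) * ((x - w0) / (z - w0)\<^sup>2) = 1 / (z - x) - 1 / (z - w0)"
  proof -
   have e: "1 - (x - w0) / (z - w0) = (z - x) / (z - w0)" using ne by (simp add: field_simps)
   show ?thesis unfolding e using ne x by (simp add: divide_simps power2_eq_square)
  qed
  ultimately show ?thesis by simp
 qed
 show ?thesis unfolding farlog_def
  using DERIV_diff[OF 1[OF assms(2) ne(3)] 1[OF assms(1) ne(2)]] by simp
qed

text \<open>Residue 1 at \<open>a\<close> and -1 at \<open>b\<close>. The exact term dE is there to
  cancel the rest of the form outside a disc.\<close>

definition arc_kernel :: "complex => complex => (complex => complex => real) => complex => complex => real" where
 "arc_kernel a b E' z v = (Im (v / (z - a)) - Im (v / (z - b))) / (2 * pi) + E' z v"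

text \<open>The residues add up to 0, so outside the disc of radius r the angular part is exact,
  with primitive -Im farlog / (2 pi). \<open>E\<close> is the negative of this primitive, switched
  on between the radii 4r/3 and 2r. Its value beyond 2r is recorded because it enters the crossing
  number later.\<close>

lemma arc_kernel_exists:
 assumes r: "r > 0" and a: "a \<in> ball w0 r" and b: "b \<in> ball w0 r"
 shows "\<exists>E E'. C1f UNIV E E' & (\<forall>z v. z ~: cball w0 (2 * r) --> arc_kernel a b E' z v = 0) &
  (\<forall>z. z ~: cball w0 (2 * r) --> E z = Im (farlog w0 a b z) / (2 * pi))"
proof -
 have pos: "0 < 4 / 3 * r" "4 / 3 * r < 2 * r" using r by auto
 have "\<exists>h h'. C1f UNIV h h' & (\<forall>z\<in>cball w0 (4 / 3 * r). h z = 1) & (\<forall>z. z ~: ball w0 (2 * r) --> h z = 0)"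
 proof (rule ex_cutoff[OF pos, of w0])
  fix h h' assume "C1f UNIV h h'" "!!z. z \<in> cball w0 (4 / 3 * r) ==> h z = 1" "!!z. z ~: ball w0 (2 * r) ==> h z = 0"
  then show ?thesis by (intro exI[of _ h] exI[of _ h']) simp
 qed
 then obtain h h' where h: "C1f UNIV h h'" "!!z. z \<in> cball w0 (4 / 3 * r) ==> h z = 1" "!!z. z ~: ball w0 (2 * r) ==> h z = 0"
  by auto
 let ?W = "- cball w0 r" and ?K = "- ball w0 (4 / 3 * r)"
 let ?l = "farlog w0 a b"
 let ?u = "%z. (1 - h z) * (1 / (2 * pi) * Im (?l z))"
 let ?u' = "%z v. (1 - h z) * (1 / (2 * pi) * Im (deriv ?l z * v)) + (0 - h' z v) * (1 / (2 * pi) * Im (?l z))"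
 have d: "(?l has_field_derivative 1 / (z - b) - 1 / (z - a)) (at z)" if "z \<in> ?W" for z
  using farlog_deriv[OF a b _ r] that by auto
 have hol: "?l holomorphic_on ?W" unfolding holomorphic_on_def field_differentiable_def
 proof
  fix z assume z: "z \<in> ?W"
  show "\<exists>f'. (?l has_field_derivative f') (at z within ?W)"
   by (rule exI, rule has_field_derivative_at_within[OF d[OF z]])
 qed
 have C: "C1f ?W ?u ?u'"
  by (intro C1f_mult C1f_diff C1f_const C1f_subset[OF h(1)] C1f_cmult C1f_Im[OF hol]) auto
 have W: "open ?W" "closed ?K" "?K \<subseteq> ?W" using r by auto
 have E: "C1f UNIV ?u (%z v. if z \<in> ?K then ?u' z v else 0)"
  by (rule C1f_extend0[OF C W]) (use h(2) in auto)
 have h'0: "h' z v = 0" if z: "z ~: cball w0 (2 * r)" for z v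
  by (rule C1f_zero_outside[OF h(1) closed_cball _ z]) (use h(3) in auto)
 show ?thesis
 proof (rule exI[of _ ?u], rule exI, intro conjI allI impI, rule E)
  fix z v assume z: "z ~: cball w0 (2 * r)"
  then have zW: "z \<in> ?W" "z \<in> ?K" "z ~: ball w0 (2 * r)" using r by auto
  have "deriv ?l z = 1 / (z - b) - 1 / (z - a)" by (rule DERIV_imp_deriv[OF d[OF zW(1)]])
  then have iv: "Im (deriv ?l z * v) = Im (v / (z - b)) - Im (v / (z - a))" by (simp add: left_diff_distrib)
  show "arc_kernel a b (%z v. if z \<in> ?K then ?u' z v else 0) z v = 0"
   using zW h'0[OF z] h(3)[OF zW(3)] by (simp add: arc_kernel_def iv diff_divide_distrib del: times_complex.simps)
 next
  fix z assume "z ~: cball w0 (2 * r)"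
  then have "z ~: ball w0 (2 * r)" by auto
  then show "?u z = Im (?l z) / (2 * pi)" using h(3) by simp
 qed
qed

lemma Im_pole_linear: "linear (%v. Im (v / w))"
 by (rule linearI) (auto simp: add_divide_distrib scaleR_conv_of_real simp flip: times_divide_eq_right)

lemma arc_kernel_linear:
 assumes "C1f UNIV E E'" shows "linear (arc_kernel a b E' z)"
proof (rule linearI)
 note l = Im_pole_linear[of "z - a"] Im_pole_linear[of "z - b"] C1f_lin[OF assms UNIV_I, of z]
 show "arc_kernel a b E' z (x + y) = arc_kernel a b E' z x + arc_kernel a b E' z y" for x y
  unfolding arc_kernel_def linear_add[OF l(1)] linear_add[OF l(2)] linear_add[OF l(3)] by (simp add: field_simps)
 show "arc_kernel a b E' z (k *\<^sub>R x) = k *\<^sub>R arc_kernel a b E' z x" for k x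
  unfolding arc_kernel_def linear_cmul[OF l(1)] linear_cmul[OF l(2)] linear_cmul[OF l(3)] by (simp add: field_simps)
qed

text \<open>The pole formula \<open>wd_Im_pole\<close> at \<open>a\<close> and at \<open>b\<close>,
  and \<open>plane_stokes\<close> for the exact term.\<close>

lemma arc_kernel_integral:
 assumes E: "C1f UNIV E E'" and p: "C1f UNIV p p'" "!!z. z ~: cball 0 R0 ==> p z = 0"
 shows "integrable lborel (wd (arc_kernel a b E') p')" "integral\<^sup>L lborel (wd (arc_kernel a b E') p') = p a - p b"
proof -
 let ?i = "%a z v. Im (v / (z - a))"
 have s: "p z = 0" if "z ~: cball x (R0 + cmod x)" for z x
  using p(2)[of z] that norm_triangle_ineq4[of z x] by (auto simp: dist_norm norm_minus_commute)
 note i = wd_Im_pole[OF p(1) s] and j = plane_stokes[OF E p]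
 have e: "wd (arc_kernel a b E') p' = (%z. (wd (?i a) p' z - wd (?i b) p' z) / (2 * pi) + wd E' p' z)"
  by (rule ext) (simp add: wd_def arc_kernel_def field_simps)
 have 1: "integrable lborel (%z. (wd (?i a) p' z - wd (?i b) p' z) / (2 * pi))"
  by (rule integrable_divide[OF Bochner_Integration.integrable_diff[OF i(1) i(1)]])
 show "integrable lborel (wd (arc_kernel a b E') p')" unfolding e
  by (rule Bochner_Integration.integrable_add[OF 1 j(1)])
 have "integral\<^sup>L lborel (%z. wd (?i a) p' z - wd (?i b) p' z) = 2 * pi * p a - 2 * pi * p b"
  using Bochner_Integration.integral_diff[OF i(1)[of a] i(1)[of b]] i(2)[of a] i(2)[of b] by simp
 then have "integral\<^sup>L lborel (%z. (wd (?i a) p' z - wd (?i b) p' z) / (2 * pi)) = p a - p b"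
  unfolding integral_divide_zero by (simp add: diff_divide_distrib)
 then show "integral\<^sup>L lborel (wd (arc_kernel a b E') p') = p a - p b" unfolding e
  using Bochner_Integration.integral_add[OF 1 j(1)] j(2) by simp
qed

context compact_surface
begin

section \<open>Forms dual to arcs and their concatenation\<close>

definition supp_in :: "'a form1 => 'a set => bool" where
 "supp_in \<eta> L \<longleftrightarrow> (\<forall>d\<in>A. \<forall>x\<in>cdom d. x ~: L --> (\<forall>v. \<eta> d x v = 0))"

lemma closed_cinv_cball:
 assumes "c \<in> A" "cball w r \<subseteq> crd c ` cdom c" shows "closed (cinv c ` cball w r)"
 by (rule compact_imp_closed) (intro compact_continuous_image continuous_on_subset[OF continuous_cinv[OF assms(1)] assms(2)] compact_cball)

lemma push_supp:
 assumes c: "c \<in> A" and 0: "!!z v. z ~: K ==> N z v = 0"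
 shows "supp_in (push c N) (cinv c ` K)"
 unfolding supp_in_def push_def using c 0 by (auto intro!: 0 image_eqI[of _ "cinv c"])

text \<open>A closed form with opposite residues at two points of a disc, supported in the disc; it is
 dual to the arcs in the disc that join the two points.\<close>

lemma arc_form:
 assumes c: "c \<in> A" and r: "r > 0" "2 * r < R" and R: "ball w0 R \<subseteq> crd c ` cdom c"
  and p: "p \<in> cdom c" "crd c p \<in> ball w0 r" and q: "q \<in> cdom c" "crd c q \<in> ball w0 r"
  and E: "C1f UNIV E E'" and E0: "!!z v. z ~: cball w0 (2 * r) ==> arc_kernel (crd c p) (crd c q) E' z v = 0"
 defines "\<eta> \<equiv> push c (arc_kernel (crd c p) (crd c q) E')"
 shows "sform {p, q} \<eta> (%x. of_bool (x = p) - of_bool (x = q))" (is ?A)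
  and "supp_in \<eta> (cinv c ` cball w0 (2 * r))" (is ?B)
  and "!!om F. hol UNIV om ==> C1f (ball w0 R) F (dpull c om) ==> integ UNIV (wedge \<eta> om) = F (crd c p) - F (crd c q)"
  and "cov1 UNIV \<eta>"
proof -
 let ?a = "crd c p" and ?b = "crd c q"
 let ?N = "arc_kernel ?a ?b E'"
 have lin: "linear (?N z)" for z by (rule arc_kernel_linear[OF E])
 show cov: "cov1 UNIV \<eta>" unfolding \<eta>_def by (rule push_cov1[OF c lin])
 have Rc: "cball w0 (2 * r) \<subseteq> crd c ` cdom c" using R r by (intro subset_trans[OF _ R]) auto
 show B: ?B unfolding \<eta>_def by (rule push_supp[OF c E0])
 \<comment> \<open>The conclusion of \<open>inverse_primitive\<close> as a predicate, to be
   instantiated at each of the two end points.\<close>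
 define ipp where "ipp z a s G \<longleftrightarrow> s > 0 & G holomorphic_on ball z s &
   (\<forall>w\<in>ball z s. w ~= z --> 1 / (w - a) = (if a = z then 1 / (w - z) else 0) + deriv G w) &
   (a ~= z --> 1 / (z - a) = deriv G z)" for z a :: complex and s :: real and G
 have ip: "\<exists>s G. ipp z a s G" for a z
 proof (rule inverse_primitive[where a = a and ?z1.0 = z])
  fix s G assume "s > 0" "G holomorphic_on ball z s"
   "!!w. w \<in> ball z s ==> w ~= z ==> 1 / (w - a) = (if a = z then 1 / (w - z) else 0) + deriv G w"
   "a ~= z ==> 1 / (z - a) = deriv G z"
  then show ?thesis unfolding ipp_def by (intro exI[of _ s] exI[of _ G]) auto
 qed
 define m where "m x = of_bool (x = p) - (of_bool (x = q) :: real)" for x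
 \<comment> \<open>One local description for all points: a pole at an end point, regularity
   elsewhere. The residue \<open>m\<close> is a difference of truth values, so that coinciding end
   points give residue 0.\<close>
 have loc: "\<exists>s>0. \<exists>u u'. C1f (ball (crd c x) s) u u' &
   (\<forall>z\<in>ball (crd c x) s. z ~= crd c x --> (\<forall>v. ?N z v = m x / (2 * pi) * Im (v / (z - crd c x)) + u' z v)) &
   (m x = 0 & x ~= p & x ~= q --> (\<forall>v. ?N (crd c x) v = u' (crd c x) v))" if x: "x \<in> cdom c" for x
 proof -
  let ?z = "crd c x"
  have xp: "?a = ?z \<longleftrightarrow> x = p" "?b = ?z \<longleftrightarrow> x = q" using inj_on_crd[OF c] x p q by (auto dest: inj_onD)
  obtain s1 G1 where "ipp ?z ?a s1 G1" using ip by blast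
  then have G1: "s1 > 0" "G1 holomorphic_on ball ?z s1"
   "!!z. z \<in> ball ?z s1 ==> z ~= ?z ==> 1 / (z - ?a) = (if ?a = ?z then 1 / (z - ?z) else 0) + deriv G1 z"
   "?a ~= ?z ==> 1 / (?z - ?a) = deriv G1 ?z" unfolding ipp_def by blast+
  obtain s2 G2 where "ipp ?z ?b s2 G2" using ip by blast
  then have G2: "s2 > 0" "G2 holomorphic_on ball ?z s2"
   "!!z. z \<in> ball ?z s2 ==> z ~= ?z ==> 1 / (z - ?b) = (if ?b = ?z then 1 / (z - ?z) else 0) + deriv G2 z"
   "?b ~= ?z ==> 1 / (?z - ?b) = deriv G2 ?z" unfolding ipp_def by blast+
  define s where "s = min s1 s2"
  let ?u' = "%z v. 1 / (2 * pi) * (Im (deriv G1 z * v) - Im (deriv G2 z * v)) + E' z v"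
  have C: "C1f (ball ?z s) (%z. 1 / (2 * pi) * (Im (G1 z) - Im (G2 z)) + E z) ?u'"
   by (intro C1f_add C1f_cmult C1f_diff C1f_subset[OF C1f_Im[OF G1(2) open_ball]] C1f_subset[OF C1f_Im[OF G2(2) open_ball]] C1f_subset[OF E])
    (auto simp: s_def)
  have v: "Im (v / w) = Im (1 / w * v)" for v w :: complex by simp
  have e: "?N z v = m x / (2 * pi) * Im (v / (z - ?z)) + ?u' z v" if z: "z \<in> ball ?z s" "z ~= ?z" for z v
  proof -
   have z12: "z \<in> ball ?z s1" "z \<in> ball ?z s2" using z(1) by (auto simp: s_def)
   have "?N z v = (Im (1 / (z - ?a) * v) - Im (1 / (z - ?b) * v)) / (2 * pi) + E' z v"
    by (simp add: arc_kernel_def)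
   also have "\<dots> = m x / (2 * pi) * Im (v / (z - ?z)) + ?u' z v"
    unfolding G1(3)[OF z12(1) z(2)] G2(3)[OF z12(2) z(2)] xp m_def
    by (cases "x = p"; cases "x = q") (simp_all add: distrib_right diff_divide_distrib add_divide_distrib)
   finally show ?thesis .
  qed
  have e0: "?N ?z v = ?u' ?z v" if "x ~= p" "x ~= q" for v
  proof -
   have g: "1 / (?z - ?a) = deriv G1 ?z" "1 / (?z - ?b) = deriv G2 ?z" using that xp G1(4) G2(4) by auto
   have "?N ?z v = (Im (1 / (?z - ?a) * v) - Im (1 / (?z - ?b) * v)) / (2 * pi) + E' ?z v"
    by (simp add: arc_kernel_def)
   also have "\<dots> = ?u' ?z v" unfolding g by simp
   finally show ?thesis .
  qed
  have "s > 0" using G1(1) G2(1) by (simp add: s_def)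
  then show ?thesis using C e e0 by (intro exI[of _ s] conjI exI[of _ ?u'] exI[of _ "%z. 1 / (2 * pi) * (Im (G1 z) - Im (G2 z)) + E z"]) auto
 qed
 have lxz: "locex (- cinv c ` cball w0 (2 * r)) \<eta>"
 proof (rule prim_locex)
  show o: "open (- cinv c ` cball w0 (2 * r))" using closed_cinv_cball[OF c Rc] by blast
  show "prim (- cinv c ` cball w0 (2 * r)) \<eta> (%p. 0)"
   by (rule prim_cong[OF prim_const[of _ 0] o]) (use B in \<open>auto simp: supp_in_def\<close>)
 qed
 have lx: "locex (- {p, q}) \<eta>"
  unfolding locex_def
 proof
  fix x assume x: "x \<in> - {p, q}"
  show "\<exists>V f. open V & x \<in> V & prim V \<eta> f"
  proof (cases "x \<in> cinv c ` cball w0 (2 * r)")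
   case False
   then show ?thesis using locexD[OF lxz, of x] by blast
  next
   case True
   then have xc: "x \<in> cdom c" using cinv_in_cdom[OF c] Rc by blast
   have m0: "m x = 0" "x ~= p" "x ~= q" using x by (auto simp: m_def)
   obtain s u u' where s: "s > 0" "C1f (ball (crd c x) s) u u'"
    "!!z v. z \<in> ball (crd c x) s ==> z ~= crd c x ==> ?N z v = m x / (2 * pi) * Im (v / (z - crd c x)) + u' z v"
    "!!v. ?N (crd c x) v = u' (crd c x) v" using loc[OF xc] m0 by blast
   obtain t where t: "t > 0" "cball (crd c x) t \<subseteq> crd c ` (cdom c Int UNIV)" using ex_cball[OF c xc open_UNIV UNIV_I] by blast
   define W where "W = ball (crd c x) (min s t)"
   have W: "W \<subseteq> crd c ` cdom c" "W \<subseteq> ball (crd c x) s" using t(2) by (auto simp: W_def subset_iff)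
   have o: "open (cinv c ` W)" by (rule open_cinv_image[OF c _ W(1)]) (simp add: W_def)
   have sub: "cinv c ` W \<subseteq> cdom c" using cinv_in_cdom[OF c] W(1) by blast
   have Wo: "open W" by (simp add: W_def)
   have "C1f W u (dpull c \<eta>)"
   proof (rule C1f_cong'[OF C1f_subset[OF s(2) W(2)] Wo])
    fix z v assume z: "z \<in> W"
    have "dpull c \<eta> z v = ?N z v" unfolding \<eta>_def by (rule dpull_push[OF c]) (use z W in blast)
    also have "\<dots> = u' z v" using s(3)[of z v] s(4) z W(2) m0 by (cases "z = crd c x") auto
    finally show "u' z v = dpull c \<eta> z v" by simp
   qed simp
   then have "prim (cinv c ` W) \<eta> (%p. u (crd c p))"
    by (intro prim_of_chart[OF c o sub cov1_subset[OF cov]]) (simp_all add: crd_cinv_image[OF c W(1)])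
   moreover have "x \<in> cinv c ` W" using c xc s(1) t(1) by (auto simp: W_def intro!: image_eqI[of _ _ "crd c x"])
   ultimately show ?thesis using o by blast
  qed
 qed
 show ?A unfolding sform_def
 proof (intro conjI lx allI ballI impI)
  fix x d assume d: "d \<in> A" "x \<in> cdom d"
  show "pole_at d \<eta> x (of_bool (x = p) - of_bool (x = q))"
  proof (cases "x \<in> cdom c")
   case True
   obtain s u u' where s: "s > 0" "C1f (ball (crd c x) s) u u'"
    "!!z v. z \<in> ball (crd c x) s ==> z ~= crd c x ==> ?N z v = m x / (2 * pi) * Im (v / (z - crd c x)) + u' z v"
    using loc[OF True] by blast
   have "pole_at c \<eta> x (m x)"
   proof (rule pole_atI[OF c True s(1,2)])
    fix z v assume z: "z \<in> ball (crd c x) s" "z \<in> crd c ` cdom c" "z ~= crd c x"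
    show "dpull c \<eta> z v = m x / (2 * pi) * Im (v / (z - crd c x)) + u' z v"
     unfolding \<eta>_def dpull_push[OF c z(2)] by (rule s(3)[OF z(1,3)])
   qed
   from pole_change[OF c True d cov this] show ?thesis by (simp add: m_def)
  next
   case False
   then have "x \<in> - {p, q}" using p q by auto
   moreover have "open (- {p, q})" by auto
   ultimately show ?thesis using pole_at_locex[OF lx _ _ d] by auto
  qed
 qed simp
 fix om F assume w: "hol UNIV om" and F: "C1f (ball w0 R) F (dpull c om)"
 have "\<exists>f f'. C1f UNIV f f' & (\<forall>z\<in>cball w0 (2 * r). f z = F z & f' z = dpull c om z) & (\<forall>z. z ~: ball w0 R --> f z = 0)"
 proof (rule cutoff_primitive[OF F _ r(2)])
  fix f f' assume "C1f UNIV f f'" "!!z. z \<in> cball w0 (2 * r) ==> f z = F z & f' z = dpull c om z" "!!z. z ~: ball w0 R ==> f z = 0"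
  then show ?thesis by (intro exI[of _ f] exI[of _ f']) simp
 qed (use r in simp)
 then obtain f f' where f: "C1f UNIV f f'" "!!z. z \<in> cball w0 (2 * r) ==> f z = F z & f' z = dpull c om z"
  "!!z. z ~: ball w0 R ==> f z = 0" by blast
 have f0: "f z = 0" if "z ~: cball 0 (R + cmod w0)" for z
  using f(3)[of z] that norm_triangle_sub[of z w0] by (auto simp: dist_norm norm_minus_commute)
 note ii = arc_kernel_integral[OF E f(1) f0]
 have "cov1 UNIV om" using w by (simp add: hol_def)
 then have "integ UNIV (wedge \<eta> om) = integral\<^sup>L lborel (wd ?N f')" unfolding \<eta>_def
  by (intro integ_push(2)[OF c Rc lin E0]) (use f(2) ii(1) in auto)
 also have "\<dots> = F ?a - F ?b" using ii(2) f(2) p(2) q(2) r(1) by auto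
 finally show "integ UNIV (wedge \<eta> om) = F (crd c p) - F (crd c q)" .
qed

text \<open>The value is minus the integral of \<open>om\<close> along the arc from
  \<open>b s\<close> to \<open>b t\<close>. The closed set \<open>L\<close> is kept because the form
  has no period on a closed curve that avoids it.\<close>

definition dual_form :: "(real => 'a) => real => real => 'a set => 'a form1 => 'a set => bool" where
 "dual_form b s t L \<eta> P \<longleftrightarrow> sform P \<eta> (%x. of_bool (x = b s) - of_bool (x = b t)) & closed L & P \<subseteq> L & supp_in \<eta> L &
  (\<forall>om F. hol UNIV om --> lft om {s..t} b F --> integ (- P) (wedge \<eta> om) = F s - F t)"

lemma integ_more_points:
 assumes "finite P" "finite Q" "P \<subseteq> Q" shows "integ (- Q) \<theta> = integ (- P) \<theta>"
proof -
 have "- Q = - P - Q" using assms(3) by blast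
 then show ?thesis using integ_null(2)[OF assms(2) borel_finite(2)[OF assms(1)], of \<theta>] by simp
qed

lemma integ_finite: "finite P ==> integ (- P) \<theta> = integ UNIV \<theta>"
 using integ_more_points[of "{}" P \<theta>] by simp

lemma intble_finite: "finite P ==> intble (- P) \<theta> \<longleftrightarrow> intble UNIV \<theta>"
 using integ_null(1)[of P UNIV \<theta>] by (simp add: Compl_eq_Diff_UNIV)

lemma sform_intble: assumes s: "sform P \<eta> N" and w: "locex UNIV om" shows "intble UNIV (wedge \<eta> om)"
proof -
 have f: "finite P" using s by (simp add: sform_def)
 show ?thesis using intble_wedge[OF f sform_tame[OF s] w] intble_finite[OF f] by simp
qed

lemma wedge_add_left: "wedge (%c p v. \<eta> c p v + \<eta>' c p v) om = (%c p. 1 * wedge \<eta> om c p + 1 * wedge \<eta>' om c p)"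
 by (intro ext) (simp add: wedge_def algebra_simps)

lemma sform_integ_add:
 assumes "sform P \<eta> N" "sform Q \<eta>' N'" "locex UNIV om"
 shows "integ UNIV (wedge (%c p v. \<eta> c p v + \<eta>' c p v) om) = integ UNIV (wedge \<eta> om) + integ UNIV (wedge \<eta>' om)"
 unfolding wedge_add_left using integ_linear(2)[OF sform_intble[OF assms(1,3)] sform_intble[OF assms(2,3)], of 1 1] by simp

text \<open>The residues -1 and 1 at the common end point cancel, and a lift along the long arc
  restricts to lifts along both parts.\<close>

lemma dual_form_join:
 assumes 1: "dual_form b s t L \<eta> P" and 2: "dual_form b t u M \<eta>' Q" and st: "s <= t" "t <= u"
 shows "dual_form b s u (L Un M) (%c p v. \<eta> c p v + \<eta>' c p v) (P Un Q)"
 unfolding dual_form_def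
proof (intro conjI allI impI)
 have s: "sform P \<eta> (%x. of_bool (x = b s) - of_bool (x = b t))" "sform Q \<eta>' (%x. of_bool (x = b t) - of_bool (x = b u))"
  using 1 2 by (auto simp: dual_form_def)
 then have f: "finite P" "finite Q" by (auto simp: sform_def)
 show "sform (P Un Q) (%c p v. \<eta> c p v + \<eta>' c p v) (%x. of_bool (x = b s) - of_bool (x = b u))"
  using sform_add[OF s] by simp
 show "closed (L Un M)" "P Un Q \<subseteq> L Un M" "supp_in (%c p v. \<eta> c p v + \<eta>' c p v) (L Un M)"
  using 1 2 by (auto simp: dual_form_def supp_in_def)
 fix om F assume w: "hol UNIV om" and F: "lft om {s..u} b F"
 have lw: "locex UNIV om" by (rule hol_locex[OF w open_UNIV])
 have "lft om {s..t} b F" "lft om {t..u} b F" by (rule lft_subset[OF F]; use st in simp)+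
 then have "integ UNIV (wedge \<eta> om) = F s - F t" "integ UNIV (wedge \<eta>' om) = F t - F u"
  using 1 2 w integ_finite[OF f(1)] integ_finite[OF f(2)] by (simp_all add: dual_form_def)
 then show "integ (- (P Un Q)) (wedge (%c p v. \<eta> c p v + \<eta>' c p v) om) = F s - F u"
  using sform_integ_add[OF s lw] integ_finite[of "P Un Q"] f by simp
qed

text \<open>The test form has a primitive on the whole disc, and the arc stays in the disc. The
  increment of any lift is therefore the difference of that primitive at the end points, which is
  what the kernel computes.\<close>

lemma arc_dual_form:
 assumes c: "c \<in> A" and r: "r > 0" "2 * r < R" and R: "ball w0 R \<subseteq> crd c ` cdom c"
  and b: "continuous_on {x..y} b" "x <= y" "!!t. t \<in> {x..y} ==> b t \<in> cdom c & crd c (b t) \<in> ball w0 r"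
  and E: "C1f UNIV E E'" "!!z v. z ~: cball w0 (2 * r) ==> arc_kernel (crd c (b x)) (crd c (b y)) E' z v = 0"
 shows "dual_form b x y (cinv c ` cball w0 (2 * r)) (push c (arc_kernel (crd c (b x)) (crd c (b y)) E')) {b x, b y}"
proof -
 let ?\<eta> = "push c (arc_kernel (crd c (b x)) (crd c (b y)) E')"
 have bx: "b x \<in> cdom c" "crd c (b x) \<in> ball w0 r" "b y \<in> cdom c" "crd c (b y) \<in> ball w0 r" using b(2) b(3)[of x] b(3)[of y] by auto
 have Rc: "cball w0 (2 * r) \<subseteq> crd c ` cdom c" using R r by (intro subset_trans[OF _ R]) auto
 note af = arc_form[OF c r R bx E]
 show ?thesis unfolding dual_form_def
 proof (intro conjI allI impI)
  show "sform {b x, b y} ?\<eta> (%p. of_bool (p = b x) - of_bool (p = b y))" by (rule af(1))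
  show "closed (cinv c ` cball w0 (2 * r))" by (rule closed_cinv_cball[OF c Rc])
  show "supp_in ?\<eta> (cinv c ` cball w0 (2 * r))" by (rule af(2))
  have "p \<in> cinv c ` cball w0 (2 * r)" if "p \<in> cdom c" "crd c p \<in> ball w0 r" for p
   using that c r(1) by (intro image_eqI[of _ _ "crd c p"]) auto
  then show "{b x, b y} \<subseteq> cinv c ` cball w0 (2 * r)" using bx by blast
  fix om F assume w: "hol UNIV om" and F: "lft om {x..y} b F"
  obtain G where G: "C1f (ball w0 R) G (dpull c om)" using hol_disc_primitive[OF w c, of w0 R] R by auto
  have cov: "cov1 UNIV om" using w by (simp add: hol_def)
  let ?V = "cinv c ` ball w0 R"
  have V: "open ?V" "?V \<subseteq> cdom c" using open_cinv_image[OF c open_ball R] cinv_in_cdom[OF c] R by blast+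
  have "prim ?V om (%p. G (crd c p))"
   by (rule prim_of_chart[OF c V cov1_subset[OF cov subset_UNIV]]) (simp add: crd_cinv_image[OF c R] G)
  then have pG: "primitive_on A ?V om (%p. G (crd c p))" by (rule prim_primitive_on)
  have "b ` {x..y} \<subseteq> ?V"
  proof
   fix p assume "p \<in> b ` {x..y}"
   then obtain t where "t \<in> {x..y}" "p = b t" by blast
   then show "p \<in> ?V" using b(3)[of t] r c by (intro image_eqI[of _ _ "crd c p"]) auto
  qed
  then have "lft om {x..y} b (%t. G (crd c (b t)))" by (rule lft_primitive[OF pG V(1)])
  then have "F y - F x = G (crd c (b y)) - G (crd c (b x))"
   by (rule lft_unique[OF b(1) connected_Icc F]) (use b(2) in auto)
  then show "integ (- {b x, b y}) (wedge ?\<eta> om) = F x - F y" using af(3)[OF _ w G] integ_finite[of "{b x, b y}"] by simp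
 qed
qed

text \<open>Bisection of the parameter interval: short arcs lie in coordinate discs inside
  \<open>W\<close>, longer ones are concatenated by \<open>dual_form_join\<close>.\<close>

lemma ex_dual_form:
 assumes b: "continuous_on {s..t} b" "s <= t" and W: "open W" "b ` {s..t} \<subseteq> W"
 shows "\<exists>L \<eta> P. L \<subseteq> W & dual_form b s t L \<eta> P"
proof -
 let ?P = "%x y. s <= x & y <= t --> (\<exists>L \<eta> P. L \<subseteq> W & dual_form b x y L \<eta> P)"
 have "?P s t"
 proof (rule Bolzano[where P = ?P, OF b(2)])
  fix x y z assume trans: "?P x y" "?P y z" "x <= y" "y <= z"
  show "?P x z"
  proof
   assume xz: "s <= x & z <= t"
   then have "s <= x & y <= t" "s <= y & z <= t" using trans(3,4) by auto
   obtain L \<eta> P where 1: "L \<subseteq> W" "dual_form b x y L \<eta> P" using trans(1) \<open>s <= x & y <= t\<close> by blast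
   obtain M \<eta>' Q where 2: "M \<subseteq> W" "dual_form b y z M \<eta>' Q" using trans(2) \<open>s <= y & z <= t\<close> by blast
   have "L Un M \<subseteq> W" using 1(1) 2(1) by blast
   with dual_form_join[OF 1(2) 2(2) trans(3,4)] show "\<exists>L \<eta> P. L \<subseteq> W & dual_form b x z L \<eta> P"
    by (intro exI conjI)
  qed
 next
  fix x assume local: "s <= x" "x <= t"
  then have bx: "b x \<in> W" using W(2) by auto
  obtain c where c: "c \<in> A" "b x \<in> cdom c" using chart_cover by blast
  obtain R where R: "R > 0" "cball (crd c (b x)) R \<subseteq> crd c ` (cdom c Int W)" using ex_cball[OF c W(1) bx] by blast
  define w0 where "w0 = crd c (b x)"
  \<comment> \<open>A quarter of \<open>R\<close> leaves room for the disc of radius 2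
    \<open>r\<close> that carries the form, inside the disc of radius \<open>R\<close> in which
    primitives are taken.\<close>
  define r where "r = R / 4"
  have r: "r > 0" "2 * r < R" using R(1) by (auto simp: r_def)
  have Rb: "ball w0 R \<subseteq> crd c ` (cdom c Int W)" "ball w0 R \<subseteq> crd c ` cdom c" using R(2) ball_subset_cball unfolding w0_def by blast+
  have Rr: "ball w0 r \<subseteq> crd c ` cdom c" using r Rb(2) by (intro subset_trans[OF _ Rb(2)]) auto
  have o: "open (cinv c ` ball w0 r)" by (rule open_cinv_image[OF c(1) open_ball Rr])
  have "b x \<in> cinv c ` ball w0 r" using c r by (auto simp: w0_def intro!: image_eqI[of _ _ "crd c (b x)"])
  then have "\<forall>\<^sub>F y in nhds x. y \<in> {s..t} --> b y \<in> cinv c ` ball w0 r"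
   using eventually_in_nhd[OF b(1) _ o] local by auto
  then obtain d where d: "d > 0" "!!y. dist y x < d ==> y \<in> {s..t} ==> b y \<in> cinv c ` ball w0 r"
   unfolding eventually_nhds_metric by blast
  show "\<exists>d>0. \<forall>y z. y <= x & x <= z & z - y < d --> ?P y z"
  proof (rule exI[of _ d], intro conjI allI impI d(1))
   fix y z assume yz: "y <= x & x <= z & z - y < d" "s <= y & z <= t"
   have bt: "b u \<in> cdom c & crd c (b u) \<in> ball w0 r" if u: "u \<in> {y..z}" for u
   proof -
    have "b u \<in> cinv c ` ball w0 r" by (rule d(2)) (use u yz in \<open>auto simp: dist_real_def\<close>)
    then obtain w where "w \<in> ball w0 r" "b u = cinv c w" by blast
    then show ?thesis using Rr c(1) cinv_in_cdom[OF c(1)] crd_cinv[OF c(1)] by (metis subsetD)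
   qed
   have yz': "y <= z" using yz by simp
   have bb: "crd c (b y) \<in> ball w0 r" "crd c (b z) \<in> ball w0 r" using bt[of y] bt[of z] yz' by auto
   obtain E E' where E: "C1f UNIV E E'" "!!u v. u ~: cball w0 (2 * r) ==> arc_kernel (crd c (b y)) (crd c (b z)) E' u v = 0"
    using arc_kernel_exists[OF r(1) bb] by auto
   have cy: "continuous_on {y..z} b" by (rule continuous_on_subset[OF b(1)]) (use yz in auto)
   have cW: "cball w0 (2 * r) \<subseteq> crd c ` (cdom c Int W)" using r by (intro subset_trans[OF _ Rb(1)]) auto
   have LW: "cinv c ` cball w0 (2 * r) \<subseteq> W"
   proof
    fix p assume "p \<in> cinv c ` cball w0 (2 * r)"
    then obtain u where u: "u \<in> cball w0 (2 * r)" "p = cinv c u" by blast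
    then obtain q where q: "q \<in> cdom c" "q \<in> W" "u = crd c q" using cW by blast
    then show "p \<in> W" using u(2) cinv_crd[OF c(1) q(1)] by simp
   qed
   with arc_dual_form[OF c(1) r Rb(2) cy yz' bt E] show "\<exists>L \<eta> P. L \<subseteq> W & dual_form b y z L \<eta> P"
    by (intro exI conjI)
  qed
 qed
 then show ?thesis by simp
qed

end

section \<open>Intersection numbers\<close>

text \<open>Here d is the increment of a continuous logarithm along the path. In this form the
  contributions of the sides of a rectangle can be added.\<close>

definition log_side :: "(real => complex) => complex => bool" where
 "log_side f d \<longleftrightarrow> path f & 0 ~: path_image f & winding_number f 0 = d / (2 * of_real pi * \<i>)"

lemma log_sideI:
 assumes m: "continuous_on {0..1} m" and f: "!!u. u \<in> {0..1} ==> f u = exp (m u)"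
 shows "log_side f (m 1 - m 0)"
 unfolding log_side_def
proof (intro conjI)
 have pm: "path m" using m by (simp add: path_def)
 have "continuous_on {0..1} (%u. exp (m u))" by (intro continuous_on_exp m)
 then show "path f" unfolding path_def by (rule continuous_on_eq) (simp add: f)
 show "0 ~: path_image f" using f by (auto simp: path_image_def)
 have "winding_number f 0 = winding_number (exp \<circ> m) 0" by (rule winding_number_cong) (simp add: f)
 then show "winding_number f 0 = (m 1 - m 0) / (2 * of_real pi * \<i>)"
  using winding_number_compose_exp[OF pm] by (simp add: pathfinish_def pathstart_def)
qed

lemma log_side_join:
 assumes "log_side f d" "log_side g e" "pathfinish f = pathstart g"
 shows "log_side (f +++ g) (d + e)"
 using assms winding_number_join[of f 0 g] unfolding log_side_def
 by (auto simp: path_image_join add_divide_distrib)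

lemma log_side_minus_one:
 assumes "log_side f X" "winding_number f 0 = - 1" shows "X = - 2 * of_real pi * \<i>"
proof -
 have c: "2 * of_real pi * \<i> ~= (0 :: complex)" by simp
 have "- 1 = X / (2 * of_real pi * \<i>)" using assms unfolding log_side_def by metis
 then have "- 1 * (2 * of_real pi * \<i>) = X" using nonzero_eq_divide_eq[OF c, of "- 1" X] by metis
 then show ?thesis by simp
qed

text \<open>Continues a curve by constants beyond its parameter interval, so that the difference of
  two curves becomes a map on the whole plane.\<close>

definition clamp1 :: "real => real => real" where "clamp1 d x = max (- d) (min d x)"

text \<open>A loop that runs around the rectangle winds once around the origin, and so does every map
 that vanishes only at the origin, up to the degree of the map.\<close>

lemma winding_difference:
 fixes A B :: "real => complex"
 assumes A: "continuous_on {-d..d} A" and B: "continuous_on {-e..e} B" and de: "0 < d" "0 < e"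
  and ne: "!!x y. x \<in> {-d..d} ==> y \<in> {-e..e} ==> A x = B y ==> x = 0 & y = 0"
  and r: "0 < r" "r <= d" "r <= e"
  and wn: "winding_number (%u. A (r * sin (2 * pi * u)) - B (r * cos (2 * pi * u))) 0 = 1"
  and Mp: "continuous_on {-d..d} Mp" "!!x. x \<in> {-d..d} ==> A x - B (- e) = exp (Mp x)"
  and Mq: "continuous_on {-d..d} Mq" "!!x. x \<in> {-d..d} ==> A x - B e = exp (Mq x)"
  and far: "!!y. y \<in> {-e..e} ==> B y \<in> ball w0 \<rho>" "A d ~: cball w0 \<rho>" "A (- d) ~: cball w0 \<rho>"
 shows "Mp d - Mp (- d) - (Mq d - Mq (- d)) + farlog w0 (B (- e)) (B e) (A d) - farlog w0 (B (- e)) (B e) (A (- d)) = - 2 * of_real pi * \<i>"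
proof -
 define T where "T z = A (clamp1 d (Re z)) - B (clamp1 e (Im z))" for z
 have cl: "clamp1 d x \<in> {-d..d}" "clamp1 e x \<in> {-e..e}" for x using de by (auto simp: clamp1_def)
 have cle: "x \<in> {-d..d} ==> clamp1 d x = x" "x \<in> {-e..e} ==> clamp1 e x = x" for x by (auto simp: clamp1_def)
 have cc: "continuous_on UNIV (%z. clamp1 d (Re z))" "continuous_on UNIV (%z. clamp1 e (Im z))"
  unfolding clamp1_def by (intro continuous_intros)+
 have T: "continuous_on UNIV T" unfolding T_def
  by (intro continuous_on_diff continuous_on_compose2[OF A cc(1)] continuous_on_compose2[OF B cc(2)]) (use cl in auto)
 have T0: "T z ~= 0" if "z ~= 0" for z
 proof
  assume "T z = 0"
  then have "A (clamp1 d (Re z)) = B (clamp1 e (Im z))" by (simp add: T_def)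
  from ne[OF cl this] have "clamp1 d (Re z) = 0 & clamp1 e (Im z) = 0" .
  then have "Re z = 0" "Im z = 0" using de by (auto simp: clamp1_def max_def min_def split: if_splits)
  then show False using that by (simp add: complex_eq_iff)
 qed
 define C where "C u = Complex (r * sin (2 * pi * u)) (r * cos (2 * pi * u))" for u
 define a1 a3 where "a1 = Complex (- d) (- e)" and "a3 = Complex d e"
 define R where "R = rectpath a1 a3"
 define a2 a4 where "a2 = Complex d (- e)" and "a4 = Complex (- d) e"
 have R: "R = linepath a1 a2 +++ linepath a2 a3 +++ linepath a3 a4 +++ linepath a4 a1"
  by (simp add: R_def rectpath_def Let_def a1_def a2_def a3_def a4_def)
 have Cs: "log_side C (Ln (of_real r * \<i>) - 2 * of_real pi * \<i> - Ln (of_real r * \<i>))"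
 proof -
  let ?m = "%u. Ln (of_real r * \<i>) - 2 * of_real pi * \<i> * of_real u"
  have "C u = exp (?m u)" for u
  proof -
   have "exp (?m u) = (of_real r * \<i>) * exp (\<i> * of_real (- (2 * pi * u)))"
    using r by (simp add: exp_diff exp_minus field_simps)
   also have "\<dots> = C u" unfolding cis_conv_exp[symmetric] by (simp add: C_def complex_eq_iff)
   finally show ?thesis by simp
  qed
  moreover have "continuous_on {0..1} ?m" by (intro continuous_intros)
  ultimately have "log_side C (?m 1 - ?m 0)" by (intro log_sideI)
  then show ?thesis by simp
 qed
 have wC: "path C" "0 ~: path_image C" "winding_number C 0 = - 1"
  using Cs by (auto simp: log_side_def)
 have inb: "0 \<in> box a1 a3" using de by (simp add: in_box_complex_iff a1_def a3_def)
 have wR: "path R" "0 ~: path_image R" "winding_number R 0 = 1"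
  using winding_number_rectpath[OF inb] path_image_rectpath_inter_box[of a1 a3] inb de
  by (auto simp: R_def a1_def a3_def)
 have lC: "pathfinish C = pathstart C" by (simp add: C_def pathfinish_def pathstart_def)
 have lR: "pathfinish R = pathstart R" by (simp add: R_def)
 have "winding_number C 0 = winding_number (reversepath R) 0"
  using wC wR winding_number_reversepath[OF wR(1,2)] by simp
 then have h: "homotopic_loops (- {0}) C (reversepath R)"
  using winding_number_homotopic_loops_eq[of C 0 "reversepath R"] wC wR lC lR by simp
 have "homotopic_loops (- {0}) (T \<circ> C) (T \<circ> reversepath R)"
  by (rule homotopic_loops_continuous_image[OF h continuous_on_subset[OF T]]) (use T0 in auto)
 then have w1: "winding_number (T \<circ> C) 0 = winding_number (T \<circ> reversepath R) 0" by (rule winding_number_homotopic_loops)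
 have "(T \<circ> C) u = A (r * sin (2 * pi * u)) - B (r * cos (2 * pi * u))" for u
 proof -
  have "\<bar>r * sin (2 * pi * u)\<bar> <= r" "\<bar>r * cos (2 * pi * u)\<bar> <= r"
   using r mult_left_mono[OF abs_sin_le_one[of "2 * pi * u"], of r] mult_left_mono[OF abs_cos_le_one[of "2 * pi * u"], of r] by (auto simp: abs_mult)
  then have "r * sin (2 * pi * u) \<in> {-d..d}" "r * cos (2 * pi * u) \<in> {-e..e}" using r by auto
  then show ?thesis by (simp add: T_def C_def cle)
 qed
 then have w2: "winding_number (T \<circ> C) 0 = 1" using wn by (simp add: comp_def)
 have TR: "path (T \<circ> R)" "0 ~: path_image (T \<circ> R)"
 proof -
  show "path (T \<circ> R)" by (rule path_continuous_image[OF wR(1) continuous_on_subset[OF T subset_UNIV]])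
  show "0 ~: path_image (T \<circ> R)"
  proof
   assume "0 \<in> path_image (T \<circ> R)"
   then obtain x where x: "0 = T x" "x \<in> path_image R" unfolding path_image_compose by (rule imageE)
   then have "x ~= 0" using wR(2) by metis
   then show False using T0 x(1) by metis
  qed
 qed
 have "T \<circ> reversepath R = reversepath (T \<circ> R)" by (simp add: reversepath_def comp_def)
 then have "- winding_number (T \<circ> R) 0 = 1" using w1 w2 winding_number_reversepath[OF TR] by simp
 then have wTR: "winding_number (T \<circ> R) 0 = - 1" by (metis minus_minus)
 have Re_lp: "Re (linepath x y u) = (1 - u) * Re x + u * Re y" "Im (linepath x y u) = (1 - u) * Im x + u * Im y" for x y u
  by (simp_all add: linepath_def)
 have iv: "(2 * u - 1) * k \<in> {-k..k}" "(1 - 2 * u) * k \<in> {-k..k}" if "u \<in> {0..1}" "0 < k" for u k :: real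
 proof -
  have "\<bar>2 * u - 1\<bar> * k <= 1 * k" using that by (intro mult_right_mono) auto
  then show "(2 * u - 1) * k \<in> {-k..k}" "(1 - 2 * u) * k \<in> {-k..k}" using that(2) by (auto simp: abs_if algebra_simps split: if_splits)
 qed
 have ivi: "(%u. (2 * u - 1) * k) ` {0..1} \<subseteq> {-k..k}" "(%u. (1 - 2 * u) * k) ` {0..1} \<subseteq> {-k..k}" if "0 < k" for k :: real
  using iv that by blast+
 have ci: "continuous_on {0..1} (%u. (2 * u - 1) * k)" "continuous_on {0..1} (%u. (1 - 2 * u) * k)" for k :: real
  by (intro continuous_intros)+
 have s1: "log_side (T \<circ> linepath a1 a2) (Mp d - Mp (- d))"
 proof -
  have "log_side (T \<circ> linepath a1 a2) (Mp ((2 * 1 - 1) * d) - Mp ((2 * 0 - 1) * d))"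
  proof (rule log_sideI)
   show "continuous_on {0..1} (%u. Mp ((2 * u - 1) * d))" by (rule continuous_on_compose2[OF Mp(1) ci(1) ivi(1)[OF de(1)]])
   fix u :: real assume u: "u \<in> {0..1}"
   have "Re (linepath a1 a2 u) = (2 * u - 1) * d" "Im (linepath a1 a2 u) = - e" by (simp_all add: Re_lp a1_def a2_def algebra_simps)
   then show "(T \<circ> linepath a1 a2) u = exp (Mp ((2 * u - 1) * d))" using iv(1)[OF u de(1)] de Mp(2) by (simp add: T_def cle)
  qed
  then show ?thesis by simp
 qed
 have s3: "log_side (T \<circ> linepath a3 a4) (Mq (- d) - Mq d)"
 proof -
  have "log_side (T \<circ> linepath a3 a4) (Mq ((1 - 2 * 1) * d) - Mq ((1 - 2 * 0) * d))"
  proof (rule log_sideI)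
   show "continuous_on {0..1} (%u. Mq ((1 - 2 * u) * d))" by (rule continuous_on_compose2[OF Mq(1) ci(2) ivi(2)[OF de(1)]])
   fix u :: real assume u: "u \<in> {0..1}"
   have "Re (linepath a3 a4 u) = (1 - 2 * u) * d" "Im (linepath a3 a4 u) = e" by (simp_all add: Re_lp a3_def a4_def algebra_simps)
   then show "(T \<circ> linepath a3 a4) u = exp (Mq ((1 - 2 * u) * d))" using iv(2)[OF u de(1)] de Mq(2) by (simp add: T_def cle)
  qed
  then show ?thesis by simp
 qed
 \<comment> \<open>On the vertical sides one point of \<open>A\<close> is fixed, outside the disc
   that contains \<open>B\<close>. A logarithm of the difference is then explicit, and its increment
   is a value of \<open>farlog\<close>.\<close>
 define N where "N z y = Ln (z - w0) + Ln (1 - (B y - w0) / (z - w0))" for z y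
 have N: "continuous_on {-e..e} (N z)" "!!y. y \<in> {-e..e} ==> z - B y = exp (N z y)" if z: "z ~: cball w0 \<rho>" for z
 proof -
  have rp: "\<rho> > 0" using far(1)[of 0] de by (auto intro: le_less_trans[OF zero_le_dist])
  have zw: "z ~= w0" using z rp by auto
  have np: "1 - (B y - w0) / (z - w0) ~: \<real>\<^sub>\<le>\<^sub>0" if "y \<in> {-e..e}" for y
   by (intro Re_pos_not_nonpos one_minus_Re far_quotient[OF far(1)[OF that] z])
  show "continuous_on {-e..e} (N z)" unfolding N_def by (intro continuous_intros B) (use np zw in auto)
  fix y assume y: "y \<in> {-e..e}"
  have "1 - (B y - w0) / (z - w0) ~= 0" using np[OF y] by force
  then have "exp (N z y) = (z - w0) * (1 - (B y - w0) / (z - w0))" using zw by (simp add: N_def exp_add)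
  also have "\<dots> = z - B y" using zw by (simp add: field_simps)
  finally show "z - B y = exp (N z y)" by simp
 qed
 have s2: "log_side (T \<circ> linepath a2 a3) (N (A d) e - N (A d) (- e))"
 proof -
  have "log_side (T \<circ> linepath a2 a3) (N (A d) ((2 * 1 - 1) * e) - N (A d) ((2 * 0 - 1) * e))"
  proof (rule log_sideI)
   show "continuous_on {0..1} (%u. N (A d) ((2 * u - 1) * e))" by (rule continuous_on_compose2[OF N(1)[OF far(2)] ci(1) ivi(1)[OF de(2)]])
   fix u :: real assume u: "u \<in> {0..1}"
   have "Re (linepath a2 a3 u) = d" "Im (linepath a2 a3 u) = (2 * u - 1) * e" by (simp_all add: Re_lp a2_def a3_def algebra_simps)
   then show "(T \<circ> linepath a2 a3) u = exp (N (A d) ((2 * u - 1) * e))" using iv(1)[OF u de(2)] de N(2)[OF far(2)] by (simp add: T_def cle)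
  qed
  then show ?thesis by simp
 qed
 have s4: "log_side (T \<circ> linepath a4 a1) (N (A (- d)) (- e) - N (A (- d)) e)"
 proof -
  have "log_side (T \<circ> linepath a4 a1) (N (A (- d)) ((1 - 2 * 1) * e) - N (A (- d)) ((1 - 2 * 0) * e))"
  proof (rule log_sideI)
   show "continuous_on {0..1} (%u. N (A (- d)) ((1 - 2 * u) * e))" by (rule continuous_on_compose2[OF N(1)[OF far(3)] ci(2) ivi(2)[OF de(2)]])
   fix u :: real assume u: "u \<in> {0..1}"
   have "Re (linepath a4 a1 u) = - d" "Im (linepath a4 a1 u) = (1 - 2 * u) * e" by (simp_all add: Re_lp a4_def a1_def algebra_simps)
   then show "(T \<circ> linepath a4 a1) u = exp (N (A (- d)) ((1 - 2 * u) * e))" using iv(2)[OF u de(2)] de N(2)[OF far(3)] by (simp add: T_def cle)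
  qed
  then show ?thesis by simp
 qed
 have TRj: "T \<circ> R = (T \<circ> linepath a1 a2) +++ (T \<circ> linepath a2 a3) +++ (T \<circ> linepath a3 a4) +++ (T \<circ> linepath a4 a1)"
  by (simp add: R path_compose_join)
 have "log_side (T \<circ> R) ((Mp d - Mp (- d)) + ((N (A d) e - N (A d) (- e)) + ((Mq (- d) - Mq d) + (N (A (- d)) (- e) - N (A (- d)) e))))"
  unfolding TRj by (intro log_side_join s1 s2 s3 s4) (simp_all add: pathfinish_compose pathstart_compose)
 then have "(Mp d - Mp (- d)) + ((N (A d) e - N (A d) (- e)) + ((Mq (- d) - Mq d) + (N (A (- d)) (- e) - N (A (- d)) e))) = - 2 * of_real pi * \<i>"
  by (rule log_side_minus_one[OF _ wTR])
 then show ?thesis by (simp add: N_def farlog_def algebra_simps)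
qed

text \<open>Near x the values of the continuous logarithm differ from \<open>M x\<close> by less
  than 1, hence by less than pi in the imaginary part, and the principal branch recovers the
  difference.\<close>

lemma log_local:
 fixes h M :: "real => complex"
 assumes M: "continuous_on K M" "!!y. y \<in> K ==> h y - p = exp (M y)" and x: "x \<in> K"
 shows "\<forall>\<^sub>F y in nhds x. y \<in> K --> M y = M x + Ln ((h y - p) / (h x - p))"
proof -
 have "\<forall>e>0. \<exists>d>0. \<forall>y\<in>K. dist y x < d --> dist (M y) (M x) < e"
  by (rule bspec[OF M(1)[unfolded continuous_on_iff] x])
 from spec[OF this, of 1] obtain d where d: "d > 0" "!!y. y \<in> K ==> dist y x < d ==> dist (M y) (M x) < 1" by auto
 have "M y = M x + Ln ((h y - p) / (h x - p))" if y: "y \<in> K" "dist y x < d" for y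
 proof -
  have "\<bar>Im (M y - M x)\<bar> < 1" using d(2)[OF y] abs_Im_le_cmod[of "M y - M x"] by (simp add: dist_norm)
  then have "\<bar>Im (M y - M x)\<bar> < pi" using pi_gt3 by linarith
  then have "Ln (exp (M y - M x)) = M y - M x" by (intro Ln_exp) auto
  then show ?thesis using M(2)[OF y(1)] M(2)[OF x] by (simp add: exp_diff)
 qed
 then show ?thesis unfolding eventually_nhds_metric using d(1) by blast
qed

text \<open>In the disc around \<open>z0\<close> that reaches to \<open>p\<close> the quotient
  differs from 1 by less than 1, so it stays in the right half plane.\<close>

lemma Ln_ratio_deriv:
 assumes "z \<in> ball z0 (cmod (z0 - p))"
 shows "((%z. k + Ln ((z - p) / (z0 - p))) has_field_derivative 1 / (z - p)) (at z)"
proof -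
 have lt: "cmod (z0 - z) < cmod (z0 - p)" using assms by (simp add: dist_norm)
 then have ne: "z0 ~= p" "z ~= p" by auto
 have "cmod ((z0 - z) / (z0 - p)) < 1" using lt ne by (simp add: norm_divide)
 then have "Re (1 - (z0 - z) / (z0 - p)) > 0" by (rule one_minus_Re)
 moreover have "1 - (z0 - z) / (z0 - p) = (z - p) / (z0 - p)" using ne by (simp add: field_simps)
 ultimately have np: "(z - p) / (z0 - p) ~: \<real>\<^sub>\<le>\<^sub>0" by (intro Re_pos_not_nonpos) simp
 have h: "((%z. (z - p) / (z0 - p)) has_field_derivative 1 / (z0 - p)) (at z)"
  by (rule DERIV_cong[OF DERIV_cdivide[OF DERIV_diff[OF DERIV_ident DERIV_const]]]) simp
 have "((%z. Ln ((z - p) / (z0 - p))) has_field_derivative inverse ((z - p) / (z0 - p)) * (1 / (z0 - p))) (at z)"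
  by (rule DERIV_chain2[where f = Ln and g = "%z. (z - p) / (z0 - p)", OF has_field_derivative_Ln[OF np] h])
 then show ?thesis by (rule DERIV_cong[OF DERIV_add[OF DERIV_const]]) (use ne in \<open>simp add: field_simps\<close>)
qed

lemma simple_closed_curve_period: "simple_closed_curve a ==> a (x + 1) = a x"
 by (simp add: simple_closed_curve_def)

lemma simple_closed_curve_range:
 assumes "simple_closed_curve (a :: real => 'a::t2_space)" shows "closed (range a)"
proof -
 have "a x \<in> a ` {0..1}" for x
 proof (rule image_eqI[of _ _ "frac x"])
  have "x - frac x \<in> \<int>" by (simp add: frac_def)
  then show "a x = a (frac x)" using assms by (simp add: simple_closed_curve_def)
 qed (use frac_lt_1[of x] in simp)
 then have "range a = a ` {0..1}" by blast
 moreover have "compact (a ` {0..1})"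
  using assms by (intro compact_continuous_image compact_Icc) (auto simp: simple_closed_curve_def intro: continuous_on_subset)
 ultimately show ?thesis by (simp add: compact_imp_closed)
qed

lemma not_Ints_between: "0 < (x :: real) ==> x < 1 ==> x ~: \<int>"
 by (auto elim!: Ints_cases)

context compact_surface
begin

section \<open>Periods of dual forms along closed curves\<close>

lemma lft_form_cong:
 assumes F: "lft om K h F" and V: "open V" "h ` K \<subseteq> V"
  and e: "!!c p v. c \<in> A ==> p \<in> cdom c ==> p \<in> V ==> \<eta> c p v = om c p v"
 shows "lft \<eta> K h F"
proof -
 have "lft (%c p v. \<eta> c p v - om c p v) K h (%x. 0)" by (rule lft_zero[OF V]) (simp add: e)
 from lft_add[OF F this] show ?thesis by simp
qed

text \<open>The lift translated by one period is again a lift of the same form along the same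
  curve.\<close>

lemma closed_curve_integral_shift:
 assumes g: "continuous_on UNIV a" "!!x. a (x + 1) = a x" and F: "lft om UNIV a F"
 shows "F (x + 1) - F x = closed_curve_integral A om a"
proof -
 have "lft om UNIV (%x. a (x + 1)) (%x. F (x + 1))" by (rule lft_compose[OF _ _ F]) (auto intro: continuous_intros)
 then have s: "lft om UNIV a (%x. F (x + 1))" by (simp add: g(2))
 have "F (x + 1) - F (0 + 1) = F x - F 0"
  by (rule lft_unique[OF g(1) convex_connected[OF convex_UNIV] s F]) auto
 then show ?thesis using closed_curve_integral_eq[OF g(1) F] by simp
qed

lemma zero_period:
 assumes g: "continuous_on UNIV a" and L: "closed L" "supp_in \<eta> L" "range a Int L = {}"
 shows "closed_curve_integral A \<eta> a = 0"
proof -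
 have "lft \<eta> UNIV a (%x. 0)"
  by (rule lft_zero[of "- L"]) (use L in \<open>auto simp: supp_in_def\<close>)
 from closed_curve_integral_eq[OF g this] show ?thesis by simp
qed

text \<open>For a closed curve the residues at the two ends fall on the same point and cancel. The
  form then extends over all its poles, and it has changed only on a finite set.\<close>

lemma dual_form_regular:
 assumes d: "dual_form b s t L \<eta> P" and st: "b s = b t"
 shows "\<exists>\<eta>'. locex UNIV \<eta>' & supp_in \<eta>' L & (\<forall>c p v. p ~: P --> \<eta>' c p v = \<eta> c p v) &
  (\<forall>om F. hol UNIV om --> lft om {s..t} b F --> integ UNIV (wedge \<eta>' om) = F s - F t)"
proof -
 have s: "sform P \<eta> (%x. 0)" and PL: "P \<subseteq> L" "supp_in \<eta> L" using d st by (simp_all add: dual_form_def)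
 obtain \<eta>' where e: "locex UNIV \<eta>'" "!!c p v. p ~: P ==> \<eta>' c p v = \<eta> c p v" using sform_regular[OF s] by blast
 have "integ UNIV (wedge \<eta>' om) = integ (- P) (wedge \<eta> om)" for om
 proof -
  have "integ (- P) (wedge \<eta>' om) = integ (- P) (wedge \<eta> om)" by (rule integ_cong(2)) (simp add: wedge_def e(2))
  then show ?thesis using integ_finite[of P] s by (simp add: sform_def)
 qed
 moreover have "supp_in \<eta>' L" unfolding supp_in_def
 proof (intro ballI impI allI)
  fix d x v assume "d \<in> A" "x \<in> cdom d" "x ~: L"
  then show "\<eta>' d x v = 0" using e(2)[of x d v] PL by (auto simp: supp_in_def)
 qed
 ultimately show ?thesis using d e by (intro exI[of _ \<eta>']) (simp add: dual_form_def)
qed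

lemma closed_dual:
 assumes b: "simple_closed_curve b" and W: "open W" "range b \<subseteq> W"
 shows "\<exists>\<eta> L. locex UNIV \<eta> & closed L & L \<subseteq> W & supp_in \<eta> L &
  (\<forall>om. hol UNIV om --> integ UNIV (wedge \<eta> om) = - closed_curve_integral A om b)"
proof -
 have cb: "continuous_on UNIV b" using b by (simp add: simple_closed_curve_def)
 have "continuous_on {0..1} b" "b ` {0..1} \<subseteq> W" using cb W(2) continuous_on_subset by blast+
 then obtain L \<eta> P where L: "L \<subseteq> W" "dual_form b 0 1 L \<eta> P" using ex_dual_form[of 0 1 b W] W(1) by auto
 have "b 0 = b 1" using simple_closed_curve_period[OF b, of 0] by simp
 from dual_form_regular[OF L(2) this] obtain \<eta>' where e: "locex UNIV \<eta>'" "supp_in \<eta>' L"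
  "!!om F. hol UNIV om ==> lft om {0..1} b F ==> integ UNIV (wedge \<eta>' om) = F 0 - F 1" by blast
 have "integ UNIV (wedge \<eta>' om) = - closed_curve_integral A om b" if w: "hol UNIV om" for om
 proof -
  obtain F where F: "lft om UNIV b F" using lft_exists_line[OF hol_locex[OF w open_UNIV] cb] by auto
  show ?thesis using e(3)[OF w lft_subset[OF F subset_UNIV]] closed_curve_integral_eq[OF cb F] by simp
 qed
 moreover have "closed L" using L(2) by (simp add: dual_form_def)
 ultimately show ?thesis using e(1,2) L(1) by blast
qed

text \<open>The imaginary part of a continuous logarithm of crd a - p is the angle under which the
  moving point is seen from p. The angular part of the kernel integrates to the difference of two
  such angles.\<close>

lemma arc_kernel_lift:
 fixes a :: "real => 'a"
 assumes c: "c \<in> A" and a: "continuous_on K a" "a ` K \<subseteq> cdom c" and E: "C1f UNIV E E'"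
  and Mp: "continuous_on K Mp" "!!x. x \<in> K ==> crd c (a x) - p = exp (Mp x)"
  and Mq: "continuous_on K Mq" "!!x. x \<in> K ==> crd c (a x) - q = exp (Mq x)"
 shows "lft (push c (arc_kernel p q E')) K a (%x. (Im (Mp x) - Im (Mq x)) / (2 * pi) + E (crd c (a x)))"
 unfolding lft_def
proof
 fix x :: real assume x: "x \<in> K"
 let ?N = "arc_kernel p q E'"
 define z0 where "z0 = crd c (a x)"
 have ax: "a x \<in> cdom c" using a(2) x by blast
 have ne: "z0 ~= p" "z0 ~= q" using Mp(2)[OF x] Mq(2)[OF x] exp_not_eq_zero[of "Mp x"] exp_not_eq_zero[of "Mq x"] by (auto simp: z0_def simp del: exp_not_eq_zero)
 obtain r0 where r0: "r0 > 0" "cball z0 r0 \<subseteq> crd c ` (cdom c Int UNIV)" using ex_cball[OF c ax open_UNIV UNIV_I] unfolding z0_def by blast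
 define \<rho> where "\<rho> = min r0 (min (cmod (z0 - p)) (cmod (z0 - q)))"
 have rho: "\<rho> > 0" using r0 ne by (simp add: \<rho>_def)
 have bsub: "ball z0 \<rho> \<subseteq> ball z0 (cmod (z0 - p))" "ball z0 \<rho> \<subseteq> ball z0 (cmod (z0 - q))" by (auto simp: \<rho>_def)
 have "ball z0 \<rho> \<subseteq> cball z0 r0" by (auto simp: \<rho>_def)
 then have br: "ball z0 \<rho> \<subseteq> crd c ` cdom c" using r0(2) by blast
 let ?lp = "%z. Mp x + Ln ((z - p) / (z0 - p))" and ?lq = "%z. Mq x + Ln ((z - q) / (z0 - q))"
 have dp: "(?lp has_field_derivative 1 / (z - p)) (at z)" "(?lq has_field_derivative 1 / (z - q)) (at z)" if z: "z \<in> ball z0 \<rho>" for z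
  using Ln_ratio_deriv[OF subsetD[OF bsub(1) z]] Ln_ratio_deriv[OF subsetD[OF bsub(2) z]] by blast+
 have hp: "?lp holomorphic_on ball z0 \<rho>" "?lq holomorphic_on ball z0 \<rho>"
  unfolding holomorphic_on_def field_differentiable_def using dp has_field_derivative_at_within by blast+
 define u where "u z = 1 / (2 * pi) * (Im (?lp z) - Im (?lq z)) + E z" for z
 have "C1f (ball z0 \<rho>) u (%z v. 1 / (2 * pi) * (Im (deriv ?lp z * v) - Im (deriv ?lq z * v)) + E' z v)"
  unfolding u_def by (intro C1f_add C1f_cmult C1f_diff C1f_Im[OF hp(1) open_ball] C1f_Im[OF hp(2) open_ball] C1f_subset[OF E]) auto
 then have "C1f (ball z0 \<rho>) u (dpull c (push c ?N))"
 proof (rule C1f_cong'[OF _ open_ball])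
  fix z v assume z: "z \<in> ball z0 \<rho>"
  have "dpull c (push c ?N) z v = ?N z v" by (rule dpull_push[OF c]) (use br z in blast)
  then show "1 / (2 * pi) * (Im (deriv ?lp z * v) - Im (deriv ?lq z * v)) + E' z v = dpull c (push c ?N) z v"
   unfolding DERIV_imp_deriv[OF dp(1)[OF z]] DERIV_imp_deriv[OF dp(2)[OF z]] by (simp add: arc_kernel_def diff_divide_distrib)
 qed simp
 then have Cc: "C1f (crd c ` cinv c ` ball z0 \<rho>) u (dpull c (push c ?N))" by (simp add: crd_cinv_image[OF c br])
 have V: "open (cinv c ` ball z0 \<rho>)" "cinv c ` ball z0 \<rho> \<subseteq> cdom c"
  using open_cinv_image[OF c open_ball br] cinv_in_cdom[OF c] br by blast+
 have lin: "linear (?N z)" for z by (rule arc_kernel_linear[OF E])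
 have cov: "cov1 UNIV (push c ?N)" by (rule push_cov1[OF c lin])
 have pr: "primitive_on A (cinv c ` ball z0 \<rho>) (push c ?N) (%q. u (crd c q))"
  by (rule prim_primitive_on[OF prim_of_chart[OF c V cov1_subset[OF cov subset_UNIV] Cc]])
 have ev1: "\<forall>\<^sub>F y in nhds x. y \<in> K --> Mp y = Mp x + Ln ((crd c (a y) - p) / (crd c (a x) - p))"
  by (rule log_local[where h = "%y. crd c (a y)" and K = K, OF Mp(1) _ x]) (rule Mp(2))
 have ev2: "\<forall>\<^sub>F y in nhds x. y \<in> K --> Mq y = Mq x + Ln ((crd c (a y) - q) / (crd c (a x) - q))"
  by (rule log_local[where h = "%y. crd c (a y)" and K = K, OF Mq(1) _ x]) (rule Mq(2))
 have ev: "\<forall>\<^sub>F y in nhds x. y \<in> K --> (Im (Mp y) - Im (Mq y)) / (2 * pi) + E (crd c (a y)) = u (crd c (a y))"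
  using ev1 ev2 by eventually_elim (simp add: u_def z0_def)
 have "a x \<in> cinv c ` ball z0 \<rho>" using c ax rho by (auto simp: z0_def intro!: image_eqI[of _ _ "crd c (a x)"])
 then show "\<exists>V f. open V & a x \<in> V & primitive_on A V (push c ?N) f &
   (\<forall>\<^sub>F y in nhds x. y \<in> K --> (Im (Mp y) - Im (Mq y)) / (2 * pi) + E (crd c (a y)) = f (a y))"
  using V(1) pr ev by (intro exI[of _ "cinv c ` ball z0 \<rho>"] exI[of _ "%q. u (crd c q)"]) simp
qed

lemma curve_near:
 assumes g: "continuous_on UNIV (a :: real => 'a)" and c: "c \<in> A" "a s \<in> cdom c" and R: "R > 0" "ball (crd c (a s)) R \<subseteq> crd c ` cdom c"
 shows "\<exists>d>0. d <= 1 / 4 & (\<forall>x\<in>{s-d..s+d}. a x \<in> cdom c & crd c (a x) \<in> ball (crd c (a s)) R)"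
proof -
 have o: "open (cinv c ` ball (crd c (a s)) R)" by (rule open_cinv_image[OF c(1) open_ball R(2)])
 have "a s \<in> cinv c ` ball (crd c (a s)) R" using c R by (auto intro!: image_eqI[of _ _ "crd c (a s)"])
 from eventually_in_nhd[OF g UNIV_I o this] obtain d where d: "d > 0" "!!y. dist y s < d ==> a y \<in> cinv c ` ball (crd c (a s)) R"
  unfolding eventually_nhds_metric by auto
 have "a x \<in> cdom c & crd c (a x) \<in> ball (crd c (a s)) R" if x: "x \<in> {s - min (d / 2) (1 / 4)..s + min (d / 2) (1 / 4)}" for x
 proof -
  have "a x \<in> cinv c ` ball (crd c (a s)) R" by (rule d(2)) (use x d(1) in \<open>auto simp: dist_real_def min_def split: if_splits\<close>)
  then obtain w where w: "w \<in> ball (crd c (a s)) R" "a x = cinv c w" by blast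
  then have "w \<in> crd c ` cdom c" using R(2) by blast
  then show ?thesis using w cinv_in_cdom[OF c(1)] crd_cinv[OF c(1)] by simp
 qed
 then show ?thesis using d(1) by (intro exI[of _ "min (d / 2) (1 / 4)"]) simp
qed

text \<open>A dual form of \<open>b\<close> is built from an arc form near the crossing and a form whose support
 avoids \<open>a\<close>; its period on \<open>a\<close> is the winding number in the definition of the intersection number.\<close>

lemma crossing_dual:
 assumes a: "simple_closed_curve a" and b: "simple_closed_curve b" and W: "open W" "range b \<subseteq> W"
  and ab: "range a Int range b = {b t}" and I: "has_local_intersection_number A a s b t 1"
 shows "\<exists>\<eta> L. locex UNIV \<eta> & closed L & L \<subseteq> W & supp_in \<eta> L & closed_curve_integral A \<eta> a = - 1 &
  (\<forall>om. hol UNIV om --> integ UNIV (wedge \<eta> om) = - closed_curve_integral A om b)"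
proof -
 have cab: "continuous_on UNIV a" "continuous_on UNIV b" using a b by (auto simp: simple_closed_curve_def)
 have pa: "a (x + 1) = a x" and pb: "b (x + 1) = b x" for x using a b by (auto simp: simple_closed_curve_period)
 have eqa: "a x = a y \<longleftrightarrow> x - y \<in> \<int>" and eqb: "b x = b y \<longleftrightarrow> x - y \<in> \<int>" for x y
  using a b by (auto simp: simple_closed_curve_def)
 have st: "a s = b t" using I by (simp add: has_local_intersection_number_def)
 obtain c where c: "c \<in> A" "a s \<in> cdom c" and wev: "\<forall>\<^sub>F e in at_right 0.
  winding_number (%u. crd c (a (s + e * sin (2 * pi * u))) - crd c (b (t + e * cos (2 * pi * u)))) 0 = 1"
  using I unfolding has_local_intersection_number_def by auto
 obtain e0 where e0: "e0 > 0" "!!e. 0 < e ==> e < e0 ==>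
  winding_number (%u. crd c (a (s + e * sin (2 * pi * u))) - crd c (b (t + e * cos (2 * pi * u)))) 0 = 1"
  using wev unfolding eventually_at_right_field by blast
 define w0 where "w0 = crd c (a s)"
 have sW: "a s \<in> W" using W(2) st by auto
 obtain R where R: "R > 0" "cball w0 R \<subseteq> crd c ` (cdom c Int W)" using ex_cball[OF c W(1) sW] unfolding w0_def by blast
 have Rb: "ball w0 R \<subseteq> crd c ` cdom c" using R(2) ball_subset_cball by blast
 obtain d where d: "d > 0" "d <= 1 / 4" "!!x. x \<in> {s-d..s+d} ==> a x \<in> cdom c & crd c (a x) \<in> ball w0 R"
  using curve_near[OF cab(1) c R(1) Rb[unfolded w0_def]] unfolding w0_def by blast
 \<comment> \<open>The part of \<open>a\<close> away from the crossing is cut out, so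
   \<open>a\<close> can meet a form supported in \<open>V\<close> only for parameters within d of s,
   modulo 1.\<close>
 define V where "V = W - a ` {s+d..s+1-d}"
 have "compact (a ` {s+d..s+1-d})" by (intro compact_continuous_image continuous_on_subset[OF cab(1)]) auto
 then have oV: "open V" unfolding V_def using W(1) by (simp add: open_Diff compact_imp_closed)
 have "a s ~= a x" if "x \<in> {s+d..s+1-d}" for x
  using not_Ints_between[of "x - s"] that d eqa[of x s] by auto
 then have "a s ~: a ` {s+d..s+1-d}" by blast
 then have sV: "a s \<in> V" using sW by (simp add: V_def)
 obtain r0 where r0: "r0 > 0" "cball w0 r0 \<subseteq> crd c ` (cdom c Int V)" using ex_cball[OF c oV sV] unfolding w0_def by blast
 define r where "r = min r0 R / 4"
 have r: "r > 0" "2 * r < R" "2 * r < r0" "r < R" using r0(1) R(1) by (auto simp: r_def)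
 have "cball w0 (2 * r) \<subseteq> cball w0 r0" using r by auto
 then have LV: "cball w0 (2 * r) \<subseteq> crd c ` (cdom c Int V)" using r0(2) by blast
 have rb: "ball w0 r \<subseteq> crd c ` cdom c" using r by (intro subset_trans[OF _ Rb]) auto
 have bt: "b t \<in> cdom c" "crd c (b t) = w0" using c st by (auto simp: w0_def)
 obtain e where e: "e > 0" "e <= 1 / 4" "!!x. x \<in> {t-e..t+e} ==> b x \<in> cdom c & crd c (b x) \<in> ball w0 r"
  using curve_near[OF cab(2) c(1) bt(1) r(1)] rb unfolding bt(2) by blast
 define p q where "p = crd c (b (t - e))" and "q = crd c (b (t + e))"
 have pq: "p \<in> ball w0 r" "q \<in> ball w0 r" using e(3)[of "t - e"] e(3)[of "t + e"] e(1) by (auto simp: p_def q_def)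
 obtain E E' where E: "C1f UNIV E E'" "!!z v. z ~: cball w0 (2 * r) ==> arc_kernel p q E' z v = 0"
  "!!z. z ~: cball w0 (2 * r) ==> E z = Im (farlog w0 p q z) / (2 * pi)" using arc_kernel_exists[OF r(1) pq] by auto
 define L1 where "L1 = cinv c ` cball w0 (2 * r)"
 define \<eta>1 where "\<eta>1 = push c (arc_kernel p q E')"
 have cbe: "continuous_on {t-e..t+e} b" using cab(2) continuous_on_subset by blast
 have te: "t - e <= t + e" using e(1) by simp
 have d1: "dual_form b (t - e) (t + e) L1 \<eta>1 {b (t - e), b (t + e)}"
  unfolding L1_def \<eta>1_def p_def q_def
  by (rule arc_dual_form[OF c(1) r(1,2) Rb cbe te e(3) E(1)]) (simp_all add: E(2)[unfolded p_def q_def])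
 have L1V: "L1 \<subseteq> V"
 proof
  fix x assume "x \<in> L1"
  then obtain u where u: "u \<in> cball w0 (2 * r)" "x = cinv c u" unfolding L1_def by blast
  then obtain y where y: "y \<in> cdom c" "y \<in> V" "u = crd c y" using LV by blast
  then show "x \<in> V" using u(2) cinv_crd[OF c(1) y(1)] by simp
 qed
 have bna: "b x ~: range a" if "x \<in> {t+e..t+1-e}" for x
 proof
  assume "b x \<in> range a"
  then have "b x = b t" using ab by blast
  then show False using not_Ints_between[of "x - t"] that e eqb[of x t] by auto
 qed
 have oW2: "open (W - range a)" using W(1) simple_closed_curve_range[OF a] by (rule open_Diff)
 have te2: "t + e <= t + 1 - e" using e(2) by simp
 have bW2: "b ` {t+e..t+1-e} \<subseteq> W - range a"
 proof (rule image_subsetI)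
  fix x assume "x \<in> {t+e..t+1-e}"
  then show "b x \<in> W - range a" using bna[of x] W(2) by blast
 qed
 \<comment> \<open>The rest of \<open>b\<close> does not meet \<open>a\<close>, so its dual form can
   be supported off the whole curve \<open>a\<close>; the crossing is seen by the arc form
   alone.\<close>
 obtain L2 \<eta>2 P2 where L2: "L2 \<subseteq> W - range a" "dual_form b (t + e) (t + 1 - e) L2 \<eta>2 P2"
  using ex_dual_form[OF continuous_on_subset[OF cab(2) subset_UNIV] te2 oW2 bW2] by blast
 define \<eta>0 where "\<eta>0 = (%c p v. \<eta>1 c p v + \<eta>2 c p v)"
 have dj: "dual_form b (t - e) (t + 1 - e) (L1 Un L2) \<eta>0 ({b (t - e), b (t + e)} Un P2)"
  unfolding \<eta>0_def by (rule dual_form_join[OF d1 L2(2) te te2])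
 have bper: "b (t - e) = b (t + 1 - e)" using pb[of "t - e"] by (simp add: algebra_simps)
 obtain \<eta> where eta: "locex UNIV \<eta>" "supp_in \<eta> (L1 Un L2)" "!!c p v. p ~: {b (t - e), b (t + e)} Un P2 ==> \<eta> c p v = \<eta>0 c p v"
  "!!om F. hol UNIV om ==> lft om {t-e..t+1-e} b F ==> integ UNIV (wedge \<eta> om) = F (t - e) - F (t + 1 - e)"
  using dual_form_regular[OF dj bper] by blast
 have cl: "closed L1" "closed L2" "supp_in \<eta>2 L2" "P2 \<subseteq> L2" "finite P2" using d1 L2(2) by (auto simp: dual_form_def sform_def)
 have int: "integ UNIV (wedge \<eta> om) = - closed_curve_integral A om b" if w: "hol UNIV om" for om
 proof -
  obtain F where F: "lft om UNIV b F" using lft_exists_line[OF hol_locex[OF w open_UNIV] cab(2)] by auto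
  have "t + 1 - e = t - e + 1" by simp
  then have "F (t + 1 - e) = F (t - e + 1)" by (rule arg_cong)
  then show ?thesis using eta(4)[OF w lft_subset[OF F subset_UNIV]] closed_curve_integral_shift[OF cab(2) pb F, of "t - e"] by linarith
 qed
 obtain G where G: "lft \<eta> UNIV a G" using lft_exists_line[OF eta(1) cab(1)] by auto
 have aL2: "a x ~: L2" for x using L2(1) by blast
 \<comment> \<open>On this part of the period \<open>a\<close> avoids both supports.\<close>
 have G1: "G (s + 1 - d) - G (s + d) = 0"
 proof -
  have "a ` {s+d..s+1-d} \<subseteq> - (L1 Un L2)" using aL2 L1V by (auto simp: V_def)
  then have z: "lft \<eta> {s+d..s+1-d} a (%x. 0)"
   by (rule lft_zero[rotated]) (use cl eta(2) in \<open>auto simp: supp_in_def\<close>)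
  have "G (s + 1 - d) - G (s + d) = 0 - (0 :: real)"
   by (rule lft_unique[OF continuous_on_subset[OF cab(1)] connected_Icc lft_subset[OF G subset_UNIV] z]) (use d in auto)
  then show ?thesis by simp
 qed
 let ?K = "{s-d..s+d}"
 have cK: "continuous_on ?K a" using cab(1) continuous_on_subset by blast
 have aK: "a ` ?K \<subseteq> cdom c" using d(3) by blast
 have cAK: "continuous_on ?K (%x. crd c (a x))" by (rule continuous_on_compose2[OF continuous_crd[OF c(1)] cK aK])
 have abne: "a x ~= b y" if "y - t ~: \<int>" for x y
 proof
  assume "a x = b y"
  then have "b y = b t" using ab by (metis Int_iff rangeI singletonD)
  then show False using that eqb by blast
 qed
 have ene: "t - e - t ~: \<int>" "t + e - t ~: \<int>"
  using not_Ints_between[of e] e Ints_minus[of "- e"] by (auto)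
 have pne: "crd c (a x) - p ~= 0" "crd c (a x) - q ~= 0" if x: "x \<in> ?K" for x
  using abne[OF ene(1), of x] abne[OF ene(2), of x] inj_onD[OF inj_on_crd[OF c(1)], of "a x" "b (t - e)"]
   inj_onD[OF inj_on_crd[OF c(1)], of "a x" "b (t + e)"] d(3)[OF x] e(1) e(3)[of "t - e"] e(3)[of "t + e"] by (auto simp: p_def q_def)
 have contr: "contractible ?K" by (rule convex_imp_contractible) simp
 \<comment> \<open>Angles of \<open>a\<close> as seen from the ends p and q of the short arc of
   \<open>b\<close>. These are not crossing points, so \<open>a\<close> avoids them and the
   logarithms exist on the interval.\<close>
 obtain Mp where Mp: "continuous_on ?K Mp" "!!x. x \<in> ?K ==> crd c (a x) - p = exp (Mp x)"
  using continuous_logarithm_on_contractible[OF continuous_on_diff[OF cAK continuous_on_const] contr pne(1)] by metis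
 obtain Mq where Mq: "continuous_on ?K Mq" "!!x. x \<in> ?K ==> crd c (a x) - q = exp (Mq x)"
  using continuous_logarithm_on_contractible[OF continuous_on_diff[OF cAK continuous_on_const] contr pne(2)] by metis
 define H where "H x = (Im (Mp x) - Im (Mq x)) / (2 * pi) + E (crd c (a x))" for x
 have l1: "lft \<eta>1 ?K a H" unfolding \<eta>1_def H_def by (rule arc_kernel_lift[OF c(1) cK aK E(1) Mp Mq])
 have G2: "G (s + d) - G (s - d) = H (s + d) - H (s - d)"
 proof -
  let ?V = "- (L2 Un {b (t - e), b (t + e)})"
  have "lft \<eta> ?K a H"
  proof (rule lft_form_cong[OF l1, of ?V])
   show "open ?V" using cl(2) by (intro open_Compl closed_Un) auto
   show "a ` ?K \<subseteq> ?V" using aL2 abne[OF ene(1)] abne[OF ene(2)] by auto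
   fix d x v assume "d \<in> A" "x \<in> cdom d" "x \<in> ?V"
   then show "\<eta> d x v = \<eta>1 d x v" using eta(3)[of x d v] cl(3,4) by (auto simp: \<eta>0_def supp_in_def)
  qed
  then show ?thesis by (rule lft_unique[OF cK connected_Icc lft_subset[OF G subset_UNIV]]) (use d in auto)
 qed
 \<comment> \<open>By periodicity s - d gives the same point as s + 1 - d, so both ends lie on the
   part of \<open>a\<close> removed from \<open>V\<close>. Hence \<open>E\<close> has its value for
   distant points there.\<close>
 have far: "crd c (a (s + d)) ~: cball w0 (2 * r)" "crd c (a (s - d)) ~: cball w0 (2 * r)"
 proof -
  have m: "a (s + d) \<in> a ` {s+d..s+1-d}" "a (s - d) \<in> a ` {s+d..s+1-d}"
   using d pa[of "s - d"] by (auto intro!: image_eqI[of "a (s - d)" a "s + 1 - d"] simp: algebra_simps)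
  have "crd c x ~: cball w0 (2 * r)" if "x \<in> a ` {s+d..s+1-d}" "x \<in> cdom c" for x
  proof
   assume "crd c x \<in> cball w0 (2 * r)"
   then obtain y where "y \<in> cdom c" "y \<in> V" "crd c x = crd c y" using LV by blast
   then have "x \<in> V" using inj_onD[OF inj_on_crd[OF c(1)]] that(2) by metis
   then show False using that(1) by (simp add: V_def)
  qed
  then show "crd c (a (s + d)) ~: cball w0 (2 * r)" "crd c (a (s - d)) ~: cball w0 (2 * r)" using m d(3)[of "s + d"] d(3)[of "s - d"] d(1) by auto
 qed
 define e' where "e' = min (min d e) (e0 / 2)"
 have e': "e' > 0" "e' <= d" "e' <= e" "e' < e0" using d e e0 by (auto simp: e'_def min_def)
 have shift: "continuous_on {-k..k} (%x. f (y + x))" if "continuous_on {y-k..y+k} f" for k y :: real and f :: "real => complex"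
  by (rule continuous_on_compose2[OF that]) (auto intro: continuous_intros)
 have cBe: "continuous_on {t-e..t+e} (%x. crd c (b x))" by (rule continuous_on_compose2[OF continuous_crd[OF c(1)] cbe]) (use e(3) in auto)
 have rr: "ball w0 r \<subseteq> ball w0 (2 * r)" using r(1) by auto
 have wd: "Mp (s + d) - Mp (s + - d) - (Mq (s + d) - Mq (s + - d)) + farlog w0 (crd c (b (t + - e))) (crd c (b (t + e))) (crd c (a (s + d)))
  - farlog w0 (crd c (b (t + - e))) (crd c (b (t + e))) (crd c (a (s + - d))) = - 2 * of_real pi * \<i>"
 proof (rule winding_difference[where \<rho> = "2 * r" and r = e' and A = "%x. crd c (a (s + x))" and B = "%x. crd c (b (t + x))"
   and Mp = "%x. Mp (s + x)" and Mq = "%x. Mq (s + x)", OF shift[OF cAK] shift[OF cBe] d(1) e(1)])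
  fix x y assume xy: "x \<in> {-d..d}" "y \<in> {-e..e}" "crd c (a (s + x)) = crd c (b (t + y))"
  then have eq: "a (s + x) = b (t + y)" using inj_onD[OF inj_on_crd[OF c(1)]] d(3)[of "s + x"] e(3)[of "t + y"] by auto
  then have "b (t + y) = b t" using ab by (metis Int_iff rangeI singletonD)
  then have "y \<in> \<int>" "x \<in> \<int>" using eqb[of "t + y" t] eqa[of "s + x" s] eq st by auto
  then obtain m n where "x = of_int m" "y = of_int n" by (auto elim!: Ints_cases)
  then show "x = 0 & y = 0" using xy d e by auto
 next
  show "winding_number (%u. crd c (a (s + e' * sin (2 * pi * u))) - crd c (b (t + e' * cos (2 * pi * u)))) 0 = 1"
   by (rule e0(2)[OF e'(1,4)])
  fix y assume "y \<in> {-e..e}"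
  then have "crd c (b (t + y)) \<in> ball w0 r" using e(3)[of "t + y"] by auto
  then show "crd c (b (t + y)) \<in> ball w0 (2 * r)" using rr by blast
 qed (use e' Mp Mq far shift[OF Mp(1)] shift[OF Mq(1)] in \<open>simp_all add: p_def q_def\<close>)
 have "Im (Mp (s + d)) - Im (Mp (s - d)) - (Im (Mq (s + d)) - Im (Mq (s - d))) + Im (farlog w0 p q (crd c (a (s + d)))) - Im (farlog w0 p q (crd c (a (s - d)))) = - 2 * pi"
  using arg_cong[OF wd, of Im] by (simp add: p_def q_def)
 moreover have "H (s + d) - H (s - d) = (Im (Mp (s + d)) - Im (Mp (s - d)) - (Im (Mq (s + d)) - Im (Mq (s - d))) + Im (farlog w0 p q (crd c (a (s + d)))) - Im (farlog w0 p q (crd c (a (s - d))))) / (2 * pi)"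
  unfolding H_def E(3)[OF far(1)] E(3)[OF far(2)] by (simp add: diff_divide_distrib add_divide_distrib)
 ultimately have "H (s + d) - H (s - d) = - 1" by simp
 then have "G (s + 1 - d) - G (s - d) = - 1" using G1 G2 by linarith
 moreover have "s + 1 - d = s - d + 1" by simp
 ultimately have "closed_curve_integral A \<eta> a = - 1" using closed_curve_integral_shift[OF cab(1) pa G, of "s - d"] by simp
 moreover have "L1 Un L2 \<subseteq> W" using L1V L2(1) by (auto simp: V_def)
 ultimately show ?thesis using eta(1,2) cl(1,2) int by (intro exI[of _ \<eta>] exI[of _ "L1 Un L2"]) auto
qed

section \<open>Curves that end at the punctures\<close>

lemma lft_continuous:
 assumes h: "continuous_on K h" and F: "lft om K h F" shows "continuous_on K F"
 unfolding continuous_on_def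
proof
 fix x assume x: "x \<in> K"
 obtain V f where V: "open V" "h x \<in> V" "primitive_on A V om f" "\<forall>\<^sub>F y in nhds x. y \<in> K --> F y = f (h y)"
  using lftD[OF F x] by blast
 obtain c where c: "c \<in> A" "h x \<in> cdom c" using chart_cover by blast
 have "((f \<circ> cinv c) has_derivative om c (h x)) (at (crd c (h x)))" using V c by (auto simp: primitive_on_def)
 then have ic: "isCont (f \<circ> cinv c) (crd c (h x))" by (rule has_derivative_continuous)
 have hx: "(h \<longlongrightarrow> h x) (at x within K)" using h x by (simp add: continuous_on_def)
 have "isCont (crd c) (h x)" using continuous_crd[OF c(1)] open_cdom[OF c(1)] c(2) continuous_on_eq_continuous_at by blast
 then have "((%y. crd c (h y)) \<longlongrightarrow> crd c (h x)) (at x within K)" by (rule isCont_tendsto_compose[OF _ hx])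
 then have "((%y. (f \<circ> cinv c) (crd c (h y))) \<longlongrightarrow> (f \<circ> cinv c) (crd c (h x))) (at x within K)" by (rule isCont_tendsto_compose[OF ic])
 moreover have "\<forall>\<^sub>F y in at x within K. (f \<circ> cinv c) (crd c (h y)) = F y"
 proof -
  have "\<forall>\<^sub>F y in at x within K. h y \<in> cdom c" using topological_tendstoD[OF hx open_cdom[OF c(1)] c(2)] .
  moreover have "\<forall>\<^sub>F y in at x within K. y \<in> K --> F y = f (h y)" unfolding eventually_at_filter using V(4) by (auto elim: eventually_mono)
  moreover have "\<forall>\<^sub>F y in at x within K. y \<in> K" by (simp add: eventually_at_filter)
  ultimately show ?thesis by eventually_elim (use c in simp)
 qed
 moreover have "(f \<circ> cinv c) (crd c (h x)) = F x" using eventually_nhds_x_imp_x[OF V(4)] x c by simp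
 ultimately show "(F \<longlongrightarrow> F x) (at x within K)" using Lim_transform_eventually by fastforce
qed

text \<open>The logistic function \<open>th\<close> maps the line onto the open unit interval, with
  inverse \<open>L\<close>. Adding the two limit points gives a path on the compact surface. A lift
  along it is continuous up to the ends, so the limits in the improper integral are its values at 0
  and 1.\<close>

lemma line_closure:
 fixes \<gamma> :: "real => 'a"
 assumes g: "continuous_on UNIV \<gamma>" and l: "(\<gamma> \<longlongrightarrow> v1) at_bot" "(\<gamma> \<longlongrightarrow> v2) at_top"
 shows "\<exists>b :: real => 'a. continuous_on {0..1} b & b 0 = v1 & b 1 = v2 & b ` {0..1} \<subseteq> insert v1 (insert v2 (range \<gamma>)) &
  (\<forall>om. locex UNIV om --> (\<exists>F. lft om {0..1} b F & line_integral A om \<gamma> = F 1 - F 0))"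
proof -
 define th where "th x = inverse (1 + exp (- x :: real))" for x
 have th: "th x > 0" "th x < 1" for x using exp_gt_zero[of "- x"] by (auto simp: th_def inverse_less_1_iff add_pos_pos)
 define L where "L t = - ln (inverse t - 1)" for t :: real
 have Lth: "L (th x) = x" for x by (simp add: L_def th_def)
 define b where "b t = (if t <= 0 then v1 else if t \<ge> 1 then v2 else \<gamma> (L t))" for t
 have b01: "b 0 = v1" "b 1 = v2" by (auto simp: b_def)
 have bth: "b (th x) = \<gamma> x" for x using th[of x] Lth[of x] by (simp add: b_def)
 have lo: "L t <= x" if "0 < t" "t < th x" for t x
 proof -
  have "inverse (th x) < inverse t" using that by (simp add: less_imp_inverse_less)
  then have 1: "exp (- x) <= inverse t - 1" by (simp add: th_def)
  then have 2: "0 < inverse t - 1" using exp_gt_zero[of "- x"] by linarith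
  have "ln (exp (- x)) <= ln (inverse t - 1)" using 1 ln_le_cancel_iff[OF exp_gt_zero 2, of "- x"] by blast
  then show ?thesis by (simp add: L_def)
 qed
 have hi: "x <= L t" if "t < 1" "th x < t" for t x
 proof -
  have t0: "0 < t" using th(1)[of x] that(2) by linarith
  have "inverse t < inverse (th x)" using that th(1)[of x] by (simp add: less_imp_inverse_less)
  then have 1: "inverse t - 1 <= exp (- x)" by (simp add: th_def)
  have "0 < inverse t - 1" using t0 that(1) by (simp add: one_less_inverse)
  then have "ln (inverse t - 1) <= ln (exp (- x))" using 1 by (subst ln_le_cancel_iff) auto
  then show ?thesis by (simp add: L_def)
 qed
 have cb: "continuous_on {0..1} b"
  unfolding continuous_on_eq_continuous_within
 proof
  fix t :: real assume t: "t \<in> {0..1}"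
  show "continuous (at t within {0..1}) b"
  proof (cases "t = 0 \<or> t = 1")
   case False
   then have t': "t \<in> {0<..<1}" using t by auto
   have "continuous_on {0<..<1} L" unfolding L_def by (intro continuous_intros) (auto simp: one_less_inverse)
   then have "continuous_on {0<..<1} (%t. \<gamma> (L t))" by (intro continuous_on_compose2[OF g]) auto
   then have "continuous_on {0<..<1} b" by (rule continuous_on_eq) (auto simp: b_def)
   then have "isCont b t" using t' continuous_on_eq_continuous_at[OF open_greaterThanLessThan] by blast
   then show ?thesis by (rule continuous_at_imp_continuous_at_within)
  next
   case True
   show ?thesis unfolding continuous_within_topological
   proof (intro allI impI)
    fix B assume B: "open B" "b t \<in> B"
    show "\<exists>U. open U & t \<in> U & (\<forall>y\<in>{0..1}. y \<in> U --> b y \<in> B)"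
    proof (cases "t = 0")
     case t0: True
     then have "\<forall>\<^sub>F x in at_bot. \<gamma> x \<in> B" using B b01 topological_tendstoD[OF l(1)] by auto
     then obtain x where x: "!!y. y <= x ==> \<gamma> y \<in> B" unfolding eventually_at_bot_linorder by blast
     show ?thesis
      by (rule exI[of _ "{..<th x}"]) (use t0 th[of x] B b01 lo x in \<open>auto simp: b_def\<close>)
    next
     case False
     then have t1: "t = 1" using True by simp
     then have "\<forall>\<^sub>F x in at_top. \<gamma> x \<in> B" using B b01 topological_tendstoD[OF l(2)] by auto
     then obtain x where x: "!!y. x <= y ==> \<gamma> y \<in> B" unfolding eventually_at_top_linorder by blast
     show ?thesis
      by (rule exI[of _ "{th x<..}"]) (use t1 th[of x] B b01 hi x in \<open>auto simp: b_def\<close>)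
    qed
   qed
  qed
 qed
 have thc: "continuous_on UNIV th" unfolding th_def
  by (intro continuous_intros) (auto simp: add_pos_pos less_imp_neq[THEN not_sym])
 have "\<exists>F. lft om {0..1} b F & line_integral A om \<gamma> = F 1 - F 0" if w: "locex UNIV om" for om
 proof -
  obtain G where G: "lft om {0..1} b G" using lft_exists_path[OF w cb] by auto
  have e01: "th x \<in> {0..1}" for x using th[of x] by (simp add: less_imp_le)
  have "lft om UNIV (%x. b (th x)) (%x. G (th x))" by (rule lft_compose[OF thc _ G]) (intro image_subsetI e01)
  then have lG: "lft om UNIV \<gamma> (%x. G (th x))" by (simp add: bth)
  note cG = lft_continuous[OF cb G]
  have "filterlim (%x::real. - x) at_top at_bot" by (rule filterlim_uminus_at_top_at_bot)
  then have "filterlim (%x::real. 1 + exp (- x)) at_top at_bot"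
   by (intro filterlim_tendsto_add_at_top[OF tendsto_const] filterlim_compose[OF exp_at_top])
  then have "(th \<longlongrightarrow> 0) at_bot" unfolding th_def by (rule tendsto_inverse_0_at_top)
  then have 1: "((%x. G (th x)) \<longlongrightarrow> G 0) at_bot"
   by (rule continuous_on_tendsto_compose[OF cG]) (use e01 in auto)
  have "filterlim (%x::real. - x) at_bot at_top" by (rule filterlim_uminus_at_bot_at_top)
  then have "((%x::real. exp (- x)) \<longlongrightarrow> 0) at_top" by (rule filterlim_compose[OF exp_at_bot])
  then have "((%x::real. inverse (1 + exp (- x))) \<longlongrightarrow> inverse (1 + 0)) at_top" by (intro tendsto_intros) auto
  then have "(th \<longlongrightarrow> 1) at_top" by (simp add: th_def[abs_def])
  then have 2: "((%x. G (th x)) \<longlongrightarrow> G 1) at_top"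
   by (rule continuous_on_tendsto_compose[OF cG]) (use e01 in auto)
  show ?thesis using line_integral_eq[OF g lG 1 2] G by blast
 qed
 then have all: "\<forall>om. locex UNIV om --> (\<exists>F. lft om {0..1} b F & line_integral A om \<gamma> = F 1 - F 0)" by (intro allI impI)
 have sub: "b ` {0..1} \<subseteq> insert v1 (insert v2 (range \<gamma>))" by (auto simp: b_def)
 show ?thesis by (rule exI[of _ b]) (intro conjI cb b01 sub all)
qed

end

section \<open>Cusps\<close>

text \<open>Test with the conjugate of q.\<close>

lemma complex_Re_bound:
 assumes "!!v. \<bar>Re (q * v)\<bar> <= e * cmod v" shows "cmod q <= e"
proof (cases "q = 0")
 case True
 then show ?thesis using assms[of 1] by simp
next
 case False
 have "Re (q * cnj q) = (cmod q)\<^sup>2" by (metis Re_complex_of_real complex_norm_square)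
 with assms[of "cnj q"] have "\<bar>(cmod q)\<^sup>2\<bar> <= e * cmod (cnj q)" by metis
 then have "(cmod q)\<^sup>2 <= e * cmod q" by simp
 then show ?thesis using False by (simp add: power2_eq_square)
qed

text \<open>exp (-2 pi \<sigma> z) is injective on the cylinder, the quotient by translations by
  \<i> times integers.\<close>

lemma exp_eq_twopi:
 assumes "exp (- (2 * of_real pi * of_real \<sigma> * z)) = exp (- (2 * of_real pi * of_real \<sigma> * w))" and s: "\<sigma> = 1 \<or> \<sigma> = (-1 :: real)"
 shows "\<exists>n::int. w = z + \<i> * of_int n"
proof -
 obtain n :: int where n: "- (2 * of_real pi * of_real \<sigma> * z) = - (2 * of_real pi * of_real \<sigma> * w) + of_real (of_int (2 * n) * pi) * \<i>"
  using assms(1) unfolding exp_eq by blast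
 then have "2 * of_real pi * (of_real \<sigma> * w - of_real \<sigma> * z - \<i> * of_int n) = 0" by (simp add: algebra_simps)
 then have "of_real \<sigma> * w - of_real \<sigma> * z = \<i> * of_int n" by simp
 then have e: "of_real \<sigma> * w = of_real \<sigma> * z + \<i> * of_int n" by (simp add: algebra_simps)
 from s show ?thesis
 proof (elim disjE)
  assume "\<sigma> = 1"
  then show ?thesis using e by (intro exI[of _ n]) simp
 next
  assume "\<sigma> = - 1"
  then have "- w = - z + \<i> * of_int n" using e by simp
  then have "w = z - \<i> * of_int n" by (metis add.inverse_inverse minus_add_distrib uminus_add_conv_diff minus_diff_eq diff_conv_add_uminus)
  then show ?thesis by (intro exI[of _ "- n"]) simp
 qed
qed

lemma Re_of_real_mult: "Re (complex_of_real r * z) = r * Re z" and Im_of_real_mult: "Im (complex_of_real r * z) = r * Im z"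
 by simp_all

context compact_surface
begin

text \<open>In the coordinate \<open>\<zeta> = exp (-2 \<pi> \<sigma> z)\<close> the cusp is a punctured disc, and the chart
 extends to a biholomorphic map of a disc; the asymptotics become a simple pole.\<close>

lemma cusp_pole:
 assumes cc: "cusp_coordinates A S \<rho> \<sigma> v \<kappa>" and sg: "\<sigma> = 1 \<or> \<sigma> = -1" and vS: "v ~: S"
  and N: "open N" "v \<in> N" "N - {v} \<subseteq> S"
  and asy: "asymptotic_to_dx A \<sigma> \<kappa> om" and h: "hol S om" and c: "c \<in> A" "v \<in> cdom c"
 shows "\<exists>r>0. \<exists>H0. cball (crd c v) r \<subseteq> crd c ` (cdom c Int N) & H0 holomorphic_on ball (crd c v) r &
  (\<forall>z\<in>ball (crd c v) r - {crd c v}. \<forall>w. dpull c om z w = Re ((- of_real (\<sigma> / (2 * pi)) / (z - crd c v) + H0 z) * w))"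
proof -
 define z1 where "z1 = crd c v"
 obtain H where H: "H holomorphic_on crd c ` (cdom c Int S)" "!!z v. z \<in> crd c ` (cdom c Int S) ==> dpull c om z v = Re (H z * v)"
  using h c(1) unfolding hol_def by blast
 obtain r1 where r1: "r1 > 0" "cball z1 r1 \<subseteq> crd c ` (cdom c Int N)" using ex_cball[OF c N(1,2)] unfolding z1_def by blast
 have r1c: "cball z1 r1 \<subseteq> crd c ` cdom c" using r1(2) by blast
 have r1S: "w \<in> crd c ` (cdom c Int S)" if w: "w \<in> cball z1 r1" "w ~= z1" for w
 proof -
  obtain p where p: "p \<in> cdom c" "p \<in> N" "w = crd c p" using r1(2) w(1) by blast
  then have "p ~= v" using w(2) z1_def by blast
  then show ?thesis using p N(3) by blast
 qed
 have lim: "(\<kappa> \<longlongrightarrow> v) (filtercomap (%z. \<sigma> * Re z) at_top)"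
  and inj: "!!z w. z \<in> cusp_halfplane \<sigma> ==> w \<in> cusp_halfplane \<sigma> ==> \<kappa> z = \<kappa> w \<longleftrightarrow> (\<exists>n::int. w = z + \<i> * of_int n)"
  and kS: "!!z. z \<in> cusp_halfplane \<sigma> ==> \<kappa> z \<in> S"
  and kD: "!!z. z \<in> cusp_halfplane \<sigma> ==> \<kappa> z \<in> cdom c ==> \<exists>D. ((crd c \<circ> \<kappa>) has_field_derivative D) (at z within cusp_halfplane \<sigma>)"
  using cc c(1) unfolding cusp_coordinates_def by blast+
 have near: "\<exists>X>0. \<forall>z. \<sigma> * Re z > X --> \<kappa> z \<in> cdom c & crd c (\<kappa> z) \<in> ball z1 r" if r: "0 < r" "r <= r1" for r
 proof -
  have br: "ball z1 r \<subseteq> crd c ` cdom c" using r by (intro subset_trans[OF _ r1c]) auto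
  have "open (cinv c ` ball z1 r)" by (rule open_cinv_image[OF c(1) open_ball br])
  moreover have "v \<in> cinv c ` ball z1 r" using c r by (auto simp: z1_def intro!: image_eqI[of _ _ "crd c v"])
  ultimately have "\<forall>\<^sub>F z in filtercomap (%z. \<sigma> * Re z) at_top. \<kappa> z \<in> cinv c ` ball z1 r" by (rule topological_tendstoD[OF lim])
  then obtain Q where Q: "eventually Q at_top" "!!z. Q (\<sigma> * Re z) ==> \<kappa> z \<in> cinv c ` ball z1 r" unfolding eventually_filtercomap by blast
  then obtain X where X: "!!x. X <= x ==> Q x" unfolding eventually_at_top_linorder by blast
  have "\<kappa> z \<in> cdom c & crd c (\<kappa> z) \<in> ball z1 r" if "\<sigma> * Re z > max X 1" for z
  proof -
   have "\<kappa> z \<in> cinv c ` ball z1 r" using Q(2) X that by simp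
   then obtain w where w: "w \<in> ball z1 r" "\<kappa> z = cinv c w" by blast
   then have "w \<in> crd c ` cdom c" using br by blast
   then show ?thesis using w cinv_in_cdom[OF c(1)] crd_cinv[OF c(1)] by simp
  qed
  then show ?thesis by (intro exI[of _ "max X 1"]) simp
 qed
 obtain X where X: "X > 0" "!!z. \<sigma> * Re z > X ==> \<kappa> z \<in> cdom c & crd c (\<kappa> z) \<in> ball z1 r1" using near[OF r1(1)] by blast
 define Hp where "Hp = {z. \<sigma> * Re z > X}"
 have oH: "open Hp" unfolding Hp_def by (intro open_Collect_less continuous_intros)
 have Hh: "Hp \<subseteq> cusp_halfplane \<sigma>" using X(1) by (auto simp: Hp_def cusp_halfplane_def)
 define Z where "Z = crd c \<circ> \<kappa>"
 have Zd: "(Z has_field_derivative deriv Z z) (at z) & (Z has_field_derivative deriv Z z) (at z within cusp_halfplane \<sigma>)" if z: "z \<in> Hp" for z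
 proof -
  obtain D where D: "(Z has_field_derivative D) (at z within cusp_halfplane \<sigma>)"
   using kD[of z] Hh z X(2) unfolding Z_def by (auto simp: Hp_def)
  have "(Z has_field_derivative D) (at z within Hp)" by (rule has_field_derivative_subset[OF D Hh])
  then have "(Z has_field_derivative D) (at z)" using at_within_open[OF z oH] by simp
  then show ?thesis using D DERIV_imp_deriv by metis
 qed
 have Zinj: "Z z = Z w \<longleftrightarrow> (\<exists>n::int. w = z + \<i> * of_int n)" if zw: "z \<in> Hp" "w \<in> Hp" for z w
 proof -
  have "Z z = Z w \<longleftrightarrow> \<kappa> z = \<kappa> w" using inj_onD[OF inj_on_crd[OF c(1)]] X(2) zw by (auto simp: Z_def Hp_def)
  then show ?thesis using inj[of z w] zw Hh by auto
 qed
 \<comment> \<open>A section of \<zeta> = exp (-2 pi \<sigma> z). It jumps across the cut of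
   \<open>Ln\<close>, by \<i> times an integer. The radius \<open>R\<close> below corresponds to the
   half plane \<open>Hp\<close>.\<close>
 define lg where "lg \<zeta> = - of_real (\<sigma> / (2 * pi)) * Ln \<zeta>" for \<zeta>
 define R where "R = exp (- (2 * pi * X))"
 have s2: "of_real \<sigma> * (of_real \<sigma> * x) = (x :: complex)" "\<sigma> * (\<sigma> * y) = y" for x y using sg by auto
 have explg: "exp (- (2 * of_real pi * of_real \<sigma> * lg \<zeta>)) = \<zeta>" if "\<zeta> ~= 0" for \<zeta>
 proof -
  have "- (2 * of_real pi * of_real \<sigma> * lg \<zeta>) = of_real \<sigma> * (of_real \<sigma> * Ln \<zeta>)" by (simp add: lg_def)
  then show ?thesis using that by (simp add: s2)
 qed
 have Relg: "\<sigma> * Re (lg \<zeta>) = - ln (cmod \<zeta>) / (2 * pi)" if "\<zeta> ~= 0" for \<zeta>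
 proof -
  have "\<sigma> * Re (lg \<zeta>) = - (\<sigma> * (\<sigma> * (ln (cmod \<zeta>) / (2 * pi))))" using that by (simp add: lg_def)
  then show ?thesis by (simp add: s2)
 qed
 have lgH: "\<sigma> * Re (lg \<zeta>) > Y" if "\<zeta> \<in> ball 0 (exp (- (2 * pi * Y)))" "\<zeta> ~= 0" for \<zeta> Y
 proof -
  have "ln (cmod \<zeta>) < ln (exp (- (2 * pi * Y)))" using that by (subst ln_less_cancel_iff) auto
  then have "2 * pi * Y < - ln (cmod \<zeta>)" by simp
  then have "Y < - ln (cmod \<zeta>) / (2 * pi)" by (subst pos_less_divide_eq) (simp_all add: mult.commute)
  then show ?thesis by (simp only: Relg[OF that(2)])
 qed
 have lgHp: "lg \<zeta> \<in> Hp" if "\<zeta> \<in> ball 0 R - {0}" for \<zeta> using lgH[of \<zeta> X] that by (simp add: R_def Hp_def)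
 define G where "G \<zeta> = (if \<zeta> = 0 then z1 else Z (lg \<zeta>))" for \<zeta>
 have Gd: "(G has_field_derivative deriv Z (lg \<zeta>) * (- of_real (\<sigma> / (2 * pi)) / \<zeta>)) (at \<zeta>)" if z: "\<zeta> \<in> ball 0 R - {0}" for \<zeta>
 proof -
  have z0: "\<zeta> ~= 0" using z by simp
  \<comment> \<open>A holomorphic branch near \<zeta>, even if \<zeta> lies on the cut. It differs
    from \<open>lg\<close> by \<i> times an integer, which \<open>Z\<close> does not see.\<close>
  define l where "l x = lg \<zeta> - of_real (\<sigma> / (2 * pi)) * (0 + Ln ((x - 0) / (\<zeta> - 0)))" for x
  have "((%x. 0 + Ln ((x - 0) / (\<zeta> - 0))) has_field_derivative 1 / (\<zeta> - 0)) (at \<zeta>)"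
  proof -
   have h: "((%x. (x - 0) / (\<zeta> - 0)) has_field_derivative 1 / \<zeta>) (at \<zeta>)"
    by (rule DERIV_cong[OF DERIV_cdivide[OF DERIV_diff[OF DERIV_ident DERIV_const]]]) simp
   have np: "(\<zeta> - 0) / (\<zeta> - 0) ~: \<real>\<^sub>\<le>\<^sub>0" using z0 by simp
   have "((%x. Ln ((x - 0) / (\<zeta> - 0))) has_field_derivative inverse ((\<zeta> - 0) / (\<zeta> - 0)) * (1 / \<zeta>)) (at \<zeta>)"
    by (rule DERIV_chain2[where f = Ln and g = "%x. (x - 0) / (\<zeta> - 0)", OF has_field_derivative_Ln[OF np] h])
   then show ?thesis by (rule DERIV_cong[OF DERIV_add[OF DERIV_const]]) (use z0 in simp)
  qed
  then have dl: "(l has_field_derivative - of_real (\<sigma> / (2 * pi)) / \<zeta>) (at \<zeta>)"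
   unfolding l_def by (rule DERIV_cong[OF DERIV_diff[OF DERIV_const DERIV_cmult]]) simp
  have l0: "l \<zeta> = lg \<zeta>" using z0 by (simp add: l_def)
  have "isCont l \<zeta>" by (rule DERIV_isCont[OF dl])
  moreover have "l \<zeta> \<in> Hp" using lgHp[OF z] l0 by simp
  ultimately have ev: "\<forall>\<^sub>F x in nhds \<zeta>. l x \<in> Hp" using oH unfolding isCont_def by (metis tendsto_at_iff_tendsto_nhds topological_tendstoD)
  have ev2: "\<forall>\<^sub>F x in nhds \<zeta>. x \<in> ball 0 R - {0}" by (rule eventually_nhds_in_open) (use z in auto)
  have "\<forall>\<^sub>F x in nhds \<zeta>. Z (l x) = G x" using ev ev2
  proof eventually_elim
   case (elim x)
   then have x0: "x ~= 0" by simp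
   have "exp (- (2 * of_real pi * of_real \<sigma> * l x)) = exp (- (2 * of_real pi * of_real \<sigma> * lg \<zeta>)) * exp (of_real \<sigma> * (of_real \<sigma> * Ln (x / \<zeta>)))"
    unfolding exp_add[symmetric] by (rule arg_cong[of _ _ exp]) (simp add: l_def algebra_simps)
   also have "\<dots> = x" using explg[OF z0] x0 z0 by (simp add: s2)
   also have "\<dots> = exp (- (2 * of_real pi * of_real \<sigma> * lg x))" using explg[OF x0] by simp
   finally have "\<exists>n::int. lg x = l x + \<i> * of_int n" by (rule exp_eq_twopi[OF _ sg])
   then have "Z (l x) = Z (lg x)" using Zinj[OF _ lgHp] elim by blast
   then show ?case using x0 by (simp add: G_def)
  qed
  moreover have "((%x. Z (l x)) has_field_derivative deriv Z (lg \<zeta>) * (- of_real (\<sigma> / (2 * pi)) / \<zeta>)) (at \<zeta>)"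
   by (rule DERIV_chain2[where f = Z and g = l, OF _ dl]) (use Zd[OF lgHp[OF z]] l0 in simp)
  ultimately show ?thesis using DERIV_cong_ev[of \<zeta> \<zeta> "%x. Z (l x)" G] by blast
 qed
 have Gb: "G \<zeta> \<in> cball z1 r1 & G \<zeta> ~= z1 & G \<zeta> = crd c (\<kappa> (lg \<zeta>)) & \<kappa> (lg \<zeta>) \<in> cdom c" if z: "\<zeta> \<in> ball 0 R - {0}" for \<zeta>
 proof -
  have k: "\<kappa> (lg \<zeta>) \<in> cdom c" "crd c (\<kappa> (lg \<zeta>)) \<in> ball z1 r1" using X(2)[of "lg \<zeta>"] lgHp[OF z] by (auto simp: Hp_def)
  have "\<kappa> (lg \<zeta>) \<in> S" using kS lgHp[OF z] Hh by blast
  then have "\<kappa> (lg \<zeta>) ~= v" using vS by blast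
  then have "crd c (\<kappa> (lg \<zeta>)) ~= z1" using inj_onD[OF inj_on_crd[OF c(1)] _ k(1) c(2)] unfolding z1_def by blast
  then show ?thesis using k z by (auto simp: G_def Z_def)
 qed
 have "(G \<longlongrightarrow> z1) (at 0)"
 proof (rule tendstoI)
  fix e :: real assume e: "e > 0"
  obtain Y where Y: "!!z. \<sigma> * Re z > Y ==> crd c (\<kappa> z) \<in> ball z1 (min e r1)" using near[of "min e r1"] e r1(1) by auto
  have "dist (G \<zeta>) z1 < e" if "\<zeta> \<in> ball 0 (exp (- (2 * pi * Y)))" "\<zeta> ~= 0" for \<zeta>
   using Y[OF lgH[OF that]] that(2) by (simp add: G_def Z_def dist_commute)
  moreover have "\<forall>\<^sub>F \<zeta> in at 0. \<zeta> \<in> ball 0 (exp (- (2 * pi * Y))) & \<zeta> ~= (0 :: complex)"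
   using eventually_at_in_open[of "ball 0 (exp (- (2 * pi * Y)))" "0 :: complex"] by (auto elim: eventually_mono)
  ultimately show "\<forall>\<^sub>F x in at 0. dist (G x) z1 < e" by (auto elim: eventually_mono)
 qed
 then have G0: "isCont G 0" by (simp add: isCont_def G_def)
 have Rp: "R > 0" by (simp add: R_def)
 have "isCont G \<zeta>" if "\<zeta> \<in> ball 0 R" for \<zeta> using G0 Gd[of \<zeta>] DERIV_isCont that by (cases "\<zeta> = 0") auto
 then have cG: "continuous_on (ball 0 R) G" by (simp add: continuous_at_imp_continuous_on)
 have "G holomorphic_on ball 0 R - {0}"
  unfolding holomorphic_on_def field_differentiable_def using Gd has_field_derivative_at_within by blast
 then have hG: "G holomorphic_on ball 0 R" by (rule no_isolated_singularity[OF cG _ open_ball]) simp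
 have iG: "inj_on G (ball 0 R)"
 proof (rule inj_onI)
  fix x y assume xy: "x \<in> ball 0 R" "y \<in> ball 0 R" "G x = G y"
  show "x = y"
  proof (cases "x = 0 \<or> y = 0")
   case True
   then show ?thesis using Gb[of x] Gb[of y] xy by (auto simp: G_def split: if_splits)
  next
   case False
   then have b: "x \<in> ball 0 R - {0}" "y \<in> ball 0 R - {0}" "x ~= 0" "y ~= 0" using xy by auto
   then have "Z (lg x) = Z (lg y)" using xy(3) by (simp add: G_def)
   then obtain n :: int where n: "lg y = lg x + \<i> * of_int n" using Zinj[OF lgHp[OF b(1)] lgHp[OF b(2)]] by blast
   have "- (2 * of_real pi * of_real \<sigma> * lg y) = - (2 * of_real pi * of_real \<sigma> * lg x) + 2 * of_int (if \<sigma> = 1 then - n else n) * of_real pi * \<i>"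
    unfolding n using sg by (auto simp: algebra_simps)
   then have "exp (- (2 * of_real pi * of_real \<sigma> * lg y)) = exp (- (2 * of_real pi * of_real \<sigma> * lg x))"
    unfolding exp_eq by (intro exI[of _ "if \<sigma> = 1 then - n else n"]) simp
   then show ?thesis using explg b by simp
  qed
 qed
 \<comment> \<open>\<open>G\<close> is injective on the full disc, so its inverse \<open>g\<close>
   expresses \<zeta> as a holomorphic function of the chart coordinate, with a simple zero at the
   puncture.\<close>
 obtain g where g: "g holomorphic_on (G ` ball 0 R)" "!!z. z \<in> ball 0 R ==> deriv G z * deriv g (G z) = 1" "!!z. z \<in> ball 0 R ==> g (G z) = z"
  using holomorphic_has_inverse[OF hG open_ball iG] by metis
 have oT: "open (G ` ball 0 R)" by (rule open_mapping_thm3[OF hG open_ball iG])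
 have zT: "z1 \<in> G ` ball 0 R" using Rp by (intro image_eqI[of _ _ 0]) (auto simp: G_def)
 obtain r2 where r2: "r2 > 0" "ball z1 r2 \<subseteq> G ` ball 0 R Int ball z1 r1"
  using open_contains_ball[of "G ` ball 0 R Int ball z1 r1"] oT zT r1(1) by (metis IntI centre_in_ball open_Int open_ball)
 have gz1: "g z1 = 0" using g(3)[of 0] Rp by (simp add: G_def)
 obtain C \<delta> where C: "\<delta> > 0" "!!z D v. z \<in> cusp_halfplane \<sigma> ==> \<kappa> z \<in> cdom c ==> (Z has_field_derivative D) (at z within cusp_halfplane \<sigma>) ==>
   \<bar>om c (\<kappa> z) (D * v) - Re v\<bar> <= C * exp (- \<delta> * \<bar>Re z\<bar>) * cmod v"
  using asy c(1) unfolding asymptotic_to_dx_def Z_def by blast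
 \<comment> \<open>The coefficient of the form relative to dz in the cusp, that is \<open>H\<close>
   times the derivative of \<open>Z\<close>, written in terms of \<open>g\<close>. By the
   asymptotics it tends to 1.\<close>
 define k where "k w = - (2 * of_real pi * of_real \<sigma>) * (H w * (g w * deriv G (g w)))" for w
 have pt: "g w \<in> ball 0 R - {0} & G (g w) = w & cmod (k w - 1) <= C * (cmod (g w)) powr (\<delta> / (2 * pi))" if w: "w \<in> ball z1 r2" "w ~= z1" for w
 proof -
  obtain \<zeta> where z: "\<zeta> \<in> ball 0 R" "w = G \<zeta>" using w(1) r2(2) by blast
  then have z': "\<zeta> \<in> ball 0 R - {0}" using w(2) by (auto simp: G_def)
  have gw: "g w = \<zeta>" using z g(3) by simp
  note gb = Gb[OF z']
  let ?z = "lg \<zeta>"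
  have zh: "?z \<in> cusp_halfplane \<sigma>" using lgHp[OF z'] Hh by blast
  have wS: "w \<in> crd c ` (cdom c Int S)" by (rule r1S) (use w r2(2) in auto)
  have "om c (\<kappa> ?z) u = Re (H w * u)" for u
  proof -
   have "\<kappa> ?z = cinv c w" using gb z(2) c(1) by simp
   then show ?thesis using H(2)[OF wS, of u] by (simp add: dpull_def)
  qed
  moreover have "(H w * deriv Z ?z - 1) * u = H w * (deriv Z ?z * u) - u" for u by (simp add: algebra_simps)
  ultimately have "\<bar>Re ((H w * deriv Z ?z - 1) * u)\<bar> <= C * exp (- \<delta> * \<bar>Re ?z\<bar>) * cmod u" for u
   using C(2)[OF zh _ conjunct2[OF Zd[OF lgHp[OF z']]], of u] gb by (simp only: minus_complex.sel)
  then have b: "cmod (H w * deriv Z ?z - 1) <= C * exp (- \<delta> * \<bar>Re ?z\<bar>)" by (rule complex_Re_bound)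
  have "deriv G \<zeta> = deriv Z ?z * (- of_real (\<sigma> / (2 * pi)) / \<zeta>)" by (rule DERIV_imp_deriv[OF Gd[OF z']])
  then have "k w = of_real \<sigma> * (of_real \<sigma> * (H w * deriv Z ?z))" using z' by (simp add: k_def gw)
  then have kw: "k w = H w * deriv Z ?z" by (simp only: s2)
  have l0: "\<bar>Re ?z\<bar> = - ln (cmod \<zeta>) / (2 * pi)"
  proof -
   have "\<sigma> * Re ?z \<ge> 0" using zh by (simp add: cusp_halfplane_def)
   then have "\<bar>Re ?z\<bar> = \<sigma> * Re ?z" using sg by auto
   then show ?thesis using Relg z' by simp
  qed
  \<comment> \<open>|Re z| = -log |\<zeta>| / (2 pi), so exponential decay in x is a positive power
    of |\<zeta>|.\<close>
  have "exp (- \<delta> * \<bar>Re ?z\<bar>) = (cmod \<zeta>) powr (\<delta> / (2 * pi))" using z' unfolding l0 by (simp add: powr_def)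
  then show ?thesis using b kw gw z' z(2) by simp
 qed
 have gh: "g holomorphic_on ball z1 r2" by (rule holomorphic_on_subset[OF g(1)]) (use r2 in auto)
 have z1b: "z1 \<in> ball z1 r2" using r2(1) by simp
 have gd: "(g has_field_derivative deriv g z1) (at z1)" by (rule holomorphic_derivI[OF gh open_ball z1b])
 have g'0: "deriv g z1 ~= 0" using g(2)[of 0] Rp by (auto simp: G_def)
 have L1: "((%w. (w - z1) / g w) \<longlongrightarrow> inverse (deriv g z1)) (at z1)"
 proof -
  have "((%w. (g w - g z1) / (w - z1)) \<longlongrightarrow> deriv g z1) (at z1)" using gd by (simp add: has_field_derivative_iff)
  from tendsto_inverse[OF this g'0] show ?thesis by (simp add: gz1)
 qed
 have "isCont (deriv g) z1"
  using holomorphic_on_imp_continuous_on[OF holomorphic_deriv[OF gh open_ball]] continuous_on_eq_continuous_at[OF open_ball] z1b by blast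
 then have L2: "(deriv g \<longlongrightarrow> deriv g z1) (at z1)" by (simp only: isCont_def)
 have gc: "(g \<longlongrightarrow> 0) (at z1)" using DERIV_isCont[OF gd] by (simp add: isCont_def gz1)
 have ev: "\<forall>\<^sub>F w in at z1. w \<in> ball z1 r2 & w ~= z1"
  using eventually_at_in_open[OF open_ball z1b] by (auto elim: eventually_mono)
 have L3: "(k \<longlongrightarrow> 1) (at z1)"
 proof (rule LIM_zero_cancel, rule Lim_null_comparison)
  show "\<forall>\<^sub>F w in at z1. norm (k w - 1) <= C * (cmod (g w)) powr (\<delta> / (2 * pi))" using ev pt by (auto elim!: eventually_mono)
  have "((%w. cmod (g w)) \<longlongrightarrow> 0) (at z1)" by (rule tendsto_norm_zero[OF gc])
  then have "((%w. (cmod (g w)) powr (\<delta> / (2 * pi))) \<longlongrightarrow> 0) (at z1)"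
   by (rule tendsto_zero_powrI[OF _ tendsto_const]) (use C(1) in auto)
  from tendsto_mult_right_zero[OF this] show "((%w. C * (cmod (g w)) powr (\<delta> / (2 * pi))) \<longlongrightarrow> 0) (at z1)" .
 qed
 define a where "a = - complex_of_real (\<sigma> / (2 * pi))"
 \<comment> \<open>The product equals a k times (w - z1) / g times the derivative of g, and these
   three factors tend to 1, to the inverse of the derivative of g at \<open>z1\<close>, and to that
   derivative.\<close>
 have L: "((%w. (w - z1) * H w) \<longlongrightarrow> a) (at z1)"
 proof -
  have "((%w. a * (k w * ((w - z1) / g w * deriv g w))) \<longlongrightarrow> a * (1 * (inverse (deriv g z1) * deriv g z1))) (at z1)"
   by (intro tendsto_intros L1 L2 L3)
  moreover have "\<forall>\<^sub>F w in at z1. a * (k w * ((w - z1) / g w * deriv g w)) = (w - z1) * H w"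
   using ev
  proof eventually_elim
   case (elim w)
   then have p: "g w \<in> ball 0 R - {0}" "G (g w) = w" using pt[of w] by auto
   have d: "deriv G (g w) * deriv g w = 1" using g(2)[of "g w"] p by simp
   have "a * (- (2 * of_real pi * of_real \<sigma>)) = of_real \<sigma> * (of_real \<sigma> * 1)" by (simp add: a_def)
   then have a1: "a * (- (2 * of_real pi * of_real \<sigma>)) = 1" by (simp only: s2)
   have "a * (k w * ((w - z1) / g w * deriv g w)) = (a * (- (2 * of_real pi * of_real \<sigma>))) * (H w * (w - z1)) * (deriv G (g w) * deriv g w) * (g w / g w)"
    by (simp add: k_def)
   also have "\<dots> = 1 * (H w * (w - z1)) * 1 * (g w / g w)" by (simp only: a1 d)
   also have "\<dots> = (w - z1) * H w" using p(1) by simp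
   finally show ?case .
  qed
  ultimately show ?thesis using g'0 Lim_transform_eventually by fastforce
 qed
 \<comment> \<open>With its limit \<open>a\<close> as value at the centre this function is
   holomorphic, by the removable singularity theorem; its difference quotient \<open>H0\<close> is
   the regular part of \<open>H\<close>.\<close>
 define \<phi> where "\<phi> w = (if w = z1 then a else (w - z1) * H w)" for w
 have "ball z1 r2 - {z1} \<subseteq> crd c ` (cdom c Int S)"
 proof
  fix x assume x: "x \<in> ball z1 r2 - {z1}"
  then have "x \<in> ball z1 r1" using r2(2) by blast
  then show "x \<in> crd c ` (cdom c Int S)" by (intro r1S) (use x in auto)
 qed
 then have "H holomorphic_on ball z1 r2 - {z1}" by (rule holomorphic_on_subset[OF H(1)])
 then have "(%w. (w - z1) * H w) holomorphic_on ball z1 r2 - {z1}" by (intro holomorphic_intros)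
 then have ph: "\<phi> holomorphic_on ball z1 r2 - {z1}" by (rule holomorphic_transform) (simp add: \<phi>_def)
 have "isCont \<phi> z1"
 proof -
  have "(\<phi> \<longlongrightarrow> a) (at z1)"
   by (rule Lim_transform_eventually[OF L]) (simp add: \<phi>_def eventually_at_filter)
  then show ?thesis by (simp add: isCont_def \<phi>_def)
 qed
 moreover have "isCont \<phi> w" if "w \<in> ball z1 r2 - {z1}" for w
 proof -
  have "open (ball z1 r2 - {z1})" by auto
  then show ?thesis using holomorphic_on_imp_continuous_on[OF ph] continuous_on_eq_continuous_at that by blast
 qed
 ultimately have "isCont \<phi> w" if "w \<in> ball z1 r2" for w using that by (cases "w = z1") auto
 then have cp: "continuous_on (ball z1 r2) \<phi>" by (simp add: continuous_at_imp_continuous_on)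
 have hp: "\<phi> holomorphic_on ball z1 r2" by (rule no_isolated_singularity[OF cp ph open_ball]) simp
 define H0 where "H0 w = (if w = z1 then deriv \<phi> z1 else (\<phi> w - \<phi> z1) / (w - z1))" for w
 have hH: "H0 holomorphic_on ball z1 r2" unfolding H0_def[abs_def] by (rule pole_lemma_open[OF hp open_ball])
 define r where "r = r2 / 2"
 have rb: "r > 0" "ball z1 r \<subseteq> ball z1 r2" "cball z1 r \<subseteq> ball z1 r2" using r2(1) by (auto simp: r_def)
 have "dpull c om z w = Re ((- of_real (\<sigma> / (2 * pi)) / (z - z1) + H0 z) * w)" if z: "z \<in> ball z1 r - {z1}" for z w
 proof -
  have z': "z \<in> ball z1 r2" "z ~= z1" using z rb(2) by auto
  have zS: "z \<in> crd c ` (cdom c Int S)" by (rule r1S) (use z' r2(2) in auto)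
  have "H0 z = H z - a / (z - z1)" using z'(2) by (simp add: H0_def \<phi>_def diff_divide_distrib)
  then have "H z = - of_real (\<sigma> / (2 * pi)) / (z - z1) + H0 z" by (simp add: a_def)
  then show ?thesis using H(2)[OF zS] by simp
 qed
 moreover have "cball z1 r \<subseteq> crd c ` (cdom c Int N)"
 proof -
  have "ball z1 r2 \<subseteq> cball z1 r1" using r2(2) ball_subset_cball by blast
  then show ?thesis using rb(3) r1(2) by blast
 qed
 moreover have "H0 holomorphic_on ball z1 r" by (rule holomorphic_on_subset[OF hH rb(2)])
 ultimately show ?thesis using rb(1) unfolding z1_def by blast
qed

lemma holomorphic_ball_primitive:
 assumes "H0 holomorphic_on ball z1 r"
 shows "\<exists>F. F holomorphic_on ball z1 r & (\<forall>z\<in>ball z1 r. deriv F z = H0 z)"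
proof -
 obtain F where "!!z. z \<in> ball z1 r ==> (F has_field_derivative H0 z) (at z within ball z1 r)"
  using holomorphic_convex_primitive'[OF convex_ball open_ball assms] by blast
 then have F: "(F has_field_derivative H0 z) (at z)" if "z \<in> ball z1 r" for z
  using that at_within_open[OF that open_ball] by metis
 have "F holomorphic_on ball z1 r" using F holomorphic_on_open[OF open_ball] by blast
 then show ?thesis using F DERIV_imp_deriv by blast
qed

text \<open>The Hodge star turns d log |z| into d arg z, so the coefficient -\<sigma> / (2 pi)
  becomes the residue -\<sigma>.\<close>

lemma pole_hodge:
 assumes c: "c \<in> A" "v \<in> cdom c" and r: "r > 0" "H0 holomorphic_on ball (crd c v) r"
  and e: "!!z w. z \<in> ball (crd c v) r - {crd c v} ==> dpull c om z w = Re ((- of_real (\<sigma> / (2 * pi)) / (z - crd c v) + H0 z) * w)"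
 shows "pole_at c (hodge om) v (- \<sigma>)"
proof -
 obtain F where F: "F holomorphic_on ball (crd c v) r" "!!z. z \<in> ball (crd c v) r ==> deriv F z = H0 z"
  using holomorphic_ball_primitive[OF r(2)] by blast
 show ?thesis
 proof (rule pole_atI[OF c r(1) C1f_Im[OF F(1) open_ball]])
  fix z w assume z: "z \<in> ball (crd c v) r" "z ~= crd c v"
  then have "dpull c om z (\<i> * w) = Re ((- of_real (\<sigma> / (2 * pi)) / (z - crd c v) + H0 z) * (\<i> * w))" by (intro e) auto
  then have 1: "dpull c (hodge om) z w = - Re (\<i> * ((- of_real (\<sigma> / (2 * pi)) / (z - crd c v) + H0 z) * w))"
   by (simp only: dpull_def hodge_def mult.left_commute)
  have "(- of_real (\<sigma> / (2 * pi)) / (z - crd c v) + H0 z) * w = of_real (- \<sigma> / (2 * pi)) * (w / (z - crd c v)) + deriv F z * w"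
   using F(2)[OF z(1)] by (simp add: algebra_simps)
  then show "dpull c (hodge om) z w = - \<sigma> / (2 * pi) * Im (w / (z - crd c v)) + Im (deriv F z * w)"
   unfolding 1 Re_i_times by (simp only: plus_complex.sel Im_of_real_mult minus_minus)
 qed
qed

lemma ln_cmod_derivative:
 assumes "z ~= z1"
 shows "((%z. ln (cmod (z - z1))) has_derivative (%v. Re (v / (z - z1)))) (at z)"
proof -
 have h: "((%x. Re (ln (cmod (z - z1)) + Ln ((x - z1) / (z - z1)))) has_derivative (%v. Re (1 / (z - z1) * v))) (at z)"
 proof -
  have d: "((%x. (x - z1) / (z - z1)) has_field_derivative 1 / (z - z1)) (at z)"
   by (rule DERIV_cong[OF DERIV_cdivide[OF DERIV_diff[OF DERIV_ident DERIV_const]]]) simp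
  have np: "(z - z1) / (z - z1) ~: \<real>\<^sub>\<le>\<^sub>0" using assms by simp
  have "((%x. Ln ((x - z1) / (z - z1))) has_field_derivative inverse ((z - z1) / (z - z1)) * (1 / (z - z1))) (at z)"
   by (rule DERIV_chain2[where f = Ln and g = "%x. (x - z1) / (z - z1)", OF has_field_derivative_Ln[OF np] d])
  then have "((%x. ln (cmod (z - z1)) + Ln ((x - z1) / (z - z1))) has_field_derivative 1 / (z - z1)) (at z)"
   by (rule DERIV_cong[OF DERIV_add[OF DERIV_const]]) (use assms in simp)
  then have "((%x. ln (cmod (z - z1)) + Ln ((x - z1) / (z - z1))) has_derivative (%v. 1 / (z - z1) * v)) (at z)"
   by (simp only: has_field_derivative_def)
  then show ?thesis by (rule bounded_linear.has_derivative[OF bounded_linear_Re])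
 qed
 have "((%z. ln (cmod (z - z1))) has_derivative (%v. Re (1 / (z - z1) * v))) (at z)"
 proof (rule has_derivative_transform_within_open[OF h, of "- {z1}"])
  fix x assume "x \<in> - {z1}"
  then have "Re (Ln ((x - z1) / (z - z1))) = ln (cmod (x - z1)) - ln (cmod (z - z1))"
   using assms by (simp add: norm_divide ln_div)
  then show "Re (ln (cmod (z - z1)) + Ln ((x - z1) / (z - z1))) = ln (cmod (x - z1))" by simp
 qed (use assms in auto)
 then show ?thesis by simp
qed

text \<open>Up to a function bounded near the puncture the primitive is -\<sigma> / (2 pi) times the
  logarithm of the distance, so \<sigma> f tends to infinity.\<close>

lemma pole_primitive_unbounded:
 assumes c: "c \<in> A" "v \<in> cdom c" and r: "r > 0" "H0 holomorphic_on ball (crd c v) r" "cball (crd c v) r \<subseteq> crd c ` (cdom c Int N)"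
  and e: "!!z w. z \<in> ball (crd c v) r - {crd c v} ==> dpull c om z w = Re ((- of_real (\<sigma> / (2 * pi)) / (z - crd c v) + H0 z) * w)"
  and sg: "\<sigma> = 1 \<or> \<sigma> = -1" and f: "primitive_on A S om f" and N: "N - {v} \<subseteq> S"
 shows "\<exists>V. open V & v \<in> V & V \<subseteq> N & (\<forall>p\<in>V - {v}. \<sigma> * f p > B)"
proof -
 let ?z = "crd c v"
 obtain F where F: "F holomorphic_on ball ?z r" "!!z. z \<in> ball ?z r ==> deriv F z = H0 z"
  using holomorphic_ball_primitive[OF r(2)] by blast
 define u where "u z = f (cinv c z) + \<sigma> / (2 * pi) * ln (cmod (z - ?z)) - Re (F z)" for z
 let ?D = "ball ?z r - {?z}"
 have inN: "\<exists>p. p \<in> cdom c & p \<in> N & p ~= v & z = crd c p & cinv c z = p" if z: "z \<in> ?D" for z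
 proof -
  have "z \<in> cball ?z r" using z by auto
  then obtain p where "p \<in> cdom c" "p \<in> N" "z = crd c p" using r(3) by blast
  then show ?thesis using z c by (intro exI[of _ p]) auto
 qed
 have du: "(u has_derivative (%v. 0)) (at z)" if z: "z \<in> ?D" for z
 proof -
  obtain p where p: "p \<in> cdom c" "p \<in> N" "p ~= v" "z = crd c p" "cinv c z = p" using inN[OF z] by blast
  then have "p \<in> S" using N by blast
  then have "((f \<circ> cinv c) has_derivative om c p) (at (crd c p))" using f c(1) p(1) by (simp add: primitive_on_def)
  moreover have "om c p = (%w. Re ((- of_real (\<sigma> / (2 * pi)) / (z - ?z) + H0 z) * w))"
   using e[OF z] p(5) by (intro ext) (simp add: dpull_def)
  ultimately have 1: "((%z. f (cinv c z)) has_derivative (%w. Re ((- of_real (\<sigma> / (2 * pi)) / (z - ?z) + H0 z) * w))) (at z)"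
   using p(4) by (simp add: comp_def)
  have zb: "z \<in> ball ?z r" "z ~= ?z" using z by auto
  note 2 = has_derivative_mult_right[OF ln_cmod_derivative[OF zb(2)], of "\<sigma> / (2 * pi)"]
  note 3 = C1f_D[OF C1f_Re[OF F(1) open_ball] zb(1)]
  have eq: "Re ((- of_real (\<sigma> / (2 * pi)) / (z - ?z) + H0 z) * w) + \<sigma> / (2 * pi) * Re (w / (z - ?z)) - Re (deriv F z * w) = 0" for w
  proof -
   have "(- of_real (\<sigma> / (2 * pi)) / (z - ?z) + H0 z) * w = H0 z * w - of_real (\<sigma> / (2 * pi)) * (w / (z - ?z))"
    by (simp add: algebra_simps)
   then show ?thesis unfolding F(2)[OF zb(1)] by (simp only: minus_complex.sel Re_of_real_mult)
  qed
  show ?thesis unfolding u_def using has_derivative_diff[OF has_derivative_add[OF 1 2] 3] by (simp only: eq)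
 qed
 have oD: "open ?D" by auto
 have cD: "connected ?D" by (rule connected_punctured_ball) simp
 define k where "k = u (?z + of_real (r / 2))"
 have zr: "?z + of_real (r / 2) \<in> ?D" using r(1) by (auto simp: dist_norm)
 have k: "u z = k" if z: "z \<in> ?D" for z unfolding k_def
  by (rule has_derivative_zero_unique_connected[OF oD cD _ z zr]) (rule du)
 have "continuous_on (cball ?z (r / 2)) F"
  by (rule continuous_on_subset[OF holomorphic_on_imp_continuous_on[OF F(1)]]) (use r(1) in auto)
 then have "compact (F ` cball ?z (r / 2))" by (intro compact_continuous_image compact_cball)
 then obtain M where M: "!!z. z \<in> cball ?z (r / 2) ==> cmod (F z) <= M"
  using compact_imp_bounded bounded_iff by (metis imageI)
 \<comment> \<open>Below this distance the logarithmic term exceeds |B| + M + |k| + 1, enough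
   against the bound \<open>M\<close> for the regular part and the constant
   \<open>k\<close>.\<close>
 define Y where "Y = exp (2 * pi * (- \<bar>B\<bar> - M - \<bar>k\<bar> - 1))"
 define t where "t = min (r / 2) Y"
 have t: "t > 0" "t <= r / 2" using r(1) by (auto simp: t_def Y_def)
 have tb: "ball ?z t \<subseteq> crd c ` (cdom c Int N)" using t r(1) by (intro subset_trans[OF _ r(3)]) auto
 have "\<sigma> * f p > B" if p: "p \<in> cinv c ` ball ?z t" "p ~= v" for p
 proof -
  obtain z where z: "z \<in> ball ?z t" "p = cinv c z" using p(1) by blast
  have zne: "z ~= ?z" using z(2) p(2) c by auto
  have zD: "z \<in> ?D" using z(1) zne t r(1) by auto
  have f1: "f p = k - \<sigma> / (2 * pi) * ln (cmod (z - ?z)) + Re (F z)" using k[OF zD] z(2) by (simp add: u_def)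
  have "cmod (z - ?z) < Y" using z(1) by (simp add: t_def dist_norm norm_minus_commute)
  then have "ln (cmod (z - ?z)) < ln Y" using zne by (subst ln_less_cancel_iff) (auto simp: Y_def)
  then have "ln (cmod (z - ?z)) < 2 * pi * (- \<bar>B\<bar> - M - \<bar>k\<bar> - 1)" by (simp add: Y_def)
  then have l: "ln (cmod (z - ?z)) / (2 * pi) < - \<bar>B\<bar> - M - \<bar>k\<bar> - 1" by (simp add: pos_divide_less_eq mult.commute)
  have "\<bar>Re (F z)\<bar> <= M" using M[of z] abs_Re_le_cmod[of "F z"] z(1) t by force
  then show ?thesis using sg l unfolding f1 by (auto simp: algebra_simps)
 qed
 moreover have "open (cinv c ` ball ?z t)" by (rule open_cinv_image[OF c(1) open_ball]) (use tb in blast)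
 moreover have "v \<in> cinv c ` ball ?z t" using c t by (auto intro!: image_eqI[of _ _ ?z])
 moreover have "cinv c ` ball ?z t \<subseteq> N"
 proof
  fix p assume "p \<in> cinv c ` ball ?z t"
  then obtain z where z: "z \<in> ball ?z t" "p = cinv c z" by blast
  then obtain q where "q \<in> cdom c" "q \<in> N" "z = crd c q" using tb by blast
  then show "p \<in> N" using z(2) cinv_crd[OF c(1)] by simp
 qed
 ultimately show ?thesis by blast
qed

section \<open>Truncation of an exact form with logarithmic poles\<close>

lemma integ_dominated:
 assumes i: "intble X \<theta>" "!!n. intble X (\<theta>n n)"
  and b: "!!n c p. c \<in> A ==> p \<in> cdom c Int X ==> \<bar>\<theta>n n c p\<bar> <= \<bar>\<theta> c p\<bar>"
  and e: "!!c p. c \<in> A ==> p \<in> cdom c Int X ==> \<forall>\<^sub>F n in sequentially. \<theta>n n c p = \<theta> c p"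
 shows "(%n. integ X (\<theta>n n)) \<longlonglongrightarrow> integ X \<theta>"
 unfolding integ_itg
proof (rule tendsto_sum)
 fix i assume "i \<in> {..<length charts}"
 then have il: "i < length charts" by simp
 have I: "integrable lborel (itg X \<theta> i)" "!!n. integrable lborel (itg X (\<theta>n n) i)" using i il unfolding intble_itg by auto
 have pt: "cinv (ch i) z \<in> cdom (ch i) Int X" if "z \<in> crd (ch i) ` (piece i Int X)" for z
  using that piece_cdom[of i] cinv_crd[OF ch_in[OF il]] by auto
 show "(%n. integral\<^sup>L lborel (itg X (\<theta>n n) i)) \<longlonglongrightarrow> integral\<^sup>L lborel (itg X \<theta> i)"
 proof (rule integral_dominated_convergence[where w = "%z. \<bar>itg X \<theta> i z\<bar>"])
  show "itg X \<theta> i \<in> borel_measurable lborel" "!!n. itg X (\<theta>n n) i \<in> borel_measurable lborel"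
   using I borel_measurable_integrable by blast+
  show "integrable lborel (%z. \<bar>itg X \<theta> i z\<bar>)" by (rule integrable_abs[OF I(1)])
  show "AE z in lborel. (%n. itg X (\<theta>n n) i z) \<longlonglongrightarrow> itg X \<theta> i z"
  proof (rule AE_I2)
   fix z
   show "(%n. itg X (\<theta>n n) i z) \<longlonglongrightarrow> itg X \<theta> i z"
   proof (cases "z \<in> crd (ch i) ` (piece i Int X)")
    case True
    have "\<forall>\<^sub>F n in sequentially. itg X (\<theta>n n) i z = itg X \<theta> i z"
     using e[OF ch_in[OF il] pt[OF True]] by eventually_elim (simp add: itg_def pull_def)
    then show ?thesis by (rule tendsto_eventually)
   qed (simp add: itg_def)
  qed
  fix n
  show "AE z in lborel. norm (itg X (\<theta>n n) i z) <= \<bar>itg X \<theta> i z\<bar>"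
  proof (rule AE_I2)
   fix z
   show "norm (itg X (\<theta>n n) i z) <= \<bar>itg X \<theta> i z\<bar>"
    using b[OF ch_in[OF il] pt, of z n] by (cases "z \<in> crd (ch i) ` (piece i Int X)") (auto simp: itg_def pull_def)
  qed
 qed
qed

lemma prim_of_primitive:
 assumes f: "primitive_on A U om f" and h: "hol U om"
 shows "prim U om f"
 unfolding prim_def C1f_def
proof (intro ballI conjI allI)
 fix c z assume c: "c \<in> A" and "z \<in> crd c ` (cdom c Int U)"
 then obtain p where p: "p \<in> cdom c" "p \<in> U" "z = crd c p" by blast
 have "((f \<circ> cinv c) has_derivative om c p) (at (crd c p))" using f c p by (simp add: primitive_on_def)
 moreover have "dpull c om z = om c p" using p c by (intro ext) simp
 ultimately show "((%z. f (cinv c z)) has_derivative dpull c om z) (at z)" using p(3) by (simp add: comp_def)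
next
 fix c v assume c: "c \<in> A"
 obtain H where H: "H holomorphic_on crd c ` (cdom c Int U)" "!!z v. z \<in> crd c ` (cdom c Int U) ==> dpull c om z v = Re (H z * v)"
  using h c unfolding hol_def by blast
 have "continuous_on (crd c ` (cdom c Int U)) (%z. Re (H z * v))"
  by (intro continuous_intros holomorphic_on_imp_continuous_on[OF H(1)])
 then show "continuous_on (crd c ` (cdom c Int U)) (%z. dpull c om z v)"
  by (rule continuous_on_eq) (simp add: H(2))
qed

text \<open>A truncation of class C^1 at scale n. Its derivative is a trapezoid that is 1 on [-n, n]
  and 0 off [-2n, 2n]; the area 3n of the trapezoid is the final constant value.\<close>

definition trunc :: "real => real => real" where
 "trunc n x = (sq_pos (x + 2 * n) - sq_pos (x + n) - sq_pos (x - n) + sq_pos (x - 2 * n)) / (2 * n)"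

definition trunc' :: "real => real => real" where
 "trunc' n x = (max 0 (x + 2 * n) - max 0 (x + n) - max 0 (x - n) + max 0 (x - 2 * n)) / n"

lemma trunc_deriv: "n > 0 ==> (trunc n has_real_derivative trunc' n x) (at x)"
proof -
 assume n: "n > 0"
 have s: "((%x. sq_pos (x + k)) has_real_derivative 2 * max 0 (x + k)) (at x)" for k
  using DERIV_shift[of sq_pos "2 * max 0 (x + k)" x k] sq_pos_deriv[of "x + k"] by blast
 have "((%x. (sq_pos (x + 2 * n) - sq_pos (x + n) - sq_pos (x + - n) + sq_pos (x + - (2 * n))) / (2 * n)) has_real_derivative
  (2 * max 0 (x + 2 * n) - 2 * max 0 (x + n) - 2 * max 0 (x + - n) + 2 * max 0 (x + - (2 * n))) / (2 * n)) (at x)"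
  by (intro DERIV_cdivide DERIV_add DERIV_diff s)
 moreover have "(2 * max 0 (x + 2 * n) - 2 * max 0 (x + n) - 2 * max 0 (x + - n) + 2 * max 0 (x + - (2 * n))) / (2 * n) = trunc' n x"
  using n by (simp add: trunc'_def field_simps)
 ultimately show ?thesis by (simp add: trunc_def[abs_def])
qed

lemma trunc'_bounds: "n > 0 ==> \<bar>trunc' n x\<bar> <= 1" "n > 0 ==> \<bar>x\<bar> <= n ==> trunc' n x = 1"
 "n > 0 ==> \<bar>x\<bar> > 2 * n ==> trunc' n x = 0"
 by (auto simp: trunc'_def max_def field_simps abs_if split: if_splits)

lemma trunc_const: "n > 0 ==> x > 2 * n ==> trunc n x = 3 * n" "n > 0 ==> x < - 2 * n ==> trunc n x = 0"
 by (auto simp: trunc_def sq_pos_def max_def power2_eq_square field_simps)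

text \<open>Truncations of the primitive are constant near the punctures, so they extend to the compact
 surface, where Stokes' theorem applies.\<close>

lemma exact_pairing_zero:
 assumes v: "v1 ~= v2" and f: "prim (- {v1, v2}) \<tau> f" and w: "locex UNIV om"
  and i: "intble (- {v1, v2}) (wedge \<tau> om)"
  and n1: "!!B. \<exists>V. open V & v1 \<in> V & V \<subseteq> - {v2} & (\<forall>p\<in>V - {v1}. - f p > B)"
  and n2: "!!B. \<exists>V. open V & v2 \<in> V & V \<subseteq> - {v1} & (\<forall>p\<in>V - {v2}. f p > B)"
 shows "integ (- {v1, v2}) (wedge \<tau> om) = 0"
proof -
 let ?S = "- {v1, v2}"
 define N where "N m = real (Suc m)" for m
 have N: "N m > 0" for m by (simp add: N_def)
 define \<Theta> where "\<Theta> m c p w = (if p \<in> ?S then trunc' (N m) (f p) * \<tau> c p w else 0)" for m c p w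
 \<comment> \<open>The values at the punctures are those of the truncation where \<open>f\<close> is
   very negative, 0 near \<open>v1\<close>, and very large, three times \<open>N m\<close> near
   \<open>v2\<close>.\<close>
 define \<Phi> where "\<Phi> m p = (if p = v1 then 0 else if p = v2 then 3 * N m else trunc (N m) (f p))" for m p
 have oS: "open ?S" by auto
 have P: "prim UNIV (\<Theta> m) (\<Phi> m)" for m
 proof -
  have S: "prim ?S (\<Theta> m) (\<Phi> m)"
  proof -
   have "prim ?S (%c p w. trunc' (N m) (f p) * \<tau> c p w) (%p. trunc (N m) (f p))"
    unfolding prim_def
   proof
    fix c assume c: "c \<in> A"
    have "C1f (crd c ` (cdom c Int ?S)) (%z. trunc (N m) (f (cinv c z))) (%z v. trunc' (N m) (f (cinv c z)) * dpull c \<tau> z v)"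
     by (rule C1f_comp_real[OF prim_C1f[OF f c] trunc_deriv[OF N]]) (use N[of m] in \<open>auto simp: trunc'_def[abs_def] intro!: continuous_intros\<close>)
    then show "C1f (crd c ` (cdom c Int ?S)) (%z. trunc (N m) (f (cinv c z))) (dpull c (%c p w. trunc' (N m) (f p) * \<tau> c p w))"
     by (simp add: dpull_def[abs_def])
   qed
   then show ?thesis by (rule prim_cong[OF _ oS]) (auto simp: \<Theta>_def \<Phi>_def)
  qed
  from n1[of "2 * N m"] obtain V1 where V1': "open V1 & v1 \<in> V1 & V1 \<subseteq> - {v2} & (\<forall>p\<in>V1 - {v1}. - f p > 2 * N m)" ..
  then have V1: "open V1" "v1 \<in> V1" "V1 \<subseteq> - {v2}" "!!p. p \<in> V1 - {v1} ==> - f p > 2 * N m" by blast+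
  from n2[of "2 * N m"] obtain V2 where V2': "open V2 & v2 \<in> V2 & V2 \<subseteq> - {v1} & (\<forall>p\<in>V2 - {v2}. f p > 2 * N m)" ..
  then have V2: "open V2" "v2 \<in> V2" "V2 \<subseteq> - {v1}" "!!p. p \<in> V2 - {v2} ==> f p > 2 * N m" by blast+
  have p1: "prim V1 (\<Theta> m) (\<Phi> m)"
  proof (rule prim_cong[OF prim_const[of _ 0] V1(1)])
   fix p assume p: "p \<in> V1"
   show "0 = \<Phi> m p" using V1(3) V1(4)[of p] p trunc_const(2)[OF N, of "f p" m] by (auto simp: \<Phi>_def)
   fix c v show "0 = \<Theta> m c p v" using V1(3) V1(4)[of p] p trunc'_bounds(3)[OF N, of m "f p"] by (cases "p = v1") (auto simp: \<Theta>_def)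
  qed
  have p2: "prim V2 (\<Theta> m) (\<Phi> m)"
  proof (rule prim_cong[OF prim_const[of _ "3 * N m"] V2(1)])
   fix p assume p: "p \<in> V2"
   show "3 * N m = \<Phi> m p" using V2(3) V2(4)[of p] p v trunc_const(1)[OF N, of m "f p"] by (auto simp: \<Phi>_def)
   fix c v show "0 = \<Theta> m c p v" using V2(3) V2(4)[of p] p trunc'_bounds(3)[OF N, of m "f p"] by (cases "p = v2") (auto simp: \<Theta>_def)
  qed
  have "prim (?S Un V1 Un V2) (\<Theta> m) (\<Phi> m)"
   by (intro prim_Un S p1 p2 open_Un oS V1(1) V2(1))
  moreover have "?S Un V1 Un V2 = UNIV" using V1(2) V2(2) by blast
  ultimately show ?thesis by simp
 qed
 have fin: "finite {v1, v2}" by simp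
 have z: "integ ?S (wedge (\<Theta> m) om) = 0" for m using stokes[OF P w] integ_finite[OF fin] by simp
 have "(%m. integ ?S (wedge (\<Theta> m) om)) \<longlonglongrightarrow> integ ?S (wedge \<tau> om)"
 proof (rule integ_dominated[OF i])
  show "intble ?S (wedge (\<Theta> m) om)" for m
   using intble_locex[OF prim_locex[OF P open_UNIV] w] intble_finite[OF fin] by blast
  have eq: "wedge (\<Theta> m) om c p = trunc' (N m) (f p) * wedge \<tau> om c p" if "p \<in> ?S" for m c p
   using that by (simp add: wedge_def \<Theta>_def algebra_simps)
  show "\<bar>wedge (\<Theta> m) om c p\<bar> <= \<bar>wedge \<tau> om c p\<bar>" if "p \<in> cdom c Int ?S" for m c p
   unfolding eq[OF IntD2[OF that]] abs_mult using mult_right_mono[OF trunc'_bounds(1)[OF N], of "\<bar>wedge \<tau> om c p\<bar>"] by simp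
  show "\<forall>\<^sub>F m in sequentially. wedge (\<Theta> m) om c p = wedge \<tau> om c p" if p: "p \<in> cdom c Int ?S" for c p
  proof -
   obtain m0 :: nat where m0: "\<bar>f p\<bar> <= real m0" using real_arch_simple by blast
   show ?thesis unfolding eventually_sequentially
   proof (intro exI[of _ m0] allI impI)
    fix m assume "m0 <= m"
    then have "\<bar>f p\<bar> <= N m" using m0 by (simp add: N_def)
    then show "wedge (\<Theta> m) om c p = wedge \<tau> om c p" unfolding eq[OF IntD2[OF p]] using trunc'_bounds(2)[OF N] by simp
   qed
  qed
 qed
 then show ?thesis using LIMSEQ_unique[OF _ tendsto_const] by (simp add: z)
qed

end

section \<open>Linear algebra\<close>

text \<open>With indices counted from 1, row k of J has the single nonzero entry
  \<open>pair_sign k\<close>, in column \<open>partner k\<close>. Products with J thus become sums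
  over one index.\<close>

definition pair_sign :: "nat => real" where "pair_sign k = (if odd k then 1 else - 1)"
definition partner :: "nat => nat" where "partner k = (if odd k then k + 1 else k - 1)"

lemma partner_in: assumes "k \<in> {3..2*g}" shows "partner k \<in> {3..2*g}"
proof (cases "odd k")
 case True
 then have "partner k = k + 1" by (simp add: partner_def)
 moreover have "k + 1 <= 2 * g" using True assms unfolding atLeastAtMost_iff by presburger
 ultimately show ?thesis using assms by simp
next
 case False
 then have "partner k = k - 1" by (simp add: partner_def)
 moreover have "3 <= k - 1" using False assms unfolding atLeastAtMost_iff by presburger
 moreover have "k - 1 <= 2 * g" using assms unfolding atLeastAtMost_iff by linarith
 ultimately show ?thesis using assms by simp
qed

lemma partner_in': assumes "k \<in> {1..2*g}" shows "partner k \<in> {1..2*g}"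
proof (cases "odd k")
 case True
 then have "partner k = k + 1" by (simp add: partner_def)
 moreover have "k + 1 <= 2 * g" using True assms unfolding atLeastAtMost_iff by presburger
 ultimately show ?thesis using assms by simp
next
 case False
 then have "partner k = k - 1" by (simp add: partner_def)
 moreover have "1 <= k - 1" using False assms unfolding atLeastAtMost_iff by presburger
 moreover have "k - 1 <= 2 * g" using assms unfolding atLeastAtMost_iff by linarith
 ultimately show ?thesis using assms by simp
qed

lemma partner_partner: "k \<ge> 1 ==> partner (partner k) = k"
 by (auto simp: partner_def)
lemma pair_sign_partner: "k \<ge> 1 ==> pair_sign (partner k) = - pair_sign k"
 by (auto simp: partner_def pair_sign_def)
lemma pair_sign_sq: "pair_sign k * pair_sign k = 1" "pair_sign k * (pair_sign k * x) = x"
 by (auto simp: pair_sign_def)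

lemma sum_partner: "(\<Sum>k\<in>{3..2*g}. f (partner k)) = (\<Sum>k\<in>{3..2*g}. f k)"
proof (rule sum.reindex_bij_witness[of _ partner partner])
 show "partner a \<in> {3..2*g}" if "a \<in> {3..2*g}" for a using partner_in[OF that] .
 show "partner a \<in> {3..2*g}" if "a \<in> {3..2*g}" for a using partner_in[OF that] .
 show "partner (partner a) = a" if "a \<in> {3..2*g}" for a using partner_partner[of a] that by simp
 show "partner (partner a) = a" if "a \<in> {3..2*g}" for a using partner_partner[of a] that by simp
qed simp

text \<open>In block form the matrix is \<open>Q + \<lambda> e\<^sub>2 e\<^sub>2\<^sup>T + \<kappa> \<kappa>\<^sup>T / \<lambda>\<close>, and the claim reduces to
 \<open>Q J \<kappa> = 0\<close> up to the second coordinate and to the symplecticity of the block of \<open>Q\<close> of the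
 compact surface.\<close>

lemma symplectic_algebra:
 fixes q :: "nat => nat => real" and c \<kappa> :: "nat => real"
 assumes g: "g \<ge> 2" and K_def: "K = {3..2*g}"
  and qs: "!!i j. i \<in> K ==> j \<in> K ==> q i j = q j i"
  and qq: "!!i j. i \<in> K ==> j \<in> K ==> (\<Sum>k\<in>K. q i k * pair_sign k * q (partner k) j) = (if j = partner i then pair_sign i else 0)"
  and k1: "\<kappa> 1 = 1" and kK: "!!j. j \<in> K ==> \<kappa> j = pair_sign j * c (partner j)"
  and q2: "!!j. j \<in> K ==> q 2 j = - (\<Sum>k\<in>K. c k * q k j)" "!!j. j \<in> K ==> q j 2 = q 2 j"
  and q22: "q 2 2 = (\<Sum>k\<in>K. \<Sum>l\<in>K. c k * c l * q k l)"
  and q1: "!!j. q 1 j = 0" "!!j. q j 1 = 0"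
  and lam: "lam ~= 0"
  and p: "!!i j. p i j = q i j + \<kappa> i * \<kappa> j / lam + (if i = 2 & j = 2 then lam else 0)"
  and ij: "i \<in> {1..2*g}" "j \<in> {1..2*g}"
 shows "(\<Sum>k\<in>{1..2*g}. p i k * pair_sign k * p (partner k) j) = (if j = partner i then pair_sign i else 0)"
proof -
 \<comment> \<open>The symplectic form on the coordinates in \<open>K\<close>; the indices 1 and 2
   form a block of their own and are treated by hand.\<close>
 define S where "S x y = (\<Sum>k\<in>K. x k * pair_sign k * y (partner k))" for x y :: "nat => real"
 have pK: "k \<in> K ==> partner k \<in> K" and K1: "k \<in> K ==> k \<ge> 1" and fK: "finite K" for k
  using partner_in by (auto simp: K_def)
 have Santi: "S y x = - S x y" for x y
 proof -
  have "S y x = (\<Sum>k\<in>K. y (partner k) * pair_sign (partner k) * x (partner (partner k)))"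
   unfolding S_def K_def by (rule sum_partner[symmetric])
  also have "\<dots> = (\<Sum>k\<in>K. - (x k * pair_sign k * y (partner k)))"
  proof (rule sum.cong[OF HOL.refl])
   fix k assume k: "k \<in> K"
   show "y (partner k) * pair_sign (partner k) * x (partner (partner k)) = - (x k * pair_sign k * y (partner k))"
    using partner_partner[OF K1[OF k]] pair_sign_partner[OF K1[OF k]] by simp
  qed
  finally show ?thesis by (simp add: S_def sum_negf)
 qed
 have Sadd: "S (%k. x k + a * y k) z = S x z + a * S y z" for x y z a
  unfolding S_def sum_distrib_left sum.distrib[symmetric] by (rule sum.cong) (simp_all add: algebra_simps)
 have Sadd': "S z (%k. x k + a * y k) = S z x + a * S z y" for x y z a
 proof -
  have e: "S z x = - S x z" "S z y = - S y z" "S z (%k. x k + a * y k) = - S (%k. x k + a * y k) z" by (rule Santi)+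
  show ?thesis unfolding e Sadd by simp
 qed
 have Scong: "(!!k. k \<in> K ==> x k = x' k) ==> (!!k. k \<in> K ==> y k = y' k) ==> S x y = S x' y'" for x x' y y'
  unfolding S_def by (rule sum.cong) (auto simp: pK)
 have S0: "S \<kappa> \<kappa> = 0" using Santi[of \<kappa> \<kappa>] by simp
 have cases: "i = 1 \<or> i = 2 \<or> i \<in> K" if "i \<in> {1..2*g}" for i using that by (auto simp: K_def)
 have qKs: "q i k = q k i" if "i \<in> {1..2*g}" "k \<in> K" for i k
  using cases[OF that(1)] qs q1 q2(2) that(2) by auto
 \<comment> \<open>Q J \<kappa> is column 2: on \<open>K\<close> one has \<kappa> = J c, so Q J
   \<kappa> = -Q c. For i = 2 this is where the prescribed corner c^T Q c is used.\<close>
 have Sk: "S (q i) \<kappa> = q i 2" if i: "i \<in> {1..2*g}" for i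
 proof -
  have "S (q i) \<kappa> = (\<Sum>k\<in>K. - (c k * q i k))"
   unfolding S_def
  proof (rule sum.cong[OF HOL.refl])
   fix k assume k: "k \<in> K"
   have "\<kappa> (partner k) = - pair_sign k * c k"
    using kK[OF pK[OF k]] partner_partner[OF K1[OF k]] pair_sign_partner[OF K1[OF k]] by simp
   then show "q i k * pair_sign k * \<kappa> (partner k) = - (c k * q i k)"
    using pair_sign_sq(1)[of k] by (simp add: algebra_simps pair_sign_sq(2))
  qed
  then have s: "S (q i) \<kappa> = - (\<Sum>k\<in>K. c k * q i k)" by (simp add: sum_negf)
  consider "i = 1" | "i = 2" | "i \<in> K" using cases[OF i] by blast
  then show ?thesis
  proof cases
   case 1
   then show ?thesis using s q1 by simp
  next
   case 2
   have "(\<Sum>k\<in>K. c k * q i k) = (\<Sum>k\<in>K. - (\<Sum>l\<in>K. c k * c l * q k l))"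
   proof (rule sum.cong[OF HOL.refl])
    fix k assume k: "k \<in> K"
    show "c k * q i k = - (\<Sum>l\<in>K. c k * c l * q k l)"
     unfolding 2 q2(1)[OF k] using qs k by (simp add: sum_distrib_left mult.assoc)
   qed
   then show ?thesis using s 2 q22 by (simp add: sum_negf)
  next
   case 3
   have "(\<Sum>k\<in>K. c k * q i k) = (\<Sum>k\<in>K. c k * q k i)" by (rule sum.cong) (auto simp: qs 3)
   then show ?thesis using s q2(1)[OF 3] q2(2)[OF 3] by simp
  qed
 qed
 define T where "T i j = S (q i) (q j)" for i j
 have TK: "T i j = (if j = partner i then pair_sign i else 0)" if "i \<in> K" "j \<in> K" for i j
 proof -
  have "T i j = (\<Sum>k\<in>K. q i k * pair_sign k * q (partner k) j)"
   unfolding T_def S_def by (rule sum.cong) (auto simp: qs[OF that(2) pK])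
  then show ?thesis using qq[OF that] by simp
 qed
 have T1: "T 1 j = 0" "T j 1 = 0" for j unfolding T_def S_def q1 by simp_all
 have T22: "T 2 2 = 0" using Santi[of "q 2" "q 2"] by (simp add: T_def)
 \<comment> \<open>Row 2 is -c^T Q, so symplecticity of the block leaves -c^T J, which is
   \<kappa>.\<close>
 have T2: "T 2 j = \<kappa> j" if j: "j \<in> K" for j
 proof -
  have "T 2 j = (\<Sum>k\<in>K. (- (\<Sum>l\<in>K. c l * q l k)) * pair_sign k * q j (partner k))"
   unfolding T_def S_def by (rule sum.cong) (auto simp: q2(1))
  also have "\<dots> = (\<Sum>k\<in>K. \<Sum>l\<in>K. - c l * (q l k * pair_sign k * q j (partner k)))"
   by (simp add: sum_distrib_left sum_distrib_right sum_negf algebra_simps)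
  also have "\<dots> = (\<Sum>l\<in>K. \<Sum>k\<in>K. - c l * (q l k * pair_sign k * q j (partner k)))" by (rule sum.swap)
  also have "\<dots> = (\<Sum>l\<in>K. - c l * T l j)" by (simp add: T_def S_def sum_distrib_left)
  also have "\<dots> = (\<Sum>l\<in>K. if l = partner j then - c l * pair_sign l else 0)"
   by (rule sum.cong) (use j TK K1 partner_partner in \<open>auto\<close>)
  also have "\<dots> = - c (partner j) * pair_sign (partner j)" using fK pK[OF j] by simp
  also have "\<dots> = \<kappa> j" using kK[OF j] pair_sign_partner[OF K1[OF j]] by simp
  finally show ?thesis .
 qed
 have T2': "T j 2 = - \<kappa> j" if j: "j \<in> K" for j using T2[OF j] Santi[of "q 2" "q j"] by (simp add: T_def)
 have Skq: "S \<kappa> (q j) = - q j 2" using Santi[of "q j" \<kappa>] Sk[OF ij(2)] by simp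
 have psym: "p k j = p j k" if "k \<in> K" for k using p qKs[OF ij(2) that] by simp
 have ps: "partner 1 = 2" "partner 2 = 1" "pair_sign 1 = 1" "pair_sign 2 = - 1" by (simp_all add: partner_def pair_sign_def)
 have nK: "1 ~: K" "2 ~: K" by (auto simp: K_def)
 have pn: "partner k ~= 1" "partner k ~= 2" if "k \<in> K" for k using pK[OF that] nK by metis+
 have eqK: "{1..2*g} = insert 1 (insert 2 K)" using g by (auto simp: K_def)
 have sumK: "sum f {1..2*g} = f 1 + (f 2 + sum f K)" for f :: "nat => real" unfolding eqK using fK nK by simp
 have "(\<Sum>k\<in>{1..2*g}. p i k * pair_sign k * p (partner k) j) =
   p i 1 * p 2 j - p i 2 * p 1 j + (\<Sum>k\<in>K. p i k * pair_sign k * p (partner k) j)"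
  unfolding sumK ps by simp
 also have "(\<Sum>k\<in>K. p i k * pair_sign k * p (partner k) j) = S (p i) (p j)"
  unfolding S_def by (rule sum.cong) (auto simp: psym pK)
 also have "S (p i) (p j) = S (%k. q i k + \<kappa> i / lam * \<kappa> k) (%k. q j k + \<kappa> j / lam * \<kappa> k)"
  by (rule Scong) (auto simp: p K_def)
 also have "\<dots> = T i j + \<kappa> j / lam * q i 2 - \<kappa> i / lam * q j 2"
  unfolding Sadd Sadd' T_def Sk[OF ij(1)] Skq S0 by (simp add: algebra_simps)
 finally have main: "(\<Sum>k\<in>{1..2*g}. p i k * pair_sign k * p (partner k) j) =
   p i 1 * p 2 j - p i 2 * p 1 j + (T i j + \<kappa> j / lam * q i 2 - \<kappa> i / lam * q j 2)" .
 have q2j: "q 2 j = q j 2" using cases[OF ij(2)] q1 q2(2) by auto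
 have k1': "\<kappa> (Suc 0) = 1" "q (Suc 0) j = 0" "q j (Suc 0) = 0" for j using k1 q1[of j] by auto
 \<comment> \<open>The terms with q / lam cancel. What survives is the product of lam in the corner
   with \<kappa> / lam from row and column 1; for i or j equal to 2 it is matched by
   \<open>T2\<close> and \<open>T2'\<close>.\<close>
 have "p i 1 * p 2 j - p i 2 * p 1 j + (T i j + \<kappa> j / lam * q i 2 - \<kappa> i / lam * q j 2)
  = (if j = 2 then \<kappa> i else 0) - (if i = 2 then \<kappa> j else 0) + T i j"
  using lam q2j by (simp add: p k1' field_simps)
 also have "\<dots> = (if j = partner i then pair_sign i else 0)"
 proof -
  consider "i = 1" "j = 1" | "i = 1" "j = 2" | "i = 1" "j \<in> K" | "i = 2" "j = 1" | "i = 2" "j = 2" | "i = 2" "j \<in> K"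
   | "i \<in> K" "j = 1" | "i \<in> K" "j = 2" | "i \<in> K" "j \<in> K" using cases[OF ij(1)] cases[OF ij(2)] by blast
  then show ?thesis
  proof cases
   case 1
   then show ?thesis using T1(1)[of 1] ps by simp
  next
   case 2
   then show ?thesis using T1(1)[of 2] k1 ps by simp
  next
   case 3
   then have "j ~= 2" using nK by metis
   then show ?thesis using 3 T1(1)[of j] ps by simp
  next
   case 4
   then show ?thesis using T1(2)[of 2] k1 ps by simp
  next
   case 5
   then show ?thesis using T22 ps by simp
  next
   case 6
   then have "j ~= 2" "j ~= 1" using nK by metis+
   then show ?thesis using 6 T2[of j] ps by simp
  next
   case 7
   then have "i ~= 2" "1 ~= partner i" using nK pn(1)[of i] by metis+
   then show ?thesis using 7 T1(2)[of i] by simp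
  next
   case 8
   then have "i ~= 2" "2 ~= partner i" using nK pn(2)[of i] by metis+
   then show ?thesis using 8 T2'[of i] by simp
  next
   case 9
   then have "i ~= 2" "j ~= 2" using nK by metis+
   then show ?thesis using TK[OF 9] by simp
  qed
 qed
 finally show ?thesis using main by simp
qed

text \<open>The induction step puts a new block at the upper left; \<open>partner\<close> and
  \<open>pair_sign\<close> are compatible with a shift of the indices by 2.\<close>

lemma J_matrix_eq: "J_matrix g = Matrix.mat (2*g) (2*g) (%(i, j). if Suc j = partner (Suc i) then pair_sign (Suc i) else 0)"
proof (induction g)
 case 0
 show ?case by (auto simp: J_matrix_def)
next
 case (Suc g)
 let ?B = "mat_of_rows_list 2 [[0, 1], [-1, 0 :: real]]"
 have "J_matrix (Suc g) = four_block_mat ?B (0\<^sub>m 2 (2*g)) (0\<^sub>m (2*g) 2) (J_matrix g)"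
 proof -
  have d: "dim_row ?B = 2" "dim_col ?B = 2" "dim_row (J_matrix g) = 2 * g" "dim_col (J_matrix g) = 2 * g"
   unfolding Suc by (simp_all add: mat_of_rows_list_def)
  have "J_matrix (Suc g) = four_block_mat ?B (0\<^sub>m (dim_row ?B) (dim_col (J_matrix g))) (0\<^sub>m (dim_row (J_matrix g)) (dim_col ?B)) (J_matrix g)"
   by (simp only: J_matrix_def replicate_Suc diag_block_mat.simps Let_def)
  then show ?thesis by (simp only: d)
 qed
 also have "\<dots> = Matrix.mat (2 * Suc g) (2 * Suc g) (%(i, j). if Suc j = partner (Suc i) then pair_sign (Suc i) else 0)"
 proof (rule eq_matI)
  fix i j assume "i < dim_row (Matrix.mat (2 * Suc g) (2 * Suc g) (%(i, j). if Suc j = partner (Suc i) then pair_sign (Suc i) else 0))"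
   "j < dim_col (Matrix.mat (2 * Suc g) (2 * Suc g) (%(i, j). if Suc j = partner (Suc i) then pair_sign (Suc i) else 0))"
  then have ij: "i < 2 * g + 2" "j < 2 * g + 2" by auto
  have B: "?B $$ (a, b) = (if Suc b = partner (Suc a) then pair_sign (Suc a) else 0)" if "a < 2" "b < 2" for a b
   using that by (auto simp: mat_of_rows_list_def partner_def pair_sign_def less_2_cases_iff)
  have dB: "dim_row ?B = 2" "dim_col ?B = 2" by (auto simp: mat_of_rows_list_def)
  have dJ: "dim_row (J_matrix g) = 2 * g" "dim_col (J_matrix g) = 2 * g" by (auto simp: Suc)
  have l: "four_block_mat ?B (0\<^sub>m 2 (2*g)) (0\<^sub>m (2*g) 2) (J_matrix g) $$ (i, j) =
   (if i < 2 then if j < 2 then ?B $$ (i, j) else 0 else if j < 2 then 0 else J_matrix g $$ (i - 2, j - 2))"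
   using ij by (simp add: index_mat_four_block dB dJ)
  have J: "J_matrix g $$ (i - 2, j - 2) = (if Suc (j - 2) = partner (Suc (i - 2)) then pair_sign (Suc (i - 2)) else 0)" if "2 <= i" "2 <= j"
   unfolding Suc using ij that by simp
  have "(if i < 2 then if j < 2 then ?B $$ (i, j) else 0 else if j < 2 then 0 else J_matrix g $$ (i - 2, j - 2))
   = (if Suc j = partner (Suc i) then pair_sign (Suc i) else 0)"
  proof -
   consider "i < 2" "j < 2" | "i < 2" "2 <= j" | "2 <= i" "j < 2" | "2 <= i" "2 <= j" by linarith
   then show ?thesis
   proof cases
    case 1
    then show ?thesis using B by simp
   next
    case 2
    then show ?thesis by (auto simp: partner_def less_2_cases_iff)
   next
    case 3
    then have "Suc j ~= partner (Suc i)" by (auto simp: partner_def less_2_cases_iff) (use 3 in presburger)?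
    then show ?thesis using 3 by simp
   next
    case 4
    then obtain a b where ab: "i = a + 2" "j = b + 2" by (metis le_add_diff_inverse2)
    have "Suc j = partner (Suc i) \<longleftrightarrow> Suc b = partner (Suc a)" "pair_sign (Suc i) = pair_sign (Suc a)"
     unfolding ab by (auto simp: partner_def pair_sign_def elim: oddE)
    then show ?thesis using J[OF 4] 4 ab by simp
   qed
  qed
  then show "four_block_mat ?B (0\<^sub>m 2 (2*g)) (0\<^sub>m (2*g) 2) (J_matrix g) $$ (i, j) =
   Matrix.mat (2 * Suc g) (2 * Suc g) (%(i, j). if Suc j = partner (Suc i) then pair_sign (Suc i) else 0) $$ (i, j)"
   using l ij by simp
 qed (auto simp: Suc mat_of_rows_list_def)
 finally show ?case .
qed

text \<open>Translation between matrices indexed from 0 and the entries \<open>p\<close>, which are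
  indexed from 1.\<close>

lemma symplectic_matrix:
 fixes p :: "nat => nat => real"
 assumes p: "!!i j. i \<in> {1..2*g} ==> j \<in> {1..2*g} ==>
  (\<Sum>k\<in>{1..2*g}. p i k * pair_sign k * p (partner k) j) = (if j = partner i then pair_sign i else 0)"
 defines "P \<equiv> Matrix.mat (2*g) (2*g) (%(i, j). p (i + 1) (j + 1))"
 shows "P * J_matrix g * P = J_matrix g"
proof (rule eq_matI)
 have dJ: "dim_row (J_matrix g) = 2 * g" "dim_col (J_matrix g) = 2 * g" by (auto simp: J_matrix_eq)
 then show "dim_row (P * J_matrix g * P) = dim_row (J_matrix g)" "dim_col (P * J_matrix g * P) = dim_col (J_matrix g)"
  by (auto simp: P_def)
 fix i j assume "i < dim_row (J_matrix g)" "j < dim_col (J_matrix g)"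
 then have ij: "i < 2 * g" "j < 2 * g" by (auto simp: dJ)
 let ?n = "2 * g"
 have Pc: "P \<in> carrier_mat ?n ?n" "J_matrix g \<in> carrier_mat ?n ?n" by (auto simp: P_def J_matrix_eq)
 have JP: "(J_matrix g * P) $$ (k, j) = pair_sign (Suc k) * p (partner (Suc k)) (Suc j)" if k: "k < ?n" for k
 proof -
  have pk: "partner (Suc k) \<in> {1..?n}" by (rule partner_in') (use k in auto)
  have "(J_matrix g * P) $$ (k, j) = (\<Sum>l<?n. (if Suc l = partner (Suc k) then pair_sign (Suc k) else 0) * p (Suc l) (Suc j))"
   using k ij by (simp add: J_matrix_eq P_def scalar_prod_def atLeast0LessThan)
  also have "\<dots> = (\<Sum>l<?n. if l = partner (Suc k) - 1 then pair_sign (Suc k) * p (partner (Suc k)) (Suc j) else 0)"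
   by (rule sum.cong) (use pk in auto)
  also have "\<dots> = pair_sign (Suc k) * p (partner (Suc k)) (Suc j)" using pk by (subst sum.delta) auto
  finally show ?thesis .
 qed
 have "P * J_matrix g * P = P * (J_matrix g * P)" by (rule assoc_mult_mat[OF Pc(1) Pc(2) Pc(1)])
 then have "(P * J_matrix g * P) $$ (i, j) = (\<Sum>k<?n. p (Suc i) (Suc k) * (J_matrix g * P) $$ (k, j))"
  using ij Pc by (simp add: P_def scalar_prod_def atLeast0LessThan dJ)
 also have "\<dots> = (\<Sum>k<?n. p (Suc i) (Suc k) * pair_sign (Suc k) * p (partner (Suc k)) (Suc j))"
  by (rule sum.cong) (use JP in \<open>auto simp: mult.assoc\<close>)
 also have "\<dots> = (\<Sum>k\<in>{1..?n}. p (Suc i) k * pair_sign k * p (partner k) (Suc j))"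
  by (simp add: sum.atLeast1_atMost_eq)
 also have "\<dots> = (if Suc j = partner (Suc i) then pair_sign (Suc i) else 0)" by (rule p) (use ij in auto)
 finally show "(P * J_matrix g * P) $$ (i, j) = J_matrix g $$ (i, j)" using ij by (simp add: J_matrix_eq)
qed

section \<open>Period relations\<close>

text \<open>The assumptions concern the compact surface only; punctures and singular forms join
  later. Disjointness of curves is made symmetric with the help of \<open>partner\<close>.\<close>

locale marked_surface = compact_surface A for A :: "('a::t2_space) chart set" +
 fixes g :: nat and \<alpha> :: "nat => real => 'a" and \<tau> :: "nat => 'a form1"
 assumes g2: "g \<ge> 2"
  and genus: "has_genus TYPE('a) (g - 1)"
  and curves: "k \<in> {3..2*g} ==> simple_closed_curve (\<alpha> k)"
  and crossing: "m \<in> {2..g} ==> \<exists>s t. range (\<alpha> (2*m-1)) Int range (\<alpha> (2*m)) = {\<alpha> (2*m) t} &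
    has_local_intersection_number A (\<alpha> (2*m-1)) s (\<alpha> (2*m)) t 1"
  and disjoint: "i \<in> {3..2*g} ==> j \<in> {3..2*g} ==> i ~= j ==> j ~= partner i ==> range (\<alpha> i) Int range (\<alpha> j) = {}"
  and hol_tau: "k \<in> {3..2*g} ==> hol UNIV (\<tau> k)"
  and dual: "i \<in> {3..2*g} ==> j \<in> {3..2*g} ==> closed_curve_integral A (\<tau> j) (\<alpha> i) = (if i = j then 1 else 0)"
begin

abbreviation "K \<equiv> {3..2*g}"
abbreviation "pairing om \<eta> \<equiv> integ UNIV (wedge om \<eta>)"
abbreviation "period om k \<equiv> closed_curve_integral A om (\<alpha> k)"

lemma curve_continuous: "k \<in> K ==> continuous_on UNIV (\<alpha> k)"
 using curves by (auto simp: simple_closed_curve_def)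

lemma curve_range_closed: "k \<in> K ==> closed (range (\<alpha> k))"
 by (rule simple_closed_curve_range[OF curves])

lemma locex_tau: "k \<in> K ==> locex UNIV (\<tau> k)" using hol_tau hol_locex by blast

lemma wedge_sum_left: "wedge (%c p v. \<Sum>k\<in>I. a k * om k c p v) \<eta> = (%c p. \<Sum>k\<in>I. a k * wedge (om k) \<eta> c p)"
 by (intro ext) (simp only: wedge_def sum_distrib_right sum_subtractf[symmetric] right_diff_distrib mult.assoc)

lemma pairing_sum:
 assumes "locex UNIV \<eta>"
 shows "pairing (%c p v. \<Sum>k\<in>K. a k * \<tau> k c p v) \<eta> = (\<Sum>k\<in>K. a k * pairing (\<tau> k) \<eta>)"
 unfolding wedge_sum_left
proof (rule integ_sum(2))
 fix k assume "k \<in> K"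
 then show "intble UNIV (wedge (\<tau> k) \<eta>)" by (rule intble_locex[OF locex_tau assms])
qed simp

lemma pairing_add:
 assumes "locex UNIV om" "locex UNIV om'" "locex UNIV \<eta>"
 shows "pairing (%c p v. om c p v + om' c p v) \<eta> = pairing om \<eta> + pairing om' \<eta>"
 unfolding wedge_add_left using integ_linear(2)[OF intble_locex[OF assms(1,3)] intble_locex[OF assms(2,3)], of 1 1] by simp

lemma pairing_swap: assumes "locex UNIV om" "locex UNIV \<eta>" shows "pairing \<eta> om = - pairing om \<eta>"
proof -
 have "wedge \<eta> om = (%c p. - 1 * wedge om \<eta> c p + 0 * wedge om \<eta> c p)" by (intro ext) (simp add: wedge_def)
 then show ?thesis using integ_linear(2)[OF intble_locex[OF assms] intble_locex[OF assms], of "- 1" 0] by simp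
qed

lemma period_lift:
 assumes "locex U om" "k \<in> K" "range (\<alpha> k) \<subseteq> U"
 shows "\<exists>F. lft om UNIV (\<alpha> k) F & period om k = F 1 - F 0"
 using lft_exists_line[OF assms(1) curve_continuous[OF assms(2)] assms(3)] closed_curve_integral_eq[OF curve_continuous[OF assms(2)]] by blast

text \<open>Stated for a lift of \<open>om\<close> along the curve, so that it also serves for a
  form with poles away from the curve.\<close>

lemma period_combination:
 assumes F: "lft om UNIV (\<alpha> j) F" and j: "j \<in> K"
 shows "\<exists>G. lft (%c p v. om c p v + (\<Sum>k\<in>K. a k * \<tau> k c p v)) UNIV (\<alpha> j) G & G 1 - G 0 = F 1 - F 0 + a j"
proof -
 have "\<forall>k. \<exists>Fk. k \<in> K --> lft (\<tau> k) UNIV (\<alpha> j) Fk & period (\<tau> k) j = Fk 1 - Fk 0"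
  using period_lift[OF locex_tau j] by blast
 then obtain Fk where Fk: "!!k. k \<in> K ==> lft (\<tau> k) UNIV (\<alpha> j) (Fk k)" "!!k. k \<in> K ==> period (\<tau> k) j = Fk k 1 - Fk k 0" by metis
 have "lft (%c p v. om c p v + (\<Sum>k\<in>K. a k * \<tau> k c p v)) UNIV (\<alpha> j) (%x. F x + (\<Sum>k\<in>K. a k * Fk k x))"
  by (rule lft_add[OF F lft_sum]) (auto intro: Fk(1))
 moreover have "(\<Sum>k\<in>K. a k * Fk k 1) - (\<Sum>k\<in>K. a k * Fk k 0) = (\<Sum>k\<in>K. a k * (if j = k then 1 else 0))"
  unfolding sum_subtractf[symmetric] by (rule sum.cong) (use Fk(2) dual[OF j] in \<open>auto simp: right_diff_distrib[symmetric]\<close>)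
 then have "(\<Sum>k\<in>K. a k * Fk k 1) - (\<Sum>k\<in>K. a k * Fk k 0) = a j" using j by (simp add: if_distrib[of "%x. _ * x"] cong: if_cong)
 ultimately show ?thesis by (intro exI[of _ "%x. F x + (\<Sum>k\<in>K. a k * Fk k x)"] conjI) (assumption, linarith)
qed

text \<open>A form without periods is exact, and Stokes' theorem applies. The shift by 3 numbers the
  curves from 0; there are 2 (g-1) of them, twice the genus.\<close>

lemma zero_periods_pairing:
 assumes w: "locex UNIV om" "!!k. k \<in> K ==> period om k = 0" and e: "locex UNIV \<eta>"
 shows "pairing om \<eta> = 0"
proof -
 have K3: "k + 3 \<in> K" if "k < 2 * (g - 1)" for k using that g2 by auto
 have per: "\<alpha> (k + 3) 0 = \<alpha> (k + 3) 1" if "k < 2 * (g - 1)" for k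
  using simple_closed_curve_period[OF curves[OF K3[OF that]], of 0] by simp
 have "\<exists>f. prim UNIV om f"
  by (rule periods_matrix[OF genus, of "%k. \<alpha> (k + 3)" "%k. \<tau> (k + 3)"])
   (use K3 per curve_continuous locex_tau dual w in \<open>simp_all\<close>)
 then show ?thesis using stokes e by blast
qed

text \<open>A closed form is determined by its periods up to an exact form.\<close>

lemma pairing_periods:
 assumes w: "locex UNIV om" and e: "locex UNIV \<eta>"
 shows "pairing om \<eta> = (\<Sum>k\<in>K. period om k * pairing (\<tau> k) \<eta>)"
proof -
 let ?s = "%c p v. \<Sum>k\<in>K. - period om k * \<tau> k c p v"
 have ls: "locex UNIV ?s" by (rule locex_sum) (auto intro: locex_tau)
 have "pairing (%c p v. om c p v + ?s c p v) \<eta> = 0"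
 proof (rule zero_periods_pairing[OF locex_add[OF w ls] _ e])
  fix j assume j: "j \<in> K"
  obtain F where F: "lft om UNIV (\<alpha> j) F" "period om j = F 1 - F 0" using period_lift[OF w j] by auto
  obtain G where G: "lft (%c p v. om c p v + ?s c p v) UNIV (\<alpha> j) G" "G 1 - G 0 = F 1 - F 0 + - period om j"
   using period_combination[OF F(1) j, of "%k. - period om k"] by blast
  show "period (%c p v. om c p v + ?s c p v) j = 0"
   using closed_curve_integral_eq[OF curve_continuous[OF j] G(1)] G(2) F(2) by simp
 qed
 then have "pairing om \<eta> + pairing ?s \<eta> = 0" using pairing_add[OF w ls e] by simp
 moreover have "pairing ?s \<eta> = - (\<Sum>k\<in>K. period om k * pairing (\<tau> k) \<eta>)"
  unfolding pairing_sum[OF e] by (simp add: sum_negf)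
 ultimately show ?thesis by simp
qed

text \<open>A dual form of \<open>\<alpha> k\<close> supported in this open set can have nonzero
  periods only on \<open>\<alpha> k\<close> and on its partner.\<close>

lemma other_ranges:
 assumes "k \<in> K"
 defines "W \<equiv> - (\<Union>i\<in>K - {k, partner k}. range (\<alpha> i))"
 shows "open W" "range (\<alpha> k) \<subseteq> W"
proof -
 have "closed (\<Union>i\<in>K - {k, partner k}. range (\<alpha> i))"
  by (intro closed_UN ballI curve_range_closed) auto
 then show "open W" unfolding W_def by (rule open_Compl)
 have "range (\<alpha> k) Int range (\<alpha> i) = {}" if "i \<in> K - {k, partner k}" for i
  using disjoint[OF assms(1), of i] that by auto
 then show "range (\<alpha> k) \<subseteq> W" unfolding W_def by blast
qed

text \<open>The pairing of the dual form with \<open>\<tau> j\<close> is computed twice: by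
  expansion in periods, where two terms remain, and by duality, which gives minus the period of
  \<open>\<tau> j\<close> on \<open>\<alpha> k\<close>.\<close>

lemma dual_pairing_row:
 assumes k: "k \<in> K" and e: "locex UNIV \<eta>" "supp_in \<eta> L" "closed L" "L \<subseteq> - (\<Union>i\<in>K - {k, partner k}. range (\<alpha> i))"
  and p: "!!om. hol UNIV om ==> pairing \<eta> om = - period om k" and j: "j \<in> K"
 shows "period \<eta> k * pairing (\<tau> k) (\<tau> j) + period \<eta> (partner k) * pairing (\<tau> (partner k)) (\<tau> j) = - (if k = j then 1 else 0)"
proof -
 have pk: "partner k \<in> K" "partner k ~= k" using partner_in[OF k] k by (auto simp: partner_def)
 have "period \<eta> i = 0" if i: "i \<in> K - {k, partner k}" for i
 proof (rule zero_period[OF curve_continuous e(3,2)])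
  show "i \<in> K" using i by blast
  show "range (\<alpha> i) Int L = {}" using i e(4) by blast
 qed
 then have "(\<Sum>i\<in>K. period \<eta> i * pairing (\<tau> i) (\<tau> j)) = (\<Sum>i\<in>{k, partner k}. period \<eta> i * pairing (\<tau> i) (\<tau> j))"
  by (intro sum.mono_neutral_right) (use k pk in auto)
 also have "\<dots> = period \<eta> k * pairing (\<tau> k) (\<tau> j) + period \<eta> (partner k) * pairing (\<tau> (partner k)) (\<tau> j)" using pk by simp
 finally show ?thesis using pairing_periods[OF e(1) locex_tau[OF j]] p[OF hol_tau[OF j]] dual[OF k j] by simp
qed

text \<open>For a handle with curves k = 2m and l = 2m-1 the dual forms of both curves give two rows
  of linear relations. The only period supplied by the crossing is -1, of the dual form of k on l.
  The other three periods are unknown at first; since \<open>pairing\<close> is antisymmetric, the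
  diagonal entries vanish and the relations determine them.\<close>

lemma pairing_tau:
 assumes i: "i \<in> K" and j: "j \<in> K"
 shows "pairing (\<tau> i) (\<tau> j) = (if j = partner i then pair_sign i else 0)"
proof -
 have main: "pairing (\<tau> (2*m)) (\<tau> j) = - (if j = 2*m-1 then 1 else 0) & pairing (\<tau> (2*m-1)) (\<tau> j) = (if j = 2*m then 1 else 0)"
  if m: "m \<in> {2..g}" and j: "j \<in> K" for m j
 proof -
  define k l where "k = 2 * m" and "l = 2 * m - 1"
  have kl: "k \<in> K" "l \<in> K" "partner k = l" "partner l = k" "k ~= l" using m by (auto simp: k_def l_def partner_def)
  let ?I = "%a b. pairing (\<tau> a) (\<tau> b)"
  have swap: "?I a b = - ?I b a" if "a \<in> K" "b \<in> K" for a b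
   by (rule pairing_swap) (use that locex_tau in auto)
  have I0: "?I k k = 0" "?I l l = 0" using swap[OF kl(1) kl(1)] swap[OF kl(2) kl(2)] by linarith+
  obtain s t where st: "range (\<alpha> l) Int range (\<alpha> k) = {\<alpha> k t}" "has_local_intersection_number A (\<alpha> l) s (\<alpha> k) t 1"
   using crossing[OF m] unfolding k_def l_def by blast
  obtain \<eta> L where e: "locex UNIV \<eta>" "closed L" "L \<subseteq> - (\<Union>i\<in>K - {k, partner k}. range (\<alpha> i))" "supp_in \<eta> L" "period \<eta> l = - 1"
   "!!om. hol UNIV om ==> pairing \<eta> om = - period om k"
   using crossing_dual[OF curves[OF kl(2)] curves[OF kl(1)] other_ranges[OF kl(1)] st] by blast
  note row1 = dual_pairing_row[OF kl(1) e(1,4,2,3,6)]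
  obtain \<eta>' L' where e': "locex UNIV \<eta>'" "closed L'" "L' \<subseteq> - (\<Union>i\<in>K - {l, partner l}. range (\<alpha> i))" "supp_in \<eta>' L'"
   "!!om. hol UNIV om ==> pairing \<eta>' om = - period om l"
   using closed_dual[OF curves[OF kl(2)] other_ranges[OF kl(2)]] by blast
  note row2 = dual_pairing_row[OF kl(2) e'(1,4,2,3,5)]
  have r1: "period \<eta> k * ?I k j - ?I l j = - (if k = j then 1 else 0)" if "j \<in> K" for j
   using row1[OF _ that] e(5) kl(3) by simp
  have r2: "period \<eta>' l * ?I l j + period \<eta>' k * ?I k j = - (if l = j then 1 else 0)" if "j \<in> K" for j
   using row2[OF _ that] kl(4) by simp
  have a: "?I l k = 1" using r1[OF kl(1)] I0 by simp
  have b: "?I k l = - 1" using swap[OF kl(1,2)] a by simp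
  have "period \<eta> k = 0" using r1[OF kl(2)] b I0 kl(5) by simp
  then have c: "?I l j = (if j = k then 1 else 0)" if "j \<in> K" for j using r1[OF that] by auto
  have "period \<eta>' l = 0" using r2[OF kl(1)] a I0 kl(5) by simp
  moreover have "period \<eta>' k = 1" using r2[OF kl(2)] b I0 by simp
  ultimately have d: "?I k j = - (if j = l then 1 else 0)" if "j \<in> K" for j using r2[OF that] by auto
  show ?thesis using c[OF j] d[OF j] by (simp add: k_def l_def)
 qed
 show ?thesis
 proof (cases "odd i")
  case True
  then obtain m where m: "i = 2 * m + 1" by (rule oddE)
  then have "m + 1 \<in> {2..g}" using i by auto
  from main[OF this j] show ?thesis using m by (simp add: partner_def pair_sign_def)
 next
  case False
  then obtain m where m: "i = 2 * m" by (auto elim: evenE)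
  then have "m \<in> {2..g}" using i by auto
  from main[OF this j] show ?thesis using m by (simp add: partner_def pair_sign_def)
 qed
qed

section \<open>The energy matrix and the Hodge star\<close>

lemma linear_wedge_hodge:
 assumes "linear (a c p)" "linear (b c p)"
 shows "wedge a (hodge b) c p = wedge b (hodge a) c p" "wedge (hodge a) (hodge b) c p = wedge a b c p"
  "wedge (hodge a) b c p = - wedge a (hodge b) c p"
proof -
 have "a c p (- 1) = - a c p 1" "b c p (- 1) = - b c p 1" using linear_neg[OF assms(1), of 1] linear_neg[OF assms(2), of 1] by auto
 then show "wedge a (hodge b) c p = wedge b (hodge a) c p" "wedge (hodge a) (hodge b) c p = wedge a b c p"
  "wedge (hodge a) b c p = - wedge a (hodge b) c p" by (simp_all add: wedge_def hodge_def)
qed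

lemma hol_linear: "hol U om ==> c \<in> A ==> p \<in> cdom c ==> p \<in> U ==> linear (om c p)"
 unfolding hol_def using cov1_linear by blast

lemma locex_hodge: "k \<in> K ==> locex UNIV (hodge (\<tau> k))" using hol_hodge[OF hol_tau] hol_locex by blast

lemma energy_symmetric: "i \<in> K ==> j \<in> K ==> pairing (\<tau> i) (hodge (\<tau> j)) = pairing (\<tau> j) (hodge (\<tau> i))"
 by (rule integ_cong(2), rule linear_wedge_hodge(1)) (auto intro: hol_linear[OF hol_tau])

text \<open>Expansion of \<star>\<open>\<tau> j\<close> by its periods; in the pairing with
  \<open>\<tau> i\<close> the intersection matrix selects the partner of i.\<close>

lemma energy_periods:
 assumes "i \<in> K" "j \<in> K"
 shows "pairing (\<tau> i) (hodge (\<tau> j)) = pair_sign i * period (hodge (\<tau> j)) (partner i)"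
proof -
 have "pairing (hodge (\<tau> j)) (\<tau> i) = (\<Sum>k\<in>K. period (hodge (\<tau> j)) k * pairing (\<tau> k) (\<tau> i))"
  by (rule pairing_periods[OF locex_hodge locex_tau]) (use assms in auto)
 also have "\<dots> = (\<Sum>k\<in>K. if k = partner i then - pair_sign i * period (hodge (\<tau> j)) k else 0)"
 proof (rule sum.cong[OF HOL.refl])
  fix k assume k: "k \<in> K"
  have "i = partner k \<longleftrightarrow> k = partner i" using partner_partner[of i] partner_partner[of k] k assms(1) by auto
  moreover have "pair_sign (partner i) = - pair_sign i" using pair_sign_partner assms(1) by simp
  ultimately show "period (hodge (\<tau> j)) k * pairing (\<tau> k) (\<tau> i) = (if k = partner i then - pair_sign i * period (hodge (\<tau> j)) k else 0)"
   using pairing_tau[OF k assms(1)] by auto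
 qed
 also have "\<dots> = - pair_sign i * period (hodge (\<tau> j)) (partner i)" using partner_in[OF assms(1)] by simp
 finally show ?thesis using pairing_swap[OF locex_tau[OF assms(1)] locex_hodge[OF assms(2)]] by simp
qed

text \<open>The invariant pairing of two Hodge duals is expanded by the periods of the first one,
  and these are energies again by \<open>energy_periods\<close>.\<close>

lemma energy_symplectic:
 assumes "i \<in> K" "j \<in> K"
 shows "(\<Sum>k\<in>K. pairing (\<tau> i) (hodge (\<tau> k)) * pair_sign k * pairing (\<tau> (partner k)) (hodge (\<tau> j))) = (if j = partner i then pair_sign i else 0)"
proof -
 let ?q = "%i j. pairing (\<tau> i) (hodge (\<tau> j))"
 have "pairing (hodge (\<tau> i)) (hodge (\<tau> j)) = pairing (\<tau> i) (\<tau> j)"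
  by (rule integ_cong(2), rule linear_wedge_hodge(2)) (auto intro: hol_linear[OF hol_tau] assms)
 moreover have "pairing (hodge (\<tau> i)) (hodge (\<tau> j)) = (\<Sum>k\<in>K. period (hodge (\<tau> i)) k * ?q k j)"
  by (rule pairing_periods[OF locex_hodge locex_hodge]) (use assms in auto)
 moreover have "(\<Sum>k\<in>K. period (hodge (\<tau> i)) k * ?q k j) = (\<Sum>k\<in>K. period (hodge (\<tau> i)) (partner k) * ?q (partner k) j)"
  by (rule sum_partner[symmetric])
 moreover have "\<dots> = (\<Sum>k\<in>K. ?q i k * pair_sign k * ?q (partner k) j)"
 proof (rule sum.cong[OF HOL.refl])
  fix k assume k: "k \<in> K"
  have "?q i k = pair_sign k * period (hodge (\<tau> i)) (partner k)" using energy_periods[OF k assms(1)] energy_symmetric[OF k assms(1)] by simp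
  then have "?q i k * pair_sign k = period (hodge (\<tau> i)) (partner k)" using pair_sign_sq[of k] by (simp add: mult.commute mult.left_commute)
  then show "period (hodge (\<tau> i)) (partner k) * ?q (partner k) j = ?q i k * pair_sign k * ?q (partner k) j" by simp
 qed
 ultimately show ?thesis using pairing_tau[OF assms] by simp
qed

text \<open>The reciprocity law: near the curve \<open>\<gamma>\<close> the form \<open>\<star>\<tau>\<^sub>1\<close> differs from the dual form of the
 curve by a closed form on the compact surface.\<close>

lemma line_reciprocity:
 assumes g: "continuous_on UNIV \<gamma>" "(\<gamma> \<longlongrightarrow> v1) at_bot" "(\<gamma> \<longlongrightarrow> v2) at_top"
  and d: "!!j. j \<in> K ==> range \<gamma> Int range (\<alpha> j) = {}" and S: "!!j. j \<in> K ==> range (\<alpha> j) \<subseteq> - {v1, v2}"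
  and s: "sform {v1, v2} \<theta> (%x. of_bool (x = v1) - of_bool (x = v2))"
  and z: "!!om. hol UNIV om ==> pairing \<theta> om = 0" and j: "j \<in> K"
 shows "- line_integral A (\<tau> j) \<gamma> = pair_sign j * period \<theta> (partner j)"
proof -
 from line_closure[OF g] obtain b :: "real => 'a" where bb: "continuous_on {0..1} b & b 0 = v1 & b 1 = v2 &
  b ` {0..1} \<subseteq> insert v1 (insert v2 (range \<gamma>)) &
  (\<forall>om. locex UNIV om --> (\<exists>F. lft om {0..1} b F & line_integral A om \<gamma> = F 1 - F 0))" ..
 note b = conjunct1[OF bb] conjunct1[OF conjunct2[OF bb]] conjunct1[OF conjunct2[OF conjunct2[OF bb]]]
  conjunct1[OF conjunct2[OF conjunct2[OF conjunct2[OF bb]]]]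
 note b5 = conjunct2[OF conjunct2[OF conjunct2[OF conjunct2[OF bb]]]]
 \<comment> \<open>The curve with its end points added still avoids all \<open>\<alpha> i\<close>,
   so its dual form can be supported off them and has no periods there.\<close>
 define W where "W = - (\<Union>i\<in>K. range (\<alpha> i))"
 have "closed (\<Union>i\<in>K. range (\<alpha> i))" by (intro closed_UN ballI curve_range_closed) auto
 then have oW: "open W" unfolding W_def by (rule open_Compl)
 have "insert v1 (insert v2 (range \<gamma>)) \<subseteq> W" unfolding W_def using d S by blast
 then have bW: "b ` {0..1} \<subseteq> W" using b(4) by blast
 obtain L \<eta> P where L: "L \<subseteq> W" "dual_form b 0 1 L \<eta> P" using ex_dual_form[OF b(1) _ oW bW] by auto
 have sP: "sform P \<eta> (%x. of_bool (x = v1) - of_bool (x = v2))" and cL: "closed L" "P \<subseteq> L" "supp_in \<eta> L" and fP: "finite P"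
  using L(2) b(2,3) by (auto simp: dual_form_def sform_def)
 define c where "c = period \<theta>"
 let ?s = "%d p v. \<Sum>k\<in>K. - c k * \<tau> k d p v"
 have ls: "locex UNIV ?s" by (rule locex_sum) (auto intro: locex_tau)
 \<comment> \<open>The residues of \<theta> and \<eta> agree and the periods of \<theta> are
   subtracted, so this form extends to a closed form on the compact surface with all periods 0. Its
   pairing with \<open>\<tau> j\<close> vanishes, and the three terms of that pairing give the
   claim.\<close>
 define \<xi> where "\<xi> = (%d p v. (\<theta> d p v + - 1 * \<eta> d p v) + ?s d p v)"
 have s1: "sform ({v1, v2} Un P) (%d p v. \<theta> d p v + - 1 * \<eta> d p v) (%x. 0)"
  using sform_add[OF s sform_cmult[OF sP, of "- 1"]] by (simp add: algebra_simps)
 have s2: "sform ({v1, v2} Un P) \<xi> (%x. 0)" unfolding \<xi>_def using sform_add[OF s1 sform_locex[OF ls]] by simp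
 define Q where "Q = {v1, v2} Un P"
 obtain \<xi>' where x: "locex UNIV \<xi>'" "!!d p v. p ~: Q ==> \<xi>' d p v = \<xi> d p v" using sform_regular[OF s2] unfolding Q_def by blast
 have lth: "locex (- {v1, v2}) \<theta>" using s by (simp add: sform_def)
 have per: "period \<xi>' k = 0" if k: "k \<in> K" for k
 proof -
  obtain F where F: "lft \<theta> UNIV (\<alpha> k) F" "period \<theta> k = F 1 - F 0" using period_lift[OF lth k S[OF k]] by blast
  obtain G where G: "lft (%d p v. \<theta> d p v + ?s d p v) UNIV (\<alpha> k) G" "G 1 - G 0 = F 1 - F 0 + - c k"
   using period_combination[OF F(1) k, of "%k. - c k"] by blast
  have "lft \<xi>' UNIV (\<alpha> k) G"
  proof (rule lft_form_cong[OF G(1), of "- (L Un {v1, v2})"])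
   show "open (- (L Un {v1, v2}))" using cL(1) by (intro open_Compl closed_Un) auto
   have "range (\<alpha> k) Int L = {}" using L(1) k unfolding W_def by blast
   then show "range (\<alpha> k) \<subseteq> - (L Un {v1, v2})" using S[OF k] by blast
   fix e p v assume "e \<in> A" "p \<in> cdom e" "p \<in> - (L Un {v1, v2})"
   then have "p ~: Q" "\<eta> e p v = 0" using cL(2,3) by (auto simp: Q_def supp_in_def)
   then show "\<xi>' e p v = \<theta> e p v + ?s e p v" using x(2) by (simp add: \<xi>_def)
  qed
  then show ?thesis using closed_curve_integral_eq[OF curve_continuous[OF k]] G(2) F(2) by (simp add: c_def)
 qed
 have lj: "locex UNIV (\<tau> j)" by (rule locex_tau[OF j])
 have fQ: "finite Q" using fP by (simp add: Q_def)
 have "integ (- Q) (wedge \<xi>' (\<tau> j)) = integ (- Q) (wedge \<xi> (\<tau> j))" by (rule integ_cong(2)) (simp add: wedge_def x(2))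
 then have "pairing \<xi> (\<tau> j) = pairing \<xi>' (\<tau> j)" using integ_finite[OF fQ] by simp
 also have "\<dots> = 0" by (rule zero_periods_pairing[OF x(1) per lj])
 finally have "pairing \<xi> (\<tau> j) = 0" .
 moreover have "pairing \<xi> (\<tau> j) = (pairing \<theta> (\<tau> j) + pairing (%d p v. - 1 * \<eta> d p v) (\<tau> j)) + pairing ?s (\<tau> j)"
  unfolding \<xi>_def sform_integ_add[OF s1 sform_locex[OF ls] lj] sform_integ_add[OF s sform_cmult[OF sP] lj] ..
 moreover have "pairing \<theta> (\<tau> j) = 0" by (rule z[OF hol_tau[OF j]])
 moreover have "pairing (%d p v. - 1 * \<eta> d p v) (\<tau> j) = line_integral A (\<tau> j) \<gamma>"
 proof -
  obtain F where F: "lft (\<tau> j) {0..1} b F" "line_integral A (\<tau> j) \<gamma> = F 1 - F 0"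
   using mp[OF spec[OF b5, of "\<tau> j"] lj] by auto
  have "pairing \<eta> (\<tau> j) = F 0 - F 1" using L(2) hol_tau[OF j] F(1) integ_finite[OF fP] unfolding dual_form_def by metis
  moreover have "wedge (%d p v. - 1 * \<eta> d p v) (\<tau> j) = (%d p. - 1 * wedge \<eta> (\<tau> j) d p + 0 * wedge \<eta> (\<tau> j) d p)"
   by (intro ext) (simp add: wedge_def)
  ultimately show ?thesis using integ_linear(2)[OF sform_intble[OF sP lj] sform_intble[OF sP lj], of "- 1" 0] F(2) by simp
 qed
 moreover have "pairing ?s (\<tau> j) = pair_sign j * c (partner j)"
 proof -
  have "pairing ?s (\<tau> j) = (\<Sum>k\<in>K. - c k * pairing (\<tau> k) (\<tau> j))" by (rule pairing_sum[OF lj])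
  also have "\<dots> = (\<Sum>k\<in>K. if k = partner j then pair_sign j * c k else 0)"
  proof (rule sum.cong[OF HOL.refl])
   fix k assume k: "k \<in> K"
   have "j = partner k \<longleftrightarrow> k = partner j" using partner_partner[of j] partner_partner[of k] k j by auto
   moreover have "pair_sign (partner j) = - pair_sign j" using pair_sign_partner j by simp
   ultimately show "- c k * pairing (\<tau> k) (\<tau> j) = (if k = partner j then pair_sign j * c k else 0)"
    using pairing_tau[OF k j] by auto
  qed
  also have "\<dots> = pair_sign j * c (partner j)" using partner_in[OF j] by simp
  finally show ?thesis .
 qed
 ultimately show ?thesis unfolding c_def by linarith
qed

end

text \<open>Finitely many points are a null set, so integrals over the punctured surface are
  pairings on the compact one.\<close>

lemma (in compact_surface) surface_integral_finite:
 assumes "finite P" "cov1 (- P) om" "cov1 (- P) \<eta>" "intble (- P) (wedge om \<eta>)"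
 shows "surface_integral A (- P) (wedge om \<eta>) = integ UNIV (wedge om \<eta>)"
 using surface_integral_eq[OF borel_finite(2)[OF assms(1)] assms(4) cov2_wedge[OF assms(2,3)]] integ_finite[OF assms(1)] by simp

theorem corollary7p11:
  fixes A :: "('a::t2_space) chart set"
    and v1 v2 :: 'a
    and S :: "'a set"
    and g :: nat
    and \<rho> :: "'a density"
    and \<kappa>1 \<kappa>2 :: "complex \<Rightarrow> 'a"
    and \<gamma> :: "real \<Rightarrow> 'a"
    and \<alpha> :: "nat \<Rightarrow> real \<Rightarrow> 'a"
    and \<tau> :: "nat \<Rightarrow> 'a form1"
    and lam :: real
  assumes "g \<ge> 2"
    and "compact_riemann_surface A"
    and "has_genus TYPE('a) (g - 1)"
    and "v1 \<noteq> v2"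
    and "S = - {v1, v2}"
    and "complete_hyperbolic_metric A S \<rho>"
    and "cusp_coordinates A S \<rho> (-1) v1 \<kappa>1"
    and "cusp_coordinates A S \<rho> 1 v2 \<kappa>2"
    and "admissible_curve S v1 \<kappa>1 v2 \<kappa>2 \<gamma>"
    and "cusp_boundary_curve \<kappa>1 (\<alpha> 2)"
    and "canonical_basis A S g \<alpha>"
    and "\<And>j. j \<in> {3..2*g} \<Longrightarrow> range \<gamma> \<inter> range (\<alpha> j) = {}"
    and "harmonic_form A S (\<tau> 1)"
    and "exact_form A S (\<tau> 1)"
    and "asymptotic_to_dx A (-1) \<kappa>1 (\<tau> 1)"
    and "asymptotic_to_dx A 1 \<kappa>2 (\<tau> 1)"
    and "\<And>j. j \<in> {3..2*g} \<Longrightarrow> harmonic_form A UNIV (\<tau> j)"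
    and "\<And>i j. i \<in> {3..2*g} \<Longrightarrow> j \<in> {3..2*g} \<Longrightarrow>
           closed_curve_integral A (\<tau> j) (\<alpha> i) = (if i = j then 1 else 0)"
    and "\<tau> 2 = tau2 A g \<alpha> \<tau>"
    and "lam > 0"
  shows "P_matrix A S \<gamma> \<tau> g lam * J_matrix g * P_matrix A S \<gamma> \<tau> g lam = J_matrix g"
proof -
 interpret compact_surface A by (unfold_locales) (rule assms(2))
 have cb: "!!k. k \<in> {3..2*g} ==> simple_closed_curve (\<alpha> k) & range (\<alpha> k) \<subseteq> S"
  "!!k. k \<in> {2..g} ==> \<exists>s t. range (\<alpha> (2*k-1)) Int range (\<alpha> (2*k)) = {\<alpha> (2*k) t} &
    has_local_intersection_number A (\<alpha> (2*k-1)) s (\<alpha> (2*k)) t 1"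
  "!!i j. i \<in> {3..2*g} ==> j \<in> {3..2*g} ==> i < j ==> \<not> (\<exists>k\<in>{2..g}. i = 2*k-1 & j = 2*k) ==> range (\<alpha> i) Int range (\<alpha> j) = {}"
  using assms(11) unfolding canonical_basis_def by blast+
 have lt: "range (\<alpha> i) Int range (\<alpha> j) = {}" if ij: "i \<in> {3..2*g}" "j \<in> {3..2*g}" "i < j" "j ~= partner i" for i j
 proof (rule cb(3)[OF ij(1-3)], rule notI)
  assume "\<exists>k\<in>{2..g}. i = 2*k-1 & j = 2*k"
  then obtain k where k: "k \<ge> 2" "i = 2 * k - 1" "j = 2 * k" by auto
  then have "odd i" "i + 1 = j" by auto
  then show False using ij(4) by (simp add: partner_def)
 qed
 interpret marked_surface A g \<alpha> \<tau>
 proof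
  show "g \<ge> 2" "has_genus TYPE('a) (g - 1)" by (rule assms)+
  show "simple_closed_curve (\<alpha> k)" if "k \<in> {3..2*g}" for k using cb(1)[OF that] by simp
  show "\<exists>s t. range (\<alpha> (2*m-1)) Int range (\<alpha> (2*m)) = {\<alpha> (2*m) t} &
    has_local_intersection_number A (\<alpha> (2*m-1)) s (\<alpha> (2*m)) t 1" if "m \<in> {2..g}" for m by (rule cb(2)[OF that])
  show "range (\<alpha> i) Int range (\<alpha> j) = {}" if ij: "i \<in> {3..2*g}" "j \<in> {3..2*g}" "i ~= j" "j ~= partner i" for i j
  proof (cases "i < j")
   case True
   then show ?thesis using lt ij by blast
  next
   case False
   have "i ~= partner j" using partner_partner[of j] ij by auto
   then have "range (\<alpha> j) Int range (\<alpha> i) = {}" using lt[OF ij(2,1)] False ij(3) by simp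
   then show ?thesis by (simp add: Int_commute)
  qed
  show "hol UNIV (\<tau> k)" if "k \<in> {3..2*g}" for k by (rule harmonic_hol[OF open_UNIV assms(17)[OF that]])
  show "closed_curve_integral A (\<tau> j) (\<alpha> i) = (if i = j then 1 else 0)" if "i \<in> {3..2*g}" "j \<in> {3..2*g}" for i j
   by (rule assms(18)[OF that])
 qed
 have oS: "open S" and fin: "finite {v1, v2}" unfolding assms(5) by auto
 have h1: "hol S (\<tau> 1)" by (rule harmonic_hol[OF oS assms(13)])
 obtain f where f: "primitive_on A S (\<tau> 1) f" using assms(14) unfolding exact_form_def by blast
 have oN: "open (- {v2})" "open (- {v1})" by auto
 have vN: "v1 \<in> - {v2}" "v2 \<in> - {v1}" "v1 ~: S" "v2 ~: S" "- {v2} - {v1} \<subseteq> S" "- {v1} - {v2} \<subseteq> S" using assms(4,5) by auto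
 \<comment> \<open>Both cusps at once: \<sigma> = -1 at \<open>v1\<close> gives residue 1 and a
   primitive tending to minus infinity, \<sigma> = 1 at \<open>v2\<close> gives residue -1 and plus
   infinity.\<close>
 have pole: "pole_at c (hodge (\<tau> 1)) v (- \<sigma>) & (\<forall>B. \<exists>V. open V & v \<in> V & V \<subseteq> N & (\<forall>p\<in>V - {v}. \<sigma> * f p > B))"
  if c: "c \<in> A" "v \<in> cdom c" and cc: "cusp_coordinates A S \<rho> \<sigma> v \<kappa>" and sg: "\<sigma> = 1 \<or> \<sigma> = -1"
   and N: "v ~: S" "open N" "v \<in> N" "N - {v} \<subseteq> S" and asy: "asymptotic_to_dx A \<sigma> \<kappa> (\<tau> 1)" for c v \<sigma> \<kappa> N
 proof -
  obtain r H0 where r: "r > 0" "cball (crd c v) r \<subseteq> crd c ` (cdom c Int N)" "H0 holomorphic_on ball (crd c v) r"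
   "!!z w. z \<in> ball (crd c v) r - {crd c v} ==> dpull c (\<tau> 1) z w = Re ((- of_real (\<sigma> / (2 * pi)) / (z - crd c v) + H0 z) * w)"
   using cusp_pole[OF cc sg N asy h1 c] by blast
  show ?thesis
   by (intro conjI allI pole_hodge[OF c r(1,3,4)] pole_primitive_unbounded[OF c r(1,3,2,4) sg f N(4)])
 qed
 have ch: "\<exists>c. c \<in> A & v \<in> cdom c" for v using chart_cover by blast
 have lh: "locex S (hodge (\<tau> 1))" by (rule hol_locex[OF hol_hodge[OF h1] oS])
 have sf: "sform {v1, v2} (hodge (\<tau> 1)) (%x. of_bool (x = v1) - of_bool (x = v2))"
  unfolding sform_def
 proof (intro conjI allI ballI impI fin)
  show "locex (- {v1, v2}) (hodge (\<tau> 1))" using lh assms(5) by simp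
  fix p c assume c: "c \<in> A" "p \<in> cdom c"
  consider "p = v1" | "p = v2" | "p \<in> S" using assms(5) by auto
  then show "pole_at c (hodge (\<tau> 1)) p (of_bool (p = v1) - of_bool (p = v2))"
  proof cases
   case 1
   then show ?thesis using pole[OF c[unfolded 1] assms(7) _ vN(3) oN(1) vN(1,5) assms(15)] assms(4) by simp
  next
   case 2
   then show ?thesis using pole[OF c[unfolded 2] assms(8) _ vN(4) oN(2) vN(2,6) assms(16)] assms(4) by simp
  next
   case 3
   then show ?thesis using pole_at_locex[OF lh oS 3 c] assms(5) by auto
  qed
 qed
 have n1: "\<exists>V. open V & v1 \<in> V & V \<subseteq> - {v2} & (\<forall>p\<in>V - {v1}. - f p > B)" for B
 proof -
  obtain c where c: "c \<in> A" "v1 \<in> cdom c" using ch by blast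
  show ?thesis using pole[OF c assms(7) _ vN(3) oN(1) vN(1,5) assms(15)] by simp
 qed
 have n2: "\<exists>V. open V & v2 \<in> V & V \<subseteq> - {v1} & (\<forall>p\<in>V - {v2}. f p > B)" for B
 proof -
  obtain c where c: "c \<in> A" "v2 \<in> cdom c" using ch by blast
  show ?thesis using pole[OF c assms(8) _ vN(4) oN(2) vN(2,6) assms(16)] by simp
 qed
 have pf: "prim (- {v1, v2}) (\<tau> 1) f" using prim_of_primitive[OF f h1] assms(5) by simp
 have lin1: "linear (\<tau> 1 c p)" if "c \<in> A" "p \<in> cdom c Int - {v1, v2}" for c p
  using hol_linear[OF h1] that assms(5) by auto
 \<comment> \<open>Integrability is taken over from the wedge product of the two Hodge duals, which
   has the same coefficient and whose first factor is already known as a form with simple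
   poles.\<close>
 have t1: "intble (- {v1, v2}) (wedge (\<tau> 1) om) & pairing (\<tau> 1) om = 0" if w: "hol UNIV om" for om
 proof -
  have lw: "locex UNIV (hodge om)" by (rule hol_locex[OF hol_hodge[OF w] open_UNIV])
  have "intble (- {v1, v2}) (wedge (hodge (\<tau> 1)) (hodge om))" using sform_intble[OF sf lw] intble_finite[OF fin] by simp
  moreover have "intble (- {v1, v2}) (wedge (hodge (\<tau> 1)) (hodge om)) \<longleftrightarrow> intble (- {v1, v2}) (wedge (\<tau> 1) om)"
   by (rule integ_cong(1), rule linear_wedge_hodge(2)) (use lin1 hol_linear[OF w] in auto)
  ultimately have i: "intble (- {v1, v2}) (wedge (\<tau> 1) om)" by simp
  then show ?thesis using exact_pairing_zero[OF assms(4) pf hol_locex[OF w open_UNIV] i n1 n2] integ_finite[OF fin] by simp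
 qed
 \<comment> \<open>Moving the star changes the sign: the pairing is minus that of
   \<open>\<tau> 1\<close> with the Hodge dual of \<open>om\<close>, which is again of the kind
   treated in \<open>t1\<close>.\<close>
 have z1: "pairing (hodge (\<tau> 1)) om = 0" if w: "hol UNIV om" for om
 proof -
  have "integ (- {v1, v2}) (wedge (hodge (\<tau> 1)) om) = integ (- {v1, v2}) (%c p. - 1 * wedge (\<tau> 1) (hodge om) c p + 0 * wedge (\<tau> 1) (hodge om) c p)"
  proof (rule integ_cong(2))
   fix c p assume cp: "c \<in> A" "p \<in> cdom c Int - {v1, v2}"
   have "linear (om c p)" by (rule hol_linear[OF w cp(1)]) (use cp(2) in auto)
   from linear_wedge_hodge(3)[where a = "\<tau> 1" and b = om and c = c and p = p, OF lin1[OF cp] this]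
   show "wedge (hodge (\<tau> 1)) om c p = - 1 * wedge (\<tau> 1) (hodge om) c p + 0 * wedge (\<tau> 1) (hodge om) c p" by simp
  qed
  also have "\<dots> = 0" using integ_linear(2)[of "- {v1, v2}" "wedge (\<tau> 1) (hodge om)" "wedge (\<tau> 1) (hodge om)" "- 1" 0] t1[OF hol_hodge[OF w]] integ_finite[OF fin] by simp
  finally show ?thesis using integ_finite[OF fin] by simp
 qed
 have gam: "continuous_on UNIV \<gamma>" "(\<gamma> \<longlongrightarrow> v1) at_bot" "(\<gamma> \<longlongrightarrow> v2) at_top" using assms(9) by (auto simp: admissible_curve_def)
 define c where "c = period (hodge (\<tau> 1))"
 have kap: "kappa_const A \<gamma> \<tau> j = pair_sign j * c (partner j)" if j: "j \<in> K" for j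
 proof -
  have "range (\<alpha> k) \<subseteq> - {v1, v2}" if "k \<in> K" for k using cb(1)[OF that] assms(5) by simp
  from line_reciprocity[OF gam assms(12) this sf z1 j] show ?thesis using j by (simp add: kappa_const_def c_def)
 qed
 \<comment> \<open>The corner is the constant \<open>pi22_const\<close>, since
   \<open>\<tau> 2\<close> has infinite energy in the cusps. With this choice P is q plus the term
   \<kappa> \<kappa>^T / \<lambda> and \<lambda> in the corner.\<close>
 define q where "q i j = (if i = 2 & j = 2 then pi22_const A S \<tau> else q_const A S \<tau> i j)" for i j
 have covS: "cov1 (- {v1, v2}) om" if "hol UNIV om" for om using that cov1_subset by (auto simp: hol_def)
 have cov1S: "cov1 (- {v1, v2}) (hodge (\<tau> 1))" "cov1 (- {v1, v2}) (\<tau> 1)" using h1 hol_hodge[OF h1] assms(5) by (auto simp: hol_def)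
 have qK: "q i j = pairing (\<tau> i) (hodge (\<tau> j))" if ij: "i \<in> K" "j \<in> K" for i j
 proof -
  have "intble (- {v1, v2}) (wedge (\<tau> i) (hodge (\<tau> j)))"
   using intble_locex[OF locex_tau[OF ij(1)] locex_hodge[OF ij(2)]] intble_finite[OF fin] by simp
  from surface_integral_finite[OF fin covS[OF hol_tau[OF ij(1)]] covS[OF hol_hodge[OF hol_tau[OF ij(2)]]] this]
  show ?thesis using ij by (simp add: q_def q_const_def assms(5))
 qed
 let ?s = "%d p v. \<Sum>k\<in>K. - c k * \<tau> k d p v"
 have ls: "locex UNIV ?s" by (rule locex_sum) (auto intro: locex_tau)
 have tau2: "\<tau> 2 = (%d p v. hodge (\<tau> 1) d p v + ?s d p v)"
  unfolding assms(19) tau2_def c_def by (intro ext) (simp add: sum_negf)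
 have covs: "cov1 UNIV ?s" by (rule locex_cov1[OF ls])
 have s2: "sform {v1, v2} (\<tau> 2) (%x. of_bool (x = v1) - of_bool (x = v2))"
  using sform_add[OF sf sform_locex[OF ls]] unfolding tau2 by simp
 have cov2: "cov1 (- {v1, v2}) (\<tau> 2)" using locex_cov1 s2 by (auto simp: sform_def)
 have lin2: "linear (\<tau> 2 c p)" if "c \<in> A" "p \<in> cdom c Int - {v1, v2}" for c p
  using cov1_linear[OF cov2] that by auto
 have q2j: "q 2 j = - (\<Sum>k\<in>K. c k * q k j)" "q j 2 = q 2 j" if j: "j \<in> K" for j
 proof -
  have hj: "hol UNIV (hodge (\<tau> j))" by (rule hol_hodge[OF hol_tau[OF j]])
  have lj: "locex UNIV (hodge (\<tau> j))" by (rule locex_hodge[OF j])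
  have i2: "intble (- {v1, v2}) (wedge (\<tau> 2) (hodge (\<tau> j)))" using sform_intble[OF s2 lj] intble_finite[OF fin] by simp
  have "surface_integral A (- {v1, v2}) (wedge (\<tau> 2) (hodge (\<tau> j))) = pairing (\<tau> 2) (hodge (\<tau> j))"
   by (rule surface_integral_finite[OF fin cov2 covS[OF hj] i2])
  also have "\<dots> = pairing (hodge (\<tau> 1)) (hodge (\<tau> j)) + pairing ?s (hodge (\<tau> j))"
   unfolding tau2 by (rule sform_integ_add[OF sf sform_locex[OF ls] lj])
  also have "\<dots> = - (\<Sum>k\<in>K. c k * q k j)" unfolding pairing_sum[OF lj] using z1[OF hj] qK[OF _ j] by (simp add: sum_negf)
  finally have 1: "surface_integral A (- {v1, v2}) (wedge (\<tau> 2) (hodge (\<tau> j))) = - (\<Sum>k\<in>K. c k * q k j)" .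
  then show "q 2 j = - (\<Sum>k\<in>K. c k * q k j)" using j by (simp add: q_def q_const_def assms(5))
  have eq: "wedge (\<tau> j) (hodge (\<tau> 2)) c p = wedge (\<tau> 2) (hodge (\<tau> j)) c p" if "c \<in> A" "p \<in> cdom c Int - {v1, v2}" for c p
   by (rule linear_wedge_hodge(1)) (use that lin2 hol_linear[OF hol_tau[OF j]] in auto)
  have B: "- {v1, v2} \<in> sets borel" by (rule borel_finite(2)[OF fin])
  have c2: "cov2 (- {v1, v2}) (wedge (\<tau> 2) (hodge (\<tau> j)))" by (rule cov2_wedge[OF cov2 covS[OF hj]])
  \<comment> \<open>The integrand of the transposed entry agrees pointwise with the previous one, so
    its transformation law and its integral are carried over.\<close>
  have c2': "cov2 (- {v1, v2}) (wedge (\<tau> j) (hodge (\<tau> 2)))"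
   unfolding cov2_def
  proof (intro ballI)
   fix d e p assume dep: "d \<in> A" "e \<in> A" "p \<in> cdom d Int cdom e Int - {v1, v2}"
   have "wedge (\<tau> 2) (hodge (\<tau> j)) d p = (cmod (deriv (transition d e) (crd d p)))\<^sup>2 * wedge (\<tau> 2) (hodge (\<tau> j)) e p"
    using c2 dep unfolding cov2_def by blast
   then show "wedge (\<tau> j) (hodge (\<tau> 2)) d p = (cmod (deriv (transition d e) (crd d p)))\<^sup>2 * wedge (\<tau> j) (hodge (\<tau> 2)) e p"
    using eq dep by simp
  qed
  have ic: "intble (- {v1, v2}) (wedge (\<tau> j) (hodge (\<tau> 2))) \<longleftrightarrow> intble (- {v1, v2}) (wedge (\<tau> 2) (hodge (\<tau> j)))"
   "integ (- {v1, v2}) (wedge (\<tau> j) (hodge (\<tau> 2))) = integ (- {v1, v2}) (wedge (\<tau> 2) (hodge (\<tau> j)))"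
   using integ_cong[of "- {v1, v2}" "wedge (\<tau> j) (hodge (\<tau> 2))" "wedge (\<tau> 2) (hodge (\<tau> j))"] eq by blast+
  have "surface_integral A (- {v1, v2}) (wedge (\<tau> j) (hodge (\<tau> 2))) = surface_integral A (- {v1, v2}) (wedge (\<tau> 2) (hodge (\<tau> j)))"
   using surface_integral_eq[OF B _ c2'] surface_integral_eq[OF B i2 c2] ic i2 by simp
  then show "q j 2 = q 2 j" using j by (simp add: q_def q_const_def assms(5))
 qed
 have q22: "q 2 2 = (\<Sum>k\<in>K. \<Sum>l\<in>K. c k * c l * q k l)"
 proof -
  \<comment> \<open>The difference of \<open>\<tau> 2\<close> and \<star>\<open>\<tau> 1\<close> is
    a combination of the forms on the compact surface, so its energy is finite and quadratic in the
    periods c.\<close>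
  have e: "(%c p v. \<tau> 2 c p v - hodge (\<tau> 1) c p v) = ?s" unfolding tau2 by simp
  have hs: "hodge ?s = (%d p v. \<Sum>k\<in>K. - c k * hodge (\<tau> k) d p v)" by (intro ext) (simp add: hodge_def sum_negf)
  have lhs: "locex UNIV (hodge ?s)" unfolding hs by (rule locex_sum) (auto intro: locex_hodge)
  have "intble (- {v1, v2}) (wedge ?s (hodge ?s))" using intble_locex[OF ls lhs] intble_finite[OF fin] by simp
  then have "surface_integral A (- {v1, v2}) (wedge ?s (hodge ?s)) = pairing ?s (hodge ?s)"
   by (rule surface_integral_finite[OF fin cov1_subset[OF covs subset_UNIV] cov1_subset[OF locex_cov1[OF lhs] subset_UNIV]])
  also have "\<dots> = (\<Sum>k\<in>K. - c k * pairing (\<tau> k) (hodge ?s))" by (rule pairing_sum[OF lhs])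
  also have "\<dots> = (\<Sum>k\<in>K. \<Sum>l\<in>K. c k * c l * q k l)"
  proof (rule sum.cong[OF HOL.refl])
   fix k assume k: "k \<in> K"
   have "pairing (\<tau> k) (hodge ?s) = - pairing (hodge ?s) (\<tau> k)" by (rule pairing_swap[OF lhs locex_tau[OF k]])
   also have "pairing (hodge ?s) (\<tau> k) = (\<Sum>l\<in>K. - c l * pairing (hodge (\<tau> l)) (\<tau> k))"
    unfolding hs wedge_sum_left
   proof (rule integ_sum(2))
    fix l assume "l \<in> K"
    then show "intble UNIV (wedge (hodge (\<tau> l)) (\<tau> k))" by (rule intble_locex[OF locex_hodge locex_tau[OF k]])
   qed simp
   also have "\<dots> = (\<Sum>l\<in>K. c l * q k l)"
    by (rule sum.cong) (use pairing_swap[OF locex_tau[OF k] locex_hodge] qK[OF k] in auto)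
   finally have pk: "pairing (\<tau> k) (hodge ?s) = - (\<Sum>l\<in>K. c l * q k l)" .
   show "- c k * pairing (\<tau> k) (hodge ?s) = (\<Sum>l\<in>K. c k * c l * q k l)"
    by (simp only: pk minus_mult_minus sum_distrib_left mult.assoc)
  qed
  finally have "surface_integral A (- {v1, v2}) (wedge ?s (hodge ?s)) = (\<Sum>k\<in>K. \<Sum>l\<in>K. c k * c l * q k l)" .
  moreover have "pi22_const A S \<tau> = surface_integral A (- {v1, v2}) (wedge ?s (hodge ?s))"
   by (simp only: pi22_const_def energy_def e assms(5))
  moreover have "q 2 2 = pi22_const A S \<tau>" by (simp add: q_def)
  ultimately show ?thesis by simp
 qed
 have q1: "q 1 j = 0" "q j 1 = 0" for j by (auto simp: q_def q_const_def)
 let ?k = "kappa_const A \<gamma> \<tau>"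
 have p: "p_entry A S \<gamma> \<tau> lam i j = q i j + ?k i * ?k j / lam + (if i = 2 & j = 2 then lam else 0)" for i j
  by (simp add: p_entry_def q_def power2_eq_square)
 have qs: "q i j = q j i" if "i \<in> K" "j \<in> K" for i j using qK that energy_symmetric by simp
 have qq: "(\<Sum>k\<in>K. q i k * pair_sign k * q (partner k) j) = (if j = partner i then pair_sign i else 0)" if "i \<in> K" "j \<in> K" for i j
 proof -
  have "(\<Sum>k\<in>K. q i k * pair_sign k * q (partner k) j) = (\<Sum>k\<in>K. pairing (\<tau> i) (hodge (\<tau> k)) * pair_sign k * pairing (\<tau> (partner k)) (hodge (\<tau> j)))"
   by (rule sum.cong) (use that qK partner_in in auto)
  then show ?thesis using energy_symplectic[OF that] by simp
 qed
 have k1: "?k 1 = 1" by (simp add: kappa_const_def)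
 have l0: "lam ~= 0" using assms(20) by simp
 show ?thesis unfolding P_matrix_def
  by (rule symplectic_matrix, rule symplectic_algebra[OF assms(1) HOL.refl qs qq k1 kap q2j q22 q1 l0 p])
qed

end
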